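(* Let $n\ge3$, let $L:\mathbb R^{n-2}\to\mathbb R^{n-2}$ be an invertible linear map, $q$ a positive definite quadratic form on $\mathbb R^{n-2}$, and $\pi_{\mathbf s}(r_1,\mathbf c,r_2)=r_1+\mathbf c\cdot L(\mathbf s)+r_2q(\mathbf s)$ for $\mathbf s\in\mathbb R^{n-2}$. Let $K\subset\mathbb R^n$ be compact. Then for Lebesgue-almost every $\mathbf s\in\mathbb R^{n-2}$, $$\dim_H(\pi_{\mathbf s}(K))=\min(1,\dim_H K),$$ where $\dim_H$ denotes Hausdorff dimension.
   Context: Coordinates on $\mathbb R^n$ are $(r_1,\mathbf c,r_2)$ with $r_1,r_2\in\mathbb R$, $\mathbf c\in\mathbb R^{n-2}$; $\mathbf c\cdot L(\mathbf s)$ is the standard inner product. *)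

theory Defs
  imports "HOL-Analysis.Analysis"
begin

definition diam_pow :: "real \<Rightarrow> 'a::metric_space set \<Rightarrow> ennreal" where
  "diam_pow s U = (if U = {} then 0 else if s = 0 then 1 else ennreal (diameter U powr s))"

definition hausdorff_approx :: "real \<Rightarrow> real \<Rightarrow> 'a::metric_space set \<Rightarrow> ennreal" where
  "hausdorff_approx s \<delta> A =
     (INF U \<in> {U :: nat \<Rightarrow> 'a set. A \<subseteq> (\<Union>i. U i) \<and>
                  (\<forall>i. bounded (U i) \<and> diameter (U i) \<le> \<delta>)}.
        (\<Sum>i. diam_pow s (U i)))"

definition hausdorff_measure :: "real \<Rightarrow> 'a::metric_space set \<Rightarrow> ennreal" where
  "hausdorff_measure s A = (SUP \<delta> \<in> {0<..}. hausdorff_approx s \<delta> A)"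

definition hausdorff_dim :: "'a::metric_space set \<Rightarrow> ereal" where
  "hausdorff_dim A = Inf {ereal s | s. s \<ge> 0 \<and> hausdorff_measure s A = 0}"

end

theory Submission
  imports Defs
begin

text \<open>
  A compact set \<open>K\<close> with \<open>H\<^sup>t(K) > 0\<close> carries, at each scale \<open>N\<^sup>-\<^sup>n\<close>, a finite weighted set with
  masses of \<open>r\<close>-balls at most \<open>A r\<^sup>t\<close> and total mass bounded below. If \<open>H\<^sup>\<tau>(\<pi>\<^sub>s K) = 0\<close> for some \<open>\<tau> < t\<close>,
  then by pigeonhole over the scales a definite part of the mass sits in cells of \<open>\<pi>\<^sub>s K\<close> that are far too
  heavy. A bound, integrated over \<open>s\<close>, for the \<open>p\<close>-th moment of the cell mass makes the set of
  such \<open>s\<close> null.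

  For \<open>n \<ge> 4\<close> the moment \<open>p = 1\<close> suffices: \<open>s\<close> ranges over at least two dimensions, so the sublevel
  set \<open>\<bar>\<pi>\<^sub>s(z)\<bar> \<le> \<delta>\<close> is either a shell of ellipsoids or transverse to a line direction, and has
  measure \<open>O(\<delta> / \<bar>z\<bar>)\<close>.

  For \<open>n = 3\<close> the functions \<open>s \<mapsto> \<pi>\<^sub>s(z)\<close> are parabolas, and tangent pairs \<open>x, y\<close> defeat any such bound;
  the moment \<open>p = 1/4\<close> replaces \<open>p = 1\<close>. Tangencies are controlled by induction on scales: each
  step splits a time interval into \<open>N\<close> pieces, and four parabolas cannot form a
  4-cycle of tangencies at well separated times, because in the alternating sum of discriminants only
  a product of slope differences survives. A Cauchy-Schwarz (Kovari--Sos--Turan type)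
  argument then costs only \<open>O(\<surd>N)\<close> per step for the power \<open>5/8\<close> of the pair
  mass, and the constant is absorbed by a large choice of \<open>N\<close>.\<close>

section \<open>Incidences without 4-cycles\<close>

text \<open>The exponents \<open>1/4\<close> and \<open>5/8\<close> come from a balance. The
  \<open>p\<close>-th moment gives a cell of mass \<open>m\<close> the weight \<open>m\<close> to
  the power \<open>1 + p\<close>, the power \<open>(1 + p)/2\<close> of its pair mass. Two parabolas
  at distance \<open>r\<close> that cross with slope difference about \<open>r / N ^ k\<close> share
  a cell of width \<open>\<delta>\<close> during time about \<open>\<delta> * N ^ k / r\<close>, a
  proportion \<open>\<delta> * N ^ (2 * k) / r\<close> of a slot of length \<open>1 / N ^ k\<close>.
  Interpolating the exponent between \<open>1/2\<close> and \<open>1\<close> turns this proportion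
  into its \<open>p\<close>-th power. The induction down to such slots has \<open>k\<close> steps,
  each costing \<open>\<surd>N\<close>, and the slot length contributes \<open>1 / N ^ k\<close>.
  The powers of \<open>N\<close> cancel exactly at \<open>p = 1/4\<close>. What is left,
  \<open>(\<delta> / r) powr (1/4)\<close> times \<open>r powr (t/4)\<close> from the masses of
  \<open>r\<close>-balls, is at most \<open>\<delta> powr (t/4)\<close> because
  \<open>t \<le> 1\<close>. There remain constants to the power \<open>k\<close>, with
  \<open>k\<close> of the order of the number of scales; these become
  \<open>\<delta> powr (- \<epsilon>)\<close> for large \<open>N\<close>. Finite weighted sets
  replace a Frostman measure: each estimate reaches only down to a finite scale, with constants
  independent of it.\<close>

lemma weighted_cauchy_schwarz:
  fixes w F :: "'y \<Rightarrow> real"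
  assumes "\<And>y. y \<in> B \<Longrightarrow> 0 \<le> w y"
  shows "(\<Sum>y\<in>B. w y * F y)\<^sup>2 \<le> (\<Sum>y\<in>B. w y) * (\<Sum>y\<in>B. w y * (F y)\<^sup>2)"
proof -
  have "(\<Sum>y\<in>B. sqrt (w y) * (sqrt (w y) * F y))\<^sup>2
      \<le> (\<Sum>y\<in>B. (sqrt (w y))\<^sup>2) * (\<Sum>y\<in>B. (sqrt (w y) * F y)\<^sup>2)"
    by (rule Cauchy_Schwarz_ineq_sum)
  moreover have "(\<Sum>y\<in>B. sqrt (w y) * (sqrt (w y) * F y)) = (\<Sum>y\<in>B. w y * F y)"
    using assms by (intro sum.cong) (auto simp: mult.assoc[symmetric])
  moreover have "(\<Sum>y\<in>B. (sqrt (w y))\<^sup>2) = (\<Sum>y\<in>B. w y)"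
    using assms by (intro sum.cong) auto
  moreover have "(\<Sum>y\<in>B. (sqrt (w y) * F y)\<^sup>2) = (\<Sum>y\<in>B. w y * (F y)\<^sup>2)"
    using assms by (intro sum.cong) (auto simp: power_mult_distrib)
  ultimately show ?thesis by simp
qed

section \<open>Masses of the fibres of a labelling\<close>

definition cmass :: "('x \<Rightarrow> real) \<Rightarrow> 'x set \<Rightarrow> ('x \<Rightarrow> 'q) \<Rightarrow> 'q \<Rightarrow> real" where
  "cmass w A g q = (\<Sum>x\<in>{x\<in>A. g x = q}. w x)"

lemma cmass_nonneg: "(\<And>x. x \<in> A \<Longrightarrow> 0 \<le> w x) \<Longrightarrow> 0 \<le> cmass w A g q"
  unfolding cmass_def by (rule sum_nonneg) auto

lemma cmass_le: "finite A \<Longrightarrow> (\<And>x. x \<in> A \<Longrightarrow> 0 \<le> w x) \<Longrightarrow> cmass w A g q \<le> sum w A"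
  unfolding cmass_def by (rule sum_mono2) auto

lemma sum_cmass_mult_le:
  assumes "finite A" "finite Q" "\<And>x. x \<in> A \<Longrightarrow> 0 \<le> w x" "\<And>q. 0 \<le> h q"
  shows "(\<Sum>q\<in>Q. h q * cmass w A g q) \<le> (\<Sum>x\<in>A. w x * h (g x))"
proof -
  have "(\<Sum>q\<in>Q. h q * cmass w A g q) = (\<Sum>q\<in>Q. \<Sum>x\<in>{x\<in>A. g x = q}. w x * h (g x))"
    by (intro sum.cong) (auto simp: cmass_def sum_distrib_left mult.commute intro!: sum.cong)
  also have "\<dots> = (\<Sum>x\<in>{x\<in>A. g x \<in> Q}. w x * h (g x))"
    using assms(1,2) by (subst sum.group[of "{x\<in>A. g x \<in> Q}" Q g "\<lambda>x. w x * h (g x)", symmetric])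
      (auto intro!: sum.cong)
  also have "\<dots> \<le> (\<Sum>x\<in>A. w x * h (g x))"
    using assms by (intro sum_mono2) auto
  finally show ?thesis .
qed

lemma sum_cmass_le:
  assumes "finite A" "finite Q" "\<And>x. x \<in> A \<Longrightarrow> 0 \<le> w x"
  shows "(\<Sum>q\<in>Q. cmass w A g q) \<le> sum w A"
  using sum_cmass_mult_le[of A Q w "\<lambda>_. 1" g] assms by simp

lemma sum_weight_eq_cmass:
  assumes "finite A"
  shows "(\<Sum>x\<in>A. w x * h (g x)) = (\<Sum>q\<in>g ` A. h q * cmass w A g q)"
proof -
  have "(\<Sum>x\<in>A. w x * h (g x)) = (\<Sum>q\<in>g ` A. \<Sum>x\<in>{x\<in>A. g x = q}. w x * h (g x))"
    using sum.image_gen[OF assms] by fastforce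
  also have "\<dots> = (\<Sum>q\<in>g ` A. h q * cmass w A g q)"
    by (intro sum.cong) (auto simp: cmass_def sum_distrib_left mult.commute intro!: sum.cong)
  finally show ?thesis .
qed

lemma sum_rotate5:
  "(\<Sum>y\<in>B. \<Sum>i\<in>I. \<Sum>j\<in>J. \<Sum>x\<in>X. \<Sum>x'\<in>X'. f y i j x x') = (\<Sum>i\<in>I. \<Sum>j\<in>J. \<Sum>x\<in>X. \<Sum>x'\<in>X'. \<Sum>y\<in>B. f y i j x x')"
proof -
  have "(\<Sum>y\<in>B. \<Sum>i\<in>I. \<Sum>j\<in>J. \<Sum>x\<in>X. \<Sum>x'\<in>X'. f y i j x x') = (\<Sum>i\<in>I. \<Sum>y\<in>B. \<Sum>j\<in>J. \<Sum>x\<in>X. \<Sum>x'\<in>X'. f y i j x x')"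
    by (rule sum.swap)
  also have "\<dots> = (\<Sum>i\<in>I. \<Sum>j\<in>J. \<Sum>y\<in>B. \<Sum>x\<in>X. \<Sum>x'\<in>X'. f y i j x x')"
    by (intro sum.cong refl) (rule sum.swap)
  also have "\<dots> = (\<Sum>i\<in>I. \<Sum>j\<in>J. \<Sum>x\<in>X. \<Sum>y\<in>B. \<Sum>x'\<in>X'. f y i j x x')"
    by (intro sum.cong refl) (rule sum.swap)
  also have "\<dots> = (\<Sum>i\<in>I. \<Sum>j\<in>J. \<Sum>x\<in>X. \<Sum>x'\<in>X'. \<Sum>y\<in>B. f y i j x x')"
    by (intro sum.cong refl) (rule sum.swap)
  finally show ?thesis .
qed

definition far :: "nat \<Rightarrow> nat \<Rightarrow> nat \<Rightarrow> bool" where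
  "far c i j \<longleftrightarrow> i + c < j \<or> j + c < i"

lemma far_sym: "far c i j = far c j i" unfolding far_def by auto

lemma card_near: "card {j. j < N \<and> \<not> far c i j} \<le> 2 * c + 1" "finite {j. \<not> far c i j}"
proof -
  have s: "{j. \<not> far c i j} \<subseteq> {i - c..i + c}" by (auto simp: far_def)
  show "finite {j. \<not> far c i j}" using s finite_subset by blast
  have "card {j. j < N \<and> \<not> far c i j} \<le> card {i - c..i + c}"
    using s by (intro card_mono) auto
  then show "card {j. j < N \<and> \<not> far c i j} \<le> 2 * c + 1" by simp
qed

lemma card_near': "card {j. \<not> far c i j} \<le> 2 * c + 1"
proof -
  have s: "{j. \<not> far c i j} \<subseteq> {i - c..i + c}" by (auto simp: far_def)
  have "card {j. \<not> far c i j} \<le> card {i - c..i + c}"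
    using s by (intro card_mono) auto
  then show ?thesis by simp
qed

text \<open>Apply Cauchy-Schwarz over \<open>B\<close>, after normalizing by \<open>v\<close>. Of the resulting double sum over times
  \<open>i, j\<close>, the near pairs contribute through the minimum, and the far pairs are rare: by \<open>cyc\<close>, all
  common neighbours \<open>y\<close> of given \<open>x, x'\<close> meet them at essentially the same pair of times.\<close>

lemma incidence_half:
  fixes A :: "'x set" and B :: "'y set" and wA :: "'x \<Rightarrow> real" and wB :: "'y \<Rightarrow> real"
    and \<alpha> :: "nat \<Rightarrow> 'x \<Rightarrow> 'q" and \<beta> :: "nat \<Rightarrow> 'y \<Rightarrow> 'q"
  assumes fin: "finite A" "finite B" "finite Q"
    and wA: "\<And>x. x \<in> A \<Longrightarrow> 0 \<le> wA x" and wB: "\<And>y. y \<in> B \<Longrightarrow> 0 \<le> wB y"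
    and N: "N > 0"
    and cyc: "\<And>x x' y y' i j k l. \<lbrakk>x \<in> A; x' \<in> A; y \<in> B; y' \<in> B; i < N; j < N; k < N; l < N;
        \<alpha> i x = \<beta> i y; \<alpha> j x' = \<beta> j y; \<alpha> k x = \<beta> k y'; \<alpha> l x' = \<beta> l y'; far c i j\<rbrakk> \<Longrightarrow> \<not> far c i k"
  shows "(\<Sum>i<N. \<Sum>q\<in>Q. min (cmass wA A (\<alpha> i) q) (sqrt (sum wA A * cmass wA A (\<alpha> i) q / N)) *
            sqrt (cmass wB B (\<beta> i) q)) \<le> 2 * (2 * real c + 1) * sum wA A * sqrt (sum wB B)"
proof -
  define W where "W = sum wA A"
  define V where "V = sum wB B"
  define m1 where "m1 i q = cmass wA A (\<alpha> i) q" for i q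
  define m2 where "m2 i q = cmass wB B (\<beta> i) q" for i q
  \<comment> \<open>Cells up to the average \<open>W / N\<close> keep the factor 1; heavier ones are
    damped so that \<open>(th * m1)\<^sup>2\<close> is at most \<open>W / N * m1\<close>. This sums
    to \<open>W\<^sup>2 / N\<close> over the cells of one time, hence to \<open>W\<^sup>2\<close>
    over all \<open>N\<close> times. The division by \<open>sqrt (m2 i q)\<close> in
    \<open>v\<close> then gives \<open>v\<^sup>2 * m2 \<le> 1\<close>.\<close>
  define th where "th i q = (if m1 i q = 0 \<or> m2 i q = 0 then 0 else min 1 (sqrt (W / (N * m1 i q))))" for i q
  define v where "v i q = th i q / sqrt (m2 i q)" for i q
  define F where "F y = (\<Sum>i<N. v i (\<beta> i y) * m1 i (\<beta> i y))" for y
  have W0: "W \<ge> 0" unfolding W_def using wA by (simp add: sum_nonneg)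
  have V0: "V \<ge> 0" unfolding V_def using wB by (simp add: sum_nonneg)
  have m10: "m1 i q \<ge> 0" for i q unfolding m1_def by (rule cmass_nonneg) (use wA in auto)
  have m20: "m2 i q \<ge> 0" for i q unfolding m2_def by (rule cmass_nonneg) (use wB in auto)
  have th0: "th i q \<ge> 0" for i q unfolding th_def using W0 m10 by auto
  have th1: "th i q \<le> 1" for i q unfolding th_def by auto
  have v0: "v i q \<ge> 0" for i q unfolding v_def using th0 m20 by auto
  have v2: "(v i q)\<^sup>2 * m2 i q = (th i q)\<^sup>2" for i q
    unfolding v_def using m20[of i q] by (cases "m2 i q = 0") (auto simp: power_divide th_def)
  have v2le: "(v i q)\<^sup>2 * m2 i q \<le> 1" for i q
    unfolding v2 using th0 th1 by (simp add: power_le_one)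
  have th2: "(th i q)\<^sup>2 * (m1 i q)\<^sup>2 \<le> W / N * m1 i q" for i q
  proof (cases "m1 i q = 0 \<or> m2 i q = 0")
    case True then show ?thesis using m10[of i q] W0 by (auto simp: th_def)
  next
    case False
    then have p: "m1 i q > 0" using m10[of i q] by (auto simp: less_le)
    have "th i q \<le> sqrt (W / (N * m1 i q))" using False by (auto simp: th_def)
    then have "(th i q)\<^sup>2 \<le> (sqrt (W / (N * m1 i q)))\<^sup>2" using th0 by (intro power_mono) auto
    also have "\<dots> = W / (N * m1 i q)" using W0 p by simp
    finally have "(th i q)\<^sup>2 * (m1 i q)\<^sup>2 \<le> W / (N * m1 i q) * (m1 i q)\<^sup>2"
      by (rule mult_right_mono) auto
    also have "\<dots> = W / N * m1 i q" using p by (simp add: power2_eq_square)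
    finally show ?thesis .
  qed
  have main_eq: "min (m1 i q) (sqrt (W * m1 i q / N)) * sqrt (m2 i q) = (v i q * m1 i q) * m2 i q" for i q
  proof (cases "m1 i q = 0 \<or> m2 i q = 0")
    case True then show ?thesis using W0 by (auto simp: v_def th_def)
  next
    case False
    then have p: "m1 i q > 0" "m2 i q > 0" using m10[of i q] m20[of i q] by (auto simp: less_le)
    have "sqrt (W / (N * m1 i q)) * m1 i q = sqrt (W / (N * m1 i q)) * sqrt ((m1 i q)\<^sup>2)"
      using p by simp
    also have "\<dots> = sqrt (W / (N * m1 i q) * (m1 i q)\<^sup>2)" by (simp only: real_sqrt_mult)
    also have "W / (N * m1 i q) * (m1 i q)\<^sup>2 = W * m1 i q / N" using p by (simp add: power2_eq_square)
    finally have e: "sqrt (W / (N * m1 i q)) * m1 i q = sqrt (W * m1 i q / N)" .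
    have "th i q * m1 i q = min (m1 i q) (sqrt (W * m1 i q / N))"
      using False p e by (simp add: th_def min_mult_distrib_right)
    moreover have "v i q * m2 i q = th i q * sqrt (m2 i q)"
      unfolding v_def using p by (simp add: real_div_sqrt field_simps)
    ultimately show ?thesis by (metis mult.commute mult.left_commute)
  qed
  define S where "S = (\<Sum>i<N. \<Sum>q\<in>Q. (v i q * m1 i q) * m2 i q)"
  have S_le: "S \<le> (\<Sum>y\<in>B. wB y * F y)"
  proof -
    have "S \<le> (\<Sum>i<N. \<Sum>y\<in>B. wB y * (v i (\<beta> i y) * m1 i (\<beta> i y)))"
      unfolding S_def m2_def using fin wB v0 m10
      by (intro sum_mono sum_cmass_mult_le) auto
    also have "\<dots> = (\<Sum>y\<in>B. wB y * F y)"
      unfolding F_def by (subst sum.swap) (simp add: sum_distrib_left)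
    finally show ?thesis .
  qed
  have S0: "S \<ge> 0" unfolding S_def using v0 m10 m20 by (intro sum_nonneg mult_nonneg_nonneg) auto
  define a where "a y i = v i (\<beta> i y) * m1 i (\<beta> i y)" for y i
  have Fsq: "(F y)\<^sup>2 = (\<Sum>i<N. \<Sum>j<N. a y i * a y j)" for y
    unfolding F_def power2_eq_square a_def by (simp add: sum_product)
  define near where "near y = (\<Sum>i<N. \<Sum>j<N. if far c i j then 0 else a y i * a y j)" for y
  define fr where "fr y = (\<Sum>i<N. \<Sum>j<N. if far c i j then a y i * a y j else 0)" for y
  have split: "(F y)\<^sup>2 = near y + fr y" for y
    unfolding Fsq near_def fr_def sum.distrib[symmetric] by (intro sum.cong) auto
  have near_le: "near y \<le> (2 * real c + 1) * (\<Sum>i<N. (a y i)\<^sup>2)" for y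
  proof -
    let ?g = "\<lambda>i j. if far c i j then 0 else (a y i)\<^sup>2 / 2"
    have "near y \<le> (\<Sum>i<N. \<Sum>j<N. ?g i j + ?g j i)"
      unfolding near_def
    proof (intro sum_mono)
      fix i j
      have "2 * (a y i * a y j) \<le> (a y i)\<^sup>2 + (a y j)\<^sup>2"
        using sum_squares_bound[of "a y i" "a y j"] by (simp add: mult.assoc)
      then show "(if far c i j then 0 else a y i * a y j) \<le> ?g i j + ?g j i"
        by (auto simp: far_sym[of c j i])
    qed
    also have "\<dots> = (\<Sum>i<N. \<Sum>j<N. ?g i j) + (\<Sum>i<N. \<Sum>j<N. ?g j i)"
      by (simp only: sum.distrib)
    also have "(\<Sum>i<N. \<Sum>j<N. ?g j i) = (\<Sum>i<N. \<Sum>j<N. ?g i j)"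
      by (subst sum.swap) simp
    also have "(\<Sum>i<N. \<Sum>j<N. ?g i j) = (\<Sum>i<N. real (card {j. j < N \<and> \<not> far c i j}) * ((a y i)\<^sup>2 / 2))"
    proof (intro sum.cong refl)
      fix i
      have "(\<Sum>j<N. ?g i j) = (\<Sum>j\<in>{j\<in>{..<N}. \<not> far c i j}. (a y i)\<^sup>2 / 2)"
        by (subst sum.inter_filter) (auto intro!: sum.cong)
      also have "{j\<in>{..<N}. \<not> far c i j} = {j. j < N \<and> \<not> far c i j}" by auto
      finally show "(\<Sum>j<N. ?g i j) = real (card {j. j < N \<and> \<not> far c i j}) * ((a y i)\<^sup>2 / 2)" by simp
    qed
    also have "\<dots> + \<dots> = (\<Sum>i<N. real (card {j. j < N \<and> \<not> far c i j}) * (a y i)\<^sup>2)"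
      unfolding sum.distrib[symmetric] by (intro sum.cong) auto
    also have "\<dots> \<le> (\<Sum>i<N. (2 * real c + 1) * (a y i)\<^sup>2)"
    proof (intro sum_mono mult_right_mono)
      fix i show "real (card {j. j < N \<and> \<not> far c i j}) \<le> 2 * real c + 1"
        using card_near(1)[of N c i] by linarith
    qed auto
    finally show ?thesis by (simp add: sum_distrib_left)
  qed
  have near_tot: "(\<Sum>y\<in>B. wB y * near y) \<le> (2 * real c + 1) * W\<^sup>2"
  proof -
    have one: "(\<Sum>y\<in>B. wB y * (a y i)\<^sup>2) \<le> W\<^sup>2 / N" for i
    proof -
      have "(\<Sum>y\<in>B. wB y * (a y i)\<^sup>2) = (\<Sum>q\<in>\<beta> i ` B. (v i q * m1 i q)\<^sup>2 * m2 i q)"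
        unfolding a_def m2_def
        using sum_weight_eq_cmass[OF fin(2), of wB "\<lambda>q. (v i q * m1 i q)\<^sup>2" "\<beta> i"] by simp
      also have "\<dots> = (\<Sum>q\<in>\<beta> i ` B. (th i q)\<^sup>2 * (m1 i q)\<^sup>2)"
        by (intro sum.cong refl) (simp add: v2[symmetric] power_mult_distrib mult.assoc mult.commute mult.left_commute)
      also have "\<dots> \<le> (\<Sum>q\<in>\<beta> i ` B. W / N * m1 i q)" by (intro sum_mono th2)
      also have "\<dots> = W / N * (\<Sum>q\<in>\<beta> i ` B. m1 i q)" by (simp add: sum_distrib_left)
      also have "\<dots> \<le> W / N * W"
        unfolding m1_def W_def
        using fin wA W0[unfolded W_def] by (intro mult_left_mono sum_cmass_le) auto
      finally show ?thesis by (simp add: power2_eq_square)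
    qed
    have "(\<Sum>y\<in>B. wB y * near y) \<le> (\<Sum>y\<in>B. wB y * ((2 * real c + 1) * (\<Sum>i<N. (a y i)\<^sup>2)))"
      using wB near_le by (intro sum_mono mult_left_mono) auto
    also have "\<dots> = (2 * real c + 1) * (\<Sum>y\<in>B. \<Sum>i<N. wB y * (a y i)\<^sup>2)"
      by (simp add: sum_distrib_left mult_ac)
    also have "(\<Sum>y\<in>B. \<Sum>i<N. wB y * (a y i)\<^sup>2) = (\<Sum>i<N. \<Sum>y\<in>B. wB y * (a y i)\<^sup>2)" by (rule sum.swap)
    also have "(2 * real c + 1) * \<dots> \<le> (2 * real c + 1) * (\<Sum>i<N. W\<^sup>2 / N)"
      using one by (intro mult_left_mono sum_mono) auto
    also have "\<dots> = (2 * real c + 1) * W\<^sup>2" using N by simp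
    finally show ?thesis .
  qed
  \<comment> \<open>\<open>T x x'\<close> is the coefficient of \<open>wA x * wA x'\<close> when the
    far part is expanded over the pairs of points in \<open>A\<close> that share the cells of
    \<open>y\<close>. It suffices to bound it by a constant.\<close>
  define T where "T x x' = (\<Sum>i<N. \<Sum>j<N. if far c i j then
      (\<Sum>y\<in>{y\<in>B. \<alpha> i x = \<beta> i y \<and> \<alpha> j x' = \<beta> j y}. wB y * (v i (\<alpha> i x) * v j (\<alpha> j x'))) else 0)" for x x'
  have aexp: "a y i = (\<Sum>x\<in>A. if \<alpha> i x = \<beta> i y then wA x * v i (\<alpha> i x) else 0)" for y i
  proof -
    have "a y i = (\<Sum>x\<in>{x\<in>A. \<alpha> i x = \<beta> i y}. wA x * v i (\<alpha> i x))"
      unfolding a_def m1_def cmass_def by (auto simp: sum_distrib_left mult.commute intro!: sum.cong)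
    also have "\<dots> = (\<Sum>x\<in>A. if \<alpha> i x = \<beta> i y then wA x * v i (\<alpha> i x) else 0)"
      using fin(1) by (rule sum.inter_filter)
    finally show ?thesis .
  qed
  have fr_tot_eq: "(\<Sum>y\<in>B. wB y * fr y) = (\<Sum>x\<in>A. \<Sum>x'\<in>A. wA x * wA x' * T x x')"
  proof -
    let ?h = "\<lambda>y i j x x'. if far c i j \<and> \<alpha> i x = \<beta> i y \<and> \<alpha> j x' = \<beta> j y
        then wB y * (wA x * wA x') * (v i (\<alpha> i x) * v j (\<alpha> j x')) else 0"
    have "(\<Sum>y\<in>B. wB y * fr y) = (\<Sum>y\<in>B. \<Sum>i<N. \<Sum>j<N. \<Sum>x\<in>A. \<Sum>x'\<in>A. ?h y i j x x')"
    proof (rule sum.cong[OF refl])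
      fix y
      have "(if far c i j then a y i * a y j else 0) * wB y = (\<Sum>x\<in>A. \<Sum>x'\<in>A. ?h y i j x x')" for i j
      proof (cases "far c i j")
        case True
        have "a y i * a y j * wB y = (\<Sum>x\<in>A. \<Sum>x'\<in>A.
            (if \<alpha> i x = \<beta> i y then wA x * v i (\<alpha> i x) else 0) *
            (if \<alpha> j x' = \<beta> j y then wA x' * v j (\<alpha> j x') else 0) * wB y)"
          unfolding aexp sum_product by (simp only: sum_distrib_right)
        also have "\<dots> = (\<Sum>x\<in>A. \<Sum>x'\<in>A. ?h y i j x x')"
          using True by (intro sum.cong refl) (simp add: mult_ac)
        finally show ?thesis using True by simp
      qed simp
      then show "wB y * fr y = (\<Sum>i<N. \<Sum>j<N. \<Sum>x\<in>A. \<Sum>x'\<in>A. ?h y i j x x')"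
        unfolding fr_def by (simp add: sum_distrib_left mult.commute[of "wB y"] sum_distrib_right)
    qed
    also have "\<dots> = (\<Sum>i<N. \<Sum>j<N. \<Sum>x\<in>A. \<Sum>x'\<in>A. \<Sum>y\<in>B. ?h y i j x x')"
      by (rule sum_rotate5)
    also have "\<dots> = (\<Sum>x\<in>A. \<Sum>x'\<in>A. \<Sum>i<N. \<Sum>j<N. \<Sum>y\<in>B. ?h y i j x x')"
    proof -
      have "(\<Sum>i<N. \<Sum>j<N. \<Sum>x\<in>A. \<Sum>x'\<in>A. \<Sum>y\<in>B. ?h y i j x x')
          = (\<Sum>i<N. \<Sum>x\<in>A. \<Sum>j<N. \<Sum>x'\<in>A. \<Sum>y\<in>B. ?h y i j x x')"
        by (intro sum.cong refl) (rule sum.swap)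
      also have "\<dots> = (\<Sum>x\<in>A. \<Sum>i<N. \<Sum>j<N. \<Sum>x'\<in>A. \<Sum>y\<in>B. ?h y i j x x')" by (rule sum.swap)
      also have "\<dots> = (\<Sum>x\<in>A. \<Sum>i<N. \<Sum>x'\<in>A. \<Sum>j<N. \<Sum>y\<in>B. ?h y i j x x')"
        by (intro sum.cong refl) (rule sum.swap)
      also have "\<dots> = (\<Sum>x\<in>A. \<Sum>x'\<in>A. \<Sum>i<N. \<Sum>j<N. \<Sum>y\<in>B. ?h y i j x x')"
        by (intro sum.cong refl) (rule sum.swap)
      finally show ?thesis .
    qed
    also have "\<dots> = (\<Sum>x\<in>A. \<Sum>x'\<in>A. wA x * wA x' * T x x')"
      unfolding T_def sum_distrib_left using fin(2)
      by (intro sum.cong refl) (auto simp: sum.inter_filter sum_distrib_left mult_ac intro!: sum.cong)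
    finally show ?thesis .
  qed
  have T_le: "T x x' \<le> (2 * real c + 1)\<^sup>2" if x: "x \<in> A" and x': "x' \<in> A" for x x'
  proof -
    define P where "P = {(i,j). i < N \<and> j < N \<and> far c i j \<and> (\<exists>y\<in>B. \<alpha> i x = \<beta> i y \<and> \<alpha> j x' = \<beta> j y)}"
    have cardP: "real (card P) \<le> (2 * real c + 1)\<^sup>2"
    proof (cases "P = {}")
      case True then show ?thesis by simp
    next
      case False
      then obtain i0 j0 where ij: "(i0,j0) \<in> P" by auto
      then obtain y0 where y0: "i0 < N" "j0 < N" "far c i0 j0" "y0 \<in> B" "\<alpha> i0 x = \<beta> i0 y0" "\<alpha> j0 x' = \<beta> j0 y0"
        by (auto simp: P_def)
      \<comment> \<open>One pair of times fixes all others up to near indices: \<open>cyc\<close>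
        controls the first coordinate, and \<open>cyc\<close> with \<open>x\<close> and
        \<open>x'\<close> exchanged the second.\<close>
      have "P \<subseteq> {i. \<not> far c i0 i} \<times> {j. \<not> far c j0 j}"
      proof
        fix p assume p: "p \<in> P"
        obtain i j where pe: "p = (i,j)" by (cases p)
        then obtain y where y: "i < N" "j < N" "far c i j" "y \<in> B" "\<alpha> i x = \<beta> i y" "\<alpha> j x' = \<beta> j y"
          using p by (auto simp: P_def)
        have "\<not> far c i0 i" using cyc[of x x' y0 y i0 j0 i j] x x' y y0 by auto
        moreover have "\<not> far c j0 j" using cyc[of x' x y0 y j0 i0 j i] x x' y y0 far_sym by metis
        ultimately show "p \<in> {i. \<not> far c i0 i} \<times> {j. \<not> far c j0 j}" using pe by auto
      qed
      then have "card P \<le> card ({i. \<not> far c i0 i} \<times> {j. \<not> far c j0 j})"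
        by (intro card_mono finite_cartesian_product card_near(2)) auto
      also have "\<dots> \<le> (2 * c + 1) * (2 * c + 1)"
        unfolding card_cartesian_product by (intro mult_mono card_near') auto
      finally have "real (card P) \<le> real ((2 * c + 1) * (2 * c + 1))" by (rule of_nat_mono)
      then show ?thesis by (simp add: power2_eq_square algebra_simps)
    qed
    let ?t = "\<lambda>i j. if far c i j then
      (\<Sum>y\<in>{y\<in>B. \<alpha> i x = \<beta> i y \<and> \<alpha> j x' = \<beta> j y}. wB y * (v i (\<alpha> i x) * v j (\<alpha> j x'))) else 0"
    have "T x x' = (\<Sum>p\<in>{..<N} \<times> {..<N}. ?t (fst p) (snd p))"
      unfolding T_def by (simp add: sum.cartesian_product case_prod_unfold)
    also have "\<dots> = (\<Sum>p\<in>P. ?t (fst p) (snd p))"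
      by (intro sum.mono_neutral_right) (auto simp: P_def intro!: sum.neutral)
    also have "\<dots> \<le> (\<Sum>p\<in>P. 1)"
    proof (intro sum_mono)
      fix p assume "p \<in> P"
      let ?i = "fst p" and ?j = "snd p"
      let ?Y = "{y\<in>B. \<alpha> ?i x = \<beta> ?i y \<and> \<alpha> ?j x' = \<beta> ?j y}"
      \<comment> \<open>The common neighbours lie in a single cell at each of the two times, so
        their weight is at most either cell mass. Bounding the product of the two \<open>v\<close>
        by half the sum of their squares then uses \<open>v2le\<close> once for each time.\<close>
      have half: "sum wB ?Y * (v i q)\<^sup>2 \<le> 1" if "?Y \<subseteq> {y\<in>B. \<beta> i y = q}" for i q
      proof -
        have "sum wB ?Y \<le> m2 i q"
          unfolding m2_def cmass_def using fin(2) wB that by (intro sum_mono2) auto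
        then have "sum wB ?Y * (v i q)\<^sup>2 \<le> m2 i q * (v i q)\<^sup>2" by (rule mult_right_mono) auto
        then show ?thesis using v2le[of i q] by (simp add: mult.commute)
      qed
      have pr: "2 * (v ?i (\<alpha> ?i x) * v ?j (\<alpha> ?j x')) \<le> (v ?i (\<alpha> ?i x))\<^sup>2 + (v ?j (\<alpha> ?j x'))\<^sup>2"
        using sum_squares_bound[of "v ?i (\<alpha> ?i x)" "v ?j (\<alpha> ?j x')"] by (simp add: mult.assoc)
      have Y0: "sum wB ?Y \<ge> 0" using wB by (intro sum_nonneg) auto
      have "2 * (sum wB ?Y * (v ?i (\<alpha> ?i x) * v ?j (\<alpha> ?j x')))
          = sum wB ?Y * (2 * (v ?i (\<alpha> ?i x) * v ?j (\<alpha> ?j x')))" by simp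
      also have "\<dots> \<le> sum wB ?Y * ((v ?i (\<alpha> ?i x))\<^sup>2 + (v ?j (\<alpha> ?j x'))\<^sup>2)"
        by (rule mult_left_mono[OF pr Y0])
      also have "\<dots> \<le> 1 + 1"
        unfolding distrib_left by (intro add_mono half) auto
      finally have "sum wB ?Y * (v ?i (\<alpha> ?i x) * v ?j (\<alpha> ?j x')) \<le> 1" by simp
      then show "?t ?i ?j \<le> 1" by (simp add: sum_distrib_right)
    qed
    finally show ?thesis using cardP by simp
  qed
  have fr_tot: "(\<Sum>y\<in>B. wB y * fr y) \<le> (2 * real c + 1)\<^sup>2 * W\<^sup>2"
  proof -
    have "(\<Sum>y\<in>B. wB y * fr y) \<le> (\<Sum>x\<in>A. \<Sum>x'\<in>A. wA x * wA x' * (2 * real c + 1)\<^sup>2)"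
      unfolding fr_tot_eq using wA T_le by (intro sum_mono mult_left_mono) auto
    also have "\<dots> = (2 * real c + 1)\<^sup>2 * W\<^sup>2"
      unfolding W_def power2_eq_square[of "sum wA A"] sum_product
      by (simp only: sum_distrib_right mult.commute)
    finally show ?thesis .
  qed
  have "(\<Sum>y\<in>B. wB y * (F y)\<^sup>2) = (\<Sum>y\<in>B. wB y * near y) + (\<Sum>y\<in>B. wB y * fr y)"
    unfolding split by (simp add: distrib_left sum.distrib)
  also have "\<dots> \<le> (2 * real c + 1) * W\<^sup>2 + (2 * real c + 1)\<^sup>2 * W\<^sup>2"
    using near_tot fr_tot by (rule add_mono)
  also have "\<dots> \<le> (2 * real c + 1)\<^sup>2 * W\<^sup>2 + (2 * real c + 1)\<^sup>2 * W\<^sup>2"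
    by (intro add_right_mono mult_right_mono) (auto simp: power2_eq_square)
  also have "\<dots> = 2 * ((2 * real c + 1)\<^sup>2 * W\<^sup>2)" by (rule mult_2[symmetric])
  also have "\<dots> \<le> 2\<^sup>2 * ((2 * real c + 1)\<^sup>2 * W\<^sup>2)" by (rule mult_right_mono) auto
  also have "\<dots> = (2 * (2 * real c + 1) * W)\<^sup>2" by (simp only: power_mult_distrib mult.assoc)
  finally have X: "(\<Sum>y\<in>B. wB y * (F y)\<^sup>2) \<le> (2 * (2 * real c + 1) * W)\<^sup>2" .
  have "S\<^sup>2 \<le> (\<Sum>y\<in>B. wB y * F y)\<^sup>2" using S_le S0 by (intro power_mono)
  also have "\<dots> \<le> V * (\<Sum>y\<in>B. wB y * (F y)\<^sup>2)"
    unfolding V_def using wB by (rule weighted_cauchy_schwarz)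
  also have "\<dots> \<le> V * (2 * (2 * real c + 1) * W)\<^sup>2" using X V0 by (rule mult_left_mono)
  also have "\<dots> = (2 * (2 * real c + 1) * W * sqrt V)\<^sup>2" using V0 by (simp add: power_mult_distrib)
  finally have S2: "S\<^sup>2 \<le> (2 * (2 * real c + 1) * W * sqrt V)\<^sup>2" .
  have "0 \<le> 2 * (2 * real c + 1) * W * sqrt V" using W0 V0 by simp
  with S2 have "S \<le> 2 * (2 * real c + 1) * W * sqrt V" by (rule power2_le_imp_le)
  moreover have "S = (\<Sum>i<N. \<Sum>q\<in>Q. min (m1 i q) (sqrt (W * m1 i q / N)) * sqrt (m2 i q))"
    unfolding S_def by (simp only: main_eq)
  ultimately show ?thesis
    unfolding m1_def m2_def W_def V_def by simp
qed

text \<open>If \<open>x\<close> or \<open>y\<close> exceeds \<open>1 / n\<close>, one of the first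
  two terms equals \<open>sqrt x * sqrt y\<close>, which is already large enough. Otherwise both
  minima are the masses themselves, and AM-GM leaves the powers \<open>3/4\<close> and
  \<open>1/2\<close> of \<open>x * y\<close>, weighted by \<open>sqrt n\<close> and
  \<open>1 / sqrt n\<close>. Their geometric mean is the power \<open>5/8\<close>, free of
  \<open>n\<close>.\<close>

lemma powr58_bound:
  fixes x y n :: real
  assumes "0 \<le> x" "x \<le> 1" "0 \<le> y" "y \<le> 1" "n \<ge> 1"
  shows "(x * y) powr (5/8) \<le> sqrt n * (min x (sqrt (x / n)) * sqrt y)
      + sqrt n * (min y (sqrt (y / n)) * sqrt x) + (x + y) / sqrt n"
proof -
  let ?A = "sqrt n * (min x (sqrt (x / n)) * sqrt y)"
  let ?B = "sqrt n * (min y (sqrt (y / n)) * sqrt x)"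
  let ?C = "(x + y) / sqrt n"
  have n: "n > 0" "sqrt n > 0" using assms by auto
  have nonneg: "?A \<ge> 0" "?B \<ge> 0" "?C \<ge> 0" using assms by auto
  have xy1: "0 \<le> x * y" "x * y \<le> 1" using assms by (auto simp: mult_le_one)
  have half: "(x * y) powr (5/8) \<le> sqrt x * sqrt y"
  proof -
    have "(x * y) powr (5/8) \<le> (x * y) powr (1/2)"
      using xy1 by (cases "x * y = 0") (auto intro: powr_mono')
    then show ?thesis using xy1 by (simp add: powr_half_sqrt real_sqrt_mult)
  qed
  have big: "sqrt n * (min u (sqrt (u / n)) * sqrt v) = sqrt u * sqrt v" if "u > 1 / n" for u v
  proof -
    have "0 < 1 / n" using n by simp
    then have u0: "u \<ge> 0" using that by linarith
    have un: "u / n \<le> u\<^sup>2"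
      using mult_left_mono[OF less_imp_le[OF that] u0] by (simp add: power2_eq_square)
    have "sqrt (u / n) \<le> u" by (rule real_le_lsqrt[OF u0 un])
    then have "min u (sqrt (u / n)) = sqrt (u / n)" by simp
    then show ?thesis using n by (simp add: real_sqrt_divide)
  qed
  consider "x > 1 / n" | "y > 1 / n" | "x \<le> 1 / n" "y \<le> 1 / n" by linarith
  then show ?thesis
  proof cases
    case 1 then show ?thesis using half big[of x y] nonneg by linarith
  next
    case 2
    then have "?B = sqrt x * sqrt y" using big[of y x] by (simp only: mult.commute)
    then show ?thesis using half nonneg by linarith
  next
    case 3
    have small: "min u (sqrt (u / n)) = u" if "0 \<le> u" "u \<le> 1 / n" for u
    proof -
      have "u\<^sup>2 \<le> u / n" using mult_left_mono[OF that(2) that(1)] by (simp add: power2_eq_square)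
      then have "u \<le> sqrt (u / n)" by (rule real_le_rsqrt)
      then show ?thesis by simp
    qed
    \<comment> \<open>With \<open>z\<close> the eighth root of \<open>x * y\<close> and
      \<open>X\<close>, \<open>Y\<close> the fourth roots of \<open>x\<close>, \<open>y\<close>,
      every exponent is an integer and both uses of AM-GM become perfect squares.\<close>
    define z where "z = (x * y) powr (1/8)"
    define X where "X = sqrt (sqrt x)"
    define Y where "Y = sqrt (sqrt y)"
    have X: "sqrt x = X^2" "x = X^4" and Y: "sqrt y = Y^2" "y = Y^4" and XY0: "X \<ge> 0" "Y \<ge> 0"
      using assms by (auto simp: X_def Y_def power4_eq_xxxx mult.assoc)
    have zp: "(x * y) powr (real k / 8) = z ^ k" if "k > 0" for k
      unfolding z_def using xy1 that by (simp add: powr_realpow'[symmetric] powr_powr)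
    have z58: "(x * y) powr (5/8) = z ^ 5" using zp[of 5] by simp
    have z0: "z \<ge> 0" unfolding z_def by simp
    have "z ^ 8 = (X * Y) ^ 4" using zp[of 8] xy1 X Y by (simp add: power_mult_distrib)
    then have "(z ^ 2) ^ 4 = (X * Y) ^ 4" by simp
    then have zXY: "z ^ 2 = X * Y" using z0 XY0 by (subst (asm) power_eq_iff_eq_base) auto
    have z6: "x * sqrt y + y * sqrt x \<ge> 2 * z ^ 6"
    proof -
      have "z ^ 6 = (z^2)^3" by simp
      also have "\<dots> = (X * X^2 * Y * Y^2)" unfolding zXY by (simp add: power3_eq_cube power2_eq_square)
      finally have z6: "z ^ 6 = X^3 * Y^3" by (simp add: power3_eq_cube power2_eq_square)
      have "x * sqrt y + y * sqrt x - 2 * z^6 = (X * Y)^2 * (X - Y)^2"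
        unfolding z6 X(1) Y(1) by (subst X(2), subst Y(2)) algebra
      then show ?thesis by (smt (verit) zero_le_mult_iff zero_le_power2)
    qed
    have z4: "x + y \<ge> 2 * z ^ 4"
    proof -
      have "z ^ 4 = (z^2)^2" by simp
      then have z4: "z ^ 4 = X^2 * Y^2" unfolding zXY by (simp add: power_mult_distrib)
      have "x + y - 2 * z^4 = (X^2 - Y^2)^2"
        unfolding z4 by (subst X(2), subst Y(2)) algebra
      then show ?thesis by (smt (verit) zero_le_power2)
    qed
    define m where "m = sqrt n"
    have m: "m > 0" unfolding m_def using n by simp
    have "0 \<le> 2 * z^4 / m * (m * z - 1)^2" using m by simp
    also have "\<dots> = m * (2 * z^6) + 2 * z^4 / m - 4 * z^5"
      using m by (simp add: field_simps power2_eq_square) algebra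
    finally have key: "4 * z^5 \<le> m * (2 * z^6) + 2 * z^4 / m" by simp
    have "z^5 \<le> 4 * z^5" using z0 by simp
    also have "\<dots> \<le> m * (2 * z^6) + (2 * z^4) / m" using key by simp
    also have "\<dots> \<le> m * (x * sqrt y + y * sqrt x) + (x + y) / m"
      using z6 z4 m by (intro add_mono mult_left_mono divide_right_mono) auto
    finally show ?thesis unfolding z58 using small[of x] small[of y] 3 assms
      by (simp add: m_def distrib_left)
  qed
qed

text \<open>The factor \<open>2 * (2 * c + 1)\<close> of \<open>incidence_half\<close> counted for
  both sides, plus 1 for each of the two total masses.\<close>

definition incidence_const :: "nat \<Rightarrow> real" where "incidence_const c = 4 * (2 * real c + 1) + 2"

text \<open>After normalizing both total masses to 1, \<open>powr58_bound\<close> with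
  \<open>n = N\<close> is summed. The first two terms are the two orientations of
  \<open>incidence_half\<close>. The last one sums to at most \<open>2 * N / sqrt N\<close>. The
  factor \<open>sqrt N\<close>, in place of the \<open>N\<close> that is trivial for
  \<open>N\<close> times, is the whole gain from the absence of 4-cycles.\<close>

lemma incidence_bound:
  fixes A :: "'x set" and B :: "'y set" and wA :: "'x \<Rightarrow> real" and wB :: "'y \<Rightarrow> real"
    and \<alpha> :: "nat \<Rightarrow> 'x \<Rightarrow> 'q" and \<beta> :: "nat \<Rightarrow> 'y \<Rightarrow> 'q"
  assumes fin: "finite A" "finite B" "finite Q"
    and wA: "\<And>x. x \<in> A \<Longrightarrow> 0 \<le> wA x" and wB: "\<And>y. y \<in> B \<Longrightarrow> 0 \<le> wB y"
    and N: "N > 0"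
    and cyc: "\<And>x x' y y' i j k l. \<lbrakk>x \<in> A; x' \<in> A; y \<in> B; y' \<in> B; i < N; j < N; k < N; l < N;
        \<alpha> i x = \<beta> i y; \<alpha> j x' = \<beta> j y; \<alpha> k x = \<beta> k y'; \<alpha> l x' = \<beta> l y'; far c i j\<rbrakk> \<Longrightarrow> \<not> far c i k"
  shows "(\<Sum>i<N. \<Sum>q\<in>Q. (cmass wA A (\<alpha> i) q * cmass wB B (\<beta> i) q) powr (5/8))
     \<le> incidence_const c * sqrt N * (sum wA A * sum wB B) powr (5/8)"
proof -
  define W where "W = sum wA A"
  define V where "V = sum wB B"
  define m1 where "m1 i q = cmass wA A (\<alpha> i) q" for i q
  define m2 where "m2 i q = cmass wB B (\<beta> i) q" for i q
  have W0: "W \<ge> 0" unfolding W_def using wA by (simp add: sum_nonneg)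
  have V0: "V \<ge> 0" unfolding V_def using wB by (simp add: sum_nonneg)
  have m1: "m1 i q \<ge> 0" "m1 i q \<le> W" for i q unfolding m1_def W_def
    using wA fin by (auto intro: cmass_nonneg cmass_le)
  have m2: "m2 i q \<ge> 0" "m2 i q \<le> V" for i q unfolding m2_def V_def
    using wB fin by (auto intro: cmass_nonneg cmass_le)
  have C0: "incidence_const c \<ge> 0" by (simp add: incidence_const_def)
  show ?thesis
  proof (cases "W = 0 \<or> V = 0")
    case True
    then have "m1 i q * m2 i q = 0" for i q using m1[of i q] m2[of i q] by auto
    then have "(cmass wA A (\<alpha> i) q * cmass wB B (\<beta> i) q) = 0" for i q
      unfolding m1_def[symmetric] m2_def[symmetric] by simp
    then have "(\<Sum>i<N. \<Sum>q\<in>Q. (cmass wA A (\<alpha> i) q * cmass wB B (\<beta> i) q) powr (5/8)) = 0"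
      by (simp only: powr_0 sum.neutral_const)
    then show ?thesis using C0 by simp
  next
    case False
    then have p: "W > 0" "V > 0" using W0 V0 by auto
    have h1: "(\<Sum>i<N. \<Sum>q\<in>Q. min (m1 i q) (sqrt (W * m1 i q / N)) * sqrt (m2 i q))
        \<le> 2 * (2 * real c + 1) * W * sqrt V"
      unfolding m1_def m2_def W_def V_def
      using fin wA wB N cyc by (rule incidence_half)
    have h2: "(\<Sum>i<N. \<Sum>q\<in>Q. min (m2 i q) (sqrt (V * m2 i q / N)) * sqrt (m1 i q))
        \<le> 2 * (2 * real c + 1) * V * sqrt W"
      unfolding m1_def m2_def W_def V_def
    proof (rule incidence_half[where c = c])
      fix x x' y y' i j k l
      assume "x \<in> B" "x' \<in> B" "y \<in> A" "y' \<in> A" "i < N" "j < N" "k < N" "l < N"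
        "\<beta> i x = \<alpha> i y" "\<beta> j x' = \<alpha> j y" "\<beta> k x = \<alpha> k y'" "\<beta> l x' = \<alpha> l y'" "far c i j"
      \<comment> \<open>The hypothesis \<open>cyc\<close> is symmetric in the two sides: exchanging
        them exchanges the roles of \<open>far c i j\<close> and \<open>far c i k\<close>, and the
        claim is the contrapositive.\<close>
      then show "\<not> far c i k" using cyc[of y y' x x' i k j l] by auto
    qed (use fin wA wB N in auto)
    have h3: "(\<Sum>i<N. \<Sum>q\<in>Q. m1 i q) \<le> N * W"
    proof -
      have "(\<Sum>i<N. \<Sum>q\<in>Q. m1 i q) \<le> (\<Sum>i<N. W)"
        unfolding m1_def W_def using fin wA by (intro sum_mono sum_cmass_le) auto
      then show ?thesis by simp
    qed
    have h4: "(\<Sum>i<N. \<Sum>q\<in>Q. m2 i q) \<le> N * V"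
    proof -
      have "(\<Sum>i<N. \<Sum>q\<in>Q. m2 i q) \<le> (\<Sum>i<N. V)"
        unfolding m2_def V_def using fin wB by (intro sum_mono sum_cmass_le) auto
      then show ?thesis by simp
    qed
    have pw: "(m1 i q * m2 i q) powr (5/8) \<le> (W * V) powr (5/8) *
        (sqrt N / (W * sqrt V) * (min (m1 i q) (sqrt (W * m1 i q / N)) * sqrt (m2 i q))
        + sqrt N / (V * sqrt W) * (min (m2 i q) (sqrt (V * m2 i q / N)) * sqrt (m1 i q))
        + m1 i q / (W * sqrt N) + m2 i q / (V * sqrt N))" for i q
    proof -
      define x where "x = m1 i q / W"
      define y where "y = m2 i q / V"
      have xy: "0 \<le> x" "x \<le> 1" "0 \<le> y" "y \<le> 1"
        unfolding x_def y_def using m1[of i q] m2[of i q] p by auto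
      have e1: "m1 i q = W * x" "m2 i q = V * y" unfolding x_def y_def using p by auto
      have mn: "min (U * u) (sqrt (U * (U * u) / N)) = U * min u (sqrt (u / N))" if "U > 0" for U u :: real
      proof -
        have "sqrt (U * (U * u) / N) = sqrt (U^2 * (u / N))" by (simp add: power2_eq_square mult.assoc)
        also have "\<dots> = U * sqrt (u / N)" using that by (simp only: real_sqrt_mult real_sqrt_abs abs_of_pos)
        finally show ?thesis using that by (simp add: min_mult_distrib_left)
      qed
      have "(m1 i q * m2 i q) powr (5/8) = (W * V) powr (5/8) * (x * y) powr (5/8)"
        unfolding e1 using p xy by (simp add: powr_mult[symmetric] mult_ac)
      also have "\<dots> \<le> (W * V) powr (5/8) * (sqrt N * (min x (sqrt (x / N)) * sqrt y)
      + sqrt N * (min y (sqrt (y / N)) * sqrt x) + (x + y) / sqrt N)"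
        using N by (intro mult_left_mono powr58_bound xy) auto
      also have "sqrt N * (min x (sqrt (x / N)) * sqrt y)
         = sqrt N / (W * sqrt V) * (min (m1 i q) (sqrt (W * m1 i q / N)) * sqrt (m2 i q))"
        unfolding e1 mn[OF p(1)] real_sqrt_mult using p by simp
      also have "sqrt N * (min y (sqrt (y / N)) * sqrt x)
         = sqrt N / (V * sqrt W) * (min (m2 i q) (sqrt (V * m2 i q / N)) * sqrt (m1 i q))"
        unfolding e1 mn[OF p(2)] real_sqrt_mult using p by simp
      also have "(x + y) / sqrt N = m1 i q / (W * sqrt N) + m2 i q / (V * sqrt N)"
        unfolding e1 using p by (simp add: add_divide_distrib)
      finally show ?thesis by (simp add: add.assoc)
    qed
    have sN: "sqrt N > 0" using N by simp
    have "(\<Sum>i<N. \<Sum>q\<in>Q. (m1 i q * m2 i q) powr (5/8)) \<le> (\<Sum>i<N. \<Sum>q\<in>Q. (W * V) powr (5/8) *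
        (sqrt N / (W * sqrt V) * (min (m1 i q) (sqrt (W * m1 i q / N)) * sqrt (m2 i q))
        + sqrt N / (V * sqrt W) * (min (m2 i q) (sqrt (V * m2 i q / N)) * sqrt (m1 i q))
        + m1 i q / (W * sqrt N) + m2 i q / (V * sqrt N)))"
      by (intro sum_mono pw)
    also have "\<dots> = (W * V) powr (5/8) *
       (sqrt N / (W * sqrt V) * (\<Sum>i<N. \<Sum>q\<in>Q. min (m1 i q) (sqrt (W * m1 i q / N)) * sqrt (m2 i q))
      + sqrt N / (V * sqrt W) * (\<Sum>i<N. \<Sum>q\<in>Q. min (m2 i q) (sqrt (V * m2 i q / N)) * sqrt (m1 i q))
      + (\<Sum>i<N. \<Sum>q\<in>Q. m1 i q) / (W * sqrt N) + (\<Sum>i<N. \<Sum>q\<in>Q. m2 i q) / (V * sqrt N))"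
      by (simp only: sum_distrib_left[symmetric] sum_divide_distrib[symmetric] sum.distrib)
    also have "\<dots> \<le> (W * V) powr (5/8) *
       (sqrt N / (W * sqrt V) * (2 * (2 * real c + 1) * W * sqrt V)
      + sqrt N / (V * sqrt W) * (2 * (2 * real c + 1) * V * sqrt W)
      + (N * W) / (W * sqrt N) + (N * V) / (V * sqrt N))"
      using h1 h2 h3 h4 p sN
      by (intro mult_left_mono add_mono divide_right_mono) auto
    also have "\<dots> = (W * V) powr (5/8) * (incidence_const c * sqrt N)"
    proof -
      have "real N / sqrt N = sqrt N" using N by (simp add: real_div_sqrt)
      then show ?thesis using p unfolding incidence_const_def by (simp add: algebra_simps)
    qed
    finally show ?thesis unfolding m1_def m2_def W_def V_def by (simp add: mult_ac)
  qed
qed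

section \<open>Tangencies of quadratic functions\<close>

text \<open>Up to sign the discriminant of a quadratic is
  \<open>4 * k * value - slope\<^sup>2\<close> at any time \<open>u\<close>, so a tangency up to
  \<open>e\<close> makes it of order \<open>e\<^sup>2\<close> without reference to \<open>u\<close>.
  Replacing \<open>k\<close> by the common constant \<open>kap\<close> costs another multiple of
  \<open>e\<^sup>2\<close>; the constant is \<open>96 + 64 + 64\<close>.\<close>

lemma discriminant_close:
  fixes d0 d1 k kap u e :: real
  assumes v: "\<bar>d0 + d1 * u + k * u\<^sup>2\<bar> \<le> 8 * e\<^sup>2" and sl: "\<bar>d1 + 2 * k * u\<bar> \<le> 8 * e"
    and k: "\<bar>k\<bar> \<le> 3" "\<bar>k - kap\<bar> \<le> 2 * e\<^sup>2" and d0: "\<bar>d0\<bar> \<le> 8" and e: "0 \<le> e" "e \<le> 1"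
    and u: "0 \<le> u" "u \<le> 1"
  shows "\<bar>4 * kap * d0 - d1\<^sup>2\<bar> \<le> 224 * e\<^sup>2" "\<bar>d1 + 2 * kap * u\<bar> \<le> 12 * e"
proof -
  have eq: "4 * kap * d0 - d1\<^sup>2 = 4 * k * (d0 + d1 * u + k * u\<^sup>2) - (d1 + 2 * k * u)\<^sup>2 - 4 * (k - kap) * d0"
    by (simp add: power2_eq_square algebra_simps)
  have 1: "\<bar>4 * k * (d0 + d1 * u + k * u\<^sup>2)\<bar> \<le> 96 * e\<^sup>2"
  proof -
    have "\<bar>k\<bar> * \<bar>d0 + d1 * u + k * u\<^sup>2\<bar> \<le> 3 * (8 * e\<^sup>2)" using k v by (intro mult_mono) auto
    then show ?thesis by (simp add: abs_mult)
  qed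
  have 2: "(d1 + 2 * k * u)\<^sup>2 \<le> 64 * e\<^sup>2"
    using power_mono[OF sl, of 2] by (simp add: power_mult_distrib)
  have 3: "\<bar>4 * (k - kap) * d0\<bar> \<le> 64 * e\<^sup>2"
  proof -
    have "\<bar>k - kap\<bar> * \<bar>d0\<bar> \<le> (2 * e\<^sup>2) * 8" using k d0 by (intro mult_mono) auto
    moreover have "\<bar>4 * (k - kap) * d0\<bar> = 4 * (\<bar>k - kap\<bar> * \<bar>d0\<bar>)" by (simp only: abs_mult abs_numeral mult.assoc)
    ultimately show ?thesis by linarith
  qed
  have "0 \<le> (d1 + 2 * k * u)\<^sup>2" by simp
  with 1 2 3 eq show "\<bar>4 * kap * d0 - d1\<^sup>2\<bar> \<le> 224 * e\<^sup>2" by linarith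
  have "e\<^sup>2 \<le> e" using e by (simp add: power2_eq_square mult_left_le)
  then have "\<bar>k - kap\<bar> \<le> 2 * e" using k by linarith
  then have "\<bar>k - kap\<bar> * u \<le> (2 * e) * 1" using u e by (intro mult_mono) auto
  then have "\<bar>(k - kap) * u\<bar> \<le> 2 * e" using u by (simp add: abs_mult)
  moreover have "d1 + 2 * kap * u = (d1 + 2 * k * u) - 2 * ((k - kap) * u)" by (simp add: algebra_simps)
  ultimately show "\<bar>d1 + 2 * kap * u\<bar> \<le> 12 * e" using sl by linarith
qed

text \<open>For fixed nearly constant leading coefficient, tangency of \<open>x\<close> and \<open>y\<close> is the vanishing of
  \<open>4\<kappa>(Dv x - Dv y) - (Ds x - Ds y)\<^sup>2\<close>; in the alternating sum over a 4-cycle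
  only the product \<open>2 (Ds x - Ds x') (Ds y - Ds y')\<close> survives.\<close>

lemma four_cycle_normalized:
  fixes Dv Ds C :: "'x \<Rightarrow> real" and e kap :: real
  assumes e: "0 < e" "e \<le> 1" and kap: "1 / 32 \<le> \<bar>kap\<bar>"
    and T: "\<And>p q. p \<in> {x, x'} \<Longrightarrow> q \<in> {y, y'} \<Longrightarrow>
        0 \<le> u p q \<and> u p q \<le> 1 \<and> \<bar>C p - C q\<bar> \<le> 3 \<and> \<bar>C p - C q - kap\<bar> \<le> 2 * e\<^sup>2 \<and> \<bar>Dv p - Dv q\<bar> \<le> 8 \<and>
        \<bar>(Dv p - Dv q) + (Ds p - Ds q) * u p q + (C p - C q) * (u p q)\<^sup>2\<bar> \<le> 8 * e\<^sup>2 \<and>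
        \<bar>(Ds p - Ds q) + 2 * (C p - C q) * u p q\<bar> \<le> 8 * e"
  shows "\<not> (\<bar>u x y - u x' y\<bar> \<ge> 800 * e \<and> \<bar>u x y - u x y'\<bar> \<ge> 800 * e)"
proof
  assume far: "\<bar>u x y - u x' y\<bar> \<ge> 800 * e \<and> \<bar>u x y - u x y'\<bar> \<ge> 800 * e"
  have G: "\<bar>4 * kap * (Dv p - Dv q) - (Ds p - Ds q)\<^sup>2\<bar> \<le> 224 * e\<^sup>2"
       "\<bar>(Ds p - Ds q) + 2 * kap * u p q\<bar> \<le> 12 * e" if "p \<in> {x, x'}" "q \<in> {y, y'}" for p q
  proof -
    note t = T[OF that]
    have c: "0 \<le> e" using e by simp
    show "\<bar>4 * kap * (Dv p - Dv q) - (Ds p - Ds q)\<^sup>2\<bar> \<le> 224 * e\<^sup>2"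
      by (rule discriminant_close(1)[of _ _ "u p q" "C p - C q"]) (use t c e in auto)
    show "\<bar>(Ds p - Ds q) + 2 * kap * u p q\<bar> \<le> 12 * e"
      by (rule discriminant_close(2)[of "Dv p - Dv q" _ _ "C p - C q"]) (use t c e in auto)
  qed
  have id: "2 * ((Ds x - Ds x') * (Ds y - Ds y')) =
     (4 * kap * (Dv x - Dv y) - (Ds x - Ds y)\<^sup>2) - (4 * kap * (Dv x' - Dv y) - (Ds x' - Ds y)\<^sup>2)
     - (4 * kap * (Dv x - Dv y') - (Ds x - Ds y')\<^sup>2) + (4 * kap * (Dv x' - Dv y') - (Ds x' - Ds y')\<^sup>2)"
    by (simp add: power2_eq_square algebra_simps)
  have up: "\<bar>(Ds x - Ds x') * (Ds y - Ds y')\<bar> \<le> 448 * e\<^sup>2"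
    using id G(1)[of x y] G(1)[of x' y] G(1)[of x y'] G(1)[of x' y'] by simp
  \<comment> \<open>The constant 800 originates here. Times \<open>800 * e\<close> apart, with
    \<open>kap\<close> at least \<open>1/32\<close>, move the slope by
    \<open>2 * 800 / 32 = 50\<close> units; the two errors of 12 leave 26. The product
    \<open>26 * 26 = 676\<close> exceeds \<open>448 = 4 * 224 / 2\<close>, the bound that the four
    discriminants give.\<close>
  have low: "\<bar>d\<bar> \<ge> 26 * e" if "\<bar>d + 2 * kap * w\<bar> \<le> 24 * e" "\<bar>w\<bar> \<ge> 800 * e" for d w
  proof -
    have "(1/32) * (800 * e) \<le> \<bar>kap\<bar> * \<bar>w\<bar>" using kap that e by (intro mult_mono) auto
    then have "\<bar>2 * kap * w\<bar> \<ge> 50 * e" by (simp add: abs_mult)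
    then show ?thesis using that by linarith
  qed
  have "\<bar>Ds x - Ds x'\<bar> \<ge> 26 * e"
  proof (rule low[of _ "u x y - u x' y"])
    have "(Ds x - Ds x') + 2 * kap * (u x y - u x' y)
       = ((Ds x - Ds y) + 2 * kap * u x y) - ((Ds x' - Ds y) + 2 * kap * u x' y)"
      by (simp add: algebra_simps)
    then show "\<bar>(Ds x - Ds x') + 2 * kap * (u x y - u x' y)\<bar> \<le> 24 * e"
      using G(2)[of x y] G(2)[of x' y] by simp
  qed (use far in auto)
  moreover have "\<bar>Ds y' - Ds y\<bar> \<ge> 26 * e"
  proof (rule low[of _ "u x y - u x y'"])
    have "(Ds y' - Ds y) + 2 * kap * (u x y - u x y')
       = ((Ds x - Ds y) + 2 * kap * u x y) - ((Ds x - Ds y') + 2 * kap * u x y')"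
      by (simp add: algebra_simps)
    then show "\<bar>(Ds y' - Ds y) + 2 * kap * (u x y - u x y')\<bar> \<le> 24 * e"
      using G(2)[of x y] G(2)[of x y'] by simp
  qed (use far in auto)
  ultimately have "(26 * e) * (26 * e) \<le> \<bar>Ds x - Ds x'\<bar> * \<bar>Ds y' - Ds y\<bar>"
    using e by (intro mult_mono) auto
  also have "\<dots> = \<bar>(Ds x - Ds x') * (Ds y - Ds y')\<bar>" by (simp add: abs_mult abs_minus_commute)
  finally have "676 * e\<^sup>2 \<le> 448 * e\<^sup>2" using up by (simp add: power2_eq_square)
  then show False using e by simp
qed

definition qv :: "('x \<Rightarrow> real) \<Rightarrow> ('x \<Rightarrow> real) \<Rightarrow> ('x \<Rightarrow> real) \<Rightarrow> 'x \<Rightarrow> real \<Rightarrow> real" where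
  "qv a b c x s = a x + b x * s + c x * s\<^sup>2"

definition qd :: "('x \<Rightarrow> real) \<Rightarrow> ('x \<Rightarrow> real) \<Rightarrow> 'x \<Rightarrow> real \<Rightarrow> real" where
  "qd b c x s = b x + 2 * c x * s"

lemma qv_shift: "qv a b c x (s + h) = qv a b c x s + qd b c x s * h + c x * h\<^sup>2"
  by (simp add: qv_def qd_def power2_eq_square algebra_simps)

lemma qd_shift: "qd b c x (s + h) = qd b c x s + 2 * c x * h"
  by (simp add: qd_def algebra_simps)

text \<open>Parabolic rescaling reduces this to the unit interval: times and slopes are divided by
  \<open>R\<close>, values by \<open>R\<^sup>2\<close>, and leading coefficients stay as they are.
  This invariance is why the conditions on \<open>c\<close> can be imposed once and survive every
  level of the induction. The index \<open>n p q\<close> marks the piece in which \<open>p\<close>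
  and \<open>q\<close> are tangent.\<close>

lemma four_cycle:
  fixes a b c :: "'x \<Rightarrow> real" and N :: nat and R so kap :: real
  assumes N: "N > 0" and R: "R > 0" and kap: "1 / 32 \<le> \<bar>kap\<bar>"
    and close: "\<And>p q. p \<in> {x, x'} \<Longrightarrow> q \<in> {y, y'} \<Longrightarrow> \<bar>qv a b c p so - qv a b c q so\<bar> \<le> 8 * R\<^sup>2 \<and>
        \<bar>c p - c q\<bar> \<le> 3 \<and> \<bar>c p - c q - kap\<bar> \<le> 2 / (real N)\<^sup>2"
    and tang: "\<And>p q. p \<in> {x, x'} \<Longrightarrow> q \<in> {y, y'} \<Longrightarrow> n p q < N \<and>
        \<bar>qv a b c p (so + R * (n p q / N)) - qv a b c q (so + R * (n p q / N))\<bar> \<le> 8 * (R / N)\<^sup>2 \<and>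
        \<bar>qd b c p (so + R * (n p q / N)) - qd b c q (so + R * (n p q / N))\<bar> \<le> 8 * (R / N)"
    and far1: "far 800 (n x y) (n x' y)"
  shows "\<not> far 800 (n x y) (n x y')"
proof
  assume far2: "far 800 (n x y) (n x y')"
  define e where "e = 1 / real N"
  have e: "0 < e" "e \<le> 1" unfolding e_def using N by auto
  define u where "u p q = real (n p q) * e" for p q
  define Dv where "Dv p = qv a b c p so / R\<^sup>2" for p
  define Ds where "Ds p = qd b c p so / R" for p
  have "\<not> (\<bar>u x y - u x' y\<bar> \<ge> 800 * e \<and> \<bar>u x y - u x y'\<bar> \<ge> 800 * e)"
  proof (rule four_cycle_normalized[where kap = kap and C = c and Dv = Dv and Ds = Ds])
    fix p q assume pq: "p \<in> {x, x'}" "q \<in> {y, y'}"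
    note cl = close[OF pq] and tg = tang[OF pq]
    have h: "R * (n p q / N) = R * u p q" unfolding u_def e_def by simp
    have u: "0 \<le> u p q" "u p q \<le> 1" using tg N unfolding u_def e_def by auto
    have e1: "qv a b c p (so + R * (n p q / N)) - qv a b c q (so + R * (n p q / N)) =
        R\<^sup>2 * ((Dv p - Dv q) + (Ds p - Ds q) * u p q + (c p - c q) * (u p q)\<^sup>2)"
      unfolding h qv_shift Dv_def Ds_def using R by (simp add: field_simps power2_eq_square)
    have e2: "qd b c p (so + R * (n p q / N)) - qd b c q (so + R * (n p q / N)) =
        R * ((Ds p - Ds q) + 2 * (c p - c q) * u p q)"
      unfolding h qd_shift Ds_def using R by (simp add: field_simps)
    have e3: "qv a b c p so - qv a b c q so = R\<^sup>2 * (Dv p - Dv q)"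
      unfolding Dv_def using R by (simp add: field_simps)
    have r2: "R\<^sup>2 > 0" using R by simp
    have x1: "\<bar>Dv p - Dv q\<bar> \<le> 8"
      using cl r2 unfolding e3 by (simp add: abs_mult)
    have x2: "\<bar>(Dv p - Dv q) + (Ds p - Ds q) * u p q + (c p - c q) * (u p q)\<^sup>2\<bar> \<le> 8 * e\<^sup>2"
    proof -
      have "R\<^sup>2 * \<bar>(Dv p - Dv q) + (Ds p - Ds q) * u p q + (c p - c q) * (u p q)\<^sup>2\<bar> \<le> R\<^sup>2 * (8 * e\<^sup>2)"
        using tg unfolding e1 by (simp add: abs_mult e_def power_divide mult.commute)
      then show ?thesis using r2 by (simp only: mult_le_cancel_left_pos)
    qed
    have x3: "\<bar>(Ds p - Ds q) + 2 * (c p - c q) * u p q\<bar> \<le> 8 * e"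
    proof -
      have "R * \<bar>(Ds p - Ds q) + 2 * (c p - c q) * u p q\<bar> \<le> R * (8 * e)"
        using tg R unfolding e2 by (simp add: abs_mult e_def mult.commute)
      then show ?thesis using R by (simp only: mult_le_cancel_left_pos)
    qed
    show "0 \<le> u p q \<and> u p q \<le> 1 \<and> \<bar>c p - c q\<bar> \<le> 3 \<and> \<bar>c p - c q - kap\<bar> \<le> 2 * e\<^sup>2 \<and> \<bar>Dv p - Dv q\<bar> \<le> 8 \<and>
        \<bar>(Dv p - Dv q) + (Ds p - Ds q) * u p q + (c p - c q) * (u p q)\<^sup>2\<bar> \<le> 8 * e\<^sup>2 \<and>
        \<bar>(Ds p - Ds q) + 2 * (c p - c q) * u p q\<bar> \<le> 8 * e"
      using u cl x1 x2 x3 by (simp add: e_def power_divide)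
  qed (use e kap in auto)
  moreover have "\<bar>u p q - u p' q'\<bar> \<ge> 800 * e" if "far 800 (n p q) (n p' q')" for p q p' q'
  proof -
    have "800 \<le> \<bar>real (n p q) - real (n p' q')\<bar>" using that unfolding far_def by linarith
    then have "800 * e \<le> \<bar>real (n p q) - real (n p' q')\<bar> * e" using e by (intro mult_right_mono) auto
    also have "\<dots> = \<bar>u p q - u p' q'\<bar>" unfolding u_def left_diff_distrib[symmetric] using e by (simp add: abs_mult)
    finally show ?thesis .
  qed
  ultimately show False using far1 far2 by blast
qed

section \<open>Power inequalities for exponents at most one\<close>

lemma powr_add_le:
  fixes x y p :: real
  assumes "0 \<le> x" "0 \<le> y" "0 < p" "p \<le> 1"
  shows "(x + y) powr p \<le> x powr p + y powr p"
proof (cases "x + y = 0")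
  case True then show ?thesis using assms by simp
next
  case False
  then have s: "x + y > 0" using assms by simp
  have h: "u / (x + y) \<le> (u / (x + y)) powr p" if "0 \<le> u" "u \<le> x + y" for u
  proof (cases "u = 0")
    case False
    then have "0 < u / (x + y)" "u / (x + y) \<le> 1" using that s by auto
    then have "(u / (x + y)) powr 1 \<le> (u / (x + y)) powr p" using assms by (intro powr_mono') auto
    then show ?thesis using \<open>0 < u / (x + y)\<close> by (simp only: powr_one)
  qed simp
  have "1 = x / (x + y) + y / (x + y)" using s by (simp add: add_divide_distrib[symmetric])
  also have "\<dots> \<le> (x / (x + y)) powr p + (y / (x + y)) powr p"
    using assms by (intro add_mono h) auto
  also have "\<dots> = (x powr p + y powr p) / (x + y) powr p"
    using assms s by (simp add: powr_divide add_divide_distrib)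
  finally show ?thesis using s by (simp add: le_divide_eq)
qed

lemma powr_sum_le:
  fixes f :: "'i \<Rightarrow> real"
  assumes "finite I" "\<And>i. i \<in> I \<Longrightarrow> 0 \<le> f i" "0 < p" "p \<le> 1"
  shows "(\<Sum>i\<in>I. f i) powr p \<le> (\<Sum>i\<in>I. f i powr p)"
  using assms(1,2)
proof (induction I rule: finite_induct)
  case empty then show ?case using assms by simp
next
  case (insert i I)
  have "(f i + sum f I) powr p \<le> f i powr p + (sum f I) powr p"
    using insert assms by (intro powr_add_le sum_nonneg) auto
  also have "\<dots> \<le> f i powr p + (\<Sum>i\<in>I. f i powr p)" using insert by auto
  finally show ?case using insert by simp
qed

text \<open>\<open>5/8\<close> lies a quarter of the way from \<open>1/2\<close> to
  \<open>1\<close>, whence \<open>k powr (1/4)\<close>; the two terms balance at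
  \<open>sqrt u = k\<close>. In the application the sum of \<open>sqrt u\<close> over the cells is
  at most 1 at every time, while the sum of \<open>u\<close> is at most \<open>k\<close> only on
  average over time.\<close>

lemma powr58_interpolate:
  fixes u k :: real
  assumes "0 \<le> u" "0 < k"
  shows "u powr (5/8) \<le> k powr (1/4) * (sqrt u + u / k)"
proof (cases "u = 0")
  case False
  then have u: "u > 0" using assms by simp
  show ?thesis
  proof (cases "sqrt u \<le> k")
    case True
    have "u powr (5/8) = u powr (1/2) * (u powr (1/2)) powr (1/4)" using u by (simp add: powr_powr powr_add[symmetric])
    also have "\<dots> \<le> sqrt u * k powr (1/4)"
      using True u by (intro mult_mono powr_mono2) (auto simp: powr_half_sqrt)
    also have "\<dots> \<le> k powr (1/4) * (sqrt u + u / k)" using u assms by (simp add: algebra_simps)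
    finally show ?thesis .
  next
    case False
    have "k powr (3/4) \<le> (u powr (1/2)) powr (3/4)"
      using False assms by (intro powr_mono2) (auto simp: powr_half_sqrt)
    then have l: "k powr (3/4) \<le> u powr (3/8)" using u by (simp add: powr_powr)
    have "u powr (5/8) * k powr (3/4) \<le> u powr (5/8) * u powr (3/8)" using l by (intro mult_left_mono) auto
    also have "\<dots> = u" using u by (simp add: powr_add[symmetric])
    finally have "u powr (5/8) \<le> u / k powr (3/4)" using assms by (simp add: le_divide_eq)
    also have "\<dots> = k powr (1/4) * (u / k)"
    proof -
      have "k powr (1/4) * k powr (3/4) = k" using assms by (simp add: powr_add[symmetric])
      then show ?thesis using assms by (simp add: field_simps)
    qed
    also have "\<dots> \<le> k powr (1/4) * (sqrt u + u / k)" using u assms by (intro mult_left_mono) auto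
    finally show ?thesis .
  qed
qed (use assms in simp)

section \<open>Induction on scales\<close>

definition tslot :: "nat \<Rightarrow> nat \<Rightarrow> nat \<Rightarrow> real set" where
  "tslot N l J = {real J / real N ^ l ..< (real J + 1) / real N ^ l}"

text \<open>The mass of pairs in the cell \<open>v\<close> at time \<open>s\<close>, restricted to
  pairs for which \<open>s\<close> lies in \<open>S x y\<close>. Keeping \<open>S\<close> abstract
  lets one induction serve every class of tangencies.\<close>

definition pmass :: "('x \<Rightarrow> real) \<Rightarrow> ('x \<Rightarrow> real \<Rightarrow> int) \<Rightarrow> ('x \<Rightarrow> 'x \<Rightarrow> real set) \<Rightarrow>
    'x set \<Rightarrow> 'x set \<Rightarrow> real \<Rightarrow> int \<Rightarrow> real" where
  "pmass w cell S A B s v =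
    (\<Sum>x\<in>A. \<Sum>y\<in>B. if cell x s = v \<and> cell y s = v \<and> s \<in> S x y then w x * w y else 0)"

lemma tslot_sets [measurable]: "tslot N l J \<in> sets borel"
  by (simp add: tslot_def)

lemma emeasure_tslot: "N > 0 \<Longrightarrow> emeasure lborel (tslot N l J) = ennreal (1 / real N ^ l)"
  by (simp add: tslot_def add_divide_distrib divide_right_mono)

lemma tslot_split:
  assumes "N > 0" "s \<in> tslot N l J"
  shows "\<exists>i<N. s \<in> tslot N (Suc l) (N * J + i)"
proof -
  have Np: "real N ^ l > 0" "real N ^ Suc l > 0" using assms by auto
  define t where "t = s * real N ^ l - real J"
  have t: "0 \<le> t" "t < 1" using assms(2) Np unfolding t_def tslot_def by (auto simp: field_simps)
  define i where "i = nat \<lfloor>t * N\<rfloor>"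
  have f: "0 \<le> \<lfloor>t * N\<rfloor>" using t by simp
  have ri: "real i = of_int \<lfloor>t * N\<rfloor>" unfolding i_def using f by simp
  have i1: "real i \<le> t * N" "t * N < real i + 1" unfolding ri by linarith+
  have "t * N < 1 * real N" using t assms(1) by (intro mult_strict_right_mono) auto
  then have "i < N" using i1 by simp
  moreover have "s \<in> tslot N (Suc l) (N * J + i)"
    using i1 Np unfolding tslot_def t_def by (auto simp: field_simps)
  ultimately show ?thesis by blast
qed

lemma pmass_nonneg:
  assumes "\<And>x. 0 \<le> w x"
  shows "0 \<le> pmass w cell S A B s v"
  unfolding pmass_def using assms by (intro sum_nonneg) auto

lemma pmass_le:
  assumes "finite A" "finite B" "\<And>x. 0 \<le> w x"
  shows "pmass w cell S A B s v \<le> cmass w A (\<lambda>x. cell x s) v * cmass w B (\<lambda>x. cell x s) v"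
proof -
  have "pmass w cell S A B s v \<le> (\<Sum>x\<in>A. \<Sum>y\<in>B. (if cell x s = v then w x else 0) * (if cell y s = v then w y else 0))"
    unfolding pmass_def using assms by (intro sum_mono) auto
  also have "\<dots> = cmass w A (\<lambda>x. cell x s) v * cmass w B (\<lambda>x. cell x s) v"
    unfolding cmass_def using assms by (simp add: sum_product sum.inter_filter)
  finally show ?thesis .
qed

lemma pmass_measurable:
  assumes [measurable]: "\<And>x v. {s. cell x s = v} \<in> sets borel" "\<And>x y. S x y \<in> sets borel"
  shows "(\<lambda>s. pmass w cell S A B s v) \<in> borel_measurable borel"
proof -
  have [measurable]: "Measurable.pred borel (\<lambda>s. cell x s = v)" for x v
    using assms(1)[of x v] by (simp add: pred_def)
  show ?thesis unfolding pmass_def by measurable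
qed

text \<open>With masses normalized, AM-GM bounds the square roots of the pair masses of all cells by
  a total of 1 at each time. By \<open>meas\<close>, the pair masses themselves integrate to at most
  \<open>kap\<close> times the slot length. \<open>powr58_interpolate\<close> with
  \<open>k = kap\<close> gives both contributions equal weight, which is the factor 2.\<close>

lemma tangent_pair_mass_bound_base:
  fixes w :: "'x \<Rightarrow> real" and kap :: real
  assumes fin: "finite A" "finite B" "finite VV" and w: "\<And>x. 0 \<le> w x" and N: "N > 0" and kap: "kap > 0"
    and ms: "\<And>x v. {s. cell x s = v} \<in> sets borel" "\<And>x y. S x y \<in> sets borel"
    and meas: "\<And>x y. x \<in> A \<Longrightarrow> y \<in> B \<Longrightarrow>
      emeasure lborel {s \<in> tslot N L J. cell x s = cell y s \<and> s \<in> S x y} \<le> ennreal (kap / real N ^ L)"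
  shows "(\<integral>\<^sup>+s. ennreal (\<Sum>v\<in>VV. pmass w cell S A B s v powr (5/8)) * indicator (tslot N L J) s \<partial>lborel)
    \<le> ennreal (2 / real N ^ L * kap powr (1/4) * (sum w A * sum w B) powr (5/8))"
proof -
  define W where "W = sum w A"
  define V where "V = sum w B"
  have W0: "W \<ge> 0" "V \<ge> 0" unfolding W_def V_def using w by (auto simp: sum_nonneg)
  let ?mA = "\<lambda>s v. cmass w A (\<lambda>x. cell x s) v" and ?mB = "\<lambda>s v. cmass w B (\<lambda>x. cell x s) v"
  have mA: "0 \<le> ?mA s v" "?mA s v \<le> W" for s v unfolding W_def using w fin by (auto intro: cmass_nonneg cmass_le)
  have mB: "0 \<le> ?mB s v" "?mB s v \<le> V" for s v unfolding V_def using w fin by (auto intro: cmass_nonneg cmass_le)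
  have [measurable]: "Measurable.pred borel (\<lambda>s. cell x s = v)" for x v
    using ms(1)[of x v] by (simp add: pred_def)
  have [measurable]: "S x y \<in> sets borel" for x y by (rule ms)
  define p where "p s v = pmass w cell S A B s v" for s v
  have p0: "0 \<le> p s v" for s v unfolding p_def using w by (rule pmass_nonneg)
  have pm: "p s v \<le> ?mA s v * ?mB s v" for s v unfolding p_def using fin w by (intro pmass_le) auto
  show ?thesis
  proof (cases "W = 0 \<or> V = 0")
    case True
    have "p s v = 0" for s v
    proof -
      have "?mA s v * ?mB s v = 0" using True mA[of s v] mB[of s v] by auto
      then show ?thesis using pm[of s v] p0[of s v] by linarith
    qed
    then show ?thesis unfolding p_def by simp
  next
    case False
    then have WV: "W > 0" "V > 0" using W0 by auto
    define G where "G x y = {s. cell x s = cell y s \<and> s \<in> S x y}" for x y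
    have Gm: "G x y \<in> sets borel" for x y
    proof -
      have "G x y = (\<Union>v. {s. cell x s = v} \<inter> {s. cell y s = v}) \<inter> S x y" by (auto simp: G_def)
      then show ?thesis using ms by auto
    qed
    define T where "T s = (\<Sum>x\<in>A. \<Sum>y\<in>B. w x * w y * indicator (G x y) s)" for s :: real
    define K where "K = (W * V) powr (5/8) * kap powr (1/4)"
    have K0: "K \<ge> 0" unfolding K_def by simp
    have T0: "T s \<ge> 0" for s unfolding T_def using w by (intro sum_nonneg mult_nonneg_nonneg) auto
    have sumT: "(\<Sum>v\<in>VV. p s v) \<le> T s" for s
    proof -
      have "(\<Sum>v\<in>VV. p s v) = (\<Sum>x\<in>A. \<Sum>y\<in>B. \<Sum>v\<in>VV. if cell x s = v \<and> cell y s = v \<and> s \<in> S x y then w x * w y else 0)"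
        unfolding p_def pmass_def by (subst sum.swap, intro sum.cong refl, subst sum.swap) simp
      also have "\<dots> \<le> T s" unfolding T_def
      proof (intro sum_mono)
        fix x y
        have "(\<Sum>v\<in>VV. if cell x s = v \<and> cell y s = v \<and> s \<in> S x y then w x * w y else 0)
           = (\<Sum>v\<in>VV. if cell x s = v then (if s \<in> G x y then w x * w y else 0) else 0)"
          by (intro sum.cong) (auto simp: G_def)
        also have "\<dots> \<le> w x * w y * indicator (G x y) s"
          using fin w by (auto simp: sum.delta)
        finally show "(\<Sum>v\<in>VV. if cell x s = v \<and> cell y s = v \<and> s \<in> S x y then w x * w y else 0)
          \<le> w x * w y * indicator (G x y) s" .
      qed
      finally show ?thesis .
    qed
    have sumsq: "(\<Sum>v\<in>VV. sqrt (p s v / (W * V))) \<le> 1" for s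
    proof -
      have "(\<Sum>v\<in>VV. sqrt (p s v / (W * V))) \<le> (\<Sum>v\<in>VV. ?mA s v / (2 * W) + ?mB s v / (2 * V))"
      proof (rule sum_mono)
        fix v
        have "p s v / (W * V) \<le> (?mA s v / W) * (?mB s v / V)"
          using divide_right_mono[OF pm[of s v], of "W * V"] WV by simp
        then have "sqrt (p s v / (W * V)) \<le> sqrt ((?mA s v / W) * (?mB s v / V))" by simp
        also have "\<dots> \<le> (?mA s v / W + ?mB s v / V) / 2"
          using mA mB WV by (intro arith_geo_mean_sqrt) auto
        finally show "sqrt (p s v / (W * V)) \<le> ?mA s v / (2 * W) + ?mB s v / (2 * V)"
          by (simp add: field_simps)
      qed
      also have "\<dots> = (\<Sum>v\<in>VV. ?mA s v) / (2 * W) + (\<Sum>v\<in>VV. ?mB s v) / (2 * V)"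
        by (simp only: sum.distrib sum_divide_distrib)
      also have "\<dots> \<le> W / (2 * W) + V / (2 * V)"
        using WV fin w unfolding W_def V_def by (intro add_mono divide_right_mono sum_cmass_le) auto
      also have "\<dots> = 1" using WV by simp
      finally show ?thesis .
    qed
    have pt: "(\<Sum>v\<in>VV. p s v powr (5/8)) \<le> K + K / (W * V * kap) * T s" for s
    proof -
      have "(\<Sum>v\<in>VV. p s v powr (5/8)) \<le>
         (\<Sum>v\<in>VV. (W * V) powr (5/8) * (kap powr (1/4) * (sqrt (p s v / (W * V)) + p s v / (W * V) / kap)))"
      proof (rule sum_mono)
        fix v
        have "p s v powr (5/8) = (W * V) powr (5/8) * (p s v / (W * V)) powr (5/8)"
          using WV p0[of s v] by (simp add: powr_divide)
        also have "\<dots> \<le> (W * V) powr (5/8) * (kap powr (1/4) * (sqrt (p s v / (W * V)) + p s v / (W * V) / kap))"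
          using WV p0[of s v] kap by (intro mult_left_mono powr58_interpolate) auto
        finally show "p s v powr (5/8) \<le> (W * V) powr (5/8) * (kap powr (1/4) * (sqrt (p s v / (W * V)) + p s v / (W * V) / kap))" .
      qed
      also have "\<dots> = K * (\<Sum>v\<in>VV. sqrt (p s v / (W * V))) + K / (W * V * kap) * (\<Sum>v\<in>VV. p s v)"
      proof -
        have "(\<Sum>v\<in>VV. (W * V) powr (5/8) * (kap powr (1/4) * (sqrt (p s v / (W * V)) + p s v / (W * V) / kap)))
          = (\<Sum>v\<in>VV. K * sqrt (p s v / (W * V)) + K / (W * V * kap) * p s v)"
          unfolding K_def by (intro sum.cong refl) (simp add: algebra_simps)
        then show ?thesis by (simp only: sum.distrib sum_distrib_left)
      qed
      also have "\<dots> \<le> K * 1 + K / (W * V * kap) * T s"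
        using sumsq sumT K0 WV kap by (intro add_mono mult_left_mono) auto
      finally show ?thesis by simp
    qed
    have "(\<integral>\<^sup>+s. ennreal (\<Sum>v\<in>VV. p s v powr (5/8)) * indicator (tslot N L J) s \<partial>lborel)
       \<le> (\<integral>\<^sup>+s. ennreal K * indicator (tslot N L J) s + ennreal (K / (W * V * kap)) *
            (\<Sum>x\<in>A. \<Sum>y\<in>B. ennreal (w x * w y) * indicator (tslot N L J \<inter> G x y) s) \<partial>lborel)"
    proof (rule nn_integral_mono)
      fix s :: real
      have eT: "ennreal (T s) = (\<Sum>x\<in>A. \<Sum>y\<in>B. ennreal (w x * w y) * indicator (G x y) s)"
        unfolding T_def using w by (simp add: sum_ennreal[symmetric] sum_nonneg ennreal_mult ennreal_indicator)
      show "ennreal (\<Sum>v\<in>VV. p s v powr (5/8)) * indicator (tslot N L J) s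
        \<le> ennreal K * indicator (tslot N L J) s + ennreal (K / (W * V * kap)) *
            (\<Sum>x\<in>A. \<Sum>y\<in>B. ennreal (w x * w y) * indicator (tslot N L J \<inter> G x y) s)"
      proof (cases "s \<in> tslot N L J")
        case True
        have "ennreal (\<Sum>v\<in>VV. p s v powr (5/8)) \<le> ennreal (K + K / (W * V * kap) * T s)"
          using pt by (rule ennreal_leI)
        also have "\<dots> = ennreal K + ennreal (K / (W * V * kap)) * ennreal (T s)"
        proof -
          have "0 \<le> K / (W * V * kap)" using K0 WV kap by simp
          then show ?thesis using K0 T0[of s] by (simp only: ennreal_plus ennreal_mult mult_nonneg_nonneg)
        qed
        finally show ?thesis using True unfolding eT by (simp add: indicator_inter_arith)
      qed simp
    qed
    also have "\<dots> = ennreal K * emeasure lborel (tslot N L J) + ennreal (K / (W * V * kap)) *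
         (\<Sum>x\<in>A. \<Sum>y\<in>B. ennreal (w x * w y) * emeasure lborel (tslot N L J \<inter> G x y))"
      using Gm by (simp add: nn_integral_add nn_integral_cmult nn_integral_sum nn_integral_cmult_indicator)
    also have "\<dots> \<le> ennreal K * ennreal (1 / real N ^ L) + ennreal (K / (W * V * kap)) *
         (\<Sum>x\<in>A. \<Sum>y\<in>B. ennreal (w x * w y) * ennreal (kap / real N ^ L))"
    proof (intro add_mono mult_left_mono sum_mono)
      show "emeasure lborel (tslot N L J) \<le> ennreal (1 / real N ^ L)" using emeasure_tslot[OF N] by simp
      fix x y assume "x \<in> A" "y \<in> B"
      moreover have "tslot N L J \<inter> G x y = {s \<in> tslot N L J. cell x s = cell y s \<and> s \<in> S x y}"
        by (auto simp: G_def)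
      ultimately show "emeasure lborel (tslot N L J \<inter> G x y) \<le> ennreal (kap / real N ^ L)" using meas by simp
    qed auto
    also have "(\<Sum>x\<in>A. \<Sum>y\<in>B. ennreal (w x * w y) * ennreal (kap / real N ^ L)) = ennreal (W * V * (kap / real N ^ L))"
    proof -
      have "(\<Sum>x\<in>A. \<Sum>y\<in>B. ennreal (w x * w y) * ennreal (kap / real N ^ L))
         = ennreal (\<Sum>x\<in>A. \<Sum>y\<in>B. w x * w y * (kap / real N ^ L))"
        using w kap by (simp add: sum_nonneg ennreal_mult''[symmetric])
      also have "(\<Sum>x\<in>A. \<Sum>y\<in>B. w x * w y * (kap / real N ^ L)) = W * V * (kap / real N ^ L)"
        unfolding W_def V_def sum_product by (simp only: sum_distrib_right)
      finally show ?thesis .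
    qed
    also have "ennreal K * ennreal (1 / real N ^ L) + ennreal (K / (W * V * kap)) * ennreal (W * V * (kap / real N ^ L))
       = ennreal (K * (1 / real N ^ L) + K / (W * V * kap) * (W * V * (kap / real N ^ L)))"
      using K0 WV kap by (simp add: ennreal_mult[symmetric] ennreal_plus[symmetric] del: ennreal_plus)
    also have "K * (1 / real N ^ L) + K / (W * V * kap) * (W * V * (kap / real N ^ L))
        = 2 / real N ^ L * kap powr (1/4) * (W * V) powr (5/8)"
      unfolding K_def using WV kap N by (simp add: field_simps)
    finally show ?thesis unfolding p_def W_def V_def .
  qed
qed

definition offs :: "(int \<times> int) set" where "offs = {-7..7} \<times> {-7..7}"

lemma offs_finite: "finite offs" and offs_card: "card offs = 225" by (auto simp: offs_def)

lemma floor_diff_bound: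
  fixes p q :: real
  assumes "\<bar>p - q\<bar> \<le> real k"
  shows "\<bar>\<lfloor>p\<rfloor> - \<lfloor>q\<rfloor>\<bar> \<le> int k"
proof -
  have "p \<le> q + of_int (int k)" "q \<le> p + of_int (int k)" using assms by auto
  from this[THEN floor_mono] have "\<lfloor>p\<rfloor> \<le> \<lfloor>q\<rfloor> + int k" "\<lfloor>q\<rfloor> \<le> \<lfloor>p\<rfloor> + int k"
    by (simp_all only: floor_add_int[symmetric])
  then show ?thesis by linarith
qed

text \<open>In each induction step, pairs tangent within a subinterval are sorted by the rounded value and
  slope at its left end; \<open>offs\<close> lists the possible differences of these labels.\<close>

lemma tangent_pair_mass_bound:
  fixes a b c w :: "'x \<Rightarrow> real" and kap0 kap :: real
  assumes fin: "finite VV" and w: "\<And>x. 0 \<le> w x" and N: "N > 0" and kap: "kap > 0" and kap0: "1 / 32 \<le> \<bar>kap0\<bar>"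
    and ms: "\<And>x v. {s. cell x s = v} \<in> sets borel" "\<And>x y. S x y \<in> sets borel"
    and meas: "\<And>x y J. emeasure lborel {s \<in> tslot N L J. cell x s = cell y s \<and> s \<in> S x y} \<le> ennreal (kap / real N ^ L)"
    and small: "\<And>x y s. cell x s = cell y s \<Longrightarrow> s \<in> S x y \<Longrightarrow>
       \<bar>qv a b c x s - qv a b c y s\<bar> \<le> (1 / real N ^ L)\<^sup>2 \<and> \<bar>qd b c x s - qd b c y s\<bar> \<le> 1 / real N ^ L"
  shows "l + k = L \<Longrightarrow> finite A \<Longrightarrow> finite B \<Longrightarrow>
    (\<And>x y. x \<in> A \<Longrightarrow> y \<in> B \<Longrightarrow> \<bar>qv a b c x (real J / real N ^ l) - qv a b c y (real J / real N ^ l)\<bar> \<le> 8 * (1 / real N ^ l)\<^sup>2 \<and>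
        \<bar>c x - c y\<bar> \<le> 3 \<and> \<bar>c x - c y - kap0\<bar> \<le> 2 / (real N)\<^sup>2) \<Longrightarrow>
    (\<integral>\<^sup>+s. ennreal (\<Sum>v\<in>VV. pmass w cell S A B s v powr (5/8)) * indicator (tslot N l J) s \<partial>lborel)
    \<le> ennreal ((225 * incidence_const 800 * sqrt N) ^ k * (2 / real N ^ L * kap powr (1/4)) * (sum w A * sum w B) powr (5/8))"
proof (induction k arbitrary: l J A B)
  case 0
  have "(\<integral>\<^sup>+s. ennreal (\<Sum>v\<in>VV. pmass w cell S A B s v powr (5/8)) * indicator (tslot N L J) s \<partial>lborel)
    \<le> ennreal (2 / real N ^ L * kap powr (1/4) * (sum w A * sum w B) powr (5/8))"
    using 0(2,3) fin w N kap ms meas by (rule tangent_pair_mass_bound_base)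
  then show ?case using 0(1) by simp
next
  case (Suc k)
  define R where "R = 1 / real N ^ l"
  define R' where "R' = 1 / real N ^ Suc l"
  define s0 where "s0 = real J / real N ^ l"
  define st where "st i = real (N * J + i) / real N ^ Suc l" for i
  have Np: "real N ^ l > 0" "real N ^ Suc l > 0" "real N > 0" using N by auto
  have R: "R > 0" "R' > 0" "R / N = R'" using Np by (auto simp: R_def R'_def)
  have st: "st i = s0 + R * (i / N)" for i using Np by (simp add: st_def s0_def R_def field_simps)
  have LR: "1 / real N ^ L \<le> R'"
  proof -
    have "real N ^ Suc l \<le> real N ^ L" using N Suc.prems(1) by (intro power_increasing) auto
    then show ?thesis using Np unfolding R'_def by (intro divide_left_mono) auto
  qed
  note finA = Suc.prems(2) and finB = Suc.prems(3)
  have close: "\<bar>qv a b c x s0 - qv a b c y s0\<bar> \<le> 8 * R\<^sup>2" "\<bar>c x - c y\<bar> \<le> 3" "\<bar>c x - c y - kap0\<bar> \<le> 2 / (real N)\<^sup>2"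
    if "x \<in> A" "y \<in> B" for x y
    using Suc.prems(4)[OF that] by (auto simp: R_def s0_def)
  define lab where "lab i x = (\<lfloor>qv a b c x (st i) / R'\<^sup>2\<rfloor>, \<lfloor>qd b c x (st i) / R'\<rfloor>)" for i x
  \<comment> \<open>Shifting the labels of the second family by \<open>e\<close> turns nearly equal
    labels into equal ones, the form in which \<open>incidence_bound\<close> sees a
    tangency.\<close>
  define lab2 where "lab2 e i x = (fst (lab i x) - fst e, snd (lab i x) - snd e)" for e :: "int \<times> int" and i x
  define Q where "Q = (\<Union>i<N. lab i ` A)"
  have finQ: "finite Q" unfolding Q_def using finA by auto
  define A' where "A' i q = {x \<in> A. lab i x = q}" for i q
  define B' where "B' e i q = {y \<in> B. lab2 e i y = q}" for e i q
  define K where "K = (225 * incidence_const 800 * sqrt N) ^ k * (2 / real N ^ L * kap powr (1/4))"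
  have K0: "K \<ge> 0" unfolding K_def incidence_const_def by simp
  \<comment> \<open>Labels that agree after a shift by at most 7 come from numbers at most 8 units
    apart. The same 8 stands in the hypothesis on \<open>A\<close> and \<open>B\<close>, so the
    classes satisfy it one level further down and the induction closes.\<close>
  have labclose: "\<bar>qv a b c x (st i) - qv a b c y (st i)\<bar> \<le> 8 * R'\<^sup>2 \<and> \<bar>qd b c x (st i) - qd b c y (st i)\<bar> \<le> 8 * R'"
    if "lab i x = lab2 e i y" "e \<in> offs" for i x y e
  proof -
    have gen: "\<bar>p - q\<bar> \<le> 8 * M" if "\<lfloor>p / M\<rfloor> = \<lfloor>q / M\<rfloor> - z" "-7 \<le> z" "z \<le> 7" "M > 0" for p q M :: real and z :: int
    proof -
      have "\<bar>p / M - q / M\<bar> \<le> 8" using that(1-3) by linarith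
      then have "\<bar>p - q\<bar> / M \<le> 8" using that(4) by (simp add: diff_divide_distrib[symmetric])
      then show ?thesis using that(4) by (simp add: divide_le_eq)
    qed
    have "\<lfloor>qv a b c x (st i) / R'\<^sup>2\<rfloor> = \<lfloor>qv a b c y (st i) / R'\<^sup>2\<rfloor> - fst e"
        "\<lfloor>qd b c x (st i) / R'\<rfloor> = \<lfloor>qd b c y (st i) / R'\<rfloor> - snd e"
      using that(1) by (simp_all add: lab_def lab2_def)
    moreover have "-7 \<le> fst e" "fst e \<le> 7" "-7 \<le> snd e" "snd e \<le> 7"
      using that(2) by (auto simp: offs_def)
    moreover have "R'\<^sup>2 > 0" using R by simp
    ultimately show ?thesis using gen R(2) by blast
  qed
  have pair: "\<exists>e\<in>offs. \<exists>q\<in>Q. lab i x = q \<and> lab2 e i y = q"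
    if xy: "x \<in> A" "y \<in> B" and i: "i < N" and s: "s \<in> tslot N (Suc l) (N * J + i)" and c1: "cell x s = cell y s" "s \<in> S x y"
    for x y i s
  proof -
    define h where "h = s - st i"
    have "(real (N * J + i) + 1) / real N ^ Suc l = st i + R'"
      by (simp only: st_def R'_def add_divide_distrib)
    then have "st i \<le> s" "s \<le> st i + R'" using s unfolding tslot_def by (auto simp: st_def)
    then have h: "0 \<le> h" "h \<le> R'" unfolding h_def by auto
    have sm: "\<bar>qv a b c x s - qv a b c y s\<bar> \<le> R'\<^sup>2" "\<bar>qd b c x s - qd b c y s\<bar> \<le> R'"
    proof -
      have "(1 / real N ^ L)\<^sup>2 \<le> R'\<^sup>2" using LR by (intro power_mono) auto
      then show "\<bar>qv a b c x s - qv a b c y s\<bar> \<le> R'\<^sup>2" using small[OF c1] by linarith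
      show "\<bar>qd b c x s - qd b c y s\<bar> \<le> R'" using small[OF c1] LR by linarith
    qed
    have sti: "st i = s + (- h)" unfolding h_def by simp
    have c3: "\<bar>c x - c y\<bar> \<le> 3" using close xy by blast
    have ch: "\<bar>(c x - c y) * h\<bar> \<le> 3 * R'" unfolding abs_mult using c3 h R by (intro mult_mono) auto
    \<comment> \<open>Of the 7 units, one is the slope difference at \<open>s\<close>, and
      \<open>2 * 3\<close> come from the drift back to the left end, as leading coefficients differ
      by at most 3. This determines the range of \<open>offs\<close>.\<close>
    have d1: "\<bar>qd b c x (st i) - qd b c y (st i)\<bar> \<le> 7 * R'"
    proof -
      have "qd b c x (st i) - qd b c y (st i) = (qd b c x s - qd b c y s) - 2 * ((c x - c y) * h)"
        unfolding sti qd_shift by (simp add: algebra_simps)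
      then show ?thesis using ch sm by linarith
    qed
    have d2: "\<bar>qv a b c x (st i) - qv a b c y (st i)\<bar> \<le> 7 * R'\<^sup>2"
    proof -
      have "qv a b c x (st i) - qv a b c y (st i)
        = (qv a b c x s - qv a b c y s) - (qd b c x s - qd b c y s) * h + (c x - c y) * h * h"
        unfolding sti qv_shift by (simp add: algebra_simps power2_eq_square)
      moreover have "\<bar>(qd b c x s - qd b c y s) * h\<bar> \<le> R' * R'"
        unfolding abs_mult using sm h R by (intro mult_mono) auto
      moreover have "\<bar>(c x - c y) * h * h\<bar> \<le> (3 * R') * R'"
        unfolding abs_mult[of "(c x - c y) * h" h] using ch h R by (intro mult_mono) auto
      ultimately show ?thesis using sm R by (simp add: power2_eq_square)
    qed
    define e where "e = (fst (lab i y) - fst (lab i x), snd (lab i y) - snd (lab i x))"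
    have gen: "\<bar>\<lfloor>q / M\<rfloor> - \<lfloor>p / M\<rfloor>\<bar> \<le> 7" if "\<bar>p - q\<bar> \<le> 7 * M" "M > 0" for p q M :: real
    proof -
      have "\<bar>q - p\<bar> / M \<le> 7" using that by (simp add: divide_le_eq abs_minus_commute)
      then have "\<bar>q / M - p / M\<bar> \<le> real 7" using that(2) by (simp add: diff_divide_distrib[symmetric])
      from floor_diff_bound[OF this] show ?thesis by simp
    qed
    have "e \<in> offs" unfolding e_def offs_def lab_def using gen[OF d2] gen[OF d1] R by auto
    moreover have "lab i x \<in> Q" unfolding Q_def using xy i by auto
    moreover have "lab2 e i y = lab i x" unfolding lab2_def e_def by simp
    ultimately show ?thesis by blast
  qed
  have pm_split: "pmass w cell S A B s v \<le> (\<Sum>e\<in>offs. \<Sum>q\<in>Q. pmass w cell S (A' i q) (B' e i q) s v)"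
    if i: "i < N" and s: "s \<in> tslot N (Suc l) (N * J + i)" for i s v
  proof -
    let ?t = "\<lambda>x y. if cell x s = v \<and> cell y s = v \<and> s \<in> S x y then w x * w y else 0"
    have t0: "?t x y \<ge> 0" for x y using w by simp
    have "pmass w cell S A B s v = (\<Sum>x\<in>A. \<Sum>y\<in>B. ?t x y)" by (simp add: pmass_def)
    also have "\<dots> \<le> (\<Sum>x\<in>A. \<Sum>y\<in>B. \<Sum>e\<in>offs. \<Sum>q\<in>Q. if lab i x = q \<and> lab2 e i y = q then ?t x y else 0)"
    proof (intro sum_mono)
      fix x y assume xy: "x \<in> A" "y \<in> B"
      let ?g = "\<lambda>e q. if lab i x = q \<and> lab2 e i y = q then ?t x y else 0"
      have g0: "?g e q \<ge> 0" for e q using t0[of x y] by simp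
      show "?t x y \<le> (\<Sum>e\<in>offs. \<Sum>q\<in>Q. ?g e q)"
      proof (cases "cell x s = v \<and> cell y s = v \<and> s \<in> S x y")
        case True
        then have "cell x s = cell y s" "s \<in> S x y" by auto
        from pair[OF xy i s this] obtain e q where eq: "e \<in> offs" "q \<in> Q" "lab i x = q" "lab2 e i y = q"
          by blast
        have "?t x y = ?g e q" using eq by simp
        also have "\<dots> \<le> (\<Sum>q\<in>Q. ?g e q)" by (rule member_le_sum) (use eq finQ g0 in auto)
        also have "\<dots> \<le> (\<Sum>e\<in>offs. \<Sum>q\<in>Q. ?g e q)"
          by (rule member_le_sum[of e "offs" "\<lambda>e. \<Sum>q\<in>Q. ?g e q"], rule eq(1), intro sum_nonneg g0, rule offs_finite)
        finally show ?thesis .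
      next
        case False
        have "0 \<le> (\<Sum>e\<in>offs. \<Sum>q\<in>Q. ?g e q)" by (intro sum_nonneg g0)
        moreover have "?t x y = 0" using False by (rule if_not_P)
        ultimately show ?thesis by linarith
      qed
    qed
    also have "\<dots> = (\<Sum>e\<in>offs. \<Sum>q\<in>Q. \<Sum>x\<in>A. \<Sum>y\<in>B. if lab i x = q \<and> lab2 e i y = q then ?t x y else 0)"
    proof -
      let ?f = "\<lambda>x y e q. if lab i x = q \<and> lab2 e i y = q then ?t x y else 0"
      have "(\<Sum>x\<in>A. \<Sum>y\<in>B. \<Sum>e\<in>offs. \<Sum>q\<in>Q. ?f x y e q) = (\<Sum>x\<in>A. \<Sum>e\<in>offs. \<Sum>y\<in>B. \<Sum>q\<in>Q. ?f x y e q)"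
        by (intro sum.cong refl) (rule sum.swap)
      also have "\<dots> = (\<Sum>e\<in>offs. \<Sum>x\<in>A. \<Sum>y\<in>B. \<Sum>q\<in>Q. ?f x y e q)" by (rule sum.swap)
      also have "\<dots> = (\<Sum>e\<in>offs. \<Sum>x\<in>A. \<Sum>q\<in>Q. \<Sum>y\<in>B. ?f x y e q)"
        by (intro sum.cong refl) (rule sum.swap)
      also have "\<dots> = (\<Sum>e\<in>offs. \<Sum>q\<in>Q. \<Sum>x\<in>A. \<Sum>y\<in>B. ?f x y e q)"
        by (intro sum.cong refl) (rule sum.swap)
      finally show ?thesis .
    qed
    also have "\<dots> = (\<Sum>e\<in>offs. \<Sum>q\<in>Q. pmass w cell S (A' i q) (B' e i q) s v)"
    proof (intro sum.cong refl)
      fix e q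
      have "(\<Sum>x\<in>A. \<Sum>y\<in>B. if lab i x = q \<and> lab2 e i y = q then ?t x y else 0)
          = (\<Sum>x\<in>A. if lab i x = q then (\<Sum>y\<in>B. if lab2 e i y = q then ?t x y else 0) else 0)"
        by (intro sum.cong refl) auto
      also have "\<dots> = (\<Sum>x\<in>A' i q. \<Sum>y\<in>B' e i q. ?t x y)"
        unfolding A'_def B'_def by (simp only: sum.inter_filter[OF finA] sum.inter_filter[OF finB])
      finally show "(\<Sum>x\<in>A. \<Sum>y\<in>B. if lab i x = q \<and> lab2 e i y = q then ?t x y else 0)
          = pmass w cell S (A' i q) (B' e i q) s v" unfolding pmass_def .
    qed
    finally show ?thesis .
  qed
  define Phi where "Phi A B s = ennreal (\<Sum>v\<in>VV. pmass w cell S A B s v powr (5/8))" for A B s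
  have Phim [measurable]: "Phi A B \<in> borel_measurable borel" for A B
  proof -
    have [measurable]: "(\<lambda>s. pmass w cell S A B s v) \<in> borel_measurable borel" for v
      using ms by (rule pmass_measurable)
    show ?thesis unfolding Phi_def by measurable
  qed
  have Phi_split: "Phi A B s \<le> (\<Sum>e\<in>offs. \<Sum>q\<in>Q. Phi (A' i q) (B' e i q) s)"
    if i: "i < N" and s: "s \<in> tslot N (Suc l) (N * J + i)" for i s
  proof -
    have "(\<Sum>v\<in>VV. pmass w cell S A B s v powr (5/8))
        \<le> (\<Sum>v\<in>VV. \<Sum>e\<in>offs. \<Sum>q\<in>Q. pmass w cell S (A' i q) (B' e i q) s v powr (5/8))"
    proof (rule sum_mono)
      fix v
      have "pmass w cell S A B s v powr (5/8) \<le> (\<Sum>e\<in>offs. \<Sum>q\<in>Q. pmass w cell S (A' i q) (B' e i q) s v) powr (5/8)"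
        using pm_split[OF i s] pmass_nonneg[OF w] by (intro powr_mono2) auto
      also have "\<dots> \<le> (\<Sum>e\<in>offs. (\<Sum>q\<in>Q. pmass w cell S (A' i q) (B' e i q) s v) powr (5/8))"
        using offs_finite w by (intro powr_sum_le sum_nonneg pmass_nonneg) auto
      also have "\<dots> \<le> (\<Sum>e\<in>offs. \<Sum>q\<in>Q. pmass w cell S (A' i q) (B' e i q) s v powr (5/8))"
        using finQ w by (intro sum_mono powr_sum_le pmass_nonneg) auto
      finally show "pmass w cell S A B s v powr (5/8) \<le> (\<Sum>e\<in>offs. \<Sum>q\<in>Q. pmass w cell S (A' i q) (B' e i q) s v powr (5/8))" .
    qed
    also have "\<dots> = (\<Sum>e\<in>offs. \<Sum>q\<in>Q. \<Sum>v\<in>VV. pmass w cell S (A' i q) (B' e i q) s v powr (5/8))"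
    proof -
      have "(\<Sum>v\<in>VV. \<Sum>e\<in>offs. \<Sum>q\<in>Q. g v e q) = (\<Sum>e\<in>offs. \<Sum>q\<in>Q. \<Sum>v\<in>VV. g v e q)" for g :: "int \<Rightarrow> int \<times> int \<Rightarrow> int \<times> int \<Rightarrow> real"
        by (subst sum.swap, intro sum.cong refl, rule sum.swap)
      then show ?thesis .
    qed
    finally have "ennreal (\<Sum>v\<in>VV. pmass w cell S A B s v powr (5/8))
       \<le> ennreal (\<Sum>e\<in>offs. \<Sum>q\<in>Q. \<Sum>v\<in>VV. pmass w cell S (A' i q) (B' e i q) s v powr (5/8))" by (rule ennreal_leI)
    then show ?thesis unfolding Phi_def by (simp add: sum_nonneg)
  qed
  have IH: "(\<integral>\<^sup>+s. Phi (A' i q) (B' e i q) s * indicator (tslot N (Suc l) (N * J + i)) s \<partial>lborel)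
      \<le> ennreal (K * (sum w (A' i q) * sum w (B' e i q)) powr (5/8))" if e: "e \<in> offs" for i q e
    unfolding Phi_def K_def
  proof (rule Suc.IH)
    show "Suc l + k = L" using Suc.prems(1) by simp
    show "finite (A' i q)" "finite (B' e i q)" using finA finB by (auto simp: A'_def B'_def)
    fix x y assume x: "x \<in> A' i q" and y: "y \<in> B' e i q"
    then have "lab i x = lab2 e i y" by (auto simp: A'_def B'_def)
    from labclose[OF this e] close[of x y] x y
    show "\<bar>qv a b c x (real (N * J + i) / real N ^ Suc l) - qv a b c y (real (N * J + i) / real N ^ Suc l)\<bar> \<le> 8 * (1 / real N ^ Suc l)\<^sup>2 \<and>
       \<bar>c x - c y\<bar> \<le> 3 \<and> \<bar>c x - c y - kap0\<bar> \<le> 2 / (real N)\<^sup>2"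
      by (auto simp: A'_def B'_def st_def R'_def)
  qed
  have inc: "(\<Sum>i<N. \<Sum>q\<in>Q. (sum w (A' i q) * sum w (B' e i q)) powr (5/8))
      \<le> incidence_const 800 * sqrt N * (sum w A * sum w B) powr (5/8)" if e: "e \<in> offs" for e
  proof -
    have "(\<Sum>i<N. \<Sum>q\<in>Q. (cmass w A (lab i) q * cmass w B (lab2 e i) q) powr (5/8))
      \<le> incidence_const 800 * sqrt N * (sum w A * sum w B) powr (5/8)"
    proof (rule incidence_bound[OF finA finB finQ w w N])
      fix x x' y y' i j k l'
      assume h: "x \<in> A" "x' \<in> A" "y \<in> B" "y' \<in> B" "i < N" "j < N" "k < N" "l' < N"
        "lab i x = lab2 e i y" "lab j x' = lab2 e j y" "lab k x = lab2 e k y'" "lab l' x' = lab2 e l' y'" "far 800 i j"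
      \<comment> \<open>The points may coincide, whereas \<open>four_cycle\<close> takes the
        tangency time as a function of the two points. Indexing the corners by 0 to 3 keeps the four
        times separate.\<close>
      define f :: "nat \<Rightarrow> 'x" where "f m = (if m = 0 then x else if m = 1 then x' else if m = 2 then y else y')" for m
      define n :: "nat \<Rightarrow> nat \<Rightarrow> nat" where
        "n p q = (if p = 0 then (if q = 2 then i else k) else (if q = 2 then j else l'))" for p q
      have f: "f 0 = x" "f 1 = x'" "f 2 = y" "f 3 = y'" by (simp_all add: f_def)
      have n: "n 0 2 = i" "n 0 3 = k" "n 1 2 = j" "n 1 3 = l'" by (simp_all add: n_def)
      have qf: "qv (a \<circ> f) (b \<circ> f) (c \<circ> f) p s = qv a b c (f p) s" "qd (b \<circ> f) (c \<circ> f) p s = qd b c (f p) s" for p s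
        by (simp_all add: qv_def qd_def)
      have "\<not> far 800 (n 0 2) (n 0 3)"
      proof (rule four_cycle[where a = "a \<circ> f" and b = "b \<circ> f" and c = "c \<circ> f" and R = R and so = s0 and kap = kap0 and N = N
            and x = 0 and x' = 1 and y = 2 and y' = 3 and n = n])
        fix p q :: nat assume pq: "p \<in> {0, 1}" "q \<in> {2, 3}"
        have "f p \<in> A" "f q \<in> B" using pq h by (auto simp: f_def)
        from close[OF this]
        show "\<bar>qv (a \<circ> f) (b \<circ> f) (c \<circ> f) p s0 - qv (a \<circ> f) (b \<circ> f) (c \<circ> f) q s0\<bar> \<le> 8 * R\<^sup>2 \<and>
            \<bar>(c \<circ> f) p - (c \<circ> f) q\<bar> \<le> 3 \<and> \<bar>(c \<circ> f) p - (c \<circ> f) q - kap0\<bar> \<le> 2 / (real N)\<^sup>2"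
          by (simp add: qf)
        have "n p q < N" using pq h by (auto simp: n_def)
        moreover have "lab (n p q) (f p) = lab2 e (n p q) (f q)"
          using pq h f n by auto
        ultimately show "n p q < N \<and>
          \<bar>qv (a \<circ> f) (b \<circ> f) (c \<circ> f) p (s0 + R * (n p q / N)) - qv (a \<circ> f) (b \<circ> f) (c \<circ> f) q (s0 + R * (n p q / N))\<bar> \<le> 8 * (R / N)\<^sup>2 \<and>
          \<bar>qd (b \<circ> f) (c \<circ> f) p (s0 + R * (n p q / N)) - qd (b \<circ> f) (c \<circ> f) q (s0 + R * (n p q / N))\<bar> \<le> 8 * (R / N)"
          using labclose[OF _ e, of "n p q" "f p" "f q"] unfolding qf st[symmetric] R(3) by blast
      qed (use N R kap0 n h in auto)
      then show "\<not> far 800 i k" unfolding n .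
    qed
    then show ?thesis by (simp add: cmass_def A'_def B'_def)
  qed
  have "(\<integral>\<^sup>+s. Phi A B s * indicator (tslot N l J) s \<partial>lborel)
     \<le> (\<integral>\<^sup>+s. (\<Sum>i<N. \<Sum>e\<in>offs. \<Sum>q\<in>Q. Phi (A' i q) (B' e i q) s * indicator (tslot N (Suc l) (N * J + i)) s) \<partial>lborel)"
  proof (rule nn_integral_mono)
    fix s :: real
    show "Phi A B s * indicator (tslot N l J) s
      \<le> (\<Sum>i<N. \<Sum>e\<in>offs. \<Sum>q\<in>Q. Phi (A' i q) (B' e i q) s * indicator (tslot N (Suc l) (N * J + i)) s)"
    proof (cases "s \<in> tslot N l J")
      case True
      then obtain i where i: "i < N" "s \<in> tslot N (Suc l) (N * J + i)" using tslot_split[OF N] by blast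
      have "Phi A B s * indicator (tslot N l J) s \<le> (\<Sum>e\<in>offs. \<Sum>q\<in>Q. Phi (A' i q) (B' e i q) s)"
        using Phi_split[OF i] True by simp
      also have "\<dots> = (\<Sum>e\<in>offs. \<Sum>q\<in>Q. Phi (A' i q) (B' e i q) s * indicator (tslot N (Suc l) (N * J + i)) s)"
        using i by simp
      also have "\<dots> \<le> (\<Sum>i<N. \<Sum>e\<in>offs. \<Sum>q\<in>Q. Phi (A' i q) (B' e i q) s * indicator (tslot N (Suc l) (N * J + i)) s)"
        by (rule member_le_sum[of i]) (use i in auto)
      finally show ?thesis .
    qed simp
  qed
  also have "\<dots> = (\<Sum>i<N. \<Sum>e\<in>offs. \<Sum>q\<in>Q. \<integral>\<^sup>+s. Phi (A' i q) (B' e i q) s * indicator (tslot N (Suc l) (N * J + i)) s \<partial>lborel)"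
    by (simp add: nn_integral_sum)
  also have "\<dots> \<le> (\<Sum>i<N. \<Sum>e\<in>offs. \<Sum>q\<in>Q. ennreal (K * (sum w (A' i q) * sum w (B' e i q)) powr (5/8)))"
    by (intro sum_mono IH)
  also have "\<dots> = ennreal (\<Sum>i<N. \<Sum>e\<in>offs. \<Sum>q\<in>Q. K * (sum w (A' i q) * sum w (B' e i q)) powr (5/8))"
    using K0 by (simp add: sum_nonneg)
  also have "(\<Sum>i<N. \<Sum>e\<in>offs. \<Sum>q\<in>Q. K * (sum w (A' i q) * sum w (B' e i q)) powr (5/8))
      = K * (\<Sum>e\<in>offs. \<Sum>i<N. \<Sum>q\<in>Q. (sum w (A' i q) * sum w (B' e i q)) powr (5/8))"
    by (subst sum.swap) (simp add: sum_distrib_left)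
  also have "ennreal \<dots> \<le> ennreal (K * (\<Sum>e\<in>offs. incidence_const 800 * sqrt N * (sum w A * sum w B) powr (5/8)))"
    using K0 inc by (intro ennreal_leI mult_left_mono sum_mono) auto
  also have "K * (\<Sum>e\<in>offs. incidence_const 800 * sqrt N * (sum w A * sum w B) powr (5/8))
     = (225 * incidence_const 800 * sqrt N) ^ Suc k * (2 / real N ^ L * kap powr (1/4)) * (sum w A * sum w B) powr (5/8)"
    unfolding K_def by (simp add: offs_card algebra_simps)
  finally show ?case unfolding Phi_def .
qed

section \<open>Moments of the cell mass for parabolas\<close>

lemma affine_sublevel:
  fixes h :: "real \<Rightarrow> real" and I :: "real set"
  assumes mono: "\<And>s u. s \<in> I \<Longrightarrow> u \<in> I \<Longrightarrow> s < u \<Longrightarrow> sig * (u - s) \<le> h u - h s"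
    and sig: "sig > 0" and d: "d \<ge> 0"
    and A: "A \<subseteq> {s \<in> I. \<bar>h s\<bar> \<le> d}" "A \<in> sets borel"
  shows "emeasure lborel A \<le> ennreal (2 * d / sig)"
proof (cases "A = {}")
  case False
  then obtain a where a: "a \<in> A" by auto
  have diff: "\<bar>s - u\<bar> \<le> 2 * d / sig" if "s \<in> A" "u \<in> A" for s u
  proof -
    have *: "v - r \<le> 2 * d / sig" if "r \<in> A" "v \<in> A" "r < v" for r v
    proof -
      have "sig * (v - r) \<le> h v - h r" using mono[of r v] that A(1) by auto
      also have "\<dots> \<le> 2 * d" using that A(1) by (smt (verit) mem_Collect_eq subsetD)
      finally show ?thesis using sig by (simp add: field_simps)
    qed
    show ?thesis using *[of s u] *[of u s] that d sig by (cases s u rule: linorder_cases) auto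
  qed
  define lo where "lo = Inf A"
  have bdd: "bdd_below A" using diff[OF a] by (intro bdd_belowI[of _ "a - 2 * d / sig"]) (smt (verit))
  have "A \<subseteq> {lo..lo + 2 * d / sig}"
  proof
    fix s assume s: "s \<in> A"
    have "lo \<le> s" unfolding lo_def using s bdd by (rule cInf_lower)
    moreover have "s - 2 * d / sig \<le> lo" unfolding lo_def
    proof (rule cInf_greatest[OF False])
      fix u assume "u \<in> A"
      then show "s - 2 * d / sig \<le> u" using diff[OF s, of u] by linarith
    qed
    ultimately show "s \<in> {lo..lo + 2 * d / sig}" by auto
  qed
  then have "emeasure lborel A \<le> emeasure lborel {lo..lo + 2 * d / sig}"
    by (intro emeasure_mono) auto
  also have "\<dots> = ennreal (2 * d / sig)" using d sig by simp
  finally show ?thesis .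
qed simp

text \<open>The difference quotient of a quadratic between two points is the mean of its slopes
  there. Hence it exceeds \<open>sig\<close> as soon as both slopes do, and
  \<open>affine_sublevel\<close> applies.\<close>

lemma quadratic_sublevel_pos:
  fixes \<alpha> \<beta> \<gamma> d sig :: real
  assumes "d \<ge> 0" "sig > 0"
  shows "emeasure lborel {s. \<bar>\<alpha> + \<beta> * s + \<gamma> * s\<^sup>2\<bar> \<le> d \<and> sig < \<beta> + 2 * \<gamma> * s} \<le> ennreal (2 * d / sig)"
proof -
  define h where "h s = \<alpha> + \<beta> * s + \<gamma> * s\<^sup>2" for s
  define A where "A = {s. \<bar>h s\<bar> \<le> d \<and> sig < \<beta> + 2 * \<gamma> * s}"
  have A [measurable]: "A \<in> sets borel" unfolding A_def h_def by measurable
  have diff: "h u - h s = (u - s) * (((\<beta> + 2 * \<gamma> * u) + (\<beta> + 2 * \<gamma> * s)) / 2)" for u s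
    unfolding h_def by (simp add: field_simps power2_eq_square)
  have "emeasure lborel A \<le> ennreal (2 * d / sig)"
  proof (rule affine_sublevel[where I = "{s. sig < \<beta> + 2 * \<gamma> * s}"])
    fix s u assume "s \<in> {s. sig < \<beta> + 2 * \<gamma> * s}" "u \<in> {s. sig < \<beta> + 2 * \<gamma> * s}" "s < u"
    then have "(u - s) * sig \<le> (u - s) * (((\<beta> + 2 * \<gamma> * u) + (\<beta> + 2 * \<gamma> * s)) / 2)"
      by (intro mult_left_mono) auto
    then show "sig * (u - s) \<le> h u - h s" unfolding diff by (simp add: mult.commute)
  next
    show "A \<subseteq> {s \<in> {s. sig < \<beta> + 2 * \<gamma> * s}. \<bar>h s\<bar> \<le> d}" by (auto simp: A_def)
  qed (use assms A in auto)
  then show ?thesis unfolding A_def h_def .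
qed

lemma quadratic_sublevel:
  fixes \<alpha> \<beta> \<gamma> d sig :: real
  assumes "d \<ge> 0" "sig > 0"
  shows "emeasure lborel {s. \<bar>\<alpha> + \<beta> * s + \<gamma> * s\<^sup>2\<bar> \<le> d \<and> sig < \<bar>\<beta> + 2 * \<gamma> * s\<bar>} \<le> ennreal (4 * d / sig)"
    (is "emeasure lborel ?E \<le> _")
proof -
  let ?A = "\<lambda>\<alpha> \<beta> \<gamma>. {s. \<bar>\<alpha> + \<beta> * s + \<gamma> * s\<^sup>2\<bar> \<le> d \<and> sig < \<beta> + 2 * \<gamma> * s}"
  have [measurable]: "?A \<alpha> \<beta> \<gamma> \<in> sets lborel" for \<alpha> \<beta> \<gamma> by measurable
  have "?E \<subseteq> ?A \<alpha> \<beta> \<gamma> \<union> ?A (- \<alpha>) (- \<beta>) (- \<gamma>)"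
  proof
    fix s assume "s \<in> ?E"
    then have s: "\<bar>\<alpha> + \<beta> * s + \<gamma> * s\<^sup>2\<bar> \<le> d" "sig < \<bar>\<beta> + 2 * \<gamma> * s\<bar>" by blast+
    have 1: "- \<alpha> + - \<beta> * s + - \<gamma> * s\<^sup>2 = - (\<alpha> + \<beta> * s + \<gamma> * s\<^sup>2)"
      by (simp only: minus_add_distrib minus_mult_left)
    have 2: "- \<beta> + 2 * - \<gamma> * s = - (\<beta> + 2 * \<gamma> * s)"
      by (simp only: minus_add_distrib minus_mult_left mult_minus_right)
    show "s \<in> ?A \<alpha> \<beta> \<gamma> \<union> ?A (- \<alpha>) (- \<beta>) (- \<gamma>)"
    proof (cases "0 \<le> \<beta> + 2 * \<gamma> * s")
      case True
      then have "sig < \<beta> + 2 * \<gamma> * s" using s(2) by (simp only: abs_of_nonneg)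
      then show ?thesis using s(1) by blast
    next
      case False
      then have "sig < - \<beta> + 2 * - \<gamma> * s" unfolding 2 using s(2) by (simp only: abs_of_neg not_le)
      moreover have "\<bar>- \<alpha> + - \<beta> * s + - \<gamma> * s\<^sup>2\<bar> \<le> d" unfolding 1 using s(1) by (simp only: abs_minus_cancel)
      ultimately show ?thesis by blast
    qed
  qed
  then have "emeasure lborel ?E \<le> emeasure lborel (?A \<alpha> \<beta> \<gamma> \<union> ?A (- \<alpha>) (- \<beta>) (- \<gamma>))"
    by (rule emeasure_mono) measurable
  also have "\<dots> \<le> emeasure lborel (?A \<alpha> \<beta> \<gamma>) + emeasure lborel (?A (- \<alpha>) (- \<beta>) (- \<gamma>))"
    by (rule emeasure_subadditive) measurable
  also have "\<dots> \<le> ennreal (2 * d / sig) + ennreal (2 * d / sig)"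
    using assms by (intro add_mono quadratic_sublevel_pos)
  also have "\<dots> = ennreal (4 * d / sig)" using assms by (simp add: ennreal_plus[symmetric] del: ennreal_plus)
  finally show ?thesis .
qed

text \<open>\<open>pairset\<close> collects the parameters at which \<open>x\<close> and \<open>y\<close> are at distance about \<open>r\<close> and
  cross with slope difference about \<open>r / N ^ k\<close>, or at most that if the tangency is already
  at the resolution \<open>\<delta>\<close>.\<close>

definition pairset :: "nat \<Rightarrow> real \<Rightarrow> real \<Rightarrow> nat \<Rightarrow> ('x \<Rightarrow> real) \<Rightarrow> ('x \<Rightarrow> real) \<Rightarrow> ('x \<Rightarrow> real) \<Rightarrow> 'x \<Rightarrow> 'x \<Rightarrow> real set" where
  "pairset N \<delta> r k a b c x y = (if (\<bar>a x - a y\<bar> > r / 2 \<or> \<bar>b x - b y\<bar> > r / 2 \<or> \<bar>c x - c y\<bar> > r / 2)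
      \<and> \<bar>a x - a y\<bar> \<le> r \<and> \<bar>b x - b y\<bar> \<le> r \<and> \<bar>c x - c y\<bar> \<le> r \<and> (k = 0 \<or> \<delta> / r \<le> 1 / real N ^ (2 * k))
    then {s. (k = 0 \<or> \<bar>qd b c x s - qd b c y s\<bar> \<le> r / real N ^ k) \<and>
             (\<bar>qd b c x s - qd b c y s\<bar> > r / real N ^ Suc k \<or> 1 / real N ^ (2 * Suc k) < \<delta> / r)} else {})"

lemma pairset_sets: "pairset N \<delta> r k a b c x y \<in> sets borel"
proof -
  have "{s. (k = 0 \<or> \<bar>qd b c x s - qd b c y s\<bar> \<le> r / real N ^ k) \<and>
     (\<bar>qd b c x s - qd b c y s\<bar> > r / real N ^ Suc k \<or> 1 / real N ^ (2 * Suc k) < \<delta> / r)} \<in> sets borel"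
    unfolding qd_def by measurable
  then show ?thesis unfolding pairset_def
    by (split if_split) (intro conjI impI, assumption, rule sets.empty_sets)
qed

lemma floor_cell_diff:
  fixes p q :: real assumes "\<lfloor>p / d\<rfloor> = \<lfloor>q / d\<rfloor>" "d > 0"
  shows "\<bar>p - q\<bar> \<le> d"
proof -
  have "\<bar>p / d - q / d\<bar> \<le> 1" using assms(1) by linarith
  then show ?thesis using assms(2) by (simp add: diff_divide_distrib[symmetric] divide_le_eq)
qed

lemma floor_cell_sets: "{s. \<lfloor>qv a b c x s / d\<rfloor> = v} \<in> sets borel"
proof -
  have "{s. \<lfloor>qv a b c x s / d\<rfloor> = v} = {s. of_int v \<le> qv a b c x s / d} \<inter> {s. qv a b c x s / d < of_int v + 1}"
    by (auto simp: floor_eq_iff)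
  moreover have "{s. of_int v \<le> qv a b c x s / d} \<in> sets borel" "{s. qv a b c x s / d < of_int v + 1} \<in> sets borel"
    unfolding qv_def by measurable
  ultimately show ?thesis by auto
qed

text \<open>If the slope condition has been dropped at the resolution limit, the right-hand side
  exceeds the slot length. Otherwise the slope exceeds \<open>r / N ^ Suc k\<close> and
  \<open>quadratic_sublevel\<close> applies. The factor \<open>N\<^sup>2\<close> pays for the gap
  between consecutive values of \<open>k\<close> in either case.\<close>

lemma pairset_measure:
  assumes N: "N > 0" and \<delta>: "\<delta> > 0" and r: "r > 0"
  shows "emeasure lborel {s \<in> tslot N k J. \<lfloor>qv a b c x s / \<delta>\<rfloor> = \<lfloor>qv a b c y s / \<delta>\<rfloor> \<and> s \<in> pairset N \<delta> r k a b c x y}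
     \<le> ennreal ((4 * (real N)\<^sup>2 * (\<delta> / r) * real N ^ (2 * k)) / real N ^ k)" (is "emeasure lborel ?E \<le> _")
proof (cases "1 / real N ^ (2 * Suc k) < \<delta> / r")
  case True
  have "emeasure lborel ?E \<le> emeasure lborel (tslot N k J)" by (intro emeasure_mono) auto
  also have "\<dots> = ennreal (1 / real N ^ k)" by (rule emeasure_tslot[OF N])
  also have "\<dots> \<le> ennreal ((4 * (real N)\<^sup>2 * (\<delta> / r) * real N ^ (2 * k)) / real N ^ k)"
  proof (intro ennreal_leI divide_right_mono)
    have "1 < \<delta> / r * real N ^ (2 * Suc k)" using True N by (simp add: field_simps)
    also have "real N ^ (2 * Suc k) = (real N)\<^sup>2 * real N ^ (2 * k)" by (simp add: power2_eq_square)
    finally have "1 < (real N)\<^sup>2 * (\<delta> / r) * real N ^ (2 * k)" by (simp add: mult_ac)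
    then show "1 \<le> 4 * (real N)\<^sup>2 * (\<delta> / r) * real N ^ (2 * k)" by linarith
  qed simp
  finally show ?thesis .
next
  case False
  have "emeasure lborel ?E \<le> emeasure lborel {s. \<bar>(a x - a y) + (b x - b y) * s + (c x - c y) * s\<^sup>2\<bar> \<le> \<delta>
      \<and> r / real N ^ Suc k < \<bar>(b x - b y) + 2 * (c x - c y) * s\<bar>}"
  proof (intro emeasure_mono subsetI)
    fix s assume s: "s \<in> ?E"
    have 1: "(a x - a y) + (b x - b y) * s + (c x - c y) * s\<^sup>2 = qv a b c x s - qv a b c y s"
      by (simp add: qv_def algebra_simps)
    have 2: "(b x - b y) + 2 * (c x - c y) * s = qd b c x s - qd b c y s" by (simp add: qd_def algebra_simps)
    have "\<bar>qv a b c x s - qv a b c y s\<bar> \<le> \<delta>" using s \<delta> by (intro floor_cell_diff) auto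
    moreover have "r / real N ^ Suc k < \<bar>qd b c x s - qd b c y s\<bar>"
      using s False unfolding pairset_def by (auto split: if_splits)
    ultimately show "s \<in> {s. \<bar>(a x - a y) + (b x - b y) * s + (c x - c y) * s\<^sup>2\<bar> \<le> \<delta>
      \<and> r / real N ^ Suc k < \<bar>(b x - b y) + 2 * (c x - c y) * s\<bar>}" by (simp only: 1 2 mem_Collect_eq)
  qed measurable
  also have "\<dots> \<le> ennreal (4 * \<delta> / (r / real N ^ Suc k))"
    using \<delta> r N by (intro quadratic_sublevel) auto
  also have "\<dots> \<le> ennreal ((4 * (real N)\<^sup>2 * (\<delta> / r) * real N ^ (2 * k)) / real N ^ k)"
  proof (rule ennreal_leI)
    have n1: "real N \<ge> 1" using N by simp
    have "4 * \<delta> / (r / real N ^ Suc k) = 4 * (\<delta> / r) * real N ^ k * N" by (simp add: field_simps)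
    also have "\<dots> \<le> 4 * (\<delta> / r) * real N ^ k * (N * N)"
      using n1 \<delta> r by (intro mult_left_mono) auto
    also have "\<dots> = (4 * (real N)\<^sup>2 * (\<delta> / r) * real N ^ (2 * k)) / real N ^ k"
    proof -
      have "real N ^ (2 * k) = real N ^ k * real N ^ k" by (simp add: mult_2 power_add)
      then show ?thesis using N by (simp add: power2_eq_square)
    qed
    finally show "4 * \<delta> / (r / real N ^ Suc k) \<le> (4 * (real N)\<^sup>2 * (\<delta> / r) * real N ^ (2 * k)) / real N ^ k" .
  qed
  finally show ?thesis .
qed

lemma abs_mult_le_unit:
  fixes p q s :: real
  assumes "\<bar>p\<bar> \<le> q" "0 \<le> s" "s \<le> 1"
  shows "\<bar>p * s\<bar> \<le> q"
proof -
  have "\<bar>p\<bar> * \<bar>s\<bar> \<le> q * 1" using assms by (intro mult_mono) auto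
  then show ?thesis by (simp add: abs_mult)
qed

text \<open>Small value and slope differences at one time, together with a small difference in
  \<open>c\<close>, would force small differences in \<open>b\<close> and then in \<open>a\<close>,
  contradicting that one of the three exceeds \<open>r / 2\<close>. So tangent pairs have well
  separated leading coefficients, which \<open>four_cycle\<close> needs as the lower bound on
  \<open>kap\<close>.\<close>

lemma pairset_leading_coeff:
  assumes s: "s \<in> pairset N \<delta> r k a b c x y" "0 \<le> s" "s \<le> 1" and k: "k > 0" and N: "N \<ge> 32" and r: "r \<ge> 32 * \<delta>" "\<delta> > 0"
    and v: "\<bar>qv a b c x s - qv a b c y s\<bar> \<le> \<delta>"
  shows "\<bar>c x - c y\<bar> \<ge> r / 16"
proof (rule ccontr)
  assume "\<not> ?thesis"
  then have cc: "\<bar>c x - c y\<bar> < r / 16" by simp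
  have r0: "r > 0" using r by linarith
  have "\<bar>qd b c x s - qd b c y s\<bar> \<le> r / real N ^ k" using s k by (auto simp: pairset_def split: if_splits)
  also have "\<dots> \<le> r / 32"
  proof -
    have "real N ^ 1 \<le> real N ^ k" using N k by (intro power_increasing) auto
    moreover have "32 \<le> real N" using N by simp
    ultimately have "32 \<le> real N ^ k" by (simp only: power_one_right) 
    then show ?thesis using r0 N by (intro divide_left_mono) auto
  qed
  finally have sl: "\<bar>qd b c x s - qd b c y s\<bar> \<le> r / 32" .
  have cs: "\<bar>(c x - c y) * s\<bar> \<le> r / 16"
    using cc s(2,3) by (intro abs_mult_le_unit) auto
  have eb: "b x - b y = (qd b c x s - qd b c y s) - 2 * ((c x - c y) * s)" by (simp add: qd_def algebra_simps)
  have bb: "\<bar>b x - b y\<bar> \<le> 5 * r / 32" using sl cs eb by linarith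
  have bs: "\<bar>(b x - b y) * s\<bar> \<le> 5 * r / 32"
    using bb s(2,3) by (intro abs_mult_le_unit) auto
  have css: "\<bar>(c x - c y) * s * s\<bar> \<le> r / 16"
    by (rule abs_mult_le_unit[OF cs s(2,3)])
  have ea: "a x - a y = (qv a b c x s - qv a b c y s) - (b x - b y) * s - (c x - c y) * s * s"
    by (simp add: qv_def algebra_simps power2_eq_square)
  have aa: "\<bar>a x - a y\<bar> \<le> r / 4" using v bs css ea r by linarith
  have "\<bar>a x - a y\<bar> > r / 2 \<or> \<bar>b x - b y\<bar> > r / 2 \<or> \<bar>c x - c y\<bar> > r / 2"
    by (rule ccontr) (use s(1) in \<open>simp add: pairset_def\<close>)
  then show False using aa bb cc r0 by linarith
qed

text \<open>The points are sorted into blocks of side \<open>r\<close>. For two fixed blocks, after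
  division by \<open>r\<close>, the difference of leading coefficients is nearly constant, so
  \<open>tangent_pair_mass_bound\<close> applies. The mass of a block is at most
  \<open>A0 * r powr t\<close>, and the number of blocks to be paired with a given one depends on
  \<open>N\<close> but not on \<open>\<delta>\<close>.\<close>

lemma pairset_mass_bound:
  fixes a b c w :: "'x \<Rightarrow> real"
  assumes fin: "finite X" "finite VV" and w: "\<And>x. 0 \<le> w x" and N: "N \<ge> 32" and \<delta>: "\<delta> > 0" and r: "r \<ge> 32 * \<delta>"
    and t: "0 \<le> t" "t \<le> 1" and A0: "A0 \<ge> 0"
    and fr: "\<And>x. x \<in> X \<Longrightarrow> sum w {y\<in>X. \<bar>a x - a y\<bar> \<le> r \<and> \<bar>b x - b y\<bar> \<le> r \<and> \<bar>c x - c y\<bar> \<le> r} \<le> A0 * r powr t"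
  shows "(\<integral>\<^sup>+s. ennreal (\<Sum>v\<in>VV. pmass w (\<lambda>x s. \<lfloor>qv a b c x s / \<delta>\<rfloor>) (pairset N \<delta> r k a b c) X X s v powr (5/8))
        * indicator (tslot N 0 0) s \<partial>lborel)
    \<le> ennreal (9 * (2 * (real N)\<^sup>2 + 1) * ((225 * incidence_const 800) ^ k * 2 * (4 * (real N)\<^sup>2 * A0) powr (1/4) * \<delta> powr (t/4) * sum w X))"
proof -
  have r0: "r > 0" using r \<delta> by linarith
  have N0: "N > 0" "real N \<ge> 32" using N by auto
  define cell where "cell x s = \<lfloor>qv a b c x s / \<delta>\<rfloor>" for x s
  define S where "S = pairset N \<delta> r k a b c"
  define kap where "kap = 4 * (real N)\<^sup>2 * (\<delta> / r) * real N ^ (2 * k)"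
  have kap: "kap > 0" unfolding kap_def using N0 \<delta> r0 by simp
  \<comment> \<open>The leading coefficient is rounded \<open>N\<^sup>2\<close> times more finely
    than the others, since \<open>four_cycle\<close> tolerates an error of only
    \<open>2 / N\<^sup>2\<close> in it.\<close>
  define lab where "lab x = (\<lfloor>a x / r\<rfloor>, \<lfloor>b x / r\<rfloor>, \<lfloor>c x * (real N)\<^sup>2 / r\<rfloor>)" for x
  define lab2 where "lab2 e x = (fst (lab x) - fst e, fst (snd (lab x)) - fst (snd e), snd (snd (lab x)) - snd (snd e))"
    for e :: "int \<times> int \<times> int" and x
  define E where "E = {-1..1::int} \<times> {-1..1::int} \<times> {- int (N\<^sup>2)..int (N\<^sup>2)}"
  have finE: "finite E" unfolding E_def by simp
  have cardE: "real (card E) = 9 * (2 * (real N)\<^sup>2 + 1)" unfolding E_def card_cartesian_product by simp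
  define Q where "Q = lab ` X"
  have finQ: "finite Q" unfolding Q_def using fin by simp
  define A' where "A' q = {x\<in>X. lab x = q}" for q
  define B' where "B' e q = {y\<in>X. lab2 e y = q}" for e q
  have finA': "finite (A' q)" "finite (B' e q)" for q e unfolding A'_def B'_def using fin by auto
  have pair: "\<exists>e\<in>E. \<exists>q\<in>Q. lab x = q \<and> lab2 e y = q" if xy: "x \<in> X" "y \<in> X" and s: "s \<in> S x y" for x y s
  proof -
    have d: "\<bar>a x - a y\<bar> \<le> r" "\<bar>b x - b y\<bar> \<le> r" "\<bar>c x - c y\<bar> \<le> r"
      using s by (auto simp: S_def pairset_def split: if_splits)
    define e where "e = (fst (lab y) - fst (lab x), fst (snd (lab y)) - fst (snd (lab x)), snd (snd (lab y)) - snd (snd (lab x)))"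
    have g1: "\<bar>\<lfloor>q / r\<rfloor> - \<lfloor>p / r\<rfloor>\<bar> \<le> 1" if "\<bar>p - q\<bar> \<le> r" for p q
    proof -
      have "\<bar>q / r - p / r\<bar> \<le> real 1" using that r0 by (simp add: diff_divide_distrib[symmetric] divide_le_eq abs_minus_commute)
      from floor_diff_bound[OF this] show ?thesis by simp
    qed
    have g2: "\<bar>\<lfloor>c y * (real N)\<^sup>2 / r\<rfloor> - \<lfloor>c x * (real N)\<^sup>2 / r\<rfloor>\<bar> \<le> int (N\<^sup>2)"
    proof (rule floor_diff_bound)
      have "c y * (real N)\<^sup>2 / r - c x * (real N)\<^sup>2 / r = (c y - c x) / r * (real N)\<^sup>2" by (simp add: diff_divide_distrib left_diff_distrib)
      also have "\<bar>\<dots>\<bar> = \<bar>c y - c x\<bar> / r * (real N)\<^sup>2" using r0 by (simp add: abs_mult)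
      also have "\<dots> \<le> 1 * (real N)\<^sup>2" using d(3) r0 by (intro mult_right_mono) (auto simp: abs_minus_commute)
      finally show "\<bar>c y * (real N)\<^sup>2 / r - c x * (real N)\<^sup>2 / r\<bar> \<le> real (N\<^sup>2)" by simp
    qed
    have "e \<in> E" unfolding e_def E_def lab_def using g1[OF d(1)] g1[OF d(2)] g2 by auto
    moreover have "lab x \<in> Q" unfolding Q_def using xy by auto
    moreover have "lab2 e y = lab x" unfolding lab2_def e_def by simp
    ultimately show ?thesis by blast
  qed
  have labd: "\<bar>a x / r - a y / r\<bar> \<le> 2 \<and> \<bar>c x / r - c y / r\<bar> \<le> 3 \<and> \<bar>c x / r - c y / r - (- of_int (snd (snd e)) / (real N)\<^sup>2)\<bar> \<le> 1 / (real N)\<^sup>2"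
    if "lab x = lab2 e y" "e \<in> E" for x y e
  proof -
    have l: "\<lfloor>a x / r\<rfloor> = \<lfloor>a y / r\<rfloor> - fst e" "\<lfloor>c x * (real N)\<^sup>2 / r\<rfloor> = \<lfloor>c y * (real N)\<^sup>2 / r\<rfloor> - snd (snd e)"
      using that(1) by (simp_all add: lab_def lab2_def)
    have e: "-1 \<le> fst e" "fst e \<le> 1" "\<bar>snd (snd e)\<bar> \<le> int (N\<^sup>2)" using that(2) by (auto simp: E_def)
    have 1: "\<bar>a x / r - a y / r\<bar> \<le> 2" using l(1) e by linarith
    have n2: "real N ^ 2 > 0" "real N ^ 2 \<ge> 1" using N0 by auto
    have 2: "\<bar>c x * (real N)\<^sup>2 / r - c y * (real N)\<^sup>2 / r + of_int (snd (snd e))\<bar> \<le> 1" using l(2) by linarith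
    have "c x / r - c y / r - (- of_int (snd (snd e)) / (real N)\<^sup>2) = (c x * (real N)\<^sup>2 / r - c y * (real N)\<^sup>2 / r + of_int (snd (snd e))) / (real N)\<^sup>2"
      using n2 r0 N0 by (simp add: field_simps)
    then have 3: "\<bar>c x / r - c y / r - (- of_int (snd (snd e)) / (real N)\<^sup>2)\<bar> \<le> 1 / (real N)\<^sup>2"
      using 2 n2 by (simp add: divide_right_mono)
    have "\<bar>real_of_int (snd (snd e))\<bar> \<le> real N ^ 2"
    proof -
      have "real_of_int \<bar>snd (snd e)\<bar> \<le> real_of_int (int (N\<^sup>2))" using e(3) by (rule of_int_le_iff[THEN iffD2])
      then show ?thesis by simp
    qed
    then have 4: "\<bar>- of_int (snd (snd e)) / (real N)\<^sup>2\<bar> \<le> 1" using n2 by simp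
    have "1 / (real N)\<^sup>2 \<le> 1" using n2 by simp
    with 3 4 have "\<bar>c x / r - c y / r\<bar> \<le> 3" by linarith
    with 1 3 show ?thesis by blast
  qed
  define p where "p A B s v = pmass w cell S A B s v" for A B s v
  have p0: "0 \<le> p A B s v" for A B s v unfolding p_def using w by (rule pmass_nonneg)
  have psplit: "p X X s v \<le> (\<Sum>e\<in>E. \<Sum>q\<in>Q. p (A' q) (B' e q) s v)" for s v
  proof -
    let ?t = "\<lambda>x y. if cell x s = v \<and> cell y s = v \<and> s \<in> S x y then w x * w y else 0"
    let ?g = "\<lambda>x y e q. if lab x = q \<and> lab2 e y = q then ?t x y else 0"
    have t0: "?t x y \<ge> 0" for x y using w by simp
    have g0: "?g x y e q \<ge> 0" for x y e q using t0[of x y] by simp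
    have "p X X s v = (\<Sum>x\<in>X. \<Sum>y\<in>X. ?t x y)" by (simp add: p_def pmass_def)
    also have "\<dots> \<le> (\<Sum>x\<in>X. \<Sum>y\<in>X. \<Sum>e\<in>E. \<Sum>q\<in>Q. ?g x y e q)"
    proof (intro sum_mono)
      fix x y assume xy: "x \<in> X" "y \<in> X"
      show "?t x y \<le> (\<Sum>e\<in>E. \<Sum>q\<in>Q. ?g x y e q)"
      proof (cases "s \<in> S x y")
        case True
        from pair[OF xy True] obtain e q where eq: "e \<in> E" "q \<in> Q" "lab x = q" "lab2 e y = q" by blast
        have "?t x y = ?g x y e q" using eq by simp
        also have "\<dots> \<le> (\<Sum>q\<in>Q. ?g x y e q)" by (rule member_le_sum) (use eq finQ g0 in auto)
        also have "\<dots> \<le> (\<Sum>e\<in>E. \<Sum>q\<in>Q. ?g x y e q)"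
          by (rule member_le_sum[of e E "\<lambda>e. \<Sum>q\<in>Q. ?g x y e q"], rule eq(1), intro sum_nonneg g0, rule finE)
        finally show ?thesis .
      next
        case False
        have "0 \<le> (\<Sum>e\<in>E. \<Sum>q\<in>Q. ?g x y e q)" by (intro sum_nonneg g0)
        moreover have "?t x y = 0" using False by simp
        ultimately show ?thesis by linarith
      qed
    qed
    also have "\<dots> = (\<Sum>x\<in>X. \<Sum>e\<in>E. \<Sum>y\<in>X. \<Sum>q\<in>Q. ?g x y e q)"
      by (intro sum.cong refl) (rule sum.swap)
    also have "\<dots> = (\<Sum>e\<in>E. \<Sum>x\<in>X. \<Sum>y\<in>X. \<Sum>q\<in>Q. ?g x y e q)" by (rule sum.swap)
    also have "\<dots> = (\<Sum>e\<in>E. \<Sum>x\<in>X. \<Sum>q\<in>Q. \<Sum>y\<in>X. ?g x y e q)"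
      by (intro sum.cong refl) (rule sum.swap)
    also have "\<dots> = (\<Sum>e\<in>E. \<Sum>q\<in>Q. \<Sum>x\<in>X. \<Sum>y\<in>X. ?g x y e q)"
      by (intro sum.cong refl) (rule sum.swap)
    also have "\<dots> = (\<Sum>e\<in>E. \<Sum>q\<in>Q. p (A' q) (B' e q) s v)"
    proof (intro sum.cong refl)
      fix e q
      have "(\<Sum>x\<in>X. \<Sum>y\<in>X. ?g x y e q) = (\<Sum>x\<in>X. if lab x = q then (\<Sum>y\<in>X. if lab2 e y = q then ?t x y else 0) else 0)"
        by (intro sum.cong refl) auto
      also have "\<dots> = (\<Sum>x\<in>A' q. \<Sum>y\<in>B' e q. ?t x y)"
        unfolding A'_def B'_def by (simp only: sum.inter_filter[OF fin(1)])
      finally show "(\<Sum>x\<in>X. \<Sum>y\<in>X. ?g x y e q) = p (A' q) (B' e q) s v" unfolding p_def pmass_def .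
    qed
    finally show ?thesis .
  qed
  define Phi where "Phi A B s = ennreal (\<Sum>v\<in>VV. p A B s v powr (5/8))" for A B s
  have cellm: "{s. cell x s = v} \<in> sets borel" for x v unfolding cell_def by (rule floor_cell_sets)
  have Sm: "S x y \<in> sets borel" for x y unfolding S_def by (rule pairset_sets)
  have Phim [measurable]: "Phi A B \<in> borel_measurable borel" for A B
  proof -
    have [measurable]: "(\<lambda>s. pmass w cell S A B s v) \<in> borel_measurable borel" for v
      using cellm Sm by (rule pmass_measurable)
    show ?thesis unfolding Phi_def p_def by measurable
  qed
  have Phisplit: "Phi X X s \<le> (\<Sum>e\<in>E. \<Sum>q\<in>Q. Phi (A' q) (B' e q) s)" for s
  proof -
    have "(\<Sum>v\<in>VV. p X X s v powr (5/8)) \<le> (\<Sum>v\<in>VV. \<Sum>e\<in>E. \<Sum>q\<in>Q. p (A' q) (B' e q) s v powr (5/8))"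
    proof (rule sum_mono)
      fix v
      have "p X X s v powr (5/8) \<le> (\<Sum>e\<in>E. \<Sum>q\<in>Q. p (A' q) (B' e q) s v) powr (5/8)"
        using psplit p0 by (intro powr_mono2) auto
      also have "\<dots> \<le> (\<Sum>e\<in>E. (\<Sum>q\<in>Q. p (A' q) (B' e q) s v) powr (5/8))"
        using finE p0 by (intro powr_sum_le sum_nonneg) auto
      also have "\<dots> \<le> (\<Sum>e\<in>E. \<Sum>q\<in>Q. p (A' q) (B' e q) s v powr (5/8))"
        using finQ p0 by (intro sum_mono powr_sum_le) auto
      finally show "p X X s v powr (5/8) \<le> (\<Sum>e\<in>E. \<Sum>q\<in>Q. p (A' q) (B' e q) s v powr (5/8))" .
    qed
    also have "\<dots> = (\<Sum>e\<in>E. \<Sum>v\<in>VV. \<Sum>q\<in>Q. p (A' q) (B' e q) s v powr (5/8))" by (rule sum.swap)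
    also have "\<dots> = (\<Sum>e\<in>E. \<Sum>q\<in>Q. \<Sum>v\<in>VV. p (A' q) (B' e q) s v powr (5/8))"
      by (intro sum.cong refl) (rule sum.swap)
    finally have "ennreal (\<Sum>v\<in>VV. p X X s v powr (5/8))
       \<le> ennreal (\<Sum>e\<in>E. \<Sum>q\<in>Q. \<Sum>v\<in>VV. p (A' q) (B' e q) s v powr (5/8))" by (rule ennreal_leI)
    then show ?thesis unfolding Phi_def by (simp add: sum_nonneg)
  qed
  have meas: "emeasure lborel {s \<in> tslot N k J. cell x s = cell y s \<and> s \<in> S x y} \<le> ennreal (kap / real N ^ k)" for J x y
    unfolding cell_def S_def kap_def using N0 \<delta> r0 by (intro pairset_measure) auto
  define K where "K = (225 * incidence_const 800 * sqrt N) ^ k * (2 / real N ^ k * kap powr (1/4))"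
  have K0: "K \<ge> 0" unfolding K_def incidence_const_def by simp
  have cls: "(\<integral>\<^sup>+s. Phi (A' q) (B' e q) s * indicator (tslot N 0 0) s \<partial>lborel)
      \<le> ennreal (K * (sum w (A' q) * sum w (B' e q)) powr (5/8))" if e: "e \<in> E" for e q
  \<comment> \<open>With \<open>k = 0\<close> there is no upper bound on the slope difference, so
    \<open>pairset_leading_coeff\<close> says nothing; but no induction step is needed and the base
    bound suffices.\<close>
  proof (cases "k = 0")
    case True
    have "(\<integral>\<^sup>+s. ennreal (\<Sum>v\<in>VV. pmass w cell S (A' q) (B' e q) s v powr (5/8)) * indicator (tslot N k 0) s \<partial>lborel)
    \<le> ennreal (2 / real N ^ k * kap powr (1/4) * (sum w (A' q) * sum w (B' e q)) powr (5/8))"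
      using finA' fin(2) w N0(1) kap cellm Sm meas by (rule tangent_pair_mass_bound_base)
    then show ?thesis using True unfolding Phi_def p_def K_def by simp
  next
    case False
    define kap0 where "kap0 = - of_int (snd (snd e)) / (real N)\<^sup>2"
    show ?thesis
    proof (cases "1 / 32 \<le> \<bar>kap0\<bar>")
      case True
      have N1: "N > 0" using N0 by simp
      have qs: "qv (\<lambda>x. a x / r) (\<lambda>x. b x / r) (\<lambda>x. c x / r) x s = qv a b c x s / r"
        "qd (\<lambda>x. b x / r) (\<lambda>x. c x / r) x s = qd b c x s / r" for x s
        by (simp_all add: qv_def qd_def add_divide_distrib)
      have small: "\<bar>qv (\<lambda>x. a x / r) (\<lambda>x. b x / r) (\<lambda>x. c x / r) x s - qv (\<lambda>x. a x / r) (\<lambda>x. b x / r) (\<lambda>x. c x / r) y s\<bar> \<le> (1 / real N ^ k)\<^sup>2 \<and>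
          \<bar>qd (\<lambda>x. b x / r) (\<lambda>x. c x / r) x s - qd (\<lambda>x. b x / r) (\<lambda>x. c x / r) y s\<bar> \<le> 1 / real N ^ k"
        if "cell x s = cell y s" "s \<in> S x y" for x y s
      proof -
        have v: "\<bar>qv a b c x s - qv a b c y s\<bar> \<le> \<delta>" using that(1) \<delta> unfolding cell_def by (rule floor_cell_diff)
        have d: "\<delta> / r \<le> 1 / real N ^ (2 * k)" "\<bar>qd b c x s - qd b c y s\<bar> \<le> r / real N ^ k"
          using that(2) False by (auto simp: S_def pairset_def split: if_splits)
        have "\<bar>qv a b c x s / r - qv a b c y s / r\<bar> = \<bar>qv a b c x s - qv a b c y s\<bar> / r"
          using r0 by (simp add: diff_divide_distrib[symmetric])
        also have "\<dots> \<le> \<delta> / r" using v r0 by (intro divide_right_mono) auto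
        also have "\<dots> \<le> (1 / real N ^ k)\<^sup>2" using d(1) by (simp add: power_divide power_mult[symmetric] mult.commute)
        finally have 1: "\<bar>qv a b c x s / r - qv a b c y s / r\<bar> \<le> (1 / real N ^ k)\<^sup>2" .
        have "\<bar>qd b c x s / r - qd b c y s / r\<bar> = \<bar>qd b c x s - qd b c y s\<bar> / r"
          using r0 by (simp add: diff_divide_distrib[symmetric])
        also have "\<dots> \<le> (r / real N ^ k) / r" using d(2) r0 by (intro divide_right_mono) auto
        finally show ?thesis unfolding qs using 1 r0 by simp
      qed
      have "(\<integral>\<^sup>+s. ennreal (\<Sum>v\<in>VV. pmass w cell S (A' q) (B' e q) s v powr (5/8)) * indicator (tslot N 0 0) s \<partial>lborel)
        \<le> ennreal ((225 * incidence_const 800 * sqrt N) ^ k * (2 / real N ^ k * kap powr (1/4)) * (sum w (A' q) * sum w (B' e q)) powr (5/8))"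
      proof (rule tangent_pair_mass_bound[OF fin(2) w N1 kap True cellm Sm meas small])
        show "0 + k = k" by simp
        show "finite (A' q)" "finite (B' e q)" by (rule finA')+
        fix x y assume "x \<in> A' q" "y \<in> B' e q"
        then have "lab x = lab2 e y" by (simp add: A'_def B'_def)
        note l = labd[OF this e]
        have z: "1 / (real N)\<^sup>2 \<le> 2 / (real N)\<^sup>2" by (simp add: divide_right_mono)
        show "\<bar>qv (\<lambda>x. a x / r) (\<lambda>x. b x / r) (\<lambda>x. c x / r) x (real 0 / real N ^ 0) - qv (\<lambda>x. a x / r) (\<lambda>x. b x / r) (\<lambda>x. c x / r) y (real 0 / real N ^ 0)\<bar>
            \<le> 8 * (1 / real N ^ 0)\<^sup>2 \<and> \<bar>c x / r - c y / r\<bar> \<le> 3 \<and> \<bar>c x / r - c y / r - kap0\<bar> \<le> 2 / (real N)\<^sup>2"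
          using l z unfolding kap0_def by (simp add: qv_def)
      qed
      then show ?thesis unfolding Phi_def p_def K_def .
    next
      \<comment> \<open>This case is void: an active pair has normalized leading coefficients at
        least \<open>1/16\<close> apart, and \<open>kap0\<close> approximates their difference
        within \<open>1 / N\<^sup>2 \<le> 1/32\<close>.\<close>
      case small: False
      have "Phi (A' q) (B' e q) s * indicator (tslot N 0 0) s = 0" for s
      proof (cases "s \<in> tslot N 0 0")
        case True
        then have s: "0 \<le> s" "s \<le> 1" by (auto simp: tslot_def)
        have "p (A' q) (B' e q) s v = 0" for v
          unfolding p_def pmass_def
        proof (intro sum.neutral ballI)
          fix x y assume xy: "x \<in> A' q" "y \<in> B' e q"
          show "(if cell x s = v \<and> cell y s = v \<and> s \<in> S x y then w x * w y else 0) = 0"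
          proof (rule if_not_P, rule notI)
            assume h: "cell x s = v \<and> cell y s = v \<and> s \<in> S x y"
            then have ce: "\<lfloor>qv a b c x s / \<delta>\<rfloor> = \<lfloor>qv a b c y s / \<delta>\<rfloor>" by (simp add: cell_def)
            from h have sS: "s \<in> pairset N \<delta> r k a b c x y" by (simp add: S_def)
            have cd: "\<bar>c x - c y\<bar> \<ge> r / 16"
              by (rule pairset_leading_coeff[OF sS s _ N r \<delta> floor_cell_diff[OF ce \<delta>]]) (use False in simp)
            have "\<bar>c x / r - c y / r\<bar> = \<bar>c x - c y\<bar> / r" using r0 by (simp add: diff_divide_distrib[symmetric])
            then have c16: "1 / 16 \<le> \<bar>c x / r - c y / r\<bar>" using cd r0 by (simp add: le_divide_eq)
            have "lab x = lab2 e y" using xy by (simp add: A'_def B'_def)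
            from labd[OF this e] have k1: "\<bar>c x / r - c y / r - kap0\<bar> \<le> 1 / (real N)\<^sup>2" unfolding kap0_def by blast
            have "32 * 1 \<le> real N * real N" using N0 by (intro mult_mono) auto
            then have "1 / (real N)\<^sup>2 \<le> 1 / 32" by (intro divide_left_mono) (auto simp: power2_eq_square)
            with k1 c16 small show False by linarith
          qed
        qed
        then show ?thesis unfolding Phi_def by simp
      qed simp
      then show ?thesis by (simp only: nn_integral_const mult_zero_left zero_le)
    qed
  qed
  define D where "D = A0 * r powr t"
  have D0: "D \<ge> 0" unfolding D_def using A0 by simp
  have mle: "sum w (A' q) \<le> D" "sum w (B' e q) \<le> D" for e q
  proof -
    have g: "\<bar>p - q\<bar> \<le> r" if "\<lfloor>p / r\<rfloor> = \<lfloor>q / r\<rfloor>" for p q using that r0 by (rule floor_cell_diff)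
    have gc: "\<bar>p - q\<bar> \<le> r" if "\<lfloor>p * (real N)\<^sup>2 / r\<rfloor> = \<lfloor>q * (real N)\<^sup>2 / r\<rfloor>" for p q :: real
    proof -
      have "\<bar>p * (real N)\<^sup>2 - q * (real N)\<^sup>2\<bar> \<le> r" using that r0 by (rule floor_cell_diff)
      then have "\<bar>p - q\<bar> * (real N)\<^sup>2 \<le> r" by (simp add: left_diff_distrib[symmetric] abs_mult)
      moreover have "\<bar>p - q\<bar> * 1 \<le> \<bar>p - q\<bar> * (real N)\<^sup>2" using N0 by (intro mult_left_mono) auto
      ultimately show ?thesis by (metis mult_1_right order_trans)
    qed
    have gen: "sum w Z \<le> D" if Z: "Z \<subseteq> X" "\<And>x y. x \<in> Z \<Longrightarrow> y \<in> Z \<Longrightarrow> lab x = lab y" for Z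
    proof (cases "Z = {}")
      case False
      then obtain x where x: "x \<in> Z" by auto
      have "sum w Z \<le> sum w {y\<in>X. \<bar>a x - a y\<bar> \<le> r \<and> \<bar>b x - b y\<bar> \<le> r \<and> \<bar>c x - c y\<bar> \<le> r}"
      proof (rule sum_mono2)
        show "Z \<subseteq> {y\<in>X. \<bar>a x - a y\<bar> \<le> r \<and> \<bar>b x - b y\<bar> \<le> r \<and> \<bar>c x - c y\<bar> \<le> r}"
          using Z(1) Z(2)[OF x] g gc unfolding lab_def by auto
      qed (use fin w in auto)
      also have "\<dots> \<le> D" unfolding D_def using x Z(1) by (intro fr) auto
      finally show ?thesis .
    qed (use D0 in simp)
    show "sum w (A' q) \<le> D" by (rule gen) (auto simp: A'_def)
    show "sum w (B' e q) \<le> D" by (rule gen) (auto simp: B'_def lab2_def prod_eq_iff)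
  qed
  \<comment> \<open>Of the exponent \<open>5/8\<close>, the part \<open>1/8\<close> is spent on the
    bound \<open>D\<close> for both factors, giving \<open>D powr (1/4)\<close>. The part
    \<open>1/2\<close> is kept for AM-GM, whose right-hand side sums to the total mass.\<close>
  have powle: "(u * v) powr (5/8) \<le> D powr (1/4) * ((u + v) / 2)" if "0 \<le> u" "u \<le> D" "0 \<le> v" "v \<le> D" for u v
  proof -
    have "(u * v) powr (5/8) = (u * v) powr (1/8) * (u * v) powr (1/2)"
      by (simp add: powr_add[symmetric])
    also have "\<dots> \<le> (D * D) powr (1/8) * ((u + v) / 2)"
    proof (rule mult_mono)
      show "(u * v) powr (1/8) \<le> (D * D) powr (1/8)" using that by (intro powr_mono2 mult_mono) auto
      show "(u * v) powr (1/2) \<le> (u + v) / 2" using that arith_geo_mean_sqrt[of u v] by (simp add: powr_half_sqrt)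
    qed (use that in auto)
    also have "(D * D) powr (1/8) = D powr (1/4)" using D0 by (simp add: powr_mult powr_add[symmetric])
    finally show ?thesis .
  qed
  have W0: "sum w X \<ge> 0" using w by (simp add: sum_nonneg)
  have sumq: "(\<Sum>q\<in>Q. (sum w (A' q) * sum w (B' e q)) powr (5/8)) \<le> D powr (1/4) * sum w X" for e
  proof -
    have "(\<Sum>q\<in>Q. (sum w (A' q) * sum w (B' e q)) powr (5/8)) \<le> (\<Sum>q\<in>Q. D powr (1/4) * ((sum w (A' q) + sum w (B' e q)) / 2))"
      using mle w by (intro sum_mono powle sum_nonneg) auto
    also have "\<dots> = D powr (1/4) * (((\<Sum>q\<in>Q. cmass w X lab q) + (\<Sum>q\<in>Q. cmass w X (lab2 e) q)) / 2)"
      unfolding cmass_def A'_def B'_def by (simp only: sum_distrib_left[symmetric] sum_divide_distrib[symmetric] sum.distrib)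
    also have "\<dots> \<le> D powr (1/4) * ((sum w X + sum w X) / 2)"
      using fin finQ w by (intro mult_left_mono divide_right_mono add_mono sum_cmass_le) auto
    finally show ?thesis by simp
  qed
  \<comment> \<open>The balance of exponents: \<open>sqrt N ^ k\<close> from the induction steps and
    \<open>N ^ (k/2)\<close> from \<open>kap powr (1/4)\<close> together cancel the slot length.
    What remains decreases in \<open>r\<close> because \<open>t \<le> 1\<close>, so \<open>r\<close>
    may be replaced by \<open>\<delta>\<close>.\<close>
  have Keq: "K * D powr (1/4) \<le> (225 * incidence_const 800) ^ k * 2 * (4 * (real N)\<^sup>2 * A0) powr (1/4) * \<delta> powr (t/4)"
  proof -
    have Nk: "(real N ^ (2 * k)) powr (1/4) = sqrt N ^ k"
    proof -
      have "(real N ^ (2 * k)) powr (1/4) = real N powr (real (2 * k) * (1/4))"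
        using N0 by (simp only: powr_realpow[symmetric] powr_powr)
      also have "\<dots> = (real N powr (1/2)) powr real k" using N0 by (simp add: powr_powr)
      also have "\<dots> = sqrt N ^ k" using N0 by (simp add: powr_half_sqrt powr_realpow)
      finally show ?thesis .
    qed
    have sq: "sqrt N ^ k * sqrt N ^ k = real N ^ k" by (simp add: power_mult_distrib[symmetric])
    have "K * D powr (1/4) = (225 * incidence_const 800) ^ k * 2 * (sqrt N ^ k * (real N ^ (2 * k)) powr (1/4) / real N ^ k) * ((4 * (real N)\<^sup>2 * (\<delta> / r)) powr (1/4) * D powr (1/4))"
    proof -
      have "kap powr (1/4) = (4 * (real N)\<^sup>2 * (\<delta> / r)) powr (1/4) * (real N ^ (2 * k)) powr (1/4)"
        unfolding kap_def by (rule powr_mult)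
      then show ?thesis unfolding K_def by (simp add: power_mult_distrib)
    qed
    also have "sqrt N ^ k * (real N ^ (2 * k)) powr (1/4) / real N ^ k = 1"
      unfolding Nk sq using N0 by simp
    also have "(4 * (real N)\<^sup>2 * (\<delta> / r)) powr (1/4) * D powr (1/4) = (4 * (real N)\<^sup>2 * A0 * (\<delta> * r powr (t - 1))) powr (1/4)"
      unfolding D_def using \<delta> r0 A0 by (simp add: powr_mult[symmetric] powr_diff mult_ac)
    also have "\<dots> \<le> (4 * (real N)\<^sup>2 * A0 * \<delta> powr t) powr (1/4)"
    proof -
      have "r powr (t - 1) \<le> \<delta> powr (t - 1)" using t \<delta> r by (intro powr_mono2') auto
      then have "\<delta> * r powr (t - 1) \<le> \<delta> * \<delta> powr (t - 1)" using \<delta> by (intro mult_left_mono) auto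
      also have "\<dots> = \<delta> powr t" using \<delta> by (simp add: powr_diff)
      finally show ?thesis using A0 \<delta> r0 by (intro powr_mono2 mult_left_mono) auto
    qed
    also have "\<dots> = (4 * (real N)\<^sup>2 * A0) powr (1/4) * \<delta> powr (t/4)" using A0 \<delta> by (simp add: powr_mult powr_powr)
    finally show ?thesis by (simp add: incidence_const_def mult_ac)
  qed
  have "(\<integral>\<^sup>+s. Phi X X s * indicator (tslot N 0 0) s \<partial>lborel)
     \<le> (\<integral>\<^sup>+s. (\<Sum>e\<in>E. \<Sum>q\<in>Q. Phi (A' q) (B' e q) s * indicator (tslot N 0 0) s) \<partial>lborel)"
  proof (rule nn_integral_mono)
    fix s :: real
    have "Phi X X s * indicator (tslot N 0 0) s \<le> (\<Sum>e\<in>E. \<Sum>q\<in>Q. Phi (A' q) (B' e q) s) * indicator (tslot N 0 0) s"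
      by (rule mult_right_mono[OF Phisplit]) simp
    then show "Phi X X s * indicator (tslot N 0 0) s \<le> (\<Sum>e\<in>E. \<Sum>q\<in>Q. Phi (A' q) (B' e q) s * indicator (tslot N 0 0) s)"
      by (simp only: sum_distrib_right)
  qed
  also have "\<dots> = (\<Sum>e\<in>E. \<Sum>q\<in>Q. \<integral>\<^sup>+s. Phi (A' q) (B' e q) s * indicator (tslot N 0 0) s \<partial>lborel)"
    by (simp add: nn_integral_sum)
  also have "\<dots> \<le> (\<Sum>e\<in>E. \<Sum>q\<in>Q. ennreal (K * (sum w (A' q) * sum w (B' e q)) powr (5/8)))"
    by (intro sum_mono cls)
  also have "\<dots> = ennreal (\<Sum>e\<in>E. K * (\<Sum>q\<in>Q. (sum w (A' q) * sum w (B' e q)) powr (5/8)))"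
    using K0 by (simp add: sum_nonneg sum_distrib_left)
  also have "\<dots> \<le> ennreal (\<Sum>e\<in>E. K * (D powr (1/4) * sum w X))"
    using K0 sumq by (intro ennreal_leI sum_mono mult_left_mono) auto
  also have "(\<Sum>e\<in>E. K * (D powr (1/4) * sum w X)) = 9 * (2 * (real N)\<^sup>2 + 1) * ((K * D powr (1/4)) * sum w X)"
    using cardE by simp
  also have "ennreal \<dots> \<le> ennreal (9 * (2 * (real N)\<^sup>2 + 1) * ((225 * incidence_const 800) ^ k * 2 * (4 * (real N)\<^sup>2 * A0) powr (1/4) * \<delta> powr (t/4) * sum w X))"
    using Keq W0 by (intro ennreal_leI mult_left_mono mult_right_mono) auto
  finally show ?thesis unfolding Phi_def p_def cell_def S_def .
qed

text \<open>\<open>i\<close> is the least dyadic scale dominating the three coefficient differences,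
  and \<open>k\<close> the greatest exponent for which the slope and the resolution conditions both
  hold; failure at \<open>Suc k\<close> is exactly the last condition in \<open>pairset\<close>.
  Since the pair is not within \<open>16 * \<delta>\<close>, \<open>i\<close> is positive and the
  scale is at least \<open>32 * \<delta>\<close>. Both ranges grow linearly in
  \<open>n\<close>.\<close>

lemma pairset_cover:
  fixes a b c :: "'x \<Rightarrow> real"
  assumes N: "N \<ge> 32" and \<delta>: "\<delta> = 1 / real N ^ n"
    and bd: "\<bar>a x - a y\<bar> \<le> 2 ^ m" "\<bar>b x - b y\<bar> \<le> 2 ^ m" "\<bar>c x - c y\<bar> \<le> 2 ^ m"
    and notnear: "\<not> (\<bar>a x - a y\<bar> \<le> 16 * \<delta> \<and> \<bar>b x - b y\<bar> \<le> 16 * \<delta> \<and> \<bar>c x - c y\<bar> \<le> 16 * \<delta>)"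
  shows "\<exists>i\<in>{1..n * N + m}. \<exists>k\<in>{0..n + m + 1}. s \<in> pairset N \<delta> (16 * \<delta> * 2 ^ i) k a b c x y"
proof -
  define d where "d = max \<bar>a x - a y\<bar> (max \<bar>b x - b y\<bar> \<bar>c x - c y\<bar>)"
  have dle: "d \<le> z \<longleftrightarrow> \<bar>a x - a y\<bar> \<le> z \<and> \<bar>b x - b y\<bar> \<le> z \<and> \<bar>c x - c y\<bar> \<le> z" for z
    unfolding d_def by auto
  have N0: "N > 0" "real N \<ge> 32" using N by auto
  have d0: "\<delta> > 0" unfolding \<delta> using N0 by simp
  have dm: "d \<le> 2 ^ m" unfolding dle using bd by simp
  have n0: "\<not> d \<le> 16 * \<delta> * 2 ^ 0" unfolding dle using notnear by simp
  define i where "i = (LEAST i. d \<le> 16 * \<delta> * 2 ^ i)"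
  have ex: "d \<le> 16 * \<delta> * 2 ^ (n * N + m)"
  proof -
    have "real N \<le> 2 ^ N" using of_nat_mono[OF less_imp_le[OF less_exp[of N]]] by simp
    then have "real N ^ n \<le> (2 ^ N) ^ n" using N0 by (intro power_mono) auto
    then have "real N ^ n \<le> 2 ^ (n * N)" by (simp add: power_mult[symmetric] mult.commute)
    then have "1 \<le> \<delta> * 2 ^ (n * N)" unfolding \<delta> using N0 by (simp add: le_divide_eq)
    then have "2 ^ m * 1 \<le> 2 ^ m * (\<delta> * 2 ^ (n * N))" by (intro mult_left_mono) auto
    also have "\<dots> \<le> 16 * (2 ^ m * (\<delta> * 2 ^ (n * N)))" using d0 by simp
    finally have "2 ^ m \<le> 16 * \<delta> * 2 ^ (n * N + m)" by (simp only: mult_1_right power_add mult_ac)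
    then show ?thesis using dm by linarith
  qed
  have i1: "d \<le> 16 * \<delta> * 2 ^ i" unfolding i_def by (rule LeastI[of _ "n * N + m"]) (rule ex)
  have i2: "i \<le> n * N + m" unfolding i_def by (rule Least_le) (rule ex)
  have i3: "i \<noteq> 0" using i1 n0 by metis
  then obtain j where j: "i = Suc j" by (cases i) auto
  have i4: "\<not> d \<le> 16 * \<delta> * 2 ^ j" using not_less_Least[of j "\<lambda>i. d \<le> 16 * \<delta> * 2 ^ i"] j unfolding i_def by simp
  define r where "r = 16 * \<delta> * 2 ^ i"
  have r0: "r > 0" unfolding r_def using d0 by simp
  have rh: "\<not> d \<le> r / 2" using i4 unfolding r_def j by simp
  define \<sigma> where "\<sigma> = \<bar>qd b c x s - qd b c y s\<bar>"
  define P where "P k \<longleftrightarrow> k = 0 \<or> (\<sigma> \<le> r / real N ^ k \<and> \<delta> / r \<le> 1 / real N ^ (2 * k))" for k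
  have Pb: "k \<le> n + m + 1" if "P k" for k
  proof (cases "k = 0")
    case False
    then have "\<delta> / r \<le> 1 / real N ^ (2 * k)" using that unfolding P_def by blast
    then have "real N ^ (2 * k) \<le> r / \<delta>" using r0 d0 N0 by (simp add: field_simps)
    also have "\<dots> \<le> 2 * 2 ^ m * real N ^ n"
    proof -
      have "r \<le> 2 * 2 ^ m" using rh dm by linarith
      then have "r / \<delta> \<le> 2 * 2 ^ m / \<delta>" using d0 by (intro divide_right_mono) auto
      then show ?thesis unfolding \<delta> by simp
    qed
    also have "\<dots> = 2 ^ Suc m * real N ^ n" by simp
    also have "\<dots> \<le> real N ^ Suc m * real N ^ n" using N0 by (intro mult_right_mono power_mono) auto
    also have "\<dots> = real N ^ (Suc m + n)" by (simp only: power_add)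
    finally have "2 * k \<le> Suc m + n" using N0 by (simp only: power_increasing_iff)
    then show ?thesis by simp
  qed simp
  define k where "k = (GREATEST k. P k)"
  have Pk: "P k" unfolding k_def by (rule GreatestI_nat[of P 0 "n + m + 1"]) (use Pb in \<open>auto simp: P_def\<close>)
  have "\<not> P (Suc k)"
  proof
    assume "P (Suc k)"
    then have "Suc k \<le> k" unfolding k_def by (rule Greatest_le_nat[of P _ "n + m + 1"]) (use Pb in auto)
    then show False by simp
  qed
  then have nP: "\<sigma> > r / real N ^ Suc k \<or> 1 / real N ^ (2 * Suc k) < \<delta> / r" unfolding P_def by linarith
  have st: "\<bar>a x - a y\<bar> > r / 2 \<or> \<bar>b x - b y\<bar> > r / 2 \<or> \<bar>c x - c y\<bar> > r / 2"
    using rh unfolding dle by linarith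
  have st2: "\<bar>a x - a y\<bar> \<le> r \<and> \<bar>b x - b y\<bar> \<le> r \<and> \<bar>c x - c y\<bar> \<le> r" using i1 unfolding dle r_def .
  have st3: "k = 0 \<or> \<delta> / r \<le> 1 / real N ^ (2 * k)" "k = 0 \<or> \<sigma> \<le> r / real N ^ k" using Pk unfolding P_def by blast+
  have "s \<in> pairset N \<delta> r k a b c x y"
    unfolding pairset_def using st st2 st3 nP unfolding \<sigma>_def by (subst if_P) blast+
  moreover have "i \<in> {1..n * N + m}" "k \<in> {0..n + m + 1}" using i2 i3 Pb[OF Pk] by auto
  ultimately show ?thesis unfolding r_def by blast
qed

text \<open>Attached to a point instead of a cell: moments of the cell mass then become weighted
  sums over \<open>X\<close>, with no summation over integers.\<close>

definition cellmass :: "('x \<Rightarrow> real) \<Rightarrow> 'x set \<Rightarrow> ('x \<Rightarrow> real) \<Rightarrow> real \<Rightarrow> 'x \<Rightarrow> real" where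
  "cellmass w X f \<delta> x = sum w {y\<in>X. \<lfloor>f y / \<delta>\<rfloor> = \<lfloor>f x / \<delta>\<rfloor>}"

text \<open>Applied with \<open>m\<close> the mass of a cell, \<open>m D\<close> bounding the pairs close in all three coefficients
  and \<open>P\<close> the remaining pairs; this is where the powers \<open>1/4\<close> and \<open>5/8\<close> are matched.\<close>

lemma mass_split_bound:
  fixes m D P :: real
  assumes m: "0 \<le> m" and D: "0 \<le> D" and P: "0 \<le> P" and le: "m\<^sup>2 \<le> P + m * D"
  shows "m powr (1/4) * m \<le> 2 * P powr (5/8) + (4 * D) powr (1/4) * m"
proof (cases "m \<le> 4 * D")
  case True
  then have "m powr (1/4) * m \<le> (4 * D) powr (1/4) * m" using m by (intro mult_right_mono powr_mono2) auto
  moreover have "0 \<le> 2 * P powr (5/8)" by simp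
  ultimately show ?thesis by linarith
next
  case False
  then have mp: "m > 0" using D by linarith
  have "m * D \<le> m * (m / 4)" using False m by (intro mult_left_mono) auto
  then have "m\<^sup>2 \<le> 2 * P" using le P by (simp add: power2_eq_square)
  then have "(m\<^sup>2) powr (5/8) \<le> (2 * P) powr (5/8)" by (intro powr_mono2) auto
  also have "\<dots> = 2 powr (5/8) * P powr (5/8)" using P by (simp add: powr_mult)
  also have "\<dots> \<le> 2 powr 1 * P powr (5/8)" by (intro mult_right_mono powr_mono) auto
  finally have "(m\<^sup>2) powr (5/8) \<le> 2 * P powr (5/8)" by simp
  moreover have "(m\<^sup>2) powr (5/8) = m powr (1/4) * m"
  proof -
    have "(m\<^sup>2) powr (5/8) = (m powr 2) powr (5/8)" using mp by (simp add: powr_numeral)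
    also have "\<dots> = m powr (1/4 + 1)" by (simp add: powr_powr)
    also have "\<dots> = m powr (1/4) * m" using mp by (simp only: powr_add powr_one)
    finally show ?thesis .
  qed
  moreover have "0 \<le> (4 * D) powr (1/4) * m" using m by simp
  ultimately show ?thesis by linarith
qed

text \<open>In each cell the pairs within \<open>16 * \<delta>\<close> in all three coefficients are
  controlled by the mass bound \<open>fr\<close>, and all others fall into the classes of
  \<open>pairset_cover\<close>. Subadditivity of the power \<open>5/8\<close> lets every class be
  integrated separately. The number of classes is only quadratic in \<open>n\<close>, so adding
  their bounds is harmless.\<close>

lemma quadratic_cellmass_bound_scale:
  fixes a b c w :: "'x \<Rightarrow> real"
  assumes fin: "finite X" and w: "\<And>x. 0 \<le> w x" and N: "N \<ge> 32" and \<delta>: "\<delta> = 1 / real N ^ n"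
    and t: "0 \<le> t" "t \<le> 1" and A0: "A0 \<ge> 0"
    and fr: "\<And>x r. x \<in> X \<Longrightarrow> r \<ge> \<delta> \<Longrightarrow>
      sum w {y\<in>X. \<bar>a x - a y\<bar> \<le> r \<and> \<bar>b x - b y\<bar> \<le> r \<and> \<bar>c x - c y\<bar> \<le> r} \<le> A0 * r powr t"
    and bd: "\<And>x y. x \<in> X \<Longrightarrow> y \<in> X \<Longrightarrow> \<bar>a x - a y\<bar> \<le> 2 ^ m \<and> \<bar>b x - b y\<bar> \<le> 2 ^ m \<and> \<bar>c x - c y\<bar> \<le> 2 ^ m"
  shows "(\<integral>\<^sup>+s. ennreal (\<Sum>x\<in>X. w x * cellmass w X (\<lambda>y. qv a b c y s) \<delta> x powr (1/4)) * indicator {0..<1} s \<partial>lborel)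
    \<le> ennreal ((2 * real (n * N + m) * real (n + m + 2) *
        (9 * (2 * (real N)\<^sup>2 + 1) * ((225 * incidence_const 800) ^ (n + m + 1) * 2 * (4 * (real N)\<^sup>2 * A0) powr (1/4))) + (64 * A0) powr (1/4))
        * \<delta> powr (t/4) * sum w X)"
proof -
  have N0: "N > 0" "real N \<ge> 32" using N by auto
  have d0: "\<delta> > 0" unfolding \<delta> using N0 by simp
  have W0: "sum w X \<ge> 0" using w by (simp add: sum_nonneg)
  define cell where "cell x s = \<lfloor>qv a b c x s / \<delta>\<rfloor>" for x s
  define rr where "rr i = 16 * \<delta> * 2 ^ i" for i :: nat
  define S where "S i k = pairset N \<delta> (rr i) k a b c" for i k
  define II where "II = {1..n * N + m}"
  define KK where "KK = {0..n + m + 1}"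
  define D where "D = A0 * (16 * \<delta>) powr t"
  have D0: "D \<ge> 0" unfolding D_def using A0 by simp
  define B where "B = (\<Sum>x\<in>X. \<bar>a x\<bar> + \<bar>b x\<bar> + \<bar>c x\<bar>)"
  \<comment> \<open>A finite range of cells that contains the value of every point of
    \<open>X\<close> at every time in the unit interval.\<close>
  define VV where "VV = {\<lfloor>- B / \<delta>\<rfloor>..\<lfloor>B / \<delta>\<rfloor>}"
  have VV: "cell x s \<in> VV" if "x \<in> X" "0 \<le> s" "s \<le> 1" for x s
  proof -
    have "\<bar>a x\<bar> + \<bar>b x\<bar> + \<bar>c x\<bar> \<le> B" unfolding B_def by (rule member_le_sum[of x X]) (use that fin in auto)
    moreover have "\<bar>b x * s\<bar> \<le> \<bar>b x\<bar>" "\<bar>c x * s * s\<bar> \<le> \<bar>c x\<bar>"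
      using that by (auto intro!: abs_mult_le_unit simp: order_refl)
    ultimately have "\<bar>qv a b c x s\<bar> \<le> B" unfolding qv_def by (simp add: power2_eq_square mult.assoc[symmetric])
    then have "- B \<le> qv a b c x s" "qv a b c x s \<le> B" by linarith+
    then have "- B / \<delta> \<le> qv a b c x s / \<delta>" "qv a b c x s / \<delta> \<le> B / \<delta>" using d0 by (simp_all only: divide_right_mono less_imp_le)
    then show ?thesis unfolding VV_def cell_def by (auto intro!: floor_mono)
  qed
  define Phi where "Phi i k s = ennreal (\<Sum>v\<in>VV. pmass w cell (S i k) X X s v powr (5/8))" for i k s
  have Phim [measurable]: "Phi i k \<in> borel_measurable borel" for i k
  proof -
    have [measurable]: "(\<lambda>s. pmass w cell (S i k) X X s v) \<in> borel_measurable borel" for v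
      unfolding cell_def S_def by (rule pmass_measurable[OF floor_cell_sets pairset_sets])
    show ?thesis unfolding Phi_def by measurable
  qed
  define KC where "KC = 9 * (2 * (real N)\<^sup>2 + 1) * ((225 * incidence_const 800) ^ (n + m + 1) * 2 * (4 * (real N)\<^sup>2 * A0) powr (1/4)) * \<delta> powr (t/4) * sum w X"
  have KC0: "KC \<ge> 0" unfolding KC_def incidence_const_def using W0 by simp
  have cls: "(\<integral>\<^sup>+s. Phi i k s * indicator (tslot N 0 0) s \<partial>lborel) \<le> ennreal KC" if "i \<in> II" "k \<in> KK" for i k
  proof -
    have r: "rr i \<ge> 32 * \<delta>"
    proof -
      have "(2::real) ^ 1 \<le> 2 ^ i" using that unfolding II_def by (intro power_increasing) auto
      then have "16 * \<delta> * 2 ^ 1 \<le> 16 * \<delta> * 2 ^ i" using d0 by (intro mult_left_mono) auto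
      then show ?thesis unfolding rr_def by simp
    qed
    have "(\<integral>\<^sup>+s. Phi i k s * indicator (tslot N 0 0) s \<partial>lborel)
      \<le> ennreal (9 * (2 * (real N)\<^sup>2 + 1) * ((225 * incidence_const 800) ^ k * 2 * (4 * (real N)\<^sup>2 * A0) powr (1/4) * \<delta> powr (t/4) * sum w X))"
      unfolding Phi_def cell_def S_def using r d0
      by (intro pairset_mass_bound fin w N t A0 fr) (auto simp: VV_def)
    also have "\<dots> \<le> ennreal KC"
    proof (rule ennreal_leI)
      have "(225 * incidence_const 800) ^ k \<le> (225 * incidence_const 800) ^ (n + m + 1)"
        using that unfolding KK_def incidence_const_def by (intro power_increasing) auto
      then have "(225 * incidence_const 800) ^ k * (9 * (2 * (real N)\<^sup>2 + 1) * (2 * (4 * (real N)\<^sup>2 * A0) powr (1/4) * \<delta> powr (t/4) * sum w X))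
        \<le> (225 * incidence_const 800) ^ (n + m + 1) * (9 * (2 * (real N)\<^sup>2 + 1) * (2 * (4 * (real N)\<^sup>2 * A0) powr (1/4) * \<delta> powr (t/4) * sum w X))"
        using W0 by (intro mult_right_mono) auto
      then show "9 * (2 * (real N)\<^sup>2 + 1) * ((225 * incidence_const 800) ^ k * 2 * (4 * (real N)\<^sup>2 * A0) powr (1/4) * \<delta> powr (t/4) * sum w X) \<le> KC"
        unfolding KC_def by (simp only: mult_ac)
    qed
    finally show ?thesis .
  qed
  have pt: "(\<Sum>x\<in>X. w x * cellmass w X (\<lambda>y. qv a b c y s) \<delta> x powr (1/4))
      \<le> (\<Sum>i\<in>II. \<Sum>k\<in>KK. 2 * (\<Sum>v\<in>VV. pmass w cell (S i k) X X s v powr (5/8))) + (4 * D) powr (1/4) * sum w X"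
    if s: "0 \<le> s" "s \<le> 1" for s
  proof -
    define mm where "mm v = cmass w X (\<lambda>x. cell x s) v" for v
    have mm0: "mm v \<ge> 0" for v unfolding mm_def by (rule cmass_nonneg) (rule w)
    have each: "mm v powr (1/4) * mm v \<le> 2 * (\<Sum>i\<in>II. \<Sum>k\<in>KK. pmass w cell (S i k) X X s v powr (5/8)) + (4 * D) powr (1/4) * mm v" for v
    proof -
      define P where "P = (\<Sum>i\<in>II. \<Sum>k\<in>KK. pmass w cell (S i k) X X s v)"
      have P0: "P \<ge> 0" unfolding P_def using w by (intro sum_nonneg pmass_nonneg) auto
      have key: "(mm v)\<^sup>2 \<le> P + mm v * D"
      proof -
        define Xv where "Xv = {x\<in>X. cell x s = v}"
        have finv: "finite Xv" "Xv \<subseteq> X" unfolding Xv_def using fin by auto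
        define nr where "nr x y \<longleftrightarrow> \<bar>a x - a y\<bar> \<le> 16 * \<delta> \<and> \<bar>b x - b y\<bar> \<le> 16 * \<delta> \<and> \<bar>c x - c y\<bar> \<le> 16 * \<delta>" for x y
        have "(mm v)\<^sup>2 = (\<Sum>x\<in>Xv. \<Sum>y\<in>Xv. w x * w y)"
          unfolding mm_def cmass_def Xv_def power2_eq_square by (rule sum_product)
        also have "\<dots> \<le> (\<Sum>x\<in>Xv. \<Sum>y\<in>Xv. (\<Sum>i\<in>II. \<Sum>k\<in>KK. if s \<in> S i k x y then w x * w y else 0) + (if nr x y then w x * w y else 0))"
        proof (intro sum_mono)
          fix x y assume xy: "x \<in> Xv" "y \<in> Xv"
          let ?g = "\<lambda>i k. if s \<in> S i k x y then w x * w y else 0"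
          have g0: "?g i k \<ge> 0" for i k using w by simp
          have gs: "0 \<le> (\<Sum>i\<in>II. \<Sum>k\<in>KK. ?g i k)" by (intro sum_nonneg g0)
          show "w x * w y \<le> (\<Sum>i\<in>II. \<Sum>k\<in>KK. ?g i k) + (if nr x y then w x * w y else 0)"
          proof (cases "nr x y")
            case True then show ?thesis using gs by simp
          next
            case False
            have "x \<in> X" "y \<in> X" using xy finv by auto
            then have bb: "\<bar>a x - a y\<bar> \<le> 2 ^ m" "\<bar>b x - b y\<bar> \<le> 2 ^ m" "\<bar>c x - c y\<bar> \<le> 2 ^ m" using bd by blast+
            from pairset_cover[OF N \<delta> bb, of s] False
            obtain i k where ik: "i \<in> II" "k \<in> KK" "s \<in> S i k x y"
              unfolding nr_def S_def rr_def II_def KK_def by blast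
            have "w x * w y = ?g i k" using ik by simp
            also have "\<dots> \<le> (\<Sum>k\<in>KK. ?g i k)" by (rule member_le_sum) (use ik g0 in \<open>auto simp: KK_def\<close>)
            also have "\<dots> \<le> (\<Sum>i\<in>II. \<Sum>k\<in>KK. ?g i k)"
              by (rule member_le_sum[of i II "\<lambda>i. \<Sum>k\<in>KK. ?g i k"], rule ik(1), intro sum_nonneg g0, simp add: II_def)
            finally show ?thesis using False by simp
          qed
        qed
        also have "\<dots> = (\<Sum>x\<in>Xv. \<Sum>y\<in>Xv. \<Sum>i\<in>II. \<Sum>k\<in>KK. if s \<in> S i k x y then w x * w y else 0)
            + (\<Sum>x\<in>Xv. \<Sum>y\<in>Xv. if nr x y then w x * w y else 0)"
          by (simp only: sum.distrib)
        also have "(\<Sum>x\<in>Xv. \<Sum>y\<in>Xv. \<Sum>i\<in>II. \<Sum>k\<in>KK. if s \<in> S i k x y then w x * w y else 0) = P"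
        proof -
          let ?f = "\<lambda>x y i k. if s \<in> S i k x y then w x * w y else 0"
          have "(\<Sum>x\<in>Xv. \<Sum>y\<in>Xv. \<Sum>i\<in>II. \<Sum>k\<in>KK. ?f x y i k) = (\<Sum>x\<in>Xv. \<Sum>i\<in>II. \<Sum>y\<in>Xv. \<Sum>k\<in>KK. ?f x y i k)"
            by (intro sum.cong refl) (rule sum.swap)
          also have "\<dots> = (\<Sum>i\<in>II. \<Sum>x\<in>Xv. \<Sum>y\<in>Xv. \<Sum>k\<in>KK. ?f x y i k)" by (rule sum.swap)
          also have "\<dots> = (\<Sum>i\<in>II. \<Sum>x\<in>Xv. \<Sum>k\<in>KK. \<Sum>y\<in>Xv. ?f x y i k)"
            by (intro sum.cong refl) (rule sum.swap)
          also have "\<dots> = (\<Sum>i\<in>II. \<Sum>k\<in>KK. \<Sum>x\<in>Xv. \<Sum>y\<in>Xv. ?f x y i k)"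
            by (intro sum.cong refl) (rule sum.swap)
          also have "\<dots> = P" unfolding P_def
          proof (intro sum.cong refl)
            fix i k
            have "pmass w cell (S i k) X X s v = (\<Sum>x\<in>X. if cell x s = v then (\<Sum>y\<in>X. if cell y s = v then ?f x y i k else 0) else 0)"
              unfolding pmass_def by (intro sum.cong refl) (auto intro!: sum.cong)
            also have "\<dots> = (\<Sum>x\<in>Xv. \<Sum>y\<in>Xv. ?f x y i k)" unfolding Xv_def by (simp only: sum.inter_filter[OF fin])
            finally show "(\<Sum>x\<in>Xv. \<Sum>y\<in>Xv. ?f x y i k) = pmass w cell (S i k) X X s v" ..
          qed
          finally show ?thesis .
        qed
        also have "(\<Sum>x\<in>Xv. \<Sum>y\<in>Xv. if nr x y then w x * w y else 0) \<le> (\<Sum>x\<in>Xv. w x * D)"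
        proof (rule sum_mono)
          fix x assume x: "x \<in> Xv"
          have "(\<Sum>y\<in>Xv. if nr x y then w x * w y else 0) = w x * (\<Sum>y\<in>{y\<in>Xv. nr x y}. w y)"
            by (simp only: sum.inter_filter[OF finv(1), symmetric] sum_distrib_left)
          also have "(\<Sum>y\<in>{y\<in>Xv. nr x y}. w y) \<le> sum w {y\<in>X. \<bar>a x - a y\<bar> \<le> 16 * \<delta> \<and> \<bar>b x - b y\<bar> \<le> 16 * \<delta> \<and> \<bar>c x - c y\<bar> \<le> 16 * \<delta>}"
            using fin w finv unfolding nr_def by (intro sum_mono2) auto
          also have "\<dots> \<le> D" unfolding D_def using x finv d0 by (intro fr) auto
          finally show "(\<Sum>y\<in>Xv. if nr x y then w x * w y else 0) \<le> w x * D" using w by (simp add: mult_left_mono)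
        qed
        also have "(\<Sum>x\<in>Xv. w x * D) = mm v * D" unfolding mm_def cmass_def Xv_def by (simp only: sum_distrib_right)
        finally show ?thesis by simp
      qed
      have "mm v powr (1/4) * mm v \<le> 2 * P powr (5/8) + (4 * D) powr (1/4) * mm v"
        using mm0 D0 P0 key by (rule mass_split_bound)
      also have "P powr (5/8) \<le> (\<Sum>i\<in>II. \<Sum>k\<in>KK. pmass w cell (S i k) X X s v powr (5/8))"
      proof -
        have "P powr (5/8) \<le> (\<Sum>i\<in>II. (\<Sum>k\<in>KK. pmass w cell (S i k) X X s v) powr (5/8))"
          unfolding P_def using w by (intro powr_sum_le sum_nonneg pmass_nonneg) (auto simp: II_def)
        also have "\<dots> \<le> (\<Sum>i\<in>II. \<Sum>k\<in>KK. pmass w cell (S i k) X X s v powr (5/8))"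
          using w by (intro sum_mono powr_sum_le pmass_nonneg) (auto simp: KK_def)
        finally show ?thesis .
      qed
      finally show ?thesis by simp
    qed
    have "(\<Sum>x\<in>X. w x * cellmass w X (\<lambda>y. qv a b c y s) \<delta> x powr (1/4)) = (\<Sum>x\<in>X. w x * mm (cell x s) powr (1/4))"
      unfolding cellmass_def mm_def cmass_def cell_def ..
    also have "\<dots> = (\<Sum>v\<in>(\<lambda>x. cell x s) ` X. mm v powr (1/4) * mm v)"
      unfolding mm_def using sum_weight_eq_cmass[OF fin, of w "\<lambda>v. cmass w X (\<lambda>x. cell x s) v powr (1/4)" "\<lambda>x. cell x s"] .
    also have "\<dots> \<le> (\<Sum>v\<in>VV. mm v powr (1/4) * mm v)"
      using VV s mm0 by (intro sum_mono2) (auto simp: VV_def)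
    also have "\<dots> \<le> (\<Sum>v\<in>VV. 2 * (\<Sum>i\<in>II. \<Sum>k\<in>KK. pmass w cell (S i k) X X s v powr (5/8)) + (4 * D) powr (1/4) * mm v)"
      by (intro sum_mono each)
    also have "\<dots> = (\<Sum>v\<in>VV. \<Sum>i\<in>II. \<Sum>k\<in>KK. 2 * pmass w cell (S i k) X X s v powr (5/8)) + (4 * D) powr (1/4) * (\<Sum>v\<in>VV. mm v)"
      by (simp only: sum.distrib sum_distrib_left)
    also have "(\<Sum>v\<in>VV. \<Sum>i\<in>II. \<Sum>k\<in>KK. 2 * pmass w cell (S i k) X X s v powr (5/8))
      = (\<Sum>i\<in>II. \<Sum>k\<in>KK. 2 * (\<Sum>v\<in>VV. pmass w cell (S i k) X X s v powr (5/8)))"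
    proof -
      have "(\<Sum>v\<in>VV. \<Sum>i\<in>II. \<Sum>k\<in>KK. g v i k) = (\<Sum>i\<in>II. \<Sum>k\<in>KK. \<Sum>v\<in>VV. g v i k)" for g :: "int \<Rightarrow> nat \<Rightarrow> nat \<Rightarrow> real"
      proof -
        have "(\<Sum>v\<in>VV. \<Sum>i\<in>II. \<Sum>k\<in>KK. g v i k) = (\<Sum>i\<in>II. \<Sum>v\<in>VV. \<Sum>k\<in>KK. g v i k)" by (rule sum.swap)
        also have "\<dots> = (\<Sum>i\<in>II. \<Sum>k\<in>KK. \<Sum>v\<in>VV. g v i k)" by (intro sum.cong refl) (rule sum.swap)
        finally show ?thesis .
      qed
      then show ?thesis by (simp only: sum_distrib_left)
    qed
    also have "(\<Sum>v\<in>VV. mm v) \<le> sum w X" unfolding mm_def using fin w by (intro sum_cmass_le) (auto simp: VV_def)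
    finally show ?thesis by (simp add: mult_left_mono)
  qed
  have slot: "tslot N 0 0 = {0..<1}" unfolding tslot_def by simp
  have "(\<integral>\<^sup>+s. ennreal (\<Sum>x\<in>X. w x * cellmass w X (\<lambda>y. qv a b c y s) \<delta> x powr (1/4)) * indicator {0..<1} s \<partial>lborel)
     \<le> (\<integral>\<^sup>+s. (\<Sum>i\<in>II. \<Sum>k\<in>KK. 2 * (Phi i k s * indicator (tslot N 0 0) s)) + ennreal ((4 * D) powr (1/4) * sum w X) * indicator (tslot N 0 0) s \<partial>lborel)"
  proof (rule nn_integral_mono)
    fix s :: real
    show "ennreal (\<Sum>x\<in>X. w x * cellmass w X (\<lambda>y. qv a b c y s) \<delta> x powr (1/4)) * indicator {0..<1} s
      \<le> (\<Sum>i\<in>II. \<Sum>k\<in>KK. 2 * (Phi i k s * indicator (tslot N 0 0) s)) + ennreal ((4 * D) powr (1/4) * sum w X) * indicator (tslot N 0 0) s"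
    proof (cases "s \<in> {0..<1}")
      case True
      have "ennreal (\<Sum>x\<in>X. w x * cellmass w X (\<lambda>y. qv a b c y s) \<delta> x powr (1/4))
        \<le> ennreal ((\<Sum>i\<in>II. \<Sum>k\<in>KK. 2 * (\<Sum>v\<in>VV. pmass w cell (S i k) X X s v powr (5/8))) + (4 * D) powr (1/4) * sum w X)"
        using True by (intro ennreal_leI pt) auto
      also have "\<dots> = (\<Sum>i\<in>II. \<Sum>k\<in>KK. 2 * Phi i k s) + ennreal ((4 * D) powr (1/4) * sum w X)"
      proof -
        have e: "ennreal (2 * (\<Sum>v\<in>VV. pmass w cell (S i k) X X s v powr (5/8))) = 2 * Phi i k s" for i k
          unfolding Phi_def by (simp add: ennreal_mult sum_nonneg)
        have z: "0 \<le> 2 * (\<Sum>v\<in>VV. pmass w cell (S i k) X X s v powr (5/8))" for i k by (simp add: sum_nonneg)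
        have "ennreal ((\<Sum>i\<in>II. \<Sum>k\<in>KK. 2 * (\<Sum>v\<in>VV. pmass w cell (S i k) X X s v powr (5/8))) + (4 * D) powr (1/4) * sum w X)
          = ennreal (\<Sum>i\<in>II. \<Sum>k\<in>KK. 2 * (\<Sum>v\<in>VV. pmass w cell (S i k) X X s v powr (5/8))) + ennreal ((4 * D) powr (1/4) * sum w X)"
          using W0 by (intro ennreal_plus sum_nonneg z) auto
        also have "ennreal (\<Sum>i\<in>II. \<Sum>k\<in>KK. 2 * (\<Sum>v\<in>VV. pmass w cell (S i k) X X s v powr (5/8)))
          = (\<Sum>i\<in>II. ennreal (\<Sum>k\<in>KK. 2 * (\<Sum>v\<in>VV. pmass w cell (S i k) X X s v powr (5/8))))"
          by (rule sum_ennreal[symmetric]) (intro sum_nonneg z)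
        also have "\<dots> = (\<Sum>i\<in>II. \<Sum>k\<in>KK. ennreal (2 * (\<Sum>v\<in>VV. pmass w cell (S i k) X X s v powr (5/8))))"
          by (intro sum.cong refl sum_ennreal[symmetric] z)
        finally show ?thesis unfolding e .
      qed
      finally show ?thesis using True unfolding slot by simp
    qed simp
  qed
  also have "\<dots> = (\<Sum>i\<in>II. \<Sum>k\<in>KK. 2 * (\<integral>\<^sup>+s. Phi i k s * indicator (tslot N 0 0) s \<partial>lborel)) + ennreal ((4 * D) powr (1/4) * sum w X) * emeasure lborel (tslot N 0 0)"
    by (simp add: nn_integral_add nn_integral_sum nn_integral_cmult nn_integral_cmult_indicator)
  also have "\<dots> \<le> (\<Sum>i\<in>II. \<Sum>k\<in>KK. 2 * ennreal KC) + ennreal ((4 * D) powr (1/4) * sum w X) * 1"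
    using cls emeasure_tslot[OF N0(1), of 0 0] by (intro add_mono sum_mono mult_left_mono) auto
  also have "\<dots> = ennreal (2 * real (n * N + m) * real (n + m + 2) * KC + (4 * D) powr (1/4) * sum w X)"
  proof -
    have "(\<Sum>i\<in>II. \<Sum>k\<in>KK. 2 * ennreal KC) = (\<Sum>i\<in>II. \<Sum>k\<in>KK. ennreal (2 * KC))"
      using KC0 by (simp add: ennreal_mult)
    also have "\<dots> = (\<Sum>i\<in>II. ennreal (\<Sum>k\<in>KK. 2 * KC))"
      using KC0 by (intro sum.cong refl sum_ennreal) auto
    also have "\<dots> = ennreal (\<Sum>i\<in>II. \<Sum>k\<in>KK. 2 * KC)"
      using KC0 by (intro sum_ennreal sum_nonneg) auto
    also have "(\<Sum>i\<in>II. \<Sum>k\<in>KK. 2 * KC) = 2 * real (n * N + m) * real (n + m + 2) * KC"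
      unfolding II_def KK_def by simp
    finally show ?thesis using KC0 W0 by (simp add: ennreal_plus[symmetric] del: ennreal_plus)
  qed
  also have "\<dots> \<le> ennreal ((2 * real (n * N + m) * real (n + m + 2) *
        (9 * (2 * (real N)\<^sup>2 + 1) * ((225 * incidence_const 800) ^ (n + m + 1) * 2 * (4 * (real N)\<^sup>2 * A0) powr (1/4))) + (64 * A0) powr (1/4))
        * \<delta> powr (t/4) * sum w X)"
  proof (rule ennreal_leI)
    have "(4 * D) powr (1/4) \<le> (64 * A0) powr (1/4) * \<delta> powr (t/4)"
    proof -
      have "16 powr t \<le> 16 powr (1::real)" using t by (intro powr_mono) auto
      then have "4 * (A0 * (16 powr t * \<delta> powr t)) \<le> 4 * (A0 * (16 * \<delta> powr t))"
        using A0 by (intro mult_left_mono mult_right_mono) auto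
      then have "4 * D \<le> 64 * A0 * \<delta> powr t" unfolding D_def using d0 by (simp add: powr_mult)
      then have "(4 * D) powr (1/4) \<le> (64 * A0 * \<delta> powr t) powr (1/4)" using D0 by (intro powr_mono2) auto
      also have "\<dots> = (64 * A0) powr (1/4) * \<delta> powr (t/4)" using A0 by (simp add: powr_mult powr_powr)
      finally show ?thesis .
    qed
    then have "(4 * D) powr (1/4) * sum w X \<le> (64 * A0) powr (1/4) * \<delta> powr (t/4) * sum w X"
      using W0 by (rule mult_right_mono)
    then show "2 * real (n * N + m) * real (n + m + 2) * KC + (4 * D) powr (1/4) * sum w X
      \<le> (2 * real (n * N + m) * real (n + m + 2) *
        (9 * (2 * (real N)\<^sup>2 + 1) * ((225 * incidence_const 800) ^ (n + m + 1) * 2 * (4 * (real N)\<^sup>2 * A0) powr (1/4))) + (64 * A0) powr (1/4))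
        * \<delta> powr (t/4) * sum w X"
      unfolding KC_def by (simp add: distrib_right mult.assoc)
  qed
  finally show ?thesis .
qed

text \<open>Absorbs the number of classes, quadratic in the scale index \<open>n\<close>, into an
  exponential factor.\<close>

lemma square_le_exp2: "(real n + 1)\<^sup>2 \<le> 4 * 2 ^ n"
proof (induction n)
  case (Suc n)
  show ?case
  proof (cases "n = 0")
    case False
    then have n: "real n \<ge> 1" by simp
    have "(real (Suc n) + 1)\<^sup>2 = (real n + 1)\<^sup>2 + 2 * real n + 3" by (simp add: power2_eq_square algebra_simps)
    also have "\<dots> \<le> (real n + 1)\<^sup>2 + (real n + 1)\<^sup>2 + (3 - 1 - real n * real n)" by (simp add: power2_eq_square algebra_simps)
    finally have *: "(real (Suc n) + 1)\<^sup>2 \<le> 2 * (real n + 1)\<^sup>2 + (2 - real n * real n)" by simp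
    show ?thesis
    proof (cases "n = 1")
      case True then show ?thesis by (simp add: power2_eq_square)
    next
      case False
      then have "real n \<ge> 2" using \<open>n \<noteq> 0\<close> by simp
      then have "2 * 2 \<le> real n * real n" by (intro mult_mono) auto
      then show ?thesis using * Suc by simp
    qed
  qed simp
qed simp

text \<open>The loss at scale \<open>n\<close> is of order \<open>(n + 1)\<^sup>2 * CC ^ n\<close>,
  hence of order \<open>(2 * CC) ^ n\<close>, where \<open>CC\<close> does not depend on
  \<open>N\<close>. Any \<open>N\<close> with \<open>N powr \<epsilon> \<ge> 2 * CC\<close> turns it
  into \<open>\<delta> powr (- \<epsilon>)\<close>. \<open>N\<close> and \<open>C\<close> are fixed
  before \<open>n\<close> and before the configuration.\<close>

lemma quadratic_cellmass_bound:
  fixes t \<epsilon> A0 :: real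
  assumes t: "0 \<le> t" "t \<le> 1" and eps: "\<epsilon> > 0" and A0: "A0 \<ge> 0"
  shows "\<exists>N\<ge>32. \<exists>C\<ge>0. \<forall>n X (w :: 'x \<Rightarrow> real) a b c. finite X \<longrightarrow> (\<forall>x. 0 \<le> w x) \<longrightarrow>
     (\<forall>x\<in>X. \<forall>r\<ge>1 / real N ^ n. sum w {y\<in>X. \<bar>a x - a y\<bar> \<le> r \<and> \<bar>b x - b y\<bar> \<le> r \<and> \<bar>c x - c y\<bar> \<le> r} \<le> A0 * r powr t) \<longrightarrow>
     (\<forall>x\<in>X. \<forall>y\<in>X. \<bar>a x - a y\<bar> \<le> 2 ^ m \<and> \<bar>b x - b y\<bar> \<le> 2 ^ m \<and> \<bar>c x - c y\<bar> \<le> 2 ^ m) \<longrightarrow>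
     (\<integral>\<^sup>+s. ennreal (\<Sum>x\<in>X. w x * cellmass w X (\<lambda>y. qv a b c y s) (1 / real N ^ n) x powr (1/4)) * indicator {0..<1} s \<partial>lborel)
      \<le> ennreal (C * sum w X * (1 / real N ^ n) powr (t/4 - \<epsilon>))"
proof -
  define CC where "CC = 225 * incidence_const 800"
  have CC1: "CC \<ge> 1" unfolding CC_def incidence_const_def by simp
  obtain N0 :: nat where N0: "(2 * CC) powr (1 / \<epsilon>) \<le> real N0" using real_arch_simple by blast
  define N where "N = max 32 N0"
  have N: "N \<ge> 32" "real N \<ge> 32" unfolding N_def by auto
  have Ne: "2 * CC \<le> real N powr \<epsilon>"
  proof -
    have "2 * CC = ((2 * CC) powr (1 / \<epsilon>)) powr \<epsilon>" using eps CC1 by (simp add: powr_powr)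
    also have "\<dots> \<le> real N powr \<epsilon>" using N0 eps unfolding N_def by (intro powr_mono2) auto
    finally show ?thesis .
  qed
  define G where "G = 9 * (2 * (real N)\<^sup>2 + 1) * (2 * (4 * (real N)\<^sup>2 * A0) powr (1/4))"
  have G0: "G \<ge> 0" unfolding G_def by simp
  define C where "C = 8 * real (N + m) * real (m + 2) * CC ^ (m + 1) * G + (64 * A0) powr (1/4)"
  have C0: "C \<ge> 0" unfolding C_def using G0 CC1 by simp
  show ?thesis
  proof (intro exI[of _ N] exI[of _ C] conjI allI impI N(1) C0)
    fix n X and w a b c :: "'x \<Rightarrow> real"
    assume fin: "finite X" and w: "\<forall>x. 0 \<le> w x"
     and fr: "\<forall>x\<in>X. \<forall>r\<ge>1 / real N ^ n. sum w {y\<in>X. \<bar>a x - a y\<bar> \<le> r \<and> \<bar>b x - b y\<bar> \<le> r \<and> \<bar>c x - c y\<bar> \<le> r} \<le> A0 * r powr t"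
     and bd: "\<forall>x\<in>X. \<forall>y\<in>X. \<bar>a x - a y\<bar> \<le> 2 ^ m \<and> \<bar>b x - b y\<bar> \<le> 2 ^ m \<and> \<bar>c x - c y\<bar> \<le> 2 ^ m"
    define \<delta> where "\<delta> = 1 / real N ^ n"
    have W0: "sum w X \<ge> 0" using w by (simp add: sum_nonneg)
    define Q where "Q = 2 * real (n * N + m) * real (n + m + 2) *
        (9 * (2 * (real N)\<^sup>2 + 1) * ((225 * incidence_const 800) ^ (n + m + 1) * 2 * (4 * (real N)\<^sup>2 * A0) powr (1/4))) + (64 * A0) powr (1/4)"
    have dn: "\<delta> powr (- \<epsilon>) = (real N powr \<epsilon>) ^ n"
    proof -
      have "\<delta> powr (- \<epsilon>) = (real N ^ n) powr \<epsilon>" unfolding \<delta>_def using N by (simp add: powr_minus_divide powr_divide)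
      also have "\<dots> = (real N powr \<epsilon>) ^ n" using N by (simp add: powr_realpow[symmetric] powr_powr mult.commute)
      finally show ?thesis .
    qed
    have d1: "1 \<le> \<delta> powr (- \<epsilon>)" unfolding dn using N eps by (intro one_le_power ge_one_powr_ge_zero) auto
    have p: "(2 * CC) ^ n \<le> \<delta> powr (- \<epsilon>)" unfolding dn using Ne CC1 by (intro power_mono) auto
    have i1: "real (n * N + m) \<le> (real n + 1) * real (N + m)" by (simp add: algebra_simps)
    have i2: "real (n + m + 2) \<le> (real n + 1) * real (m + 2)" by (simp add: algebra_simps)
    have "Q = 2 * (real (n * N + m) * real (n + m + 2)) * (CC ^ n * CC ^ (m + 1)) * G + (64 * A0) powr (1/4)"
      unfolding Q_def G_def CC_def by (simp add: power_add mult_ac)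
    also have "\<dots> \<le> 2 * (((real n + 1) * real (N + m)) * ((real n + 1) * real (m + 2))) * (CC ^ n * CC ^ (m + 1)) * G + (64 * A0) powr (1/4)"
      using i1 i2 G0 CC1 by (intro add_right_mono mult_right_mono mult_left_mono mult_mono) auto
    also have "\<dots> = (real n + 1)\<^sup>2 * CC ^ n * (2 * real (N + m) * real (m + 2) * CC ^ (m + 1) * G) + (64 * A0) powr (1/4)"
      by (simp only: power2_eq_square mult_ac)
    also have "\<dots> \<le> (4 * 2 ^ n) * CC ^ n * (2 * real (N + m) * real (m + 2) * CC ^ (m + 1) * G) + (64 * A0) powr (1/4)"
      using G0 CC1 square_le_exp2[of n] by (intro add_right_mono mult_right_mono) auto
    also have "\<dots> = (2 * CC) ^ n * (8 * real (N + m) * real (m + 2) * CC ^ (m + 1) * G) + 1 * (64 * A0) powr (1/4)"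
      by (simp add: power_mult_distrib)
    also have "\<dots> \<le> \<delta> powr (- \<epsilon>) * (8 * real (N + m) * real (m + 2) * CC ^ (m + 1) * G) + \<delta> powr (- \<epsilon>) * (64 * A0) powr (1/4)"
      using p d1 G0 CC1 by (intro add_mono mult_right_mono) auto
    also have "\<dots> = C * \<delta> powr (- \<epsilon>)" unfolding C_def by (simp add: algebra_simps)
    finally have QC: "Q \<le> C * \<delta> powr (- \<epsilon>)" .
    have "(\<integral>\<^sup>+s. ennreal (\<Sum>x\<in>X. w x * cellmass w X (\<lambda>y. qv a b c y s) \<delta> x powr (1/4)) * indicator {0..<1} s \<partial>lborel)
       \<le> ennreal (Q * \<delta> powr (t/4) * sum w X)"
      unfolding Q_def using fr bd w
      by (intro quadratic_cellmass_bound_scale fin N \<delta>_def t A0) (auto simp: \<delta>_def)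
    also have "\<dots> \<le> ennreal (C * \<delta> powr (- \<epsilon>) * \<delta> powr (t/4) * sum w X)"
      using QC W0 by (intro ennreal_leI mult_right_mono) auto
    also have "C * \<delta> powr (- \<epsilon>) * \<delta> powr (t/4) * sum w X = C * sum w X * \<delta> powr (t/4 - \<epsilon>)"
      by (simp add: powr_add[symmetric] mult_ac)
    finally show "(\<integral>\<^sup>+s. ennreal (\<Sum>x\<in>X. w x * cellmass w X (\<lambda>y. qv a b c y s) (1 / real N ^ n) x powr (1/4)) * indicator {0..<1} s \<partial>lborel)
      \<le> ennreal (C * sum w X * (1 / real N ^ n) powr (t/4 - \<epsilon>))" unfolding \<delta>_def .
  qed
qed

section \<open>Frostman weights and exceptional parameters\<close>

lemma sum_union_le_real:
  fixes w :: "'a \<Rightarrow> real"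
  assumes "finite I" "\<And>i. i \<in> I \<Longrightarrow> finite (A i)" "\<And>x. 0 \<le> w x"
  shows "sum w (\<Union>i\<in>I. A i) \<le> (\<Sum>i\<in>I. sum w (A i))"
  using assms(1,2)
proof (induction I rule: finite_induct)
  case (insert i I)
  have "sum w (A i \<union> (\<Union>i\<in>I. A i)) \<le> sum w (A i) + sum w (\<Union>i\<in>I. A i)"
    using sum_Un[of "A i" "\<Union>i\<in>I. A i" w] insert assms(3) by (simp add: sum_nonneg)
  then show ?case using insert by simp
qed simp

text \<open>The labels \<open>D j\<close> will be the dyadic cubes of level \<open>j\<close>: the weights are maximal subject to the
  capacities \<open>kap\<close>, so every point lies in a saturated cube, and the saturated cubes form a cover.\<close>

lemma greedy_weights:
  fixes D :: "nat \<Rightarrow> 'a \<Rightarrow> 'b" and kap :: "nat \<Rightarrow> real"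
  assumes "finite X" and J: "finite J" "J \<noteq> {}" and kap: "\<And>j. j \<in> J \<Longrightarrow> 0 \<le> kap j"
  shows "\<exists>w. (\<forall>x. 0 \<le> w x) \<and> (\<forall>j\<in>J. \<forall>q. sum w {y\<in>X. D j y = q} \<le> kap j) \<and>
     (\<forall>x\<in>X. \<exists>j\<in>J. sum w {y\<in>X. D j y = D j x} = kap j)"
  using assms(1)
proof (induction X rule: finite_induct)
  case empty
  show ?case by (rule exI[of _ "\<lambda>_. 0"]) (use kap in auto)
next
  case (insert x0 X)
  then obtain w where w: "\<And>x. 0 \<le> w x" "\<And>j q. j \<in> J \<Longrightarrow> sum w {y\<in>X. D j y = q} \<le> kap j"
     "\<And>x. x \<in> X \<Longrightarrow> \<exists>j\<in>J. sum w {y\<in>X. D j y = D j x} = kap j" by blast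
  define g where "g j = kap j - sum w {y\<in>X. D j y = D j x0}" for j
  \<comment> \<open>The new point receives the smallest remaining capacity among its cubes: no
    capacity is exceeded, and the one attaining the minimum becomes saturated.\<close>
  define v where "v = Min (g ` J)"
  have v0: "0 \<le> v" unfolding v_def using J w(2) by (simp add: g_def)
  have vle: "v \<le> g j" if "j \<in> J" for j unfolding v_def using J that by simp
  have "v \<in> g ` J" unfolding v_def using J by (intro Min_in) auto
  then obtain j0 where j0: "j0 \<in> J" "v = g j0" by auto
  define w' where "w' = w(x0 := v)"
  have sum': "sum w' {y\<in>insert x0 X. D j y = q} = sum w {y\<in>X. D j y = q} + (if D j x0 = q then v else 0)" for j q
  proof -
    have e: "sum w' {y\<in>X. D j y = q} = sum w {y\<in>X. D j y = q}"
      using insert by (intro sum.cong) (auto simp: w'_def)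
    show ?thesis
    proof (cases "D j x0 = q")
      case True
      have "{y\<in>insert x0 X. D j y = q} = insert x0 {y\<in>X. D j y = q}" using True by auto
      then have "sum w' {y\<in>insert x0 X. D j y = q} = w' x0 + sum w' {y\<in>X. D j y = q}" using insert by simp
      then show ?thesis using True e by (simp add: w'_def)
    next
      case False
      then have "{y\<in>insert x0 X. D j y = q} = {y\<in>X. D j y = q}" by auto
      then show ?thesis using False e by simp
    qed
  qed
  show ?case
  proof (intro exI[of _ w'] conjI allI ballI)
    fix x show "0 \<le> w' x" using w v0 by (simp add: w'_def)
  next
    fix j q assume j: "j \<in> J"
    show "sum w' {y\<in>insert x0 X. D j y = q} \<le> kap j"
      unfolding sum' using w(2)[OF j, of q] vle[OF j] by (auto simp: g_def)
  next
    fix x assume x: "x \<in> insert x0 X"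
    show "\<exists>j\<in>J. sum w' {y\<in>insert x0 X. D j y = D j x} = kap j"
    proof (cases "x = x0")
      case True
      then have "sum w' {y\<in>insert x0 X. D j0 y = D j0 x} = kap j0" unfolding sum' using j0 by (simp add: g_def)
      then show ?thesis using j0(1) by blast
    next
      case False
      then obtain j where j: "j \<in> J" "sum w {y\<in>X. D j y = D j x} = kap j" using x w(3) by blast
      have "sum w {y\<in>X. D j y = D j x} + (if D j x0 = D j x then v else 0) \<le> kap j"
        using w(2)[OF j(1), of "D j x"] vle[OF j(1)] by (auto simp: g_def)
      then have "sum w {y\<in>X. D j y = D j x} + (if D j x0 = D j x then v else 0) = kap j"
        using j(2) v0 by (auto split: if_splits)
      then show ?thesis using j(1) unfolding sum' by blast
    qed
  qed
qed

section \<open>Dyadic cubes and a discrete Frostman lemma\<close>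

definition dcube :: "nat \<Rightarrow> 'a::euclidean_space \<Rightarrow> 'a \<Rightarrow> int" where
  "dcube j x = (\<lambda>b. if b \<in> Basis then \<lfloor>(x \<bullet> b) * 2 ^ j\<rfloor> else 0)"

lemma dcube_dist:
  fixes x y :: "'a::euclidean_space"
  assumes "dcube j x = dcube j y"
  shows "dist x y \<le> DIM('a) / 2 ^ j"
proof -
  have "\<bar>(x - y) \<bullet> b\<bar> \<le> 1 / 2 ^ j" if "b \<in> Basis" for b
  proof -
    have "\<lfloor>(x \<bullet> b) * 2 ^ j\<rfloor> = \<lfloor>(y \<bullet> b) * 2 ^ j\<rfloor>" using fun_cong[OF assms, of b] that by (simp add: dcube_def)
    then have "\<bar>(x \<bullet> b) * 2 ^ j - (y \<bullet> b) * 2 ^ j\<bar> \<le> 1" by linarith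
    then have "\<bar>(x - y) \<bullet> b\<bar> * 2 ^ j \<le> 1" by (simp add: inner_diff_left left_diff_distrib[symmetric] abs_mult)
    then show ?thesis by (simp add: field_simps)
  qed
  then have "(\<Sum>b\<in>(Basis::'a set). \<bar>(x - y) \<bullet> b\<bar>) \<le> (\<Sum>b\<in>(Basis::'a set). 1 / 2 ^ j)" by (rule sum_mono)
  then show ?thesis using norm_le_l1[of "x - y"] by (simp add: dist_norm)
qed

lemma dcube_nested:
  assumes "dcube (j + k) x = dcube (j + k) y"
  shows "dcube j x = dcube j y"
  using assms
proof (induction k)
  case (Suc k)
  have fl: "\<lfloor>u * 2 ^ (j + k)\<rfloor> = \<lfloor>u * 2 ^ (j + Suc k)\<rfloor> div 2" for u :: real
  proof -
    have "\<lfloor>u * 2 ^ (j + Suc k) / real_of_int 2\<rfloor> = \<lfloor>u * 2 ^ (j + Suc k)\<rfloor> div 2" by (rule floor_divide_real_eq_div) simp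
    then show ?thesis by simp
  qed
  have "dcube (j + k) x = dcube (j + k) y"
  proof
    fix b
    have "\<lfloor>(x \<bullet> b) * 2 ^ (j + Suc k)\<rfloor> = \<lfloor>(y \<bullet> b) * 2 ^ (j + Suc k)\<rfloor>" if "b \<in> Basis"
      using fun_cong[OF Suc.prems, of b] that by (simp add: dcube_def)
    then show "dcube (j + k) x b = dcube (j + k) y b" unfolding dcube_def fl by auto
  qed
  then show ?case by (rule Suc.IH)
qed simp

lemma dcube_nested_le: "i \<le> j \<Longrightarrow> dcube j x = dcube j y \<Longrightarrow> dcube i x = dcube i y"
  using dcube_nested[of i "j - i" x y] by simp

lemma finite_dcube_image:
  fixes K :: "'a::euclidean_space set"
  assumes "bounded K"
  shows "finite (dcube j ` K)"
proof -
  obtain B where B: "\<And>x. x \<in> K \<Longrightarrow> norm x \<le> B" using assms by (auto simp: bounded_iff)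
  have "dcube j ` K \<subseteq> {f. \<forall>b. (b \<in> Basis \<longrightarrow> f b \<in> {\<lfloor>- B * 2 ^ j\<rfloor>..\<lfloor>B * 2 ^ j\<rfloor>}) \<and> (b \<notin> Basis \<longrightarrow> f b = 0)}"
  proof
    fix f assume "f \<in> dcube j ` K"
    then obtain x where x: "x \<in> K" "f = dcube j x" by auto
    have "\<lfloor>(x \<bullet> b) * 2 ^ j\<rfloor> \<in> {\<lfloor>- B * 2 ^ j\<rfloor>..\<lfloor>B * 2 ^ j\<rfloor>}" if "b \<in> Basis" for b
    proof -
      have "\<bar>x \<bullet> b\<bar> \<le> B" using Basis_le_norm[OF that, of x] B[OF x(1)] by linarith
      then have "- B \<le> x \<bullet> b" "x \<bullet> b \<le> B" by linarith+
      then have "- B * 2 ^ j \<le> (x \<bullet> b) * 2 ^ j" "(x \<bullet> b) * 2 ^ j \<le> B * 2 ^ j" by (intro mult_right_mono; simp)+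
      then show ?thesis by (auto intro: floor_mono)
    qed
    then show "f \<in> {f. \<forall>b. (b \<in> Basis \<longrightarrow> f b \<in> {\<lfloor>- B * 2 ^ j\<rfloor>..\<lfloor>B * 2 ^ j\<rfloor>}) \<and> (b \<notin> Basis \<longrightarrow> f b = 0)}"
      unfolding x(2) dcube_def by auto
  qed
  moreover have "finite {f. \<forall>b. (b \<in> (Basis::'a set) \<longrightarrow> f b \<in> {\<lfloor>- B * 2 ^ j\<rfloor>..\<lfloor>B * 2 ^ j\<rfloor>}) \<and> (b \<notin> Basis \<longrightarrow> f b = 0)}"
    by (rule finite_set_of_finite_funs) auto
  ultimately show ?thesis by (rule finite_subset)
qed

definition dnbr :: "('a::euclidean_space \<Rightarrow> int) set" where
  "dnbr = {f. \<forall>b. (b \<in> Basis \<longrightarrow> f b \<in> {-1..1}) \<and> (b \<notin> Basis \<longrightarrow> f b = 0)}"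

lemma finite_dnbr: "finite (dnbr :: ('a::euclidean_space \<Rightarrow> int) set)"
  unfolding dnbr_def by (rule finite_set_of_finite_funs) auto

lemma dcube_near:
  fixes x y :: "'a::euclidean_space"
  assumes "dist x y \<le> r" "r \<le> 1 / 2 ^ j"
  shows "(\<lambda>b. dcube j y b - dcube j x b) \<in> dnbr"
proof -
  have "\<lfloor>(y \<bullet> b) * 2 ^ j\<rfloor> - \<lfloor>(x \<bullet> b) * 2 ^ j\<rfloor> \<in> {-1..1}" if b: "b \<in> Basis" for b
  proof -
    have "\<bar>(y - x) \<bullet> b\<bar> \<le> 1 / 2 ^ j" using Basis_le_norm[OF b, of "y - x"] assms by (simp add: dist_norm norm_minus_commute)
    then have "\<bar>(y - x) \<bullet> b\<bar> * 2 ^ j \<le> 1" by (simp add: field_simps)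
    moreover have "\<bar>(y - x) \<bullet> b\<bar> * 2 ^ j = \<bar>(y \<bullet> b) * 2 ^ j - (x \<bullet> b) * 2 ^ j\<bar>"
      by (simp add: inner_diff_left left_diff_distrib[symmetric] abs_mult)
    ultimately have "\<bar>(y \<bullet> b) * 2 ^ j - (x \<bullet> b) * 2 ^ j\<bar> \<le> 1" by linarith
    then show ?thesis by simp linarith
  qed
  then show ?thesis unfolding dnbr_def dcube_def by simp
qed

text \<open>The coarsest saturated cubes are disjoint, cover \<open>K\<close>, and each carries its
  side length to the power \<open>t\<close>. The total mass therefore dominates a sum of powers of
  diameters over a cover, which is bounded below since the measure is not zero. The constants
  \<open>A\<close> and \<open>c\<close> do not depend on \<open>n\<close>, so no limiting measure
  has to be formed.\<close>

lemma finite_frostman: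
  fixes K :: "'a::euclidean_space set"
  assumes bK: "bounded K" and t: "t > 0" and pos: "hausdorff_measure t K \<noteq> 0"
  shows "\<exists>A\<ge>0. \<exists>c>0. \<forall>n. \<exists>X w. finite X \<and> X \<subseteq> K \<and> (\<forall>x. 0 \<le> w x) \<and> c \<le> sum w X \<and>
     (\<forall>x. \<forall>r\<ge>1 / 2 ^ n. sum w {y\<in>X. dist x y \<le> r} \<le> A * r powr t)"
proof -
  obtain \<delta>0 where d0: "\<delta>0 > 0" "hausdorff_approx t \<delta>0 K \<noteq> 0"
  proof (rule ccontr)
    assume "\<not> thesis"
    then have "hausdorff_approx t \<delta> K = 0" if "\<delta> > 0" for \<delta> using that \<open>\<And>\<delta>0. \<lbrakk>0 < \<delta>0; hausdorff_approx t \<delta>0 K \<noteq> 0\<rbrakk> \<Longrightarrow> thesis\<close> by blast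
    then have "hausdorff_measure t K = 0" unfolding hausdorff_measure_def by (auto simp: SUP_eq_const)
    then show False using pos by simp
  qed
  \<comment> \<open>Capping at 1 makes the lower bound a finite number without a separate
    argument.\<close>
  define \<eta> where "\<eta> = min 1 (hausdorff_approx t \<delta>0 K)"
  have eta: "\<eta> \<noteq> 0" "\<eta> \<le> 1" "\<eta> \<noteq> top" unfolding \<eta>_def using d0 by (auto simp: min_def top_unique)
  have cover: "\<eta> \<le> (\<Sum>i. diam_pow t (U i))"
    if "K \<subseteq> (\<Union>i. U i)" "\<And>i. bounded (U i) \<and> diameter (U i) \<le> \<delta>0" for U :: "nat \<Rightarrow> 'a set"
  proof -
    have "hausdorff_approx t \<delta>0 K \<le> (\<Sum>i. diam_pow t (U i))"
      unfolding hausdorff_approx_def by (rule INF_lower) (use that in auto)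
    then show ?thesis unfolding \<eta>_def by (meson min.cobounded2 order_trans)
  qed
  define d where "d = real DIM('a)"
  have d1: "d \<ge> 1" unfolding d_def using DIM_positive[where 'a='a] by simp
  \<comment> \<open>Cubes of level at least \<open>j0\<close> have diameter at most
    \<open>\<delta>0\<close>, so they are admissible in the cover.\<close>
  obtain j0 where j0: "d / 2 ^ j0 \<le> \<delta>0"
  proof -
    obtain j where "d / \<delta>0 < 2 ^ j" using real_arch_pow[of 2 "d / \<delta>0"] by auto
    then have "d / 2 ^ j \<le> \<delta>0" using d0 by (simp add: field_simps)
    then show ?thesis by (rule that)
  qed
  define M where "M = card (dnbr :: ('a \<Rightarrow> int) set)"
  \<comment> \<open>The first term serves radii up to \<open>1 / 2 ^ j0\<close>, where a ball meets
    at most \<open>M\<close> cubes of a side at most \<open>2 * r\<close>. The second serves larger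
    radii, where the whole of \<open>X\<close> is counted by its cubes of level
    \<open>j0\<close>.\<close>
  define A where "A = real M * 2 powr t + real (card (dcube j0 ` K))"
  define c where "c = enn2real \<eta> / d powr t"
  have A0: "A \<ge> 0" unfolding A_def by simp
  have "enn2real \<eta> > 0" unfolding enn2real_positive_iff
    using eta(1,3) by (simp add: zero_less_iff_neq_zero less_top[symmetric])
  moreover have "d powr t > 0" using d1 by simp
  ultimately have c0: "c > 0" unfolding c_def by (rule divide_pos_pos)
  show ?thesis
  proof (rule exI[of _ A], rule conjI[OF A0], rule exI[of _ c], rule conjI[OF c0], rule allI)
    fix n :: nat
    define n' where "n' = max n j0"
    define J where "J = {j0..n'}"
    define kap where "kap j = (1 / 2 ^ j :: real) powr t" for j :: nat
    \<comment> \<open>One point of \<open>K\<close> from each cube of level \<open>n'\<close> that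
      meets \<open>K\<close>. A saturated cube of level at most \<open>n'\<close> around a
      representative contains all of \<open>K\<close> in the representative's finest cube.\<close>
    define X where "X = (\<lambda>q. SOME x. x \<in> K \<and> dcube n' x = q) ` (dcube n' ` K)"
    have rep: "(SOME x. x \<in> K \<and> dcube n' x = dcube n' z) \<in> K \<and> dcube n' (SOME x. x \<in> K \<and> dcube n' x = dcube n' z) = dcube n' z"
      if "z \<in> K" for z
      by (rule someI[of "\<lambda>x. x \<in> K \<and> dcube n' x = dcube n' z" z]) (use that in simp)
    have finX: "finite X" unfolding X_def using finite_dcube_image[OF bK] by simp
    have XK: "X \<subseteq> K" unfolding X_def using rep by auto
    have Xrep: "\<exists>x\<in>X. dcube n' x = dcube n' z" if "z \<in> K" for z
      unfolding X_def using rep[OF that] that by (auto intro!: bexI)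
    have Jf: "finite J" "J \<noteq> {}" unfolding J_def n'_def by auto
    have "\<exists>w. (\<forall>x. 0 \<le> w x) \<and> (\<forall>j\<in>J. \<forall>q. sum w {y\<in>X. dcube j y = q} \<le> kap j) \<and>
        (\<forall>x\<in>X. \<exists>j\<in>J. sum w {y\<in>X. dcube j y = dcube j x} = kap j)"
      by (rule greedy_weights[OF finX Jf]) (simp add: kap_def)
    then obtain w where "(\<forall>x. 0 \<le> w x) \<and> (\<forall>j\<in>J. \<forall>q. sum w {y\<in>X. dcube j y = q} \<le> kap j) \<and>
        (\<forall>x\<in>X. \<exists>j\<in>J. sum w {y\<in>X. dcube j y = dcube j x} = kap j)" by (elim exE)
    then have w: "\<And>x. 0 \<le> w x" "\<And>j q. j \<in> J \<Longrightarrow> sum w {y\<in>X. dcube j y = q} \<le> kap j"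
      "\<And>x. x \<in> X \<Longrightarrow> \<exists>j\<in>J. sum w {y\<in>X. dcube j y = dcube j x} = kap j" by blast+
    define sat where "sat x j \<longleftrightarrow> j \<in> J \<and> sum w {y\<in>X. dcube j y = dcube j x} = kap j" for x j
    \<comment> \<open>Taking the coarsest saturated level makes the chosen cubes disjoint: if two of
      them met, the finer one would lie in a saturated coarser cube.\<close>
    define lev where "lev x = (LEAST j. sat x j)" for x
    have lev: "sat x (lev x)" if x: "x \<in> X" for x
    proof -
      obtain j where "sat x j" using w(3)[OF x] unfolding sat_def by blast
      then show ?thesis unfolding lev_def by (rule LeastI)
    qed
    define F where "F = (\<lambda>x. (lev x, dcube (lev x) x)) ` X"
    have finF: "finite F" unfolding F_def using finX by simp
    define cell where "cell p = {y\<in>X. dcube (fst p) y = snd p}" for p :: "nat \<times> ('a \<Rightarrow> int)"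
    have disj: "p = p'" if p: "p \<in> F" "p' \<in> F" and y: "y \<in> cell p" "y \<in> cell p'" for p p' y
    proof -
      obtain x where x: "x \<in> X" "p = (lev x, dcube (lev x) x)" using p(1) unfolding F_def by auto
      obtain x' where x': "x' \<in> X" "p' = (lev x', dcube (lev x') x')" using p(2) unfolding F_def by auto
      have yx: "dcube (lev x) y = dcube (lev x) x" "dcube (lev x') y = dcube (lev x') x'"
        using y x x' unfolding cell_def by auto
      have *: "lev v \<le> lev u" if "u \<in> X" "v \<in> X" "dcube (lev u) y = dcube (lev u) u" "dcube (lev v) y = dcube (lev v) v" "lev u \<le> lev v" for u v
      proof -
        have "dcube (lev u) y = dcube (lev u) v" by (rule dcube_nested_le[OF that(5) that(4)])
        then have "sat v (lev u)" using lev[OF that(1)] that(3) unfolding sat_def by simp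
        then show ?thesis unfolding lev_def[of v] by (rule Least_le)
      qed
      have "lev x = lev x'" using *[of x x'] *[of x' x] x(1) x'(1) yx by linarith
      then show ?thesis using yx x(2) x'(2) by simp
    qed
    have Fkap: "sum w (cell p) = kap (fst p)" "fst p \<in> J" if "p \<in> F" for p
      using that lev unfolding F_def cell_def sat_def by auto
    have Fsum: "(\<Sum>p\<in>F. kap (fst p)) \<le> sum w X"
    proof -
      have "(\<Sum>p\<in>F. kap (fst p)) = (\<Sum>p\<in>F. sum w (cell p))" using Fkap by (intro sum.cong) auto
      also have "\<dots> = sum w (\<Union>p\<in>F. cell p)"
        using disj finF finX by (intro sum.UNION_disjoint[symmetric]) (auto simp: cell_def)
      also have "\<dots> \<le> sum w X" using finX w(1) by (intro sum_mono2) (auto simp: cell_def)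
      finally show ?thesis .
    qed
    obtain f where f: "bij_betw f {..<card F} F" using ex_bij_betw_nat_finite[OF finF] by (auto simp: atLeast0LessThan)
    define U where "U i = (if i < card F then {z\<in>K. dcube (fst (f i)) z = snd (f i)} else {})" for i
    have fF: "f i \<in> F" if "i < card F" for i using f that by (auto simp: bij_betw_def)
    have diamU: "diameter (U i) \<le> d / 2 ^ fst (f i)" if "i < card F" for i
    proof (rule diameter_le)
      show "U i \<noteq> {} \<or> 0 \<le> d / 2 ^ fst (f i)" using d1 by simp
      fix x y assume "x \<in> U i" "y \<in> U i"
      then have "dcube (fst (f i)) x = dcube (fst (f i)) y" using that by (simp add: U_def)
      from dcube_dist[OF this] show "norm (x - y) \<le> d / 2 ^ fst (f i)" unfolding d_def by (simp add: dist_norm)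
    qed
    have Ucov: "K \<subseteq> (\<Union>i. U i)"
    proof
      fix z assume z: "z \<in> K"
      then obtain x where x: "x \<in> X" "dcube n' x = dcube n' z" using Xrep by blast
      have "lev x \<le> n'" using lev[OF x(1)] unfolding sat_def J_def by simp
      then have e: "dcube (lev x) z = dcube (lev x) x" using dcube_nested_le[of "lev x" n' x z] x by simp
      have "(lev x, dcube (lev x) x) \<in> F" unfolding F_def using x by auto
      then obtain i where i: "i < card F" "f i = (lev x, dcube (lev x) x)" using f unfolding bij_betw_def by (metis imageE lessThan_iff)
      then have "z \<in> U i" unfolding U_def using z e by simp
      then show "z \<in> (\<Union>i. U i)" by blast
    qed
    have Ubd: "bounded (U i) \<and> diameter (U i) \<le> \<delta>0" for i
    proof (cases "i < card F")
      case True
      have "U i \<subseteq> K" unfolding U_def by auto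
      moreover have "d / 2 ^ fst (f i) \<le> d / 2 ^ j0"
        using Fkap(2)[OF fF[OF True]] d1 unfolding J_def by (intro divide_left_mono power_increasing) auto
      ultimately show ?thesis using bK bounded_subset diamU[OF True] j0 by (meson order_trans)
    next
      case False then show ?thesis using d0 by (simp add: U_def)
    qed
    have "\<eta> \<le> (\<Sum>i. diam_pow t (U i))" using Ucov Ubd by (rule cover)
    also have "\<dots> = (\<Sum>i<card F. diam_pow t (U i))"
      by (rule suminf_finite) (auto simp: U_def diam_pow_def)
    also have "\<dots> \<le> (\<Sum>i<card F. ennreal (d powr t * kap (fst (f i))))"
    proof (rule sum_mono)
      fix i assume "i \<in> {..<card F}"
      then have i: "i < card F" by simp
      have "diam_pow t (U i) \<le> ennreal (diameter (U i) powr t)" using t by (simp add: diam_pow_def)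
      also have "\<dots> \<le> ennreal ((d / 2 ^ fst (f i)) powr t)"
        using diamU[OF i] t Ubd[of i] by (intro ennreal_leI powr_mono2) (auto intro: diameter_ge_0)
      also have "(d / 2 ^ fst (f i)) powr t = d powr t * kap (fst (f i))"
      proof -
        have "d / 2 ^ fst (f i) = d * (1 / 2 ^ fst (f i))" by simp
        then show ?thesis unfolding kap_def by (simp only: powr_mult)
      qed
      finally show "diam_pow t (U i) \<le> ennreal (d powr t * kap (fst (f i)))" .
    qed
    also have "\<dots> = ennreal (\<Sum>i<card F. d powr t * kap (fst (f i)))" by (rule sum_ennreal) (simp add: kap_def)
    also have "(\<Sum>i<card F. d powr t * kap (fst (f i))) = d powr t * (\<Sum>p\<in>F. kap (fst p))"
      unfolding sum_distrib_left by (rule sum.reindex_bij_betw[OF f, of "\<lambda>p. d powr t * kap (fst p)"])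
    also have "ennreal \<dots> \<le> ennreal (d powr t * sum w X)" using Fsum by (intro ennreal_leI mult_left_mono) auto
    finally have "\<eta> \<le> ennreal (d powr t * sum w X)" .
    then have "enn2real \<eta> \<le> d powr t * sum w X"
      using w(1) by (simp add: enn2real_leI sum_nonneg)
    then have cX: "c \<le> sum w X" unfolding c_def using d1 by (simp add: divide_le_eq mult.commute)
    have ball: "sum w {y\<in>X. dist x y \<le> r} \<le> A * r powr t" if r: "r \<ge> 1 / 2 ^ n" for x r
    proof (cases "r \<le> 1 / 2 ^ j0")
      case True
      have r0: "r > 0" using r by (smt (verit) divide_pos_pos zero_less_power)
      define P where "P j \<longleftrightarrow> j \<in> J \<and> r \<le> 1 / 2 ^ j" for j
      define j where "j = (GREATEST j. P j)"
      have Pj: "P j" unfolding j_def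
        by (rule GreatestI_nat[of P j0 n']) (use True in \<open>auto simp: P_def J_def n'_def\<close>)
      have kj: "kap j \<le> (2 * r) powr t"
      proof -
        have "1 / 2 ^ j \<le> 2 * r"
        proof (cases "j = n'")
          case True
          have "(1::real) / 2 ^ n' \<le> 1 / 2 ^ n" unfolding n'_def by (intro divide_left_mono power_increasing) auto
          then have "1 / 2 ^ n' \<le> r" using r by (rule order_trans)
          then show ?thesis unfolding True using r0 by linarith
        next
          case False
          then have "Suc j \<in> J" using Pj unfolding P_def J_def by auto
          moreover have "\<not> P (Suc j)"
          proof
            assume "P (Suc j)"
            then have "Suc j \<le> j" unfolding j_def by (rule Greatest_le_nat[of P _ n']) (auto simp: P_def J_def)
            then show False by simp
          qed
          ultimately have "1 / 2 ^ Suc j < r" unfolding P_def by auto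
          then show ?thesis by simp
        qed
        then show ?thesis unfolding kap_def using t by (intro powr_mono2) auto
      qed
      have "{y\<in>X. dist x y \<le> r} \<subseteq> (\<Union>h\<in>dnbr. {y\<in>X. dcube j y = (\<lambda>b. dcube j x b + h b)})"
      proof
        fix y assume y: "y \<in> {y\<in>X. dist x y \<le> r}"
        have "(\<lambda>b. dcube j y b - dcube j x b) \<in> dnbr" using y Pj unfolding P_def by (intro dcube_near[of x y r]) auto
        then show "y \<in> (\<Union>h\<in>dnbr. {y\<in>X. dcube j y = (\<lambda>b. dcube j x b + h b)})"
          using y by (intro UN_I[of "\<lambda>b. dcube j y b - dcube j x b"]) auto
      qed
      then have "sum w {y\<in>X. dist x y \<le> r} \<le> sum w (\<Union>h\<in>dnbr. {y\<in>X. dcube j y = (\<lambda>b. dcube j x b + h b)})"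
        using finX w(1) finite_dnbr by (intro sum_mono2) auto
      also have "\<dots> \<le> (\<Sum>h\<in>dnbr. sum w {y\<in>X. dcube j y = (\<lambda>b. dcube j x b + h b)})"
        using finX w(1) finite_dnbr by (intro sum_union_le_real) auto
      also have "\<dots> \<le> (\<Sum>h\<in>(dnbr :: ('a \<Rightarrow> int) set). (2 * r) powr t)"
        using w(2)[of j] Pj kj unfolding P_def by (intro sum_mono) (meson order_trans)
      also have "\<dots> = real M * 2 powr t * r powr t" unfolding M_def by (simp add: powr_mult)
      also have "\<dots> \<le> A * r powr t" unfolding A_def by (intro mult_right_mono) auto
      finally show ?thesis .
    next
      case False
      have "sum w {y\<in>X. dist x y \<le> r} \<le> sum w (\<Union>q\<in>dcube j0 ` K. {y\<in>X. dcube j0 y = q})"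
      proof (rule sum_mono2)
        show "finite (\<Union>q\<in>dcube j0 ` K. {y\<in>X. dcube j0 y = q})" by (rule finite_subset[OF _ finX]) auto
      qed (use w(1) XK in auto)
      also have "\<dots> \<le> (\<Sum>q\<in>dcube j0 ` K. sum w {y\<in>X. dcube j0 y = q})"
        using finX w(1) finite_dcube_image[OF bK] by (intro sum_union_le_real) auto
      also have "\<dots> \<le> (\<Sum>q\<in>dcube j0 ` K. kap j0)"
        using w(2)[of j0] by (intro sum_mono) (auto simp: J_def n'_def)
      also have "\<dots> = real (card (dcube j0 ` K)) * kap j0" by simp
      also have "\<dots> \<le> real (card (dcube j0 ` K)) * r powr t"
        unfolding kap_def using False t by (intro mult_left_mono powr_mono2) auto
      also have "\<dots> \<le> A * r powr t" unfolding A_def by (intro mult_right_mono) auto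
      finally show ?thesis .
    qed
    show "\<exists>X w. finite X \<and> X \<subseteq> K \<and> (\<forall>x. 0 \<le> w x) \<and> c \<le> sum w X \<and>
     (\<forall>x. \<forall>r\<ge>1 / 2 ^ n. sum w {y\<in>X. dist x y \<le> r} \<le> A * r powr t)"
      using finX XK w(1) cX ball by (intro exI[of _ X] exI[of _ w]) auto
  qed
qed

text \<open>Finitely many open balls make membership an open condition on the parameter when
  \<open>K\<close> is compact. The lower bound \<open>\<beta>\<close> on the radii limits the scales
  involved, so that one finite weighted set suffices.\<close>

definition fine_covers :: "real \<Rightarrow> 'a set \<Rightarrow> ('p \<Rightarrow> 'a \<Rightarrow> real) \<Rightarrow> real \<Rightarrow> real \<Rightarrow> 'p set" where
  "fine_covers \<tau> K pr \<eta> \<beta> = {s. \<exists>(I::nat set) u \<rho>. finite I \<and> (\<forall>i\<in>I. \<beta> \<le> \<rho> i \<and> 0 < \<rho> i) \<and>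
     pr s ` K \<subseteq> (\<Union>i\<in>I. ball (u i) (\<rho> i)) \<and> (\<Sum>i\<in>I. \<rho> i powr \<tau>) < \<eta>}"

lemma fine_coversI:
  assumes "finite (I::nat set)" "\<And>i. i \<in> I \<Longrightarrow> \<beta> \<le> \<rho> i" "\<And>i. i \<in> I \<Longrightarrow> 0 < \<rho> i"
    "pr s ` K \<subseteq> (\<Union>i\<in>I. ball (u i) (\<rho> i))" "(\<Sum>i\<in>I. \<rho> i powr \<tau>) < \<eta>"
  shows "s \<in> fine_covers \<tau> K pr \<eta> \<beta>"
  unfolding fine_covers_def mem_Collect_eq
  using assms by (intro exI[of _ I] exI[of _ u] exI[of _ \<rho>] conjI ballI)

lemma fine_coversE:
  assumes "s \<in> fine_covers \<tau> K pr \<eta> \<beta>"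
  obtains I :: "nat set" and u \<rho> where "finite I" "\<And>i. i \<in> I \<Longrightarrow> \<beta> \<le> \<rho> i" "\<And>i. i \<in> I \<Longrightarrow> 0 < \<rho> i"
    "pr s ` K \<subseteq> (\<Union>i\<in>I. ball (u i) (\<rho> i))" "(\<Sum>i\<in>I. \<rho> i powr \<tau>) < \<eta>"
proof -
  from assms obtain I :: "nat set" and u \<rho> where "finite I \<and> (\<forall>i\<in>I. \<beta> \<le> \<rho> i \<and> 0 < \<rho> i) \<and>
     pr s ` K \<subseteq> (\<Union>i\<in>I. ball (u i) (\<rho> i)) \<and> (\<Sum>i\<in>I. \<rho> i powr \<tau>) < \<eta>"
    unfolding fine_covers_def mem_Collect_eq by (elim exE)
  then show ?thesis by (intro that[of I \<rho> u]) simp_all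
qed

lemma fine_covers_antimono:
  assumes "\<beta>' \<le> \<beta>"
  shows "fine_covers \<tau> K pr \<eta> \<beta> \<subseteq> fine_covers \<tau> K pr \<eta> \<beta>'"
proof
  fix s assume "s \<in> fine_covers \<tau> K pr \<eta> \<beta>"
  then obtain I :: "nat set" and u \<rho> where I: "finite I" "\<And>i. i \<in> I \<Longrightarrow> \<beta> \<le> \<rho> i" "\<And>i. i \<in> I \<Longrightarrow> 0 < \<rho> i"
    "pr s ` K \<subseteq> (\<Union>i\<in>I. ball (u i) (\<rho> i))" "(\<Sum>i\<in>I. \<rho> i powr \<tau>) < \<eta>" by (rule fine_coversE) blast
  show "s \<in> fine_covers \<tau> K pr \<eta> \<beta>'"
    by (rule fine_coversI[of I \<beta>' \<rho> pr s K u \<tau> \<eta>, OF I(1) order_trans[OF assms I(2)] I(3-5)])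
qed

text \<open>A Borel set of parameters that contains every \<open>s\<close> with \<open>H\<^sup>\<tau>(pr s ` K) = 0\<close>; using finite
  covers by balls instead of \<open>hausdorff_measure\<close> avoids any question of measurability.\<close>

definition null_params :: "real \<Rightarrow> 'a set \<Rightarrow> ('p \<Rightarrow> 'a \<Rightarrow> real) \<Rightarrow> 'p set" where
  "null_params \<tau> K pr = (\<Inter>k. fine_covers \<tau> K pr (1 / real (Suc k)) 0)"

text \<open>The union of the balls is open, so by the tube lemma the same cover serves all nearby
  parameters.\<close>

lemma open_fine_covers:
  fixes pr :: "'p::euclidean_space \<Rightarrow> 'a::euclidean_space \<Rightarrow> real"
  assumes K: "compact K" and cont: "continuous_on UNIV (\<lambda>(s, x). pr s x)"
  shows "open (fine_covers \<tau> K pr \<eta> \<beta>)"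
proof (subst open_subopen, intro ballI)
  fix s assume "s \<in> fine_covers \<tau> K pr \<eta> \<beta>"
  then obtain I :: "nat set" and u \<rho> where I: "finite I" "\<forall>i\<in>I. \<beta> \<le> \<rho> i \<and> 0 < \<rho> i"
     "pr s ` K \<subseteq> (\<Union>i\<in>I. ball (u i) (\<rho> i))" "(\<Sum>i\<in>I. \<rho> i powr \<tau>) < \<eta>" unfolding fine_covers_def by blast
  define W where "W = (\<Union>i\<in>I. ball (u i) (\<rho> i))"
  define V where "V = (\<lambda>(s, x). pr s x) -` W"
  have "open W" unfolding W_def by auto
  then have V: "open V" unfolding V_def using cont by (intro open_vimage) auto
  have "\<forall>x\<in>K. pr s x \<in> W" using I(3) unfolding W_def by blast
  then have "{s} \<times> K \<subseteq> V" unfolding V_def by auto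
  from Elementary_Topology.tube_lemma[OF K V this] obtain X0 where X0: "s \<in> X0" "open X0" "X0 \<times> K \<subseteq> V" by blast
  have "X0 \<subseteq> fine_covers \<tau> K pr \<eta> \<beta>"
  proof
    fix s' assume "s' \<in> X0"
    then have "pr s' x \<in> W" if "x \<in> K" for x using X0(3) that unfolding V_def by auto
    then have "pr s' ` K \<subseteq> (\<Union>i\<in>I. ball (u i) (\<rho> i))" unfolding W_def by auto
    then show "s' \<in> fine_covers \<tau> K pr \<eta> \<beta>" unfolding fine_covers_def mem_Collect_eq
      using I(1,2,4) by (intro exI[of _ I] exI[of _ u] exI[of _ \<rho>] conjI)
  qed
  then show "\<exists>T. open T \<and> s \<in> T \<and> T \<subseteq> fine_covers \<tau> K pr \<eta> \<beta>" using X0 by blast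
qed

lemma null_params_sets:
  fixes pr :: "'p::euclidean_space \<Rightarrow> 'a::euclidean_space \<Rightarrow> real"
  assumes "compact K" and "continuous_on UNIV (\<lambda>(s, x). pr s x)"
  shows "null_params \<tau> K pr \<in> sets borel"
  unfolding null_params_def using open_fine_covers[OF assms] by (intro sets.countable_INT) auto

text \<open>The sets of a countable cover with small sum are placed in slightly larger open balls
  around one of their points, after which compactness leaves finitely many.\<close>

lemma hausdorff_null_in_null_params:
  fixes pr :: "'p::euclidean_space \<Rightarrow> 'a::euclidean_space \<Rightarrow> real"
  assumes K: "compact (pr s ` K)" and \<tau>: "\<tau> > 0" and null: "hausdorff_measure \<tau> (pr s ` K) = 0"
  shows "s \<in> null_params \<tau> K pr"
  unfolding null_params_def
proof
  fix k :: nat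
  define \<eta> where "\<eta> = 1 / real (Suc k)"
  have eta: "\<eta> > 0" unfolding \<eta>_def by simp
  have "hausdorff_approx \<tau> 1 (pr s ` K) \<le> hausdorff_measure \<tau> (pr s ` K)"
    unfolding hausdorff_measure_def by (rule SUP_upper) simp
  then have "hausdorff_approx \<tau> 1 (pr s ` K) < ennreal \<eta>" using null eta by simp
  then obtain U :: "nat \<Rightarrow> real set" where U: "pr s ` K \<subseteq> (\<Union>i. U i)" "\<And>i. bounded (U i)"
    "(\<Sum>i. diam_pow \<tau> (U i)) < ennreal \<eta>"
    unfolding hausdorff_approx_def INF_less_iff by blast
  define dm where "dm i = (if U i = {} then 0 else diameter (U i))" for i
  have dm0: "dm i \<ge> 0" for i unfolding dm_def using U(2) by (auto intro: diameter_ge_0)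
  have dp: "diam_pow \<tau> (U i) = ennreal (dm i powr \<tau>)" for i
    unfolding diam_pow_def dm_def using \<tau> by simp
  have fin: "(\<Sum>i. ennreal (dm i powr \<tau>)) < ennreal \<eta>" using U(3) unfolding dp .
  have summ: "summable (\<lambda>i. dm i powr \<tau>)"
    by (rule summable_suminf_not_top) (use fin in \<open>auto simp: less_top[symmetric] top_unique\<close>)
  define S where "S = (\<Sum>i. dm i powr \<tau>)"
  have "ennreal S < ennreal \<eta>" using fin unfolding S_def by (subst suminf_ennreal2[symmetric]) (auto intro: summ)
  then have S: "S < \<eta>" using eta by (simp add: ennreal_less_iff S_def suminf_nonneg summ)
  define g where "g = \<eta> - S"
  have g: "g > 0" unfolding g_def using S by simp
  \<comment> \<open>The enlargements \<open>z i\<close> keep radii positive even for sets of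
    diameter zero. Their shares \<open>g * (1/2) ^ (i + 2)\<close> add up to half of the slack
    \<open>g\<close>.\<close>
  have "\<exists>z>0. (dm i + z) powr \<tau> \<le> dm i powr \<tau> + g * (1/2) ^ (i + 2)" for i
  proof -
    have "((\<lambda>z. (dm i + z) powr \<tau>) \<longlongrightarrow> (dm i + 0) powr \<tau>) (at_right 0)"
      using dm0[of i] \<tau> by (intro tendsto_powr' tendsto_intros) (auto simp: eventually_at_filter)
    moreover have "(dm i + 0) powr \<tau> < dm i powr \<tau> + g * (1/2) ^ (i + 2)" using g by simp
    ultimately have "\<forall>\<^sub>F z in at_right 0. (dm i + z) powr \<tau> < dm i powr \<tau> + g * (1/2) ^ (i + 2)"
      by (rule order_tendstoD(2))
    moreover have "\<forall>\<^sub>F z in at_right (0::real). z > 0" by (rule eventually_at_right_less)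
    ultimately have "\<forall>\<^sub>F z in at_right 0. 0 < z \<and> (dm i + z) powr \<tau> < dm i powr \<tau> + g * (1/2) ^ (i + 2)"
      by eventually_elim auto
    then obtain z where "0 < z" "(dm i + z) powr \<tau> < dm i powr \<tau> + g * (1/2) ^ (i + 2)"
      using eventually_happens[of _ "at_right (0::real)"] by (auto simp: trivial_limit_at_right_real)
    then show ?thesis by (intro exI[of _ z]) auto
  qed
  then obtain z where z: "\<And>i. z i > 0" "\<And>i. (dm i + z i) powr \<tau> \<le> dm i powr \<tau> + g * (1/2) ^ (i + 2)" by metis
  define u where "u i = (SOME x. x \<in> U i)" for i
  define \<rho> where "\<rho> i = dm i + z i" for i
  have \<rho>0: "\<rho> i > 0" for i unfolding \<rho>_def using dm0[of i] z(1)[of i] by linarith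
  have Ub: "U i \<subseteq> ball (u i) (\<rho> i)" for i
  proof
    fix x assume x: "x \<in> U i"
    then have "u i \<in> U i" unfolding u_def by (rule someI)
    then have "dist (u i) x \<le> diameter (U i)" using x U(2) by (intro diameter_bounded_bound) auto
    also have "\<dots> < \<rho> i" unfolding \<rho>_def dm_def using x z(1)[of i] by auto
    finally show "x \<in> ball (u i) (\<rho> i)" by simp
  qed
  have "pr s ` K \<subseteq> (\<Union>i\<in>UNIV. ball (u i) (\<rho> i))" using U(1) Ub by blast
  then obtain I where I: "finite I" "pr s ` K \<subseteq> (\<Union>i\<in>I. ball (u i) (\<rho> i))"
    using compactE_image[OF K, of UNIV "\<lambda>i. ball (u i) (\<rho> i)"] by auto
  have "(\<Sum>i\<in>I. \<rho> i powr \<tau>) \<le> (\<Sum>i\<in>I. dm i powr \<tau> + g * (1/2) ^ (i + 2))"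
    unfolding \<rho>_def by (intro sum_mono z)
  also have "\<dots> = (\<Sum>i\<in>I. dm i powr \<tau>) + (\<Sum>i\<in>I. g / 4 * (1/2) ^ i)"
    by (simp add: sum.distrib power_add)
  also have "\<dots> \<le> S + g / 4 * 2"
  proof (rule add_mono)
    show "(\<Sum>i\<in>I. dm i powr \<tau>) \<le> S" unfolding S_def using I(1) summ by (intro sum_le_suminf) auto
    have "(\<Sum>i\<in>I. (1/2::real) ^ i) \<le> (\<Sum>i. (1/2) ^ i)" using I(1) by (intro sum_le_suminf summable_geometric) auto
    also have "\<dots> = 2" by (simp add: suminf_geometric)
    finally show "(\<Sum>i\<in>I. g / 4 * (1/2) ^ i) \<le> g / 4 * 2"
      unfolding sum_distrib_left[symmetric] using g by (intro mult_left_mono) auto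
  qed
  also have "\<dots> < \<eta>" using g unfolding g_def by (simp add: field_simps)
  finally show "s \<in> fine_covers \<tau> K pr (1 / real (Suc k)) 0"
    unfolding fine_covers_def \<eta>_def[symmetric] mem_Collect_eq
    using I \<rho>0 by (intro exI[of _ I] exI[of _ u] exI[of _ \<rho>] conjI ballI) (auto intro: less_imp_le)
qed

lemma floor_ball_cells:
  fixes u \<rho> \<delta> x :: real
  assumes "x \<in> ball u \<rho>" "\<rho> \<le> \<delta>" "\<delta> > 0"
  shows "\<lfloor>x / \<delta>\<rfloor> \<in> {\<lfloor>u / \<delta>\<rfloor> - 1..\<lfloor>u / \<delta>\<rfloor> + 1}"
proof -
  have "\<bar>x - u\<bar> \<le> \<delta>" using assms by (auto simp: dist_real_def)
  then have "\<bar>x - u\<bar> / \<delta> \<le> 1" using assms by (simp add: divide_le_eq)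
  then have "\<bar>x / \<delta> - u / \<delta>\<bar> \<le> 1" using assms by (simp add: diff_divide_distrib[symmetric])
  then show ?thesis by simp linarith
qed

text \<open>If \<open>pr s ` K\<close> is covered by few intervals, then half of the mass must be heavy,
  meaning that it lies in an overcrowded cell at some scale.\<close>

lemma heavy_mass:
  fixes f :: "'a \<Rightarrow> real" and w :: "'a \<Rightarrow> real"
  assumes fin: "finite X" and w: "\<And>x. 0 \<le> w x" and N: "N \<ge> 2" and \<tau>: "\<tau> > 0" and p: "p > 0"
    and I: "finite I" "\<And>i. i \<in> I \<Longrightarrow> 1 / real N ^ n \<le> \<rho> i \<and> \<rho> i \<le> 1 / real N ^ j0"
    and cov: "f ` X \<subseteq> (\<Union>i\<in>I. ball (u i) (\<rho> i))" and sm: "3 * real N powr \<tau> * (\<Sum>i\<in>I. \<rho> i powr \<tau>) \<le> c / 2"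
    and c: "c \<le> sum w X"
  shows "c / 2 \<le> (\<Sum>j\<in>{j0..n}. (real N ^ j) powr (p * \<tau>) * (\<Sum>x\<in>X. w x * cellmass w X f (1 / real N ^ j) x powr p))"
proof -
  have N0: "real N > 1" using N by simp
  \<comment> \<open>The light points: at every scale from \<open>j0\<close> to \<open>n\<close>
    their cell stays below the power \<open>\<tau>\<close> of its width. A cover with small sum can
    hold at most \<open>c / 2\<close> of their mass.\<close>
  define L where "L = {x\<in>X. \<forall>j\<in>{j0..n}. cellmass w X f (1 / real N ^ j) x < (1 / real N ^ j) powr \<tau>}"
  have finL: "finite L" "L \<subseteq> X" unfolding L_def using fin by auto
  have Lball: "sum w {x\<in>L. f x \<in> ball (u i) (\<rho> i)} \<le> 3 * real N powr \<tau> * \<rho> i powr \<tau>" if i: "i \<in> I" for i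
  proof -
    have \<rho>: "1 / real N ^ n \<le> \<rho> i" "\<rho> i \<le> 1 / real N ^ j0" using I(2)[OF i] by auto
    have j0n: "j0 \<le> n"
    proof (rule ccontr)
      assume "\<not> j0 \<le> n"
      then have "real N ^ n < real N ^ j0" using N0 by (intro power_strict_increasing) auto
      then have "1 / real N ^ j0 < 1 / real N ^ n" using N0 by (intro divide_strict_left_mono) auto
      then show False using \<rho> by linarith
    qed
    \<comment> \<open>The greatest such \<open>j\<close> gives the finest available cell width that
      is still at least the radius. The ball then meets at most three cells, and the width is at
      most \<open>N\<close> times the radius; this is the factor \<open>3 * N powr \<tau>\<close> in
      \<open>sm\<close>.\<close>
    define P where "P j \<longleftrightarrow> j \<le> n \<and> \<rho> i \<le> 1 / real N ^ j" for j
    define j where "j = (GREATEST j. P j)"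
    have P0: "P j0" unfolding P_def using j0n \<rho> by simp
    have Pj: "P j" unfolding j_def by (rule GreatestI_nat[of P j0 n, OF P0]) (simp add: P_def)
    have jj0: "j0 \<le> j" unfolding j_def by (rule Greatest_le_nat[of P j0 n, OF P0]) (simp add: P_def)
    define \<delta> where "\<delta> = 1 / real N ^ j"
    have d0: "\<delta> > 0" unfolding \<delta>_def using N0 by simp
    have \<rho>d: "\<rho> i \<le> \<delta>" using Pj unfolding P_def \<delta>_def by simp
    have dN: "\<delta> \<le> real N * \<rho> i"
    proof (cases "j = n")
      case True
      have "\<delta> \<le> \<rho> i" using \<rho>(1) unfolding \<delta>_def True .
      moreover have "1 * \<rho> i \<le> real N * \<rho> i" using N0 \<rho>d d0 \<rho>(1) by (intro mult_right_mono) (auto intro: order_trans[OF _ \<rho>(1)])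
      ultimately show ?thesis by linarith
    next
      case False
      have "\<not> P (Suc j)"
      proof
        assume "P (Suc j)"
        then have "Suc j \<le> j" unfolding j_def by (rule Greatest_le_nat[of P _ n]) (simp add: P_def)
        then show False by simp
      qed
      then have "1 / real N ^ Suc j \<le> \<rho> i" using False Pj unfolding P_def by auto
      then have "real N * (1 / real N ^ Suc j) \<le> real N * \<rho> i" using N0 by (intro mult_left_mono) auto
      then show ?thesis unfolding \<delta>_def using N0 by simp
    qed
    let ?Z = "\<lambda>q. {x\<in>L. \<lfloor>f x / \<delta>\<rfloor> = q}"
    have Zle: "sum w (?Z q) \<le> \<delta> powr \<tau>" for q
    proof (cases "?Z q = {}")
      case False
      then obtain x where x: "x \<in> L" "\<lfloor>f x / \<delta>\<rfloor> = q" by auto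
      have "sum w (?Z q) \<le> cellmass w X f \<delta> x"
        unfolding cellmass_def using finL fin w x by (intro sum_mono2) auto
      also have "\<dots> \<le> \<delta> powr \<tau>" using x(1) jj0 Pj unfolding L_def \<delta>_def P_def by (auto intro: less_imp_le)
      finally show ?thesis .
    next
      case True
      have "sum w (?Z q) = 0" unfolding True by simp
      then show ?thesis by simp
    qed
    have "sum w {x\<in>L. f x \<in> ball (u i) (\<rho> i)} \<le> sum w (\<Union>q\<in>{\<lfloor>u i / \<delta>\<rfloor> - 1..\<lfloor>u i / \<delta>\<rfloor> + 1}. ?Z q)"
      using finL w floor_ball_cells[OF _ \<rho>d d0] by (intro sum_mono2) auto
    also have "\<dots> \<le> (\<Sum>q\<in>{\<lfloor>u i / \<delta>\<rfloor> - 1..\<lfloor>u i / \<delta>\<rfloor> + 1}. sum w (?Z q))"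
      using finL w by (intro sum_union_le_real) auto
    also have "\<dots> \<le> (\<Sum>q\<in>{\<lfloor>u i / \<delta>\<rfloor> - 1..\<lfloor>u i / \<delta>\<rfloor> + 1}. \<delta> powr \<tau>)" by (intro sum_mono Zle)
    also have "\<dots> = 3 * \<delta> powr \<tau>" by simp
    also have "\<dots> \<le> 3 * (real N * \<rho> i) powr \<tau>" using dN d0 \<tau> by (intro mult_left_mono powr_mono2) auto
    also have "\<dots> = 3 * real N powr \<tau> * \<rho> i powr \<tau>" by (simp add: powr_mult)
    finally show ?thesis .
  qed
  have "sum w L \<le> sum w (\<Union>i\<in>I. {x\<in>L. f x \<in> ball (u i) (\<rho> i)})"
  proof (rule sum_mono2)
    show "finite (\<Union>i\<in>I. {x\<in>L. f x \<in> ball (u i) (\<rho> i)})" using finL I(1) by auto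
    show "L \<subseteq> (\<Union>i\<in>I. {x\<in>L. f x \<in> ball (u i) (\<rho> i)})" using cov finL(2) by blast
  qed (use w in auto)
  also have "\<dots> \<le> (\<Sum>i\<in>I. sum w {x\<in>L. f x \<in> ball (u i) (\<rho> i)})"
    using finL w I(1) by (intro sum_union_le_real) auto
  also have "\<dots> \<le> (\<Sum>i\<in>I. 3 * real N powr \<tau> * \<rho> i powr \<tau>)" by (intro sum_mono Lball)
  also have "\<dots> = 3 * real N powr \<tau> * (\<Sum>i\<in>I. \<rho> i powr \<tau>)" by (simp only: sum_distrib_left)
  finally have wL: "sum w L \<le> c / 2" using sm by linarith
  have "sum w X = sum w L + sum w (X - L)" using finL fin by (simp add: sum.subset_diff add.commute)
  then have "c / 2 \<le> sum w (X - L)" using wL c by linarith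
  also have "\<dots> \<le> (\<Sum>x\<in>X - L. \<Sum>j\<in>{j0..n}. (real N ^ j) powr (p * \<tau>) * (w x * cellmass w X f (1 / real N ^ j) x powr p))"
  proof (rule sum_mono)
    fix x assume "x \<in> X - L"
    then obtain j where j: "j \<in> {j0..n}" "(1 / real N ^ j) powr \<tau> \<le> cellmass w X f (1 / real N ^ j) x"
      unfolding L_def by force
    \<comment> \<open>Chebyshev at the scale where \<open>x\<close> is heavy: the weight
      \<open>(real N ^ j) powr (p * \<tau>)\<close> raises the contribution of \<open>x\<close> to
      at least its own mass.\<close>
    have "1 = (real N ^ j) powr (p * \<tau>) * ((1 / real N ^ j) powr \<tau>) powr p"
      using N0 by (simp add: powr_powr powr_divide mult.commute)
    also have "\<dots> \<le> (real N ^ j) powr (p * \<tau>) * cellmass w X f (1 / real N ^ j) x powr p"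
      using j(2) p by (intro mult_left_mono powr_mono2) auto
    finally have "w x * 1 \<le> w x * ((real N ^ j) powr (p * \<tau>) * cellmass w X f (1 / real N ^ j) x powr p)"
      using w by (rule mult_left_mono)
    also have "\<dots> = (real N ^ j) powr (p * \<tau>) * (w x * cellmass w X f (1 / real N ^ j) x powr p)" by (simp only: mult_ac)
    also have "\<dots> \<le> (\<Sum>j\<in>{j0..n}. (real N ^ j) powr (p * \<tau>) * (w x * cellmass w X f (1 / real N ^ j) x powr p))"
      by (rule member_le_sum) (use j w in auto)
    finally show "w x \<le> (\<Sum>j\<in>{j0..n}. (real N ^ j) powr (p * \<tau>) * (w x * cellmass w X f (1 / real N ^ j) x powr p))" by simp
  qed
  also have "\<dots> \<le> (\<Sum>x\<in>X. \<Sum>j\<in>{j0..n}. (real N ^ j) powr (p * \<tau>) * (w x * cellmass w X f (1 / real N ^ j) x powr p))"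
    using fin w by (intro sum_mono2 sum_nonneg) auto
  also have "\<dots> = (\<Sum>j\<in>{j0..n}. (real N ^ j) powr (p * \<tau>) * (\<Sum>x\<in>X. w x * cellmass w X f (1 / real N ^ j) x powr p))"
    by (subst sum.swap) (simp only: sum_distrib_left)
  finally show ?thesis .
qed

lemma cellmass_measurable:
  fixes pr :: "'p::euclidean_space \<Rightarrow> 'a::euclidean_space \<Rightarrow> real"
  assumes cont: "continuous_on UNIV (\<lambda>(s, x). pr s x)" and "finite X"
  shows "(\<lambda>s. cellmass w X (pr s) \<delta> x) \<in> borel_measurable borel"
proof -
  have c: "continuous_on UNIV (\<lambda>s. pr s y)" for y
  proof -
    have "continuous_on UNIV ((\<lambda>(s, x). pr s x) \<circ> (\<lambda>s. (s, y)))"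
      by (rule continuous_on_compose) (auto intro!: continuous_intros continuous_on_subset[OF cont])
    then show ?thesis by (simp add: o_def)
  qed
  have [measurable]: "(\<lambda>s. pr s y) \<in> borel_measurable borel" for y
    by (rule borel_measurable_continuous_onI[OF c])
  have "(\<lambda>s. cellmass w X (pr s) \<delta> x) = (\<lambda>s. \<Sum>y\<in>X. if real_of_int \<lfloor>pr s y / \<delta>\<rfloor> = real_of_int \<lfloor>pr s x / \<delta>\<rfloor> then w y else 0)"
    unfolding cellmass_def using assms(2) by (simp add: sum.inter_filter)
  also have "\<dots> \<in> borel_measurable borel" by measurable
  finally show ?thesis .
qed

text \<open>By \<open>heavy_mass\<close> and Chebyshev, the measure of the parameters with a cheap
  cover is at most a sum of moments weighted by \<open>N ^ j\<close> to the power
  \<open>p * \<tau>\<close>. Because \<open>e > p * \<tau>\<close> this is a geometric tail starting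
  at \<open>j0\<close>, and \<open>j0\<close> is arbitrary. The estimate is assumed for each
  \<open>A\<close> separately since \<open>N\<close> may depend on the Frostman constant.\<close>

lemma null_params_null:
  fixes K :: "'a::euclidean_space set" and pr :: "'p::euclidean_space \<Rightarrow> 'a \<Rightarrow> real"
  assumes K: "compact K" and cont: "continuous_on UNIV (\<lambda>(s, x). pr s x)" and D: "D \<in> sets borel"
    and t: "t > 0" and pos: "hausdorff_measure t K \<noteq> 0" and \<tau>: "\<tau> > 0" and p: "p > 0"
    and est: "\<And>A. A \<ge> 0 \<Longrightarrow> \<exists>N\<ge>2. \<exists>C\<ge>0. \<exists>e>p * \<tau>. \<forall>j X w. finite X \<longrightarrow> X \<subseteq> K \<longrightarrow> (\<forall>x. 0 \<le> w x) \<longrightarrow>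
      (\<forall>x. \<forall>r\<ge>1 / real N ^ j. sum w {y\<in>X. dist x y \<le> r} \<le> A * r powr t) \<longrightarrow>
      (\<integral>\<^sup>+s. ennreal (\<Sum>x\<in>X. w x * cellmass w X (pr s) (1 / real N ^ j) x powr p) * indicator D s \<partial>lborel)
        \<le> ennreal (C * sum w X * (1 / real N ^ j) powr e)"
  shows "emeasure lborel (null_params \<tau> K pr \<inter> D) = 0"
proof -
  obtain A c where A: "A \<ge> 0" and c: "c > 0" and frost: "\<And>n. \<exists>X w. finite X \<and> X \<subseteq> K \<and> (\<forall>x. 0 \<le> w x) \<and> c \<le> sum w X \<and>
     (\<forall>x. \<forall>r\<ge>1 / 2 ^ n. sum w {y\<in>X. dist x y \<le> r} \<le> A * r powr t)"
    using finite_frostman[OF compact_imp_bounded[OF K] t pos] by blast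
  obtain N C e where N: "N \<ge> 2" and C: "C \<ge> 0" and e: "e > p * \<tau>" and est': "\<And>j X w. \<lbrakk>finite X; X \<subseteq> K; \<forall>x. 0 \<le> w x;
      \<forall>x. \<forall>r\<ge>1 / real N ^ j. sum w {y\<in>X. dist x y \<le> r} \<le> A * r powr t\<rbrakk> \<Longrightarrow>
      (\<integral>\<^sup>+s. ennreal (\<Sum>x\<in>X. w x * cellmass w X (pr s) (1 / real N ^ j) x powr p) * indicator D s \<partial>lborel)
        \<le> ennreal (C * sum w X * (1 / real N ^ j) powr e)"
    using est[OF A] by blast
  have N0: "real N \<ge> 2" using N by simp
  obtain R0 where R0: "\<And>x y. x \<in> K \<Longrightarrow> y \<in> K \<Longrightarrow> dist x y \<le> R0"
    using compact_imp_bounded[OF K] unfolding bounded_two_points by blast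
  define R where "R = max 1 R0"
  have R: "R \<ge> 1" "\<And>x y. x \<in> K \<Longrightarrow> y \<in> K \<Longrightarrow> dist x y \<le> R" unfolding R_def using R0 by (auto simp: le_max_iff_disj)
  define SW where "SW = A * R powr t"
  have SW0: "SW \<ge> 0" unfolding SW_def using A by simp
  define \<theta> where "\<theta> = real N powr (p * \<tau> - e)"
  have \<theta>0: "0 < \<theta>" unfolding \<theta>_def using N0 by simp
  have \<theta>1: "\<theta> < 1" unfolding \<theta>_def by (rule powr_less_one) (use N0 e in linarith)+
  note \<theta> = \<theta>0 \<theta>1
  define B where "B = 2 / c * (C * SW / (1 - \<theta>))"
  \<comment> \<open>The bound is free of \<open>n\<close>, although the weighted set in its proof is
    not; so the restriction on the radii can be lifted by a monotone union. The first condition on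
    \<open>\<eta>\<close> excludes radii above \<open>1 / N ^ j0\<close>, the second keeps the light
    mass below \<open>c / 2\<close>.\<close>
  have step: "emeasure lborel (fine_covers \<tau> K pr \<eta> (1 / real N ^ n) \<inter> D) \<le> ennreal (B * \<theta> ^ j0)"
    if eta: "\<eta> \<le> (1 / real N ^ j0) powr \<tau>" "3 * real N powr \<tau> * \<eta> \<le> c / 2" for \<eta> n j0
  proof -
    define O' where "O' = fine_covers \<tau> K pr \<eta> (1 / real N ^ n)"
    have Om: "O' \<in> sets borel" unfolding O'_def using open_fine_covers[OF K cont] by auto
    \<comment> \<open>Dyadic level \<open>n * N\<close> is at least as fine as \<open>N\<close>-adic
      level \<open>n\<close>, because \<open>N \<le> 2 ^ N\<close>; one set of weights thus serves
      all scales \<open>j \<le> n\<close>.\<close>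
    obtain X w where X: "finite X" "X \<subseteq> K" and w: "\<forall>x. 0 \<le> w x" and cX: "c \<le> sum w X"
      and fr: "\<And>x r. r \<ge> 1 / 2 ^ (n * N) \<Longrightarrow> sum w {y\<in>X. dist x y \<le> r} \<le> A * r powr t"
      using frost[of "n * N"] by blast
    have frj: "\<forall>x. \<forall>r\<ge>1 / real N ^ j. sum w {y\<in>X. dist x y \<le> r} \<le> A * r powr t" if "j \<le> n" for j
    proof (intro allI impI)
      fix x r assume r: "1 / real N ^ j \<le> r"
      have "real N \<le> 2 ^ N" using of_nat_mono[OF less_imp_le[OF less_exp[of N]]] by simp
      then have "real N ^ n \<le> (2 ^ N) ^ n" using N0 by (intro power_mono) auto
      then have "real N ^ n \<le> 2 ^ (n * N)" by (simp add: power_mult[symmetric] mult.commute)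
      moreover have "real N ^ j \<le> real N ^ n" using that N0 by (intro power_increasing) auto
      ultimately have "real N ^ j \<le> 2 ^ (n * N)" by linarith
      then have "1 / 2 ^ (n * N) \<le> 1 / real N ^ j" using N0 by (intro divide_left_mono) auto
      then show "sum w {y\<in>X. dist x y \<le> r} \<le> A * r powr t" using r by (intro fr) linarith
    qed
    have wX: "sum w X \<le> SW"
    proof (cases "X = {}")
      case False
      then obtain x where x: "x \<in> X" by auto
      have XR: "{y\<in>X. dist x y \<le> R} = X" using R(2) x X(2) by auto
      have "(1 / 2 :: real) ^ (n * N) \<le> 1" by (rule power_le_one) auto
      then have "1 / 2 ^ (n * N) \<le> R" using R(1) by (simp only: power_one_over)
      from fr[OF this, of x] show ?thesis unfolding SW_def XR .
    qed (use SW0 in simp)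
    let ?g = "\<lambda>j s. \<Sum>x\<in>X. w x * cellmass w X (pr s) (1 / real N ^ j) x powr p"
    have g0: "?g j s \<ge> 0" for j s using w by (intro sum_nonneg) auto
    have gm: "?g j \<in> borel_measurable borel" for j
    proof -
      have [measurable]: "(\<lambda>s. cellmass w X (pr s) \<delta> x) \<in> borel_measurable borel" for \<delta> x
        using cont X(1) by (rule cellmass_measurable)
      show ?thesis by measurable
    qed
    have heavy: "c / 2 \<le> (\<Sum>j\<in>{j0..n}. (real N ^ j) powr (p * \<tau>) * ?g j s)" if s: "s \<in> O'" for s
    proof -
      obtain I :: "nat set" and u \<rho> where Ia: "finite I" "\<And>i. i \<in> I \<Longrightarrow> 1 / real N ^ n \<le> \<rho> i" "\<And>i. i \<in> I \<Longrightarrow> 0 < \<rho> i"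
        "pr s ` K \<subseteq> (\<Union>i\<in>I. ball (u i) (\<rho> i))" "(\<Sum>i\<in>I. \<rho> i powr \<tau>) < \<eta>"
        using s unfolding O'_def by (rule fine_coversE) blast
      have I: "finite I" "\<forall>i\<in>I. 1 / real N ^ n \<le> \<rho> i \<and> 0 < \<rho> i"
        "pr s ` K \<subseteq> (\<Union>i\<in>I. ball (u i) (\<rho> i))" "(\<Sum>i\<in>I. \<rho> i powr \<tau>) < \<eta>" using Ia by auto
      show ?thesis
      proof (rule heavy_mass[where I = I and u = u and \<rho> = \<rho>])
        fix i assume i: "i \<in> I"
        have "\<rho> i \<le> 1 / real N ^ j0"
        proof (rule ccontr)
          assume "\<not> \<rho> i \<le> 1 / real N ^ j0"
          then have "(1 / real N ^ j0) powr \<tau> < \<rho> i powr \<tau>" using \<tau> N0 by (intro powr_less_mono2) auto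
          also have "\<dots> \<le> (\<Sum>i\<in>I. \<rho> i powr \<tau>)" using I(1) i by (intro member_le_sum) auto
          finally show False using I(4) eta(1) by linarith
        qed
        then show "1 / real N ^ n \<le> \<rho> i \<and> \<rho> i \<le> 1 / real N ^ j0" using I(2) i by blast
      next
        show "pr s ` X \<subseteq> (\<Union>i\<in>I. ball (u i) (\<rho> i))" using I(3) X(2) by blast
        have "3 * real N powr \<tau> * (\<Sum>i\<in>I. \<rho> i powr \<tau>) \<le> 3 * real N powr \<tau> * \<eta>" using I(4) by (intro mult_left_mono) auto
        then show "3 * real N powr \<tau> * (\<Sum>i\<in>I. \<rho> i powr \<tau>) \<le> c / 2" using eta(2) by linarith
      qed (use X w N \<tau> p I(1) cX in auto)
    qed
    have "ennreal (c / 2) * emeasure lborel (O' \<inter> D) = (\<integral>\<^sup>+s. ennreal (c / 2) * indicator (O' \<inter> D) s \<partial>lborel)"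
      using Om D by (subst nn_integral_cmult_indicator) auto
    also have "\<dots> \<le> (\<integral>\<^sup>+s. (\<Sum>j\<in>{j0..n}. ennreal ((real N ^ j) powr (p * \<tau>)) * (ennreal (?g j s) * indicator D s)) \<partial>lborel)"
    proof (rule nn_integral_mono)
      fix s
      show "ennreal (c / 2) * indicator (O' \<inter> D) s \<le> (\<Sum>j\<in>{j0..n}. ennreal ((real N ^ j) powr (p * \<tau>)) * (ennreal (?g j s) * indicator D s))"
      proof (cases "s \<in> O' \<inter> D")
        case True
        have "ennreal (c / 2) \<le> ennreal (\<Sum>j\<in>{j0..n}. (real N ^ j) powr (p * \<tau>) * ?g j s)"
          using heavy True by (intro ennreal_leI) auto
        also have "\<dots> = (\<Sum>j\<in>{j0..n}. ennreal ((real N ^ j) powr (p * \<tau>) * ?g j s))"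
          using g0 by (intro sum_ennreal[symmetric] mult_nonneg_nonneg) auto
        also have "\<dots> = (\<Sum>j\<in>{j0..n}. ennreal ((real N ^ j) powr (p * \<tau>)) * ennreal (?g j s))"
          using g0 by (intro sum.cong refl ennreal_mult) auto
        finally show ?thesis using True by simp
      qed simp
    qed
    also have "\<dots> = (\<Sum>j\<in>{j0..n}. ennreal ((real N ^ j) powr (p * \<tau>)) * (\<integral>\<^sup>+s. ennreal (?g j s) * indicator D s \<partial>lborel))"
      using gm D by (subst nn_integral_sum) (auto intro!: sum.cong nn_integral_cmult)
    also have "\<dots> \<le> (\<Sum>j\<in>{j0..n}. ennreal ((real N ^ j) powr (p * \<tau>)) * ennreal (C * sum w X * (1 / real N ^ j) powr e))"
      using X w frj by (intro sum_mono mult_left_mono est') auto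
    also have "\<dots> \<le> (\<Sum>j\<in>{j0..n}. ennreal (C * SW * \<theta> ^ j))"
    proof (rule sum_mono)
      fix j
      have th: "(real N ^ j) powr (p * \<tau>) * (1 / real N ^ j) powr e = \<theta> ^ j"
      proof -
        have "(real N ^ j) powr (p * \<tau>) * (1 / real N ^ j) powr e = (real N ^ j) powr (p * \<tau> - e)"
          using N0 by (simp add: powr_divide powr_diff)
        also have "\<dots> = \<theta> ^ j" unfolding \<theta>_def using N0 by (simp add: powr_realpow[symmetric] powr_powr mult.commute)
        finally show ?thesis .
      qed
      have "ennreal ((real N ^ j) powr (p * \<tau>)) * ennreal (C * sum w X * (1 / real N ^ j) powr e)
         = ennreal ((real N ^ j) powr (p * \<tau>) * (C * sum w X * (1 / real N ^ j) powr e))"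
        using C w by (intro ennreal_mult[symmetric]) (auto intro!: mult_nonneg_nonneg sum_nonneg)
      also have "(real N ^ j) powr (p * \<tau>) * (C * sum w X * (1 / real N ^ j) powr e) = C * sum w X * \<theta> ^ j"
        unfolding th[symmetric] by (simp only: mult_ac)
      also have "ennreal \<dots> \<le> ennreal (C * SW * \<theta> ^ j)"
        using C wX \<theta> by (intro ennreal_leI mult_right_mono mult_left_mono) auto
      finally show "ennreal ((real N ^ j) powr (p * \<tau>)) * ennreal (C * sum w X * (1 / real N ^ j) powr e) \<le> ennreal (C * SW * \<theta> ^ j)" .
    qed
    also have "\<dots> = ennreal (\<Sum>j\<in>{j0..n}. C * SW * \<theta> ^ j)" using C SW0 \<theta> by (intro sum_ennreal) auto
    also have "\<dots> \<le> ennreal (C * SW * (\<theta> ^ j0 / (1 - \<theta>)))"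
    proof (rule ennreal_leI)
      have "(\<Sum>j\<in>{j0..n}. \<theta> ^ j) \<le> \<theta> ^ j0 / (1 - \<theta>)"
      proof (cases "j0 \<le> n")
        case True
        have "(\<Sum>j\<in>{j0..n}. \<theta> ^ j) = (\<theta> ^ j0 - \<theta> ^ Suc n) / (1 - \<theta>)" using True \<theta> by (simp add: sum_gp)
        also have "\<dots> \<le> \<theta> ^ j0 / (1 - \<theta>)" using \<theta> by (intro divide_right_mono) auto
        finally show ?thesis .
      qed (use \<theta> in simp)
      then have "C * SW * (\<Sum>j\<in>{j0..n}. \<theta> ^ j) \<le> C * SW * (\<theta> ^ j0 / (1 - \<theta>))" using C SW0 by (intro mult_left_mono) auto
      then show "(\<Sum>j\<in>{j0..n}. C * SW * \<theta> ^ j) \<le> C * SW * (\<theta> ^ j0 / (1 - \<theta>))" by (simp only: sum_distrib_left)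
    qed
    finally have fin: "ennreal (c / 2) * emeasure lborel (O' \<inter> D) \<le> ennreal (C * SW * (\<theta> ^ j0 / (1 - \<theta>)))" .
    have "emeasure lborel (O' \<inter> D) = ennreal (2 / c) * (ennreal (c / 2) * emeasure lborel (O' \<inter> D))"
    proof -
      have "ennreal (2 / c) * ennreal (c / 2) = 1" using c by (simp add: ennreal_mult[symmetric])
      then show ?thesis by (simp only: mult.assoc[symmetric] mult_1_left)
    qed
    also have "\<dots> \<le> ennreal (2 / c) * ennreal (C * SW * (\<theta> ^ j0 / (1 - \<theta>)))" using fin by (rule mult_left_mono) simp
    also have "\<dots> = ennreal (2 / c * (C * SW * (\<theta> ^ j0 / (1 - \<theta>))))"
      using c C SW0 \<theta> by (intro ennreal_mult[symmetric]) auto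
    also have "2 / c * (C * SW * (\<theta> ^ j0 / (1 - \<theta>))) = B * \<theta> ^ j0" unfolding B_def by simp
    finally show ?thesis unfolding O'_def .
  qed
  \<comment> \<open>A finite cover has a smallest radius, so it is admissible for some
    \<open>n\<close>.\<close>
  have union: "fine_covers \<tau> K pr \<eta> 0 = (\<Union>n. fine_covers \<tau> K pr \<eta> (1 / real N ^ n))" for \<eta>
  proof (intro equalityI subsetI)
    fix s assume "s \<in> fine_covers \<tau> K pr \<eta> 0"
    then obtain I :: "nat set" and u \<rho> where I: "finite I" "\<And>i. i \<in> I \<Longrightarrow> 0 \<le> \<rho> i" "\<And>i. i \<in> I \<Longrightarrow> 0 < \<rho> i"
      "pr s ` K \<subseteq> (\<Union>i\<in>I. ball (u i) (\<rho> i))" "(\<Sum>i\<in>I. \<rho> i powr \<tau>) < \<eta>" by (rule fine_coversE) blast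
    have "\<exists>n. \<forall>i\<in>I. 1 / real N ^ n \<le> \<rho> i"
      using I(1,3)
    proof (induction I rule: finite_induct)
      case (insert i I)
      then obtain n where n: "\<forall>i\<in>I. 1 / real N ^ n \<le> \<rho> i" by auto
      obtain m where m: "(1 / real N) ^ m < \<rho> i" using real_arch_pow_inv[of "\<rho> i" "1 / real N"] insert N0 by auto
      have mono: "1 / real N ^ (m + n) \<le> 1 / real N ^ k" if "k \<le> m + n" for k
        using that N0 by (intro divide_left_mono power_increasing) auto
      show ?case
      proof (intro exI[of _ "m + n"] ballI)
        fix k assume "k \<in> insert i I"
        then show "1 / real N ^ (m + n) \<le> \<rho> k"
          using n m mono[of m] mono[of n] by (auto simp: power_one_over intro: order_trans)
      qed
    qed simp
    then obtain n where n: "\<And>i. i \<in> I \<Longrightarrow> 1 / real N ^ n \<le> \<rho> i" by blast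
    have "s \<in> fine_covers \<tau> K pr \<eta> (1 / real N ^ n)" by (rule fine_coversI[of I _ \<rho> pr s K u \<tau> \<eta>, OF I(1) n I(3-5)])
    then show "s \<in> (\<Union>n. fine_covers \<tau> K pr \<eta> (1 / real N ^ n))" by blast
  next
    fix s assume "s \<in> (\<Union>n. fine_covers \<tau> K pr \<eta> (1 / real N ^ n))"
    then obtain n where "s \<in> fine_covers \<tau> K pr \<eta> (1 / real N ^ n)" by blast
    moreover have "fine_covers \<tau> K pr \<eta> (1 / real N ^ n) \<subseteq> fine_covers \<tau> K pr \<eta> 0"
      by (rule fine_covers_antimono) simp
    ultimately show "s \<in> fine_covers \<tau> K pr \<eta> 0" by blast
  qed
  have inc: "incseq (\<lambda>n. fine_covers \<tau> K pr \<eta> (1 / real N ^ n) \<inter> D)" for \<eta>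
  proof (rule incseq_SucI, rule Int_mono[OF fine_covers_antimono subset_refl])
    fix n show "1 / real N ^ Suc n \<le> 1 / real N ^ n" using N0 by (intro divide_left_mono power_increasing) auto
  qed
  have bound: "emeasure lborel (null_params \<tau> K pr \<inter> D) \<le> ennreal (B * \<theta> ^ j0)" for j0
  proof -
    define \<eta>0 where "\<eta>0 = min ((1 / real N ^ j0) powr \<tau>) (c / (6 * real N powr \<tau>))"
    have "\<eta>0 > 0" unfolding \<eta>0_def using N0 c by simp
    then obtain k where k: "1 / real (Suc k) < \<eta>0" using nat_approx_posE by blast
    define \<eta> where "\<eta> = 1 / real (Suc k)"
    have e1: "\<eta> \<le> (1 / real N ^ j0) powr \<tau>" and e2: "\<eta> \<le> c / (6 * real N powr \<tau>)" using k unfolding \<eta>_def \<eta>0_def by auto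
    have e3: "3 * real N powr \<tau> * \<eta> \<le> c / 2" using e2 N0 by (simp add: field_simps)
    have "emeasure lborel (null_params \<tau> K pr \<inter> D) \<le> emeasure lborel (fine_covers \<tau> K pr \<eta> 0 \<inter> D)"
      using open_fine_covers[OF K cont] D unfolding null_params_def \<eta>_def by (intro emeasure_mono) auto
    also have "fine_covers \<tau> K pr \<eta> 0 \<inter> D = (\<Union>n. fine_covers \<tau> K pr \<eta> (1 / real N ^ n) \<inter> D)"
      unfolding union by blast
    also have "emeasure lborel \<dots> = (SUP n. emeasure lborel (fine_covers \<tau> K pr \<eta> (1 / real N ^ n) \<inter> D))"
      using open_fine_covers[OF K cont] D inc by (intro SUP_emeasure_incseq[symmetric]) auto
    also have "\<dots> \<le> ennreal (B * \<theta> ^ j0)" by (intro SUP_least step e1 e3)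
    finally show ?thesis .
  qed
  have "(\<lambda>j. ennreal (B * \<theta> ^ j)) \<longlonglongrightarrow> ennreal (B * 0)"
    using \<theta> by (intro tendsto_ennrealI tendsto_intros LIMSEQ_realpow_zero) auto
  then have "emeasure lborel (null_params \<tau> K pr \<inter> D) \<le> ennreal (B * 0)"
    by (rule LIMSEQ_le_const) (use bound in auto)
  then show ?thesis by simp
qed

section \<open>Hausdorff measure and dimension\<close>

text \<open>Translation invariance and Tonelli. Estimates on unit segments in one direction thereby
  become estimates in the full parameter space, with no change of coordinates.\<close>

lemma emeasure_line_average:
  fixes G :: "'p::euclidean_space set"
  assumes G: "G \<in> sets borel"
  shows "emeasure lborel G = (\<integral>\<^sup>+s. emeasure lborel {\<tau> \<in> {0..<1}. s + \<tau> *\<^sub>R d \<in> G} \<partial>lborel)"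
proof -
  have [measurable]: "G \<in> sets borel" by (rule G)
  have tr: "(\<integral>\<^sup>+s. indicator G (s + c) \<partial>lborel) = emeasure lborel G" for c :: 'p
  proof -
    have "emeasure lborel G = (\<integral>\<^sup>+s. indicator G s \<partial>lborel)" by simp
    also have "\<dots> = (\<integral>\<^sup>+s. indicator G s \<partial>distr lborel borel ((+) c))" by (simp only: lborel_distr_plus)
    also have "\<dots> = (\<integral>\<^sup>+s. indicator G (c + s) \<partial>lborel)" by (subst nn_integral_distr) auto
    finally show ?thesis by (simp add: add.commute)
  qed
  have "(\<integral>\<^sup>+s. emeasure lborel {\<tau> \<in> {0..<1}. s + \<tau> *\<^sub>R d \<in> G} \<partial>lborel)
     = (\<integral>\<^sup>+s. (\<integral>\<^sup>+\<tau>. indicator {0..<1} \<tau> * indicator G (s + \<tau> *\<^sub>R d) \<partial>lborel) \<partial>lborel)"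
  proof (intro nn_integral_cong)
    fix s :: 'p
    have "{\<tau> \<in> {0..<1}. s + \<tau> *\<^sub>R d \<in> G} \<in> sets borel" by measurable
    then have "emeasure lborel {\<tau> \<in> {0..<1}. s + \<tau> *\<^sub>R d \<in> G} = (\<integral>\<^sup>+\<tau>. indicator {\<tau> \<in> {0..<1}. s + \<tau> *\<^sub>R d \<in> G} \<tau> \<partial>lborel)"
      by simp
    also have "\<dots> = (\<integral>\<^sup>+\<tau>. indicator {0..<1} \<tau> * indicator G (s + \<tau> *\<^sub>R d) \<partial>lborel)"
      by (intro nn_integral_cong) (auto simp: indicator_def)
    finally show "emeasure lborel {\<tau> \<in> {0..<1}. s + \<tau> *\<^sub>R d \<in> G} = (\<integral>\<^sup>+\<tau>. indicator {0..<1} \<tau> * indicator G (s + \<tau> *\<^sub>R d) \<partial>lborel)" .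
  qed
  also have "\<dots> = (\<integral>\<^sup>+\<tau>. (\<integral>\<^sup>+s. indicator {0..<1::real} \<tau> * indicator G (s + \<tau> *\<^sub>R d) \<partial>lborel) \<partial>lborel)"
    by (rule lborel_pair.Fubini') measurable
  also have "\<dots> = (\<integral>\<^sup>+\<tau>. emeasure lborel G * indicator {0..<1::real} \<tau> \<partial>lborel)"
    by (intro nn_integral_cong) (simp add: nn_integral_cmult tr mult.commute)
  also have "\<dots> = emeasure lborel G" by (simp add: nn_integral_cmult_indicator)
  finally show ?thesis ..
qed

section \<open>Vanishing Hausdorff measure and the dimension\<close>

lemma hausdorff_approx_zero:
  "hausdorff_measure s A = 0 \<Longrightarrow> \<delta> > 0 \<Longrightarrow> hausdorff_approx s \<delta> A = 0"
proof -
  assume h: "hausdorff_measure s A = 0" and d: "\<delta> > 0"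
  have "hausdorff_approx s \<delta> A \<le> hausdorff_measure s A"
    unfolding hausdorff_measure_def by (rule SUP_upper) (use d in simp)
  then show ?thesis using h by simp
qed

lemma hausdorff_measure_zeroI:
  assumes "\<And>\<delta>. \<delta> > 0 \<Longrightarrow> hausdorff_approx s \<delta> A = 0"
  shows "hausdorff_measure s A = 0"
proof -
  have "hausdorff_measure s A \<le> 0"
    unfolding hausdorff_measure_def
  proof (rule SUP_least)
    fix \<delta> :: real assume "\<delta> \<in> {0<..}"
    then show "hausdorff_approx s \<delta> A \<le> 0" using assms[of \<delta>] by simp
  qed
  then show ?thesis by simp
qed

text \<open>Covers with diameters at most 1 are enough for measure zero, and for those
  \<open>diam_pow\<close> is antitone in the exponent, including exponent 0, where every nonempty
  set counts as 1.\<close>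

lemma hausdorff_measure_zero_mono:
  assumes "0 \<le> u" "u \<le> v" "hausdorff_measure u A = 0"
  shows "hausdorff_measure v A = 0"
proof (rule hausdorff_measure_zeroI)
  fix \<delta> :: real assume d: "\<delta> > 0"
  have "hausdorff_approx v \<delta> A \<le> hausdorff_approx u (min \<delta> 1) A"
    unfolding hausdorff_approx_def
  proof (rule INF_mono)
    fix U :: "nat \<Rightarrow> 'a set"
    assume U: "U \<in> {U. A \<subseteq> (\<Union>i. U i) \<and> (\<forall>i. bounded (U i) \<and> diameter (U i) \<le> min \<delta> 1)}"
    have "diam_pow v (U i) \<le> diam_pow u (U i)" for i
    proof -
      have b: "bounded (U i)" "diameter (U i) \<le> min \<delta> 1" using U by auto
      have d: "0 \<le> diameter (U i)" "diameter (U i) \<le> 1" using b diameter_ge_0[OF b(1)] by auto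
      have "diameter (U i) powr v \<le> 1" using d assms by (intro powr_le1) auto
      moreover have "diameter (U i) powr v \<le> diameter (U i) powr u"
        using d assms by (cases "diameter (U i) = 0") (auto intro: powr_mono')
      ultimately show ?thesis using assms unfolding diam_pow_def by (auto intro: ennreal_leI)
    qed
    then show "\<exists>U'\<in>{U. A \<subseteq> (\<Union>i. U i) \<and> (\<forall>i. bounded (U i) \<and> diameter (U i) \<le> \<delta>)}. (\<Sum>i. diam_pow v (U' i)) \<le> (\<Sum>i. diam_pow u (U i))"
      using U by (intro bexI[of _ U] suminf_le) auto
  qed
  also have "\<dots> = 0" using assms(3) d by (intro hausdorff_approx_zero) auto
  finally show "hausdorff_approx v \<delta> A = 0" by simp
qed

lemma hausdorff_measure_lipschitz_zero:
  fixes f :: "'a::metric_space \<Rightarrow> 'b::metric_space"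
  assumes u: "u \<ge> 0" and \<Lambda>: "\<Lambda> > 0" and lip: "\<And>x y. x \<in> K \<Longrightarrow> y \<in> K \<Longrightarrow> dist (f x) (f y) \<le> \<Lambda> * dist x y"
    and null: "hausdorff_measure u K = 0"
  shows "hausdorff_measure u (f ` K) = 0"
proof (rule hausdorff_measure_zeroI)
  fix \<delta> :: real assume d: "\<delta> > 0"
  define k where "k = max 1 (\<Lambda> powr u)"
  have k: "k > 0" unfolding k_def by simp
  have bnd: "hausdorff_approx u \<delta> (f ` K) \<le> ennreal (k * \<eta>)" if eta: "\<eta> > 0" for \<eta>
  proof -
    have "hausdorff_approx u (\<delta> / \<Lambda>) K < ennreal \<eta>"
      using hausdorff_approx_zero[OF null, of "\<delta> / \<Lambda>"] d \<Lambda> eta by simp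
    then obtain U :: "nat \<Rightarrow> 'a set" where U: "K \<subseteq> (\<Union>i. U i)" "\<And>i. bounded (U i)" "\<And>i. diameter (U i) \<le> \<delta> / \<Lambda>"
      "(\<Sum>i. diam_pow u (U i)) < ennreal \<eta>"
      unfolding hausdorff_approx_def INF_less_iff by blast
    \<comment> \<open>The Lipschitz bound is available on \<open>K\<close> only, so the covering
      sets are cut down to \<open>K\<close> before being mapped.\<close>
    define V where "V i = f ` (U i \<inter> K)" for i
    have dV: "dist p q \<le> \<Lambda> * diameter (U i)" if "p \<in> V i" "q \<in> V i" for p q i
    proof -
      obtain x y where xy: "x \<in> U i" "x \<in> K" "y \<in> U i" "y \<in> K" "p = f x" "q = f y" using \<open>p \<in> V i\<close> \<open>q \<in> V i\<close> unfolding V_def by auto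
      have "dist p q \<le> \<Lambda> * dist x y" using lip xy by simp
      also have "\<dots> \<le> \<Lambda> * diameter (U i)" using \<Lambda> xy U(2) by (intro mult_left_mono diameter_bounded_bound) auto
      finally show ?thesis .
    qed
    have dU0: "0 \<le> diameter (U i)" for i using U(2) by (rule diameter_ge_0)
    have diamV: "diameter (V i) \<le> \<Lambda> * diameter (U i)" for i
    proof (cases "V i = {}")
      case False
      have "(SUP (x,y)\<in>V i \<times> V i. dist x y) \<le> \<Lambda> * diameter (U i)"
        using False dV by (intro cSUP_least) auto
      then show ?thesis using False unfolding diameter_def by simp
    qed (use \<Lambda> dU0 in simp)
    have bV: "bounded (V i)" for i
    proof -
      have "\<forall>x\<in>V i. \<forall>y\<in>V i. dist x y \<le> \<Lambda> * diameter (U i)" using dV by blast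
      then show ?thesis unfolding bounded_two_points by blast
    qed
    have "f ` K \<subseteq> (\<Union>i. V i)" using U(1) unfolding V_def by blast
    moreover have "diameter (V i) \<le> \<delta>" for i
    proof -
      have "\<Lambda> * diameter (U i) \<le> \<Lambda> * (\<delta> / \<Lambda>)" using U(3) \<Lambda> by (intro mult_left_mono) auto
      then show ?thesis using diamV[of i] \<Lambda> by simp
    qed
    ultimately have "hausdorff_approx u \<delta> (f ` K) \<le> (\<Sum>i. diam_pow u (V i))"
      unfolding hausdorff_approx_def using bV by (intro INF_lower) auto
    also have "\<dots> \<le> (\<Sum>i. ennreal k * diam_pow u (U i))"
    proof (intro suminf_le)
      fix i
      show "diam_pow u (V i) \<le> ennreal k * diam_pow u (U i)"
      proof (cases "V i = {}")
        case False
        then have ne: "U i \<noteq> {}" unfolding V_def by auto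
        show ?thesis
        proof (cases "u = 0")
          case True
          have "(1::ennreal) \<le> ennreal k" unfolding k_def by (simp add: ennreal_1[symmetric] del: ennreal_1)
          then show ?thesis using True False ne by (simp add: diam_pow_def)
        next
          case u0: False
          have "diameter (V i) powr u \<le> (\<Lambda> * diameter (U i)) powr u"
            using diamV u bV by (intro powr_mono2) (auto intro: diameter_ge_0)
          also have "\<dots> = \<Lambda> powr u * diameter (U i) powr u" by (rule powr_mult)
          also have "\<dots> \<le> k * diameter (U i) powr u" unfolding k_def by (intro mult_right_mono) auto
          finally have "ennreal (diameter (V i) powr u) \<le> ennreal (k * diameter (U i) powr u)" by (rule ennreal_leI)
          also have "\<dots> = ennreal k * ennreal (diameter (U i) powr u)" using k by (simp add: ennreal_mult)
          finally show ?thesis using u0 False ne by (simp add: diam_pow_def)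
        qed
      qed (simp add: diam_pow_def)
    qed auto
    also have "\<dots> = ennreal k * (\<Sum>i. diam_pow u (U i))" by simp
    also have "\<dots> \<le> ennreal k * ennreal \<eta>" using U(4) by (intro mult_left_mono) auto
    also have "\<dots> = ennreal (k * \<eta>)" using k eta by (simp add: ennreal_mult)
    finally show ?thesis .
  qed
  have "hausdorff_approx u \<delta> (f ` K) \<le> 0 + ennreal \<epsilon>" if "\<epsilon> > 0" for \<epsilon>
  proof -
    have "k * (\<epsilon> / k) = \<epsilon>" using k by simp
    moreover have "\<epsilon> / k > 0" using k that by simp
    ultimately show ?thesis using bnd[of "\<epsilon> / k"] by simp
  qed
  then have "hausdorff_approx u \<delta> (f ` K) \<le> 0" by (rule ennreal_le_epsilon)
  then show "hausdorff_approx u \<delta> (f ` K) = 0" by simp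
qed

lemma hausdorff_dim_le:
  assumes "0 \<le> s" "hausdorff_measure s A = 0"
  shows "hausdorff_dim A \<le> ereal s"
  unfolding hausdorff_dim_def
proof (rule Inf_lower)
  show "ereal s \<in> {ereal s |s. 0 \<le> s \<and> hausdorff_measure s A = 0}"
    using assms by (intro CollectI exI[of _ s] conjI refl)
qed

lemma hausdorff_dim_lipschitz_le:
  fixes f :: "'a::metric_space \<Rightarrow> 'b::metric_space"
  assumes \<Lambda>: "\<Lambda> > 0" and lip: "\<And>x y. x \<in> K \<Longrightarrow> y \<in> K \<Longrightarrow> dist (f x) (f y) \<le> \<Lambda> * dist x y"
  shows "hausdorff_dim (f ` K) \<le> hausdorff_dim K"
  unfolding hausdorff_dim_def[of K]
proof (rule Inf_greatest)
  fix e assume "e \<in> {ereal s |s. 0 \<le> s \<and> hausdorff_measure s K = 0}"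
  then obtain s where s: "e = ereal s" "0 \<le> s" "hausdorff_measure s K = 0" by auto
  show "hausdorff_dim (f ` K) \<le> e" unfolding s(1)
    by (rule hausdorff_dim_le[OF s(2) hausdorff_measure_lipschitz_zero[OF s(2) \<Lambda> lip s(3)]])
qed

lemma hausdorff_measure_real_zero:
  fixes A :: "real set"
  assumes A: "bounded A" and u: "u > 1"
  shows "hausdorff_measure u A = 0"
proof (rule hausdorff_measure_zeroI)
  fix \<delta> :: real assume d: "\<delta> > 0"
  obtain M0 where M0: "\<And>x. x \<in> A \<Longrightarrow> \<bar>x\<bar> \<le> M0" using A by (auto simp: bounded_iff)
  define M where "M = max 1 M0"
  have M: "M \<ge> 1" "\<And>x. x \<in> A \<Longrightarrow> \<bar>x\<bar> \<le> M" unfolding M_def using M0 by (auto simp: le_max_iff_disj)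
  have bound: "hausdorff_approx u \<delta> A \<le> ennreal ((3 * M) powr u * real k powr (1 - u))" if k: "k > 0" "3 * M / real k \<le> \<delta>" for k :: nat
  proof -
    \<comment> \<open>The \<open>k\<close> intervals span \<open>3 * M\<close>, more than the
      \<open>2 * M\<close> to be covered, so the right end of the range still receives an index
      below \<open>k\<close>.\<close>
    define h where "h = 3 * M / real k"
    have h: "h > 0" unfolding h_def using M k by simp
    define U where "U i = (if i < k then {- M + real i * h..- M + real (Suc i) * h} else {})" for i
    have "A \<subseteq> (\<Union>i. U i)"
    proof
      fix x assume "x \<in> A"
      then have x: "- M \<le> x" "x \<le> M" using M(2)[of x] by auto
      define i where "i = nat \<lfloor>(x + M) / h\<rfloor>"
      have f0: "0 \<le> (x + M) / h" using x h by simp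
      then have ri: "real i = of_int \<lfloor>(x + M) / h\<rfloor>" unfolding i_def by simp
      have "real i \<le> (x + M) / h" "(x + M) / h \<le> real i + 1" unfolding ri by linarith+
      then have i: "real i * h \<le> x + M" "x + M \<le> (real i + 1) * h" using h by (simp_all add: field_simps)
      have "real i * h < 3 * M" using i(1) x M(1) by linarith
      also have "3 * M = real k * h" unfolding h_def using k by simp
      finally have "i < k" using h by simp
      then have "x \<in> U i" using i unfolding U_def by (simp add: algebra_simps)
      then show "x \<in> (\<Union>i. U i)" by blast
    qed
    moreover have dU: "diameter (U i) \<le> h" "bounded (U i)" for i
    proof -
      show "bounded (U i)" unfolding U_def by simp
      show "diameter (U i) \<le> h" unfolding U_def using h by (auto simp: diameter_closed_interval algebra_simps)
    qed
    ultimately have "hausdorff_approx u \<delta> A \<le> (\<Sum>i. diam_pow u (U i))"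
      unfolding hausdorff_approx_def using k(2) unfolding h_def[symmetric] by (intro INF_lower) (auto intro: order_trans)
    also have "\<dots> = (\<Sum>i<k. diam_pow u (U i))" by (rule suminf_finite) (auto simp: U_def diam_pow_def)
    also have "\<dots> \<le> (\<Sum>i<k. ennreal (h powr u))"
    proof (rule sum_mono)
      fix i
      have "diam_pow u (U i) \<le> ennreal (diameter (U i) powr u)" using u by (simp add: diam_pow_def)
      also have "\<dots> \<le> ennreal (h powr u)" using dU u by (intro ennreal_leI powr_mono2) (auto intro: diameter_ge_0)
      finally show "diam_pow u (U i) \<le> ennreal (h powr u)" .
    qed
    also have "\<dots> = ennreal (\<Sum>i<k. h powr u)" by (rule sum_ennreal) simp
    also have "(\<Sum>i<k. h powr u) = (3 * M) powr u * real k powr (1 - u)"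
      unfolding h_def using k by (simp add: powr_divide powr_diff)
    finally show ?thesis .
  qed
  have "((\<lambda>k. (3 * M) powr u * real k powr (1 - u)) \<longlongrightarrow> (3 * M) powr u * 0) sequentially"
    using u by (intro tendsto_intros tendsto_neg_powr filterlim_real_sequentially) auto
  then have lim: "((\<lambda>k. ennreal ((3 * M) powr u * real k powr (1 - u))) \<longlongrightarrow> ennreal 0) sequentially"
    by (intro tendsto_ennrealI) simp
  obtain k0 :: nat where k0: "3 * M / \<delta> < real k0" using reals_Archimedean2 by blast
  have "hausdorff_approx u \<delta> A \<le> ennreal 0"
  proof (rule LIMSEQ_le_const[OF lim], rule exI[of _ "Suc k0"], intro allI impI)
    fix k assume "Suc k0 \<le> k"
    then have k: "k > 0" "3 * M / \<delta> \<le> real k" using k0 by auto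
    then have "3 * M / real k \<le> \<delta>" using d by (simp add: field_simps)
    then show "hausdorff_approx u \<delta> A \<le> ennreal ((3 * M) powr u * real k powr (1 - u))" by (rule bound[OF k(1)])
  qed
  then show "hausdorff_approx u \<delta> A = 0" by simp
qed

lemma hausdorff_dim_real_le:
  fixes A :: "real set"
  assumes "bounded A"
  shows "hausdorff_dim A \<le> 1"
proof (rule ereal_le_epsilon2)
  fix e :: real assume e: "e > 0"
  have "hausdorff_dim A \<le> ereal (1 + e)"
    using e by (intro hausdorff_dim_le hausdorff_measure_real_zero[OF assms]) auto
  then show "hausdorff_dim A \<le> 1 + ereal e" by (simp add: one_ereal_def)
qed

lemma hausdorff_measure_below_dim:
  assumes "0 \<le> t" "ereal t < hausdorff_dim A"
  shows "hausdorff_measure t A \<noteq> 0"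
proof
  assume "hausdorff_measure t A = 0"
  then have "hausdorff_dim A \<le> ereal t" by (rule hausdorff_dim_le[OF assms(1)])
  then show False using assms(2) by (simp add: leD)
qed

section \<open>Sublevel sets in dimension at least two\<close>

text \<open>Sublevel sets of a quadratic form grow like a power of the radius, while shells are
  prescribed by the squared radius. From exponent 2 on, the volume of a shell is linear in the
  difference of squares, even near radius 0; this is where two dimensions enter.\<close>

lemma power_diff_le_square_diff:
  fixes u w :: real
  assumes "0 \<le> w" "w \<le> u"
  shows "u ^ (k + 2) - w ^ (k + 2) \<le> real (k + 2) * u ^ k * (u\<^sup>2 - w\<^sup>2)"
proof (induction k)
  case 0
  have "w\<^sup>2 \<le> u\<^sup>2" using assms by (intro power_mono) auto
  then show ?case by (simp add: power2_eq_square)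
next
  case (Suc k)
  have e: "u ^ (Suc k + 2) - w ^ (Suc k + 2) = u * (u ^ (k + 2) - w ^ (k + 2)) + w ^ Suc k * (w * (u - w))"
    by (simp add: algebra_simps)
  have a: "u * (u ^ (k + 2) - w ^ (k + 2)) \<le> u * (real (k + 2) * u ^ k * (u\<^sup>2 - w\<^sup>2))"
    using Suc assms by (intro mult_left_mono) auto
  have "w * (u - w) \<le> (u + w) * (u - w)" using assms by (intro mult_right_mono) auto
  then have "w * (u - w) \<le> u\<^sup>2 - w\<^sup>2" by (simp add: power2_eq_square algebra_simps)
  moreover have "w ^ Suc k \<le> u ^ Suc k" using assms by (intro power_mono) auto
  ultimately have b: "w ^ Suc k * (w * (u - w)) \<le> u ^ Suc k * (u\<^sup>2 - w\<^sup>2)"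
    using assms by (intro mult_mono) auto
  have "u * (real (k + 2) * u ^ k * (u\<^sup>2 - w\<^sup>2)) + u ^ Suc k * (u\<^sup>2 - w\<^sup>2) = real (Suc k + 2) * u ^ Suc k * (u\<^sup>2 - w\<^sup>2)"
    by (simp add: algebra_simps)
  then show ?case using a b e by linarith
qed

lemma pos_form_coercive:
  fixes q :: "'p::euclidean_space \<Rightarrow> real"
  assumes cont: "continuous_on UNIV q" and hom: "\<And>r x. q (r *\<^sub>R x) = r\<^sup>2 * q x" and pos: "\<And>x. x \<noteq> 0 \<Longrightarrow> q x > 0"
  shows "\<exists>lam>0. \<forall>x. lam * (norm x)\<^sup>2 \<le> q x"
proof -
  have "sphere (0::'p) 1 \<noteq> {}" by simp
  then obtain z where z: "z \<in> sphere 0 1" "\<And>y. y \<in> sphere 0 1 \<Longrightarrow> q z \<le> q y"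
    using continuous_attains_inf[OF compact_sphere _ continuous_on_subset[OF cont subset_UNIV]] by blast
  have "q z * (norm x)\<^sup>2 \<le> q x" for x
  proof (cases "x = 0")
    case True
    then show ?thesis using hom[of 0 0] by simp
  next
    case False
    have "q x = q (norm x *\<^sub>R sgn x)" using False by (simp add: sgn_div_norm)
    also have "\<dots> = (norm x)\<^sup>2 * q (sgn x)" by (rule hom)
    finally have "q x = (norm x)\<^sup>2 * q (sgn x)" .
    moreover have "q z \<le> q (sgn x)" using False by (intro z) (simp add: norm_sgn)
    ultimately show ?thesis by (simp add: mult.commute mult_right_mono)
  qed
  moreover have "z \<noteq> 0" using z(1) by auto
  ultimately show ?thesis using pos by blast
qed

lemma form_sublevel_scale:
  fixes q :: "'p::euclidean_space \<Rightarrow> real"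
  assumes cont: "continuous_on UNIV q" and hom: "\<And>r x. q (r *\<^sub>R x) = r\<^sup>2 * q x" and r: "r > 0"
  shows "emeasure lborel {s. q (s - p) \<le> r\<^sup>2} = ennreal (r ^ DIM('p)) * emeasure lborel {x. q x \<le> 1}"
proof -
  have [measurable]: "q \<in> borel_measurable borel" by (rule borel_measurable_continuous_onI[OF cont])
  have im: "{s. q (s - p) \<le> r\<^sup>2} = (\<lambda>x. r *\<^sub>R x + p) ` {x. q x \<le> 1}"
  proof (intro equalityI subsetI)
    fix s assume s: "s \<in> {s. q (s - p) \<le> r\<^sup>2}"
    have "q ((1 / r) *\<^sub>R (s - p)) = (1 / r)\<^sup>2 * q (s - p)" by (rule hom)
    also have "\<dots> \<le> (1 / r)\<^sup>2 * r\<^sup>2" using s by (intro mult_left_mono) auto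
    also have "\<dots> = 1" using r by (simp add: power_divide)
    finally have "q ((1 / r) *\<^sub>R (s - p)) \<le> 1" .
    then show "s \<in> (\<lambda>x. r *\<^sub>R x + p) ` {x. q x \<le> 1}"
      using r by (intro image_eqI[of _ _ "(1 / r) *\<^sub>R (s - p)"]) auto
  next
    fix s assume "s \<in> (\<lambda>x. r *\<^sub>R x + p) ` {x. q x \<le> 1}"
    then obtain x where x: "s = r *\<^sub>R x + p" "q x \<le> 1" by blast
    have "q (s - p) = r\<^sup>2 * q x" using x(1) hom by simp
    also have "\<dots> \<le> r\<^sup>2 * 1" using x by (intro mult_left_mono) auto
    finally show "s \<in> {s. q (s - p) \<le> r\<^sup>2}" by simp
  qed
  have B: "{x. q x \<le> 1} \<in> sets lborel" "{s. q (s - p) \<le> r\<^sup>2} \<in> sets lborel" by measurable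
  have "emeasure lebesgue {s. q (s - p) \<le> r\<^sup>2} = \<bar>r\<bar> ^ DIM('p) * emeasure lebesgue {x. q x \<le> 1}"
    unfolding im by (rule emeasure_lebesgue_affine)
  then show ?thesis using B r by (simp add: ennreal_power)
qed

text \<open>A shell lies in the difference of two ellipsoids with the same centre \<open>p\<close>,
  whose volumes are known by scaling. The constant is uniform in the centre and in all heights
  \<open>h \<le> H\<close>.\<close>

lemma form_shell_measure:
  fixes q :: "'p::euclidean_space \<Rightarrow> real"
  assumes cont: "continuous_on UNIV q" and hom: "\<And>r x. q (r *\<^sub>R x) = r\<^sup>2 * q x" and pos: "\<And>x. x \<noteq> 0 \<Longrightarrow> q x > 0"
    and dim: "DIM('p) \<ge> 2" and H: "H \<ge> 0"
  shows "\<exists>C\<ge>0. \<forall>p h e. 0 < e \<longrightarrow> e \<le> 1 \<longrightarrow> h \<le> H \<longrightarrow>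
    emeasure lborel {s. \<bar>q (s - p) - h\<bar> \<le> e} \<le> ennreal (C * e)"
proof -
  have [measurable]: "q \<in> borel_measurable borel" by (rule borel_measurable_continuous_onI[OF cont])
  obtain lam where lam: "lam > 0" "\<And>x. lam * (norm x)\<^sup>2 \<le> q x" using pos_form_coercive[OF cont hom pos] by blast
  have "{x. q x \<le> 1} \<subseteq> cball 0 (sqrt (1 / lam))"
  proof
    fix x assume "x \<in> {x. q x \<le> 1}"
    then have "lam * (norm x)\<^sup>2 \<le> 1" using lam(2)[of x] by simp
    then have "(norm x)\<^sup>2 \<le> 1 / lam" using lam(1) by (simp add: field_simps)
    then show "x \<in> cball 0 (sqrt (1 / lam))" by (simp add: real_le_rsqrt)
  qed
  then have "bounded {x. q x \<le> 1}" using bounded_cball bounded_subset by blast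
  then have fin: "emeasure lborel {x. q x \<le> 1} < top" using emeasure_bounded_finite by fastforce
  define V where "V = measure lborel {x. q x \<le> 1}"
  have V: "emeasure lborel {x. q x \<le> 1} = ennreal V" "V \<ge> 0"
    unfolding V_def using fin by (auto intro!: emeasure_eq_ennreal_measure)
  obtain k where k: "DIM('p) = k + 2" using dim by (metis add.commute le_Suc_ex)
  define U where "U = H + 1"
  have U: "U \<ge> 1" unfolding U_def using H by simp
  define C where "C = 3 * real (k + 2) * U ^ k * V"
  have C: "C \<ge> 0" unfolding C_def using U V by simp
  have "emeasure lborel {s. \<bar>q (s - p) - h\<bar> \<le> e} \<le> ennreal (C * e)" if e: "0 < e" "e \<le> 1" and h: "h \<le> H" for p h e
  proof (cases "h + e \<le> 0")
    case True
    have "{s. \<bar>q (s - p) - h\<bar> \<le> e} \<subseteq> {p}"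
    proof
      fix s assume "s \<in> {s. \<bar>q (s - p) - h\<bar> \<le> e}"
      then have "q (s - p) \<le> 0" using True by auto
      then show "s \<in> {p}" using pos[of "s - p"] by auto
    qed
    then have "emeasure lborel {s. \<bar>q (s - p) - h\<bar> \<le> e} \<le> emeasure lborel {p}" by (intro emeasure_mono) auto
    then show ?thesis by simp
  next
    case False
    define u where "u = sqrt (h + e)"
    have u: "u > 0" "u\<^sup>2 = h + e" unfolding u_def using False by auto
    have "u\<^sup>2 \<le> U" unfolding u U_def using h e by simp
    also have "U \<le> U\<^sup>2" using U by (simp add: power2_eq_square)
    finally have uU: "u \<le> U" by (rule power2_le_imp_le) (use U in simp)
    have up: "u ^ k \<le> U ^ k" using u uU by (intro power_mono) auto
    have mu: "emeasure lborel {s. q (s - p) \<le> u\<^sup>2} = ennreal (u ^ (k + 2) * V)"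
      using form_sublevel_scale[OF cont hom u(1), of p] V u by (simp add: k ennreal_mult)
    show ?thesis
    proof (cases "h - 2 * e \<le> 0")
      case True
      have "emeasure lborel {s. \<bar>q (s - p) - h\<bar> \<le> e} \<le> emeasure lborel {s. q (s - p) \<le> u\<^sup>2}"
        unfolding u by (intro emeasure_mono) auto
      also have "\<dots> \<le> ennreal (C * e)" unfolding mu
      proof (rule ennreal_leI)
        have "u ^ (k + 2) = u ^ k * u\<^sup>2" by (rule power_add)
        also have "\<dots> \<le> U ^ k * (3 * e)" using up u True U e False by (intro mult_mono) auto
        also have "\<dots> = 1 * (U ^ k * (3 * e))" by simp
        also have "\<dots> \<le> real (k + 2) * (U ^ k * (3 * e))" using U e by (intro mult_right_mono) auto
        finally have "u ^ (k + 2) * V \<le> real (k + 2) * (U ^ k * (3 * e)) * V" using V by (intro mult_right_mono) auto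
        then show "u ^ (k + 2) * V \<le> C * e" unfolding C_def by (simp only: mult_ac)
      qed
      finally show ?thesis .
    next
      case False
      \<comment> \<open>\<open>h - 2 * e\<close> instead of \<open>h - e\<close>: the ellipsoid to
        be removed is closed and must not contain the inner boundary of the shell. Hence the
        thickness \<open>3 * e\<close>.\<close>
      define v where "v = sqrt (h - 2 * e)"
      have v: "v > 0" "v\<^sup>2 = h - 2 * e" unfolding v_def using False by auto
      have vu: "v \<le> u" unfolding u_def v_def using e by simp
      have mv: "emeasure lborel {s. q (s - p) \<le> v\<^sup>2} = ennreal (v ^ (k + 2) * V)"
        using form_sublevel_scale[OF cont hom v(1), of p] V v by (simp add: k ennreal_mult)
      have "emeasure lborel {s. \<bar>q (s - p) - h\<bar> \<le> e} \<le> emeasure lborel ({s. q (s - p) \<le> u\<^sup>2} - {s. q (s - p) \<le> v\<^sup>2})"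
        unfolding u v using e by (intro emeasure_mono) auto
      also have "\<dots> = emeasure lborel {s. q (s - p) \<le> u\<^sup>2} - emeasure lborel {s. q (s - p) \<le> v\<^sup>2}"
      proof (rule emeasure_Diff)
        show "emeasure lborel {s. q (s - p) \<le> v\<^sup>2} \<noteq> \<infinity>" unfolding mv by simp
        have "v\<^sup>2 \<le> u\<^sup>2" using v vu by (intro power_mono) auto
        then show "{s. q (s - p) \<le> v\<^sup>2} \<subseteq> {s. q (s - p) \<le> u\<^sup>2}" by auto
      qed measurable
      also have "\<dots> = ennreal (u ^ (k + 2) * V - v ^ (k + 2) * V)"
        unfolding mu mv using v V by (intro ennreal_minus) auto
      also have "\<dots> \<le> ennreal (C * e)"
      proof (rule ennreal_leI)
        have "u ^ (k + 2) - v ^ (k + 2) \<le> real (k + 2) * u ^ k * (u\<^sup>2 - v\<^sup>2)"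
          using v vu by (intro power_diff_le_square_diff) auto
        also have "u\<^sup>2 - v\<^sup>2 = 3 * e" unfolding u v by simp
        also have "real (k + 2) * u ^ k * (3 * e) \<le> real (k + 2) * U ^ k * (3 * e)"
          using up e by (intro mult_right_mono mult_left_mono) auto
        finally have "(u ^ (k + 2) - v ^ (k + 2)) * V \<le> real (k + 2) * U ^ k * (3 * e) * V" using V by (intro mult_right_mono) auto
        also have "real (k + 2) * U ^ k * (3 * e) * V = C * e" unfolding C_def by (simp only: mult_ac)
        finally show "u ^ (k + 2) * V - v ^ (k + 2) * V \<le> C * e" by (simp only: left_diff_distrib)
      qed
      finally show ?thesis .
    qed
  qed
  then show ?thesis using C by blast
qed

text \<open>On each line parallel to \<open>d\<close> the function is a quadratic whose slope
  exceeds \<open>\<sigma>\<close> inside the ball, so \<open>quadratic_sublevel\<close> bounds every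
  unit segment. Only segments starting in the ball of radius \<open>\<rho> + 1\<close> can reach the
  set.\<close>

lemma directional_slope_sublevel:
  fixes f :: "'p::euclidean_space \<Rightarrow> real"
  assumes [measurable]: "f \<in> borel_measurable borel" and d: "norm d = 1" and \<sigma>: "\<sigma> > 0" and \<delta>: "\<delta> \<ge> 0"
    and along: "\<And>s \<tau>. f (s + \<tau> *\<^sub>R d) = f s + \<beta> s * \<tau> + \<kappa> * \<tau>\<^sup>2"
    and slope: "\<And>s \<tau>. norm (s + \<tau> *\<^sub>R d) \<le> \<rho> \<Longrightarrow> \<sigma> < \<bar>\<beta> s + 2 * \<kappa> * \<tau>\<bar>"
  shows "emeasure lborel {s\<in>cball 0 \<rho>. \<bar>f s\<bar> \<le> \<delta>} \<le> ennreal (4 * \<delta> / \<sigma>) * emeasure lborel (cball (0::'p) (\<rho> + 1))"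
proof -
  define G where "G = {s\<in>cball 0 \<rho>. \<bar>f s\<bar> \<le> \<delta>}"
  have G: "G \<in> sets borel" unfolding G_def by measurable
  have "emeasure lborel {\<tau> \<in> {0..<1}. s + \<tau> *\<^sub>R d \<in> G} \<le> ennreal (4 * \<delta> / \<sigma>) * indicator (cball 0 (\<rho> + 1)) s" for s
  proof (cases "s \<in> cball 0 (\<rho> + 1)")
    case True
    have "{\<tau> \<in> {0..<1}. s + \<tau> *\<^sub>R d \<in> G} \<subseteq> {\<tau>. \<bar>f s + \<beta> s * \<tau> + \<kappa> * \<tau>\<^sup>2\<bar> \<le> \<delta> \<and> \<sigma> < \<bar>\<beta> s + 2 * \<kappa> * \<tau>\<bar>}"
      unfolding G_def using slope[of s] along[of s] by auto
    then have "emeasure lborel {\<tau> \<in> {0..<1}. s + \<tau> *\<^sub>R d \<in> G} \<le> emeasure lborel {\<tau>. \<bar>f s + \<beta> s * \<tau> + \<kappa> * \<tau>\<^sup>2\<bar> \<le> \<delta> \<and> \<sigma> < \<bar>\<beta> s + 2 * \<kappa> * \<tau>\<bar>}"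
      by (rule emeasure_mono) measurable
    also have "\<dots> \<le> ennreal (4 * \<delta> / \<sigma>)" by (rule quadratic_sublevel[OF \<delta> \<sigma>])
    finally show ?thesis using True by simp
  next
    case False
    have "s + \<tau> *\<^sub>R d \<notin> G" if "\<tau> \<in> {0..<1}" for \<tau>
    proof
      assume "s + \<tau> *\<^sub>R d \<in> G"
      then have "norm (s + \<tau> *\<^sub>R d) \<le> \<rho>" unfolding G_def by simp
      moreover have "norm s \<le> norm (s + \<tau> *\<^sub>R d) + norm (\<tau> *\<^sub>R d)" using norm_triangle_ineq4[of "s + \<tau> *\<^sub>R d" "\<tau> *\<^sub>R d"] by simp
      moreover have "norm (\<tau> *\<^sub>R d) \<le> 1" using that d by simp
      ultimately show False using False by simp
    qed
    then have "{\<tau> \<in> {0..<1}. s + \<tau> *\<^sub>R d \<in> G} = {}" by blast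
    then show ?thesis by (simp only: emeasure_empty) simp
  qed
  then have "emeasure lborel G \<le> (\<integral>\<^sup>+s. ennreal (4 * \<delta> / \<sigma>) * indicator (cball 0 (\<rho> + 1)) s \<partial>(lborel::'p measure))"
    unfolding emeasure_line_average[OF G, of d] by (rule nn_integral_mono)
  also have "\<dots> = ennreal (4 * \<delta> / \<sigma>) * emeasure lborel (cball (0::'p) (\<rho> + 1))" by (simp add: nn_integral_cmult_indicator)
  finally show ?thesis unfolding G_def .
qed

text \<open>Three regimes, according to the dominant coefficient. If \<open>b\<close> dominates,
  completing the square yields a shell of ellipsoids. If \<open>v\<close> dominates, the slope in
  the direction of \<open>v\<close> is bounded below. If \<open>r\<close> dominates, the function is
  too large on the ball for the sublevel set to be nonempty, unless \<open>\<delta>\<close> is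
  comparable to the coefficients.\<close>

lemma quadratic_family_sublevel:
  fixes S :: "'p::euclidean_space \<Rightarrow> 'p"
  assumes lin: "linear S" and sym: "\<And>x y. x \<bullet> S y = y \<bullet> S x" and pos: "\<And>x. x \<noteq> 0 \<Longrightarrow> 0 < x \<bullet> S x"
    and dim: "DIM('p) \<ge> 2" and \<rho>: "\<rho> \<ge> 0"
  shows "\<exists>C\<ge>0. \<forall>r v b \<delta>. \<delta> > 0 \<longrightarrow> 0 < \<bar>r\<bar> + norm v + \<bar>b\<bar> \<longrightarrow>
    emeasure lborel {s\<in>cball 0 \<rho>. \<bar>r + v \<bullet> s + b * (s \<bullet> S s / 2)\<bar> \<le> \<delta>} \<le> ennreal (C * \<delta> / (\<bar>r\<bar> + norm v + \<bar>b\<bar>))"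
proof -
  define q where "q x = x \<bullet> S x / 2" for x
  interpret S: linear S by (rule lin)
  have contS: "continuous_on UNIV S" using lin by (simp add: linear_continuous_on linear_conv_bounded_linear)
  have cont: "continuous_on UNIV q" unfolding q_def by (intro continuous_intros contS) simp
  have [measurable]: "q \<in> borel_measurable borel" by (rule borel_measurable_continuous_onI[OF cont])
  have hom: "q (r *\<^sub>R x) = r\<^sup>2 * q x" for r x unfolding q_def by (simp add: S.scaleR power2_eq_square)
  have q0: "0 \<le> q x" for x using pos[of x] unfolding q_def by (cases "x = 0") auto
  have qpos: "x \<noteq> 0 \<Longrightarrow> q x > 0" for x using pos[of x] unfolding q_def by simp
  have add: "q (x + y) = q x + x \<bullet> S y + q y" for x y
    unfolding q_def using sym[of y x] by (simp add: S.add inner_add_left inner_add_right field_simps)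
  obtain B where B: "B > 0" "\<And>x. norm (S x) \<le> B * norm x" using linear_bounded_pos[OF lin] by blast
  have qB: "q x \<le> B * (norm x)\<^sup>2" for x
  proof -
    have "x \<bullet> S x \<le> norm x * norm (S x)" by (rule norm_cauchy_schwarz)
    also have "\<dots> \<le> norm x * (B * norm x)" using B by (intro mult_left_mono) auto
    finally have "x \<bullet> S x \<le> B * (norm x)\<^sup>2" by (simp add: power2_eq_square mult_ac)
    moreover have "0 \<le> B * (norm x)\<^sup>2" using B by simp
    ultimately show ?thesis unfolding q_def by linarith
  qed
  have "x = 0" if "S x = 0" for x
    using pos[of x] that by force
  then have inj: "inj S" using linear_injective_0[OF lin] by blast
  have surj: "surj S" using linear_injective_imp_surjective[OF lin inj] by simp
  obtain \<kappa> where \<kappa>: "\<kappa> > 0" "\<And>x. \<kappa> * norm x \<le> norm (S x)" using linear_inj_bounded_below_pos[OF lin inj] by blast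
  define Q where "Q = B * \<rho>\<^sup>2"
  have Q0: "Q \<ge> 0" unfolding Q_def using B by simp
  have Qs: "q s \<le> Q" if "norm s \<le> \<rho>" for s
  proof -
    have "B * (norm s)\<^sup>2 \<le> Q" unfolding Q_def using B that by (intro mult_left_mono power_mono) auto
    then show "q s \<le> Q" using qB[of s] by linarith
  qed
  note Q = Q0 Qs
  \<comment> \<open>The thresholds between the regimes. When both \<open>v\<close> and
    \<open>b\<close> are below theirs, \<open>a1 * (1 + \<rho>) = 1/4\<close> and
    \<open>a * (1 + Q) \<le> 1/4\<close> leave at least \<open>n / 2\<close> for the absolute value
    of the function. The second entry of the minimum in \<open>a\<close> keeps the contribution of
    \<open>b\<close> to the slope along \<open>v\<close> below half the threshold
    \<open>a1 * n\<close>.\<close>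
  define a1 where "a1 = 1 / (4 * (1 + \<rho>))"
  define a where "a = min (1 / (4 * (1 + Q))) (a1 / (2 * (B * \<rho> + 1)))"
  have a1: "a1 > 0" "a1 * (1 + \<rho>) = 1 / 4" unfolding a1_def using \<rho> by (auto simp: field_simps)
  have Brho: "B * \<rho> + 1 > 0" using B \<rho> by (simp add: add_nonneg_pos)
  have canc: "(x / (c * k)) * k = x / c" if "k > 0" for x c k :: real using that by simp
  have Q1: "1 + Q > 0" using Q0 by simp
  have a: "a > 0" "a * (1 + Q) \<le> 1 / 4" "a * (B * \<rho>) \<le> a1 / 2"
  proof -
    show "a > 0" unfolding a_def using Q a1 Brho by simp
    have "a * (1 + Q) \<le> (1 / (4 * (1 + Q))) * (1 + Q)" unfolding a_def using Q by (intro mult_right_mono) auto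
    then show "a * (1 + Q) \<le> 1 / 4" unfolding canc[OF Q1] .
    have "a * (B * \<rho>) \<le> a * (B * \<rho> + 1)" using \<open>a > 0\<close> by simp
    also have "\<dots> \<le> (a1 / (2 * (B * \<rho> + 1))) * (B * \<rho> + 1)" unfolding a_def using Brho by (intro mult_right_mono) auto
    finally show "a * (B * \<rho>) \<le> a1 / 2" unfolding canc[OF Brho] .
  qed
  \<comment> \<open>Bounds the height \<open>h\<close> after completing the square: the centre has
    norm at most \<open>1 / (\<kappa> * a)\<close>, and \<open>r / b\<close> is at most
    \<open>1 / a\<close> in absolute value.\<close>
  define H where "H = B * (1 / (\<kappa> * a))\<^sup>2 + 1 / a"
  have H: "H \<ge> 0" unfolding H_def using B a by simp
  obtain C0 where C0: "C0 \<ge> 0" "\<And>p h e. 0 < e \<Longrightarrow> e \<le> 1 \<Longrightarrow> h \<le> H \<Longrightarrow> emeasure lborel {s. \<bar>q (s - p) - h\<bar> \<le> e} \<le> ennreal (C0 * e)"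
    using form_shell_measure[OF cont hom qpos dim H] by blast
  define V where "V = measure lborel (cball (0::'p) (\<rho> + 1))"
  have fin: "emeasure lborel (cball (0::'p) (\<rho> + 1)) < top" using emeasure_lborel_cball_finite[of "0::'p" "\<rho> + 1"] by simp
  have V: "emeasure lborel (cball (0::'p) (\<rho> + 1)) = ennreal V" "V \<ge> 0"
    unfolding V_def using fin by (auto intro!: emeasure_eq_ennreal_measure)
  define C where "C = C0 / a + V / a + 16 * V / a1 + 2 * V"
  have Cs: "C0 / a \<le> C" "V / a \<le> C" "16 * V / a1 \<le> C" "2 * V \<le> C" "C \<ge> 0"
    unfolding C_def using C0(1) V(2) a(1) a1(1) by simp_all
  have "emeasure lborel {s\<in>cball 0 \<rho>. \<bar>r + v \<bullet> s + b * q s\<bar> \<le> \<delta>} \<le> ennreal (C * \<delta> / (\<bar>r\<bar> + norm v + \<bar>b\<bar>))"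
    if \<delta>: "\<delta> > 0" and n0: "0 < \<bar>r\<bar> + norm v + \<bar>b\<bar>" for r v b \<delta>
  proof -
    define n where "n = \<bar>r\<bar> + norm v + \<bar>b\<bar>"
    have n: "n > 0" unfolding n_def using n0 .
    define f where "f s = r + v \<bullet> s + b * q s" for s
    have [measurable]: "f \<in> borel_measurable borel" unfolding f_def by measurable
    define G where "G = {s\<in>cball 0 \<rho>. \<bar>f s\<bar> \<le> \<delta>}"
    have GV: "emeasure lborel G \<le> ennreal V"
      unfolding V(1)[symmetric] G_def by (intro emeasure_mono) auto
    have up: "emeasure lborel G \<le> ennreal (C * \<delta> / n)" if "emeasure lborel G \<le> ennreal (c * \<delta> / n)" "c \<le> C" for c
    proof -
      have "c * \<delta> / n \<le> C * \<delta> / n" using that n \<delta> by (intro divide_right_mono mult_right_mono) auto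
      then show ?thesis using that(1) by (meson ennreal_leI order_trans)
    qed
    \<comment> \<open>When \<open>n\<close> is at most a multiple of \<open>\<delta>\<close>, the
      claimed bound already exceeds the volume of the ball.\<close>
    have triv: "emeasure lborel G \<le> ennreal (C * \<delta> / n)" if "n \<le> c * \<delta>" "V * c \<le> C" for c
    proof (rule up[OF _ that(2)])
      have "V * 1 \<le> V * (c * \<delta> / n)" using that n V by (intro mult_left_mono) auto
      then show "emeasure lborel G \<le> ennreal (V * c * \<delta> / n)" using GV by (simp add: mult.assoc) (meson ennreal_leI order_trans)
    qed
    have "emeasure lborel G \<le> ennreal (C * \<delta> / n)"
    proof (cases "\<bar>b\<bar> \<ge> a * n")
      case True
      have an: "a * n > 0" using a n by simp
      then have b: "\<bar>b\<bar> > 0" using True by linarith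
      show ?thesis
      proof (cases "\<delta> / \<bar>b\<bar> \<le> 1")
        case False
        then have "\<bar>b\<bar> < \<delta>" using b by (simp add: field_simps)
        then have "a * n \<le> \<delta>" using True by linarith
        then have "n \<le> (1 / a) * \<delta>" using a by (simp add: field_simps)
        then show ?thesis by (rule triv) (use Cs in simp)
      next
        case e1: True
        \<comment> \<open>The critical point of the quadratic, about which the square is
          completed.\<close>
        obtain p where p: "S p = - (1 / b) *\<^sub>R v" using surj by (metis surjD)
        define h where "h = q p - r / b"
        have f: "f s = b * (q (s - p) - h)" for s
        proof -
          have "q (s - p) = q (s + (- 1) *\<^sub>R p)" by simp
          also have "\<dots> = q s + s \<bullet> S ((- 1) *\<^sub>R p) + q ((- 1) *\<^sub>R p)" by (rule add)
          also have "\<dots> = q s - s \<bullet> S p + q p" by (simp only: S.scaleR hom) simp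
          also have "s \<bullet> S p = - (1 / b) * (v \<bullet> s)" unfolding p by (simp add: inner_commute)
          finally have "q (s - p) = q s + (v \<bullet> s) / b + q p" by simp
          then show ?thesis unfolding f_def h_def using b by (simp add: field_simps)
        qed
        have "\<bar>r\<bar> \<le> n" "norm v \<le> n" unfolding n_def by auto
        have nb: "n / \<bar>b\<bar> \<le> 1 / a" using True a b by (simp add: field_simps)
        have "\<kappa> * norm p \<le> norm (S p)" by (rule \<kappa>)
        also have "\<dots> = norm v / \<bar>b\<bar>" unfolding p by simp
        also have "\<dots> \<le> n / \<bar>b\<bar>" using \<open>norm v \<le> n\<close> b by (intro divide_right_mono) auto
        finally have "\<kappa> * norm p \<le> 1 / a" using nb by linarith
        then have "norm p \<le> 1 / (\<kappa> * a)" using \<kappa> a by (simp add: field_simps)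
        then have "B * (norm p)\<^sup>2 \<le> B * (1 / (\<kappa> * a))\<^sup>2" using B by (intro mult_left_mono power_mono) auto
        then have qp: "q p \<le> B * (1 / (\<kappa> * a))\<^sup>2" using qB[of p] by linarith
        have "- (r / b) \<le> \<bar>r\<bar> / \<bar>b\<bar>" using abs_ge_minus_self[of "r / b"] by (simp only: abs_divide)
        also have "\<dots> \<le> n / \<bar>b\<bar>" using \<open>\<bar>r\<bar> \<le> n\<close> b by (intro divide_right_mono) auto
        finally have hH: "h \<le> H" unfolding h_def H_def using nb qp by linarith
        have "G \<subseteq> {s. \<bar>q (s - p) - h\<bar> \<le> \<delta> / \<bar>b\<bar>}"
          unfolding G_def f abs_mult using b by (auto simp: pos_le_divide_eq mult.commute)
        then have "emeasure lborel G \<le> emeasure lborel {s. \<bar>q (s - p) - h\<bar> \<le> \<delta> / \<bar>b\<bar>}" by (rule emeasure_mono) measurable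
        also have "\<dots> \<le> ennreal (C0 * (\<delta> / \<bar>b\<bar>))" using \<delta> b e1 hH by (intro C0(2)) auto
        also have "\<dots> \<le> ennreal (C0 / a * \<delta> / n)"
        proof (rule ennreal_leI)
          have "\<delta> / \<bar>b\<bar> \<le> \<delta> / (a * n)" using True \<delta> by (intro divide_left_mono mult_pos_pos[OF b an]) auto
          then have "C0 * (\<delta> / \<bar>b\<bar>) \<le> C0 * (\<delta> / (a * n))" using C0 by (intro mult_left_mono) auto
          then show "C0 * (\<delta> / \<bar>b\<bar>) \<le> C0 / a * \<delta> / n" by simp
        qed
        finally show ?thesis by (rule up) (use Cs in simp)
      qed
    next
      case bs: False
      show ?thesis
      proof (cases "norm v \<ge> a1 * n")
        case True
        have "a1 * n > 0" using a1 n by simp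
        then have v: "v \<noteq> 0" using True by auto
        define d where "d = sgn v"
        have d: "norm d = 1" unfolding d_def using v by (simp add: norm_sgn)
        have vd: "v \<bullet> d = norm v" unfolding d_def sgn_div_norm using v by (simp add: power2_norm_eq_inner[symmetric] power2_eq_square)
        define \<beta> where "\<beta> s = v \<bullet> d + b * (s \<bullet> S d)" for s
        have "emeasure lborel G \<le> ennreal (4 * \<delta> / (a1 * n / 4)) * emeasure lborel (cball (0::'p) (\<rho> + 1))"
          unfolding G_def
        proof (rule directional_slope_sublevel[OF _ d, where \<beta> = \<beta> and \<kappa> = "b * q d"])
          show "f (s + \<tau> *\<^sub>R d) = f s + \<beta> s * \<tau> + b * q d * \<tau>\<^sup>2" for s \<tau>
            unfolding f_def \<beta>_def add hom S.scaleR by (simp add: inner_add_right algebra_simps)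
          fix s \<tau> assume "norm (s + \<tau> *\<^sub>R d) \<le> \<rho>"
          have "norm (S d) \<le> B" using B(2)[of d] d by simp
          have "\<bar>(s + \<tau> *\<^sub>R d) \<bullet> S d\<bar> \<le> norm (s + \<tau> *\<^sub>R d) * norm (S d)" by (rule Cauchy_Schwarz_ineq2)
          also have "\<dots> \<le> \<rho> * B" using \<open>norm (s + \<tau> *\<^sub>R d) \<le> \<rho>\<close> \<open>norm (S d) \<le> B\<close> \<rho> by (intro mult_mono) auto
          finally have "\<bar>b * ((s + \<tau> *\<^sub>R d) \<bullet> S d)\<bar> \<le> (a * n) * (\<rho> * B)"
            unfolding abs_mult using bs a n by (intro mult_mono) auto
          also have "\<dots> = (a * (B * \<rho>)) * n" by simp
          also have "\<dots> \<le> (a1 / 2) * n" using a n by (intro mult_right_mono) auto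
          finally have "\<bar>b * ((s + \<tau> *\<^sub>R d) \<bullet> S d)\<bar> \<le> a1 * n / 2" by simp
          moreover have "\<beta> s + 2 * (b * q d) * \<tau> = norm v + b * ((s + \<tau> *\<^sub>R d) \<bullet> S d)"
            unfolding \<beta>_def vd by (simp add: inner_add_left q_def algebra_simps)
          ultimately show "a1 * n / 4 < \<bar>\<beta> s + 2 * (b * q d) * \<tau>\<bar>" using True \<open>a1 * n > 0\<close> by linarith
        qed (use \<delta> a1 n in auto)
        also have "\<dots> = ennreal (4 * \<delta> / (a1 * n / 4) * V)"
          unfolding V(1) using \<delta> a1 n by (intro ennreal_mult'[symmetric]) auto
        also have "4 * \<delta> / (a1 * n / 4) * V = 16 * V / a1 * \<delta> / n" using a1 n by (simp add: field_simps)
        finally show ?thesis by (rule up) (use Cs in simp)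
      next
        case vs: False
        show ?thesis
        proof (cases "n \<le> 2 * \<delta>")
          case True
          then show ?thesis by (rule triv) (use Cs in simp)
        next
          case False
          have "\<not> \<bar>f s\<bar> \<le> \<delta>" if s: "norm s \<le> \<rho>" for s
          proof -
            have "\<bar>v \<bullet> s\<bar> \<le> norm v * norm s" by (rule Cauchy_Schwarz_ineq2)
            also have "\<dots> \<le> (a1 * n) * \<rho>" using vs s a1 n by (intro mult_mono) auto
            finally have 1: "\<bar>v \<bullet> s\<bar> \<le> a1 * n * \<rho>" .
            have "\<bar>b * q s\<bar> = \<bar>b\<bar> * q s" using q0 by (simp add: abs_mult)
            also have "\<dots> \<le> (a * n) * Q" using bs Q(2)[OF s] a n q0 by (intro mult_mono) auto
            finally have 2: "\<bar>b * q s\<bar> \<le> a * n * Q" .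
            have 3: "a1 * n + a1 * n * \<rho> = n / 4"
            proof -
              have "a1 * n + a1 * n * \<rho> = (a1 * (1 + \<rho>)) * n" by (simp add: algebra_simps)
              then show ?thesis unfolding a1(2) by simp
            qed
            have 4: "a * n + a * n * Q \<le> n / 4"
            proof -
              have "a * n + a * n * Q = (a * (1 + Q)) * n" by (simp add: algebra_simps)
              also have "\<dots> \<le> (1 / 4) * n" using a n by (intro mult_right_mono) auto
              finally show ?thesis by simp
            qed
            show ?thesis using 1 2 3 4 bs vs False n_def unfolding f_def by linarith
          qed
          then have "G = {}" unfolding G_def by auto
          then show ?thesis by simp
        qed
      qed
    qed
    then show ?thesis unfolding G_def f_def n_def .
  qed
  then show ?thesis using Cs(5) unfolding q_def by blast
qed

text \<open>The points at distance about \<open>2 ^ J * \<delta>\<close> have mass of order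
  \<open>(2 ^ J * \<delta>) powr t\<close> and kernel of order \<open>1 / 2 ^ J\<close>. As
  \<open>t < 1\<close>, the shells form a geometric series with ratio \<open>2 powr (t - 1)\<close>,
  dominated by the scale \<open>\<delta>\<close>.\<close>

lemma dyadic_kernel_sum:
  fixes w :: "'a::metric_space \<Rightarrow> real"
  assumes X: "finite X" and w: "\<And>x. 0 \<le> w x" and A: "A \<ge> 0" and t: "0 < t" "t < 1"
    and \<delta>: "\<delta> > 0" and V: "V \<ge> 0" and C: "C \<ge> 0"
    and mass: "\<And>r. r \<ge> \<delta> \<Longrightarrow> sum w {y\<in>X. dist x y \<le> r} \<le> A * r powr t"
  shows "(\<Sum>y\<in>X. w y * (if dist x y \<le> \<delta> then V else C * \<delta> / dist x y))
     \<le> A * (V + 2 * C / (1 - 2 powr (t - 1))) * \<delta> powr t"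
proof -
  define b where "b y = (if dist x y \<le> \<delta> then V else C * \<delta> / dist x y)" for y
  define \<theta> :: real where "\<theta> = 2 powr (t - 1)"
  have th: "0 < \<theta>" "\<theta> < 1" unfolding \<theta>_def using t by (auto intro: powr_less_one)
  have step: "(\<Sum>y\<in>{y\<in>X. dist x y \<le> 2 ^ J * \<delta>}. w y * b y) \<le> A * \<delta> powr t * (V + 2 * C * (\<Sum>i<J. \<theta> ^ i))" for J
  proof (induction J)
    case 0
    have "(\<Sum>y\<in>{y\<in>X. dist x y \<le> \<delta>}. w y * b y) = (\<Sum>y\<in>{y\<in>X. dist x y \<le> \<delta>}. w y) * V"
      by (simp add: b_def sum_distrib_right)
    also have "\<dots> \<le> (A * \<delta> powr t) * V" using mass[of \<delta>] V by (intro mult_right_mono) auto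
    finally show ?case by simp
  next
    case (Suc J)
    let ?a = "{y\<in>X. dist x y \<le> 2 ^ J * \<delta>}" and ?b = "{y\<in>X. 2 ^ J * \<delta> < dist x y \<and> dist x y \<le> 2 ^ Suc J * \<delta>}"
    have le: "2 ^ J * \<delta> \<le> 2 ^ Suc J * \<delta>" using \<delta> by simp
    have one: "\<delta> \<le> 2 ^ J * \<delta>" for J :: nat using \<delta> by simp
    have un: "{y\<in>X. dist x y \<le> 2 ^ Suc J * \<delta>} = ?a \<union> ?b" using le by (auto intro: order_trans)
    have pw: "(2 * 2 ^ J :: real) powr t \<le> 2 * (\<theta> ^ J * 2 ^ J)"
    proof -
      have "(2 * 2 ^ J :: real) powr t = 2 powr t * 2 powr (real J * t)"
        by (simp add: powr_mult powr_realpow[symmetric] powr_powr)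
      also have "2 powr (real J * t) = \<theta> ^ J * 2 ^ J"
        unfolding \<theta>_def by (simp add: powr_realpow[symmetric] powr_powr powr_add[symmetric] algebra_simps)
      also have "2 powr t * (\<theta> ^ J * 2 ^ J) \<le> 2 powr 1 * (\<theta> ^ J * 2 ^ J)"
        using t th by (intro mult_right_mono powr_mono) auto
      finally show ?thesis by simp
    qed
    have "(\<Sum>y\<in>?b. w y * b y) \<le> (\<Sum>y\<in>?b. w y * (C / 2 ^ J))"
    proof (intro sum_mono mult_left_mono w)
      fix y assume y: "y \<in> ?b"
      then have "\<not> dist x y \<le> \<delta>" using one[of J] by auto
      then have "b y = C * \<delta> / dist x y" by (simp add: b_def)
      also have "\<dots> \<le> C * \<delta> / (2 ^ J * \<delta>)"
      proof (rule divide_left_mono)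
        have "0 < 2 ^ J * \<delta>" using \<delta> by simp
        moreover have "2 ^ J * \<delta> < dist x y" using y by simp
        ultimately show "0 < dist x y * (2 ^ J * \<delta>)" "2 ^ J * \<delta> \<le> dist x y" by (auto intro: mult_pos_pos less_trans)
      qed (use C \<delta> in simp)
      also have "\<dots> = C / 2 ^ J" using \<delta> by simp
      finally show "b y \<le> C / 2 ^ J" .
    qed
    also have "\<dots> = sum w ?b * (C / 2 ^ J)" by (rule sum_distrib_right[symmetric])
    also have "\<dots> \<le> (A * (2 ^ Suc J * \<delta>) powr t) * (C / 2 ^ J)"
    proof (rule mult_right_mono)
      have "sum w ?b \<le> sum w {y\<in>X. dist x y \<le> 2 ^ Suc J * \<delta>}" using X w by (intro sum_mono2) auto
      then show "sum w ?b \<le> A * (2 ^ Suc J * \<delta>) powr t" using mass[OF one[of "Suc J"]] by linarith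
    qed (use C in simp)
    also have "(2 ^ Suc J * \<delta>) powr t = (2 * 2 ^ J) powr t * \<delta> powr t" by (simp only: powr_mult power_Suc)
    also have "A * ((2 * 2 ^ J) powr t * \<delta> powr t) * (C / 2 ^ J) \<le> A * (2 * (\<theta> ^ J * 2 ^ J) * \<delta> powr t) * (C / 2 ^ J)"
      using A C pw by (intro mult_right_mono mult_left_mono) auto
    also have "A * (2 * (\<theta> ^ J * 2 ^ J) * \<delta> powr t) * (C / 2 ^ J) = A * \<delta> powr t * (2 * C * \<theta> ^ J)" by simp
    finally have b: "(\<Sum>y\<in>?b. w y * b y) \<le> A * \<delta> powr t * (2 * C * \<theta> ^ J)" .
    have "(\<Sum>y\<in>?a \<union> ?b. w y * b y) = (\<Sum>y\<in>?a. w y * b y) + (\<Sum>y\<in>?b. w y * b y)"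
      using X by (intro sum.union_disjoint) auto
    also have "\<dots> \<le> A * \<delta> powr t * (V + 2 * C * (\<Sum>i<J. \<theta> ^ i)) + A * \<delta> powr t * (2 * C * \<theta> ^ J)"
      using Suc b by (rule add_mono)
    also have "\<dots> = A * \<delta> powr t * (V + 2 * C * (\<Sum>i<Suc J. \<theta> ^ i))" by (simp add: algebra_simps)
    finally show ?case unfolding un .
  qed
  have "\<exists>J::nat. \<forall>y\<in>X. dist x y \<le> 2 ^ J * \<delta>"
  proof -
    obtain J :: nat where J: "(\<Sum>y\<in>X. dist x y) / \<delta> < 2 ^ J" using real_arch_pow[of 2] by auto
    have "dist x y \<le> 2 ^ J * \<delta>" if "y \<in> X" for y
    proof -
      have "dist x y \<le> (\<Sum>y\<in>X. dist x y)" using X that by (intro member_le_sum) auto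
      then show ?thesis using J \<delta> by (simp add: field_simps)
    qed
    then show ?thesis by blast
  qed
  then obtain J :: nat where J: "\<And>y. y \<in> X \<Longrightarrow> dist x y \<le> 2 ^ J * \<delta>" by blast
  have "{y\<in>X. dist x y \<le> 2 ^ J * \<delta>} = X" using J by blast
  then have "(\<Sum>y\<in>X. w y * b y) \<le> A * \<delta> powr t * (V + 2 * C * (\<Sum>i<J. \<theta> ^ i))" using step[of J] by simp
  also have "\<dots> \<le> A * \<delta> powr t * (V + 2 * C * (1 / (1 - \<theta>)))"
  proof (intro mult_left_mono add_left_mono)
    have "(\<Sum>i<J. \<theta> ^ i) = (1 - \<theta> ^ J) / (1 - \<theta>)" using th by (subst sum_gp_strict) simp
    also have "\<dots> \<le> 1 / (1 - \<theta>)" using th by (intro divide_right_mono) auto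
    finally show "(\<Sum>i<J. \<theta> ^ i) \<le> 1 / (1 - \<theta>)" .
  qed (use A C in auto)
  finally show ?thesis unfolding b_def \<theta>_def by (simp add: algebra_simps)
qed

text \<open>The first moment is a double sum over pairs, each weighted by the measure of the
  parameters at which the pair shares a cell. Transversality bounds that measure by
  \<open>C * \<delta> / dist x y\<close>, the volume of \<open>D\<close> takes over for pairs within
  \<open>\<delta>\<close>, and \<open>dyadic_kernel_sum\<close> produces the decay
  \<open>\<delta> powr t\<close> with \<open>t > \<tau>\<close>.\<close>

lemma null_params_transversal:
  fixes K :: "'a::euclidean_space set" and pr :: "'p::euclidean_space \<Rightarrow> 'a \<Rightarrow> real"
  assumes K: "compact K" and cont: "continuous_on UNIV (\<lambda>(s, x). pr s x)" and D: "D \<in> sets borel"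
    and V: "V \<ge> 0" "emeasure lborel D \<le> ennreal V"
    and t: "0 < t" "t < 1" and pos: "hausdorff_measure t K \<noteq> 0" and \<tau>: "0 < \<tau>" "\<tau> < t"
    and C: "C \<ge> 0" and trans: "\<And>x y \<delta>. x \<noteq> y \<Longrightarrow> \<delta> > 0 \<Longrightarrow>
       emeasure lborel {s\<in>D. \<bar>pr s x - pr s y\<bar> \<le> \<delta>} \<le> ennreal (C * \<delta> / dist x y)"
  shows "emeasure lborel (null_params \<tau> K pr \<inter> D) = 0"
proof (rule null_params_null[OF K cont D t(1) pos \<tau>(1), of 1])
  fix A :: real assume A: "A \<ge> 0"
  define B where "B = A * (V + 2 * C / (1 - 2 powr (t - 1)))"
  have "2 powr (t - 1) < (1::real)" using t by (auto intro: powr_less_one)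
  then have B: "B \<ge> 0" unfolding B_def using A V C by simp
  have c: "continuous_on UNIV (\<lambda>s. pr s y)" for y
  proof -
    have "continuous_on UNIV ((\<lambda>(s, x). pr s x) \<circ> (\<lambda>s. (s, y)))"
      by (rule continuous_on_compose) (auto intro!: continuous_intros continuous_on_subset[OF cont])
    then show ?thesis by (simp add: o_def)
  qed
  have [measurable]: "(\<lambda>s. pr s y) \<in> borel_measurable borel" for y
    by (rule borel_measurable_continuous_onI[OF c])
  have [measurable]: "D \<in> sets borel" by (rule D)
  have main: "(\<integral>\<^sup>+s. ennreal (\<Sum>x\<in>X. w x * cellmass w X (pr s) \<delta> x powr 1) * indicator D s \<partial>lborel)
        \<le> ennreal (B * sum w X * \<delta> powr t)"
    if X: "finite X" and w: "\<And>x. 0 \<le> w x" and \<delta>: "\<delta> > 0"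
      and mass: "\<And>x r. r \<ge> \<delta> \<Longrightarrow> sum w {y\<in>X. dist x y \<le> r} \<le> A * r powr t"
    for X and w :: "'a \<Rightarrow> real" and \<delta>
  proof -
    define E where "E x y = {s\<in>D. \<bar>pr s x - pr s y\<bar> \<le> \<delta>}" for x y
    have [measurable]: "E x y \<in> sets borel" for x y unfolding E_def by measurable
    have cm: "ennreal (\<Sum>x\<in>X. w x * cellmass w X (pr s) \<delta> x powr 1) * indicator D s
       \<le> (\<Sum>x\<in>X. \<Sum>y\<in>X. ennreal (w x * w y) * indicator (E x y) s)" for s
    proof (cases "s \<in> D")
      case True
      have "(\<Sum>x\<in>X. w x * cellmass w X (pr s) \<delta> x powr 1) = (\<Sum>x\<in>X. \<Sum>y\<in>X. w x * w y * (if \<lfloor>pr s y / \<delta>\<rfloor> = \<lfloor>pr s x / \<delta>\<rfloor> then 1 else 0))"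
        unfolding cellmass_def using X w
        by (simp add: sum_nonneg sum.inter_filter sum_distrib_left if_distrib cong: if_cong)
      also have "\<dots> \<le> (\<Sum>x\<in>X. \<Sum>y\<in>X. w x * w y * indicator (E x y) s)"
      proof (intro sum_mono mult_left_mono)
        fix x y
        show "(if \<lfloor>pr s y / \<delta>\<rfloor> = \<lfloor>pr s x / \<delta>\<rfloor> then 1 else 0) \<le> (indicator (E x y) s :: real)"
        proof (cases "\<lfloor>pr s y / \<delta>\<rfloor> = \<lfloor>pr s x / \<delta>\<rfloor>")
          case eq: True
          have "\<bar>pr s x / \<delta> - pr s y / \<delta>\<bar> \<le> 1" using eq by linarith
          then have "\<bar>(pr s x - pr s y) / \<delta>\<bar> \<le> 1" by (simp add: diff_divide_distrib)
          then have "\<bar>pr s x - pr s y\<bar> \<le> \<delta>" using \<delta> by (simp add: abs_divide)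
          then show ?thesis using True by (simp add: E_def)
        qed simp
      qed (use w in simp)
      finally have "ennreal (\<Sum>x\<in>X. w x * cellmass w X (pr s) \<delta> x powr 1) \<le> ennreal (\<Sum>x\<in>X. \<Sum>y\<in>X. w x * w y * indicator (E x y) s)"
        by (rule ennreal_leI)
      also have "\<dots> = (\<Sum>x\<in>X. ennreal (\<Sum>y\<in>X. w x * w y * indicator (E x y) s))"
        using w by (intro sum_ennreal[symmetric] sum_nonneg mult_nonneg_nonneg) auto
      also have "\<dots> = (\<Sum>x\<in>X. \<Sum>y\<in>X. ennreal (w x * w y * indicator (E x y) s))"
        using w by (intro sum.cong refl sum_ennreal[symmetric] mult_nonneg_nonneg) auto
      also have "\<dots> = (\<Sum>x\<in>X. \<Sum>y\<in>X. ennreal (w x * w y) * indicator (E x y) s)"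
        by (intro sum.cong refl) (simp add: indicator_def)
      finally show ?thesis using True by simp
    qed simp
    have "(\<integral>\<^sup>+s. ennreal (\<Sum>x\<in>X. w x * cellmass w X (pr s) \<delta> x powr 1) * indicator D s \<partial>lborel)
       \<le> (\<integral>\<^sup>+s. (\<Sum>x\<in>X. \<Sum>y\<in>X. ennreal (w x * w y) * indicator (E x y) s) \<partial>lborel)"
      by (intro nn_integral_mono cm)
    also have "\<dots> = (\<Sum>x\<in>X. \<Sum>y\<in>X. ennreal (w x * w y) * emeasure lborel (E x y))"
      by (simp add: nn_integral_sum nn_integral_cmult)
    also have "\<dots> \<le> (\<Sum>x\<in>X. \<Sum>y\<in>X. ennreal (w x * w y * (if dist x y \<le> \<delta> then V else C * \<delta> / dist x y)))"
    proof (intro sum_mono)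
      fix x y
      have "emeasure lborel (E x y) \<le> ennreal (if dist x y \<le> \<delta> then V else C * \<delta> / dist x y)"
      proof (cases "dist x y \<le> \<delta>")
        case True
        have "emeasure lborel (E x y) \<le> emeasure lborel D" by (intro emeasure_mono) (auto simp: E_def)
        then show ?thesis using V True by (auto intro: order_trans)
      next
        case False
        then have "x \<noteq> y" using \<delta> by auto
        then show ?thesis using trans[OF _ \<delta>, of x y] False unfolding E_def by simp
      qed
      then have "ennreal (w x * w y) * emeasure lborel (E x y) \<le> ennreal (w x * w y) * ennreal (if dist x y \<le> \<delta> then V else C * \<delta> / dist x y)"
        by (rule mult_left_mono) simp
      also have "\<dots> = ennreal (w x * w y * (if dist x y \<le> \<delta> then V else C * \<delta> / dist x y))"
        using w by (intro ennreal_mult'[symmetric]) simp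
      finally show "ennreal (w x * w y) * emeasure lborel (E x y) \<le> ennreal (w x * w y * (if dist x y \<le> \<delta> then V else C * \<delta> / dist x y))" .
    qed
    also have "\<dots> = (\<Sum>x\<in>X. ennreal (\<Sum>y\<in>X. w x * w y * (if dist x y \<le> \<delta> then V else C * \<delta> / dist x y)))"
      using w V C \<delta> by (intro sum.cong refl sum_ennreal mult_nonneg_nonneg) auto
    also have "\<dots> = ennreal (\<Sum>x\<in>X. \<Sum>y\<in>X. w x * w y * (if dist x y \<le> \<delta> then V else C * \<delta> / dist x y))"
      using w V C \<delta> by (intro sum_ennreal sum_nonneg mult_nonneg_nonneg) auto
    also have "\<dots> \<le> ennreal (B * sum w X * \<delta> powr t)"
    proof (rule ennreal_leI)
      have "(\<Sum>x\<in>X. \<Sum>y\<in>X. w x * w y * (if dist x y \<le> \<delta> then V else C * \<delta> / dist x y))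
         = (\<Sum>x\<in>X. w x * (\<Sum>y\<in>X. w y * (if dist x y \<le> \<delta> then V else C * \<delta> / dist x y)))"
        by (simp add: sum_distrib_left mult.assoc)
      also have "\<dots> \<le> (\<Sum>x\<in>X. w x * (B * \<delta> powr t))"
        unfolding B_def by (intro sum_mono mult_left_mono w dyadic_kernel_sum X A t \<delta> V C mass)
      also have "\<dots> = B * sum w X * \<delta> powr t" by (simp add: sum_distrib_right[symmetric])
      finally show "(\<Sum>x\<in>X. \<Sum>y\<in>X. w x * w y * (if dist x y \<le> \<delta> then V else C * \<delta> / dist x y)) \<le> B * sum w X * \<delta> powr t" .
    qed
    finally show ?thesis .
  qed
  show "\<exists>N\<ge>2. \<exists>C\<ge>0. \<exists>e>1 * \<tau>. \<forall>j X w. finite X \<longrightarrow> X \<subseteq> K \<longrightarrow> (\<forall>x. 0 \<le> w x) \<longrightarrow>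
      (\<forall>x. \<forall>r\<ge>1 / real N ^ j. sum w {y\<in>X. dist x y \<le> r} \<le> A * r powr t) \<longrightarrow>
      (\<integral>\<^sup>+s. ennreal (\<Sum>x\<in>X. w x * cellmass w X (pr s) (1 / real N ^ j) x powr 1) * indicator D s \<partial>lborel)
        \<le> ennreal (C * sum w X * (1 / real N ^ j) powr e)"
  \<comment> \<open>There is no loss per scale to absorb here, so the smallest admissible base 2
    serves.\<close>
  proof (rule exI[of _ 2], intro conjI, simp, rule exI[of _ B], intro conjI, rule B, rule exI[of _ t], intro conjI allI impI)
    show "1 * \<tau> < t" using \<tau> by simp
    fix j :: nat and X :: "'a set" and w :: "'a \<Rightarrow> real"
    assume "finite X" "\<forall>x. 0 \<le> w x" "\<forall>x. \<forall>r\<ge>1 / real 2 ^ j. sum w {y\<in>X. dist x y \<le> r} \<le> A * r powr t"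
    then show "(\<integral>\<^sup>+s. ennreal (\<Sum>x\<in>X. w x * cellmass w X (pr s) (1 / real 2 ^ j) x powr 1) * indicator D s \<partial>lborel)
        \<le> ennreal (B * sum w X * (1 / real 2 ^ j) powr t)"
      by (intro main) simp_all
  qed
qed simp

section \<open>Dimension of almost every projection\<close>

text \<open>The symmetric map \<open>S\<close> stands for the Hessian of the form: with the factor
  \<open>1/2\<close>, the derivative of the quadratic term along \<open>d\<close> is simply
  \<open>s \<bullet> S d\<close>, and the adjoint of \<open>L\<close> supplies the linear
  part.\<close>

definition qproj :: "('p::euclidean_space \<Rightarrow> 'p) \<Rightarrow> ('p \<Rightarrow> 'p) \<Rightarrow> 'p \<Rightarrow> real \<times> 'p \<times> real \<Rightarrow> real" where
  "qproj L S s z = fst z + fst (snd z) \<bullet> L s + snd (snd z) * (s \<bullet> S s / 2)"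

lemma linear_qproj: "linear (qproj L S s)"
  by (rule linearI) (simp_all add: qproj_def inner_add_left algebra_simps)

lemma continuous_qproj:
  assumes "linear L" "linear S"
  shows "continuous_on UNIV (\<lambda>(s, z). qproj L S s z)"
proof -
  have L: "continuous_on A L" and S: "continuous_on A S" for A
    using assms by (auto simp: linear_continuous_on linear_conv_bounded_linear)
  have "continuous_on UNIV (\<lambda>p. qproj L S (fst p) (snd p))" unfolding qproj_def
    by (intro continuous_intros continuous_on_compose2[OF L[of UNIV]] continuous_on_compose2[OF S[of UNIV]]) auto
  then show ?thesis by (simp add: case_prod_unfold)
qed

text \<open>Surjectivity of \<open>L\<close> makes its adjoint injective, hence bounded below in
  finite dimension. The normalization \<open>\<mu> \<le> 1\<close> lets the same factor serve the
  two real coordinates.\<close>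

lemma adjoint_bounded_below:
  fixes L :: "'p::euclidean_space \<Rightarrow> 'p"
  assumes L: "linear L" "surj L"
  obtains \<mu> where "0 < \<mu>" "\<mu> \<le> 1" "\<And>c::'p. \<mu> * norm c \<le> norm (adjoint L c)"
proof -
  have "c = 0" if "adjoint L c = 0" for c
  proof -
    obtain x where x: "c = L x" using L(2) by (metis surjD)
    have "c \<bullet> c = adjoint L c \<bullet> x" unfolding adjoint_clauses(2)[OF L(1)] x ..
    then show "c = 0" using that by simp
  qed
  then have "inj (adjoint L)" using linear_injective_0[OF adjoint_linear[OF L(1)]] by blast
  then obtain B where B: "B > 0" "\<And>c. B * norm c \<le> norm (adjoint L c)"
    using linear_inj_bounded_below_pos[OF adjoint_linear[OF L(1)]] by blast
  show ?thesis
  proof (rule that[of "min 1 B"])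
    fix c :: 'p
    have "min 1 B * norm c \<le> B * norm c" by (intro mult_right_mono) auto
    then show "min 1 B * norm c \<le> norm (adjoint L c)" using B(2)[of c] by linarith
  qed (use B in auto)
qed

text \<open>A projection is linear in the point, so a difference of two projected points is a
  quadratic function of the parameter with linear part \<open>adjoint L c\<close>. Its coefficients
  dominate a multiple of the distance of the points; the sublevel bound on each ball is thus the
  transversality required, and the balls exhaust the parameter space.\<close>

lemma null_params_qproj_higher:
  fixes L S :: "'p::euclidean_space \<Rightarrow> 'p" and K :: "(real \<times> 'p \<times> real) set"
  assumes L: "linear L" "surj L" and S: "linear S" and sym: "\<And>x y. x \<bullet> S y = y \<bullet> S x" and pos: "\<And>x. x \<noteq> 0 \<Longrightarrow> 0 < x \<bullet> S x"
    and dim: "DIM('p) \<ge> 2" and K: "compact K" and \<tau>: "0 < \<tau>" "\<tau> < t" and t: "t < 1" and Ht: "hausdorff_measure t K \<noteq> 0"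
  shows "emeasure lborel (null_params \<tau> K (qproj L S)) = 0"
proof -
  note cont = continuous_qproj[OF L(1) S]
  have N [measurable]: "null_params \<tau> K (qproj L S) \<in> sets borel" by (rule null_params_sets[OF K cont])
  obtain \<mu> where \<mu>: "0 < \<mu>" "\<mu> \<le> 1" "\<And>c. \<mu> * norm c \<le> norm (adjoint L c)" using adjoint_bounded_below[OF L] by blast
  have null: "emeasure lborel (null_params \<tau> K (qproj L S) \<inter> cball 0 (real k)) = 0" for k :: nat
  proof -
    obtain C where C: "C \<ge> 0" "\<And>r v b \<delta>. \<delta> > 0 \<Longrightarrow> 0 < \<bar>r\<bar> + norm v + \<bar>b\<bar> \<Longrightarrow>
      emeasure lborel {s\<in>cball 0 (real k). \<bar>r + v \<bullet> s + b * (s \<bullet> S s / 2)\<bar> \<le> \<delta>} \<le> ennreal (C * \<delta> / (\<bar>r\<bar> + norm v + \<bar>b\<bar>))"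
      using quadratic_family_sublevel[OF S sym pos dim, of "real k"] by auto
    have fin: "emeasure lborel (cball (0::'p) (real k)) \<noteq> top" using emeasure_lborel_cball_finite[of "0::'p" "real k"] by simp
    show ?thesis
    proof (rule null_params_transversal[OF K cont, where t = t and C = "C / \<mu>" and V = "measure lborel (cball (0::'p) (real k))"])
      show "emeasure lborel (cball (0::'p) (real k)) \<le> ennreal (measure lborel (cball (0::'p) (real k)))"
        using emeasure_eq_ennreal_measure[OF fin] by simp
      show "0 < t" using \<tau> by simp
      show "C / \<mu> \<ge> 0" using C \<mu> by simp
      fix x y :: "real \<times> 'p \<times> real" and \<delta> :: real assume xy: "x \<noteq> y" and \<delta>: "\<delta> > 0"
      define r where "r = fst (x - y)"
      define c where "c = fst (snd (x - y))"
      define b where "b = snd (snd (x - y))"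
      have z: "x - y = (r, c, b)" unfolding r_def c_def b_def by (simp add: prod_eq_iff)
      have diff: "qproj L S s x - qproj L S s y = r + adjoint L c \<bullet> s + b * (s \<bullet> S s / 2)" for s
      proof -
        have "qproj L S s x - qproj L S s y = qproj L S s (x - y)" using linear_qproj[of L S s] by (simp add: linear_diff)
        also have "\<dots> = r + c \<bullet> L s + b * (s \<bullet> S s / 2)" unfolding z qproj_def by simp
        finally show ?thesis by (simp add: adjoint_clauses(2)[OF L(1)])
      qed
      have "dist x y \<le> \<bar>r\<bar> + (norm c + \<bar>b\<bar>)"
      proof -
        have "norm (c, b) \<le> norm c + \<bar>b\<bar>" using norm_Pair_le[of c b] by simp
        moreover have "norm (r, c, b) \<le> \<bar>r\<bar> + norm (c, b)" using norm_Pair_le[of r "(c, b)"] by simp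
        ultimately show ?thesis unfolding dist_norm z by linarith
      qed
      then have "\<mu> * dist x y \<le> \<mu> * (\<bar>r\<bar> + (norm c + \<bar>b\<bar>))" using \<mu> by (intro mult_left_mono) auto
      also have "\<dots> = \<mu> * \<bar>r\<bar> + \<mu> * norm c + \<mu> * \<bar>b\<bar>" by (simp add: algebra_simps)
      also have "\<dots> \<le> \<bar>r\<bar> + norm (adjoint L c) + \<bar>b\<bar>"
        using \<mu> by (intro add_mono) (auto intro: mult_left_le_one_le)
      finally have low: "\<mu> * dist x y \<le> \<bar>r\<bar> + norm (adjoint L c) + \<bar>b\<bar>" .
      have d0: "0 < \<mu> * dist x y" using xy \<mu> by simp
      then have n0: "0 < \<bar>r\<bar> + norm (adjoint L c) + \<bar>b\<bar>" using low by linarith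
      have "emeasure lborel {s\<in>cball 0 (real k). \<bar>qproj L S s x - qproj L S s y\<bar> \<le> \<delta>} \<le> ennreal (C * \<delta> / (\<bar>r\<bar> + norm (adjoint L c) + \<bar>b\<bar>))"
        unfolding diff by (rule C(2)[OF \<delta> n0])
      also have "\<dots> \<le> ennreal (C * \<delta> / (\<mu> * dist x y))"
        using low C \<delta> by (intro ennreal_leI divide_left_mono mult_pos_pos[OF n0 d0]) auto
      finally show "emeasure lborel {s\<in>cball 0 (real k). \<bar>qproj L S s x - qproj L S s y\<bar> \<le> \<delta>} \<le> ennreal (C / \<mu> * \<delta> / dist x y)" by simp
    qed (use \<tau> t Ht in auto)
  qed
  have "emeasure lborel (\<Union>k. null_params \<tau> K (qproj L S) \<inter> cball 0 (real k)) = 0"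
    by (rule emeasure_UN_eq_0[OF null]) auto
  moreover have "(\<Union>k. null_params \<tau> K (qproj L S) \<inter> cball 0 (real k)) = null_params \<tau> K (qproj L S)"
    using real_arch_simple by auto
  ultimately show ?thesis by simp
qed

lemma null_params_reparametrize:
  "{u. \<phi> u \<in> null_params \<tau> K pr} = null_params \<tau> K (\<lambda>u. pr (\<phi> u))"
  unfolding null_params_def fine_covers_def by (rule set_eqI) simp

text \<open>On the unit segment starting at \<open>s\<close>, the projection of a point is a
  parabola whose coefficients depend linearly and injectively on the point. Distances in
  \<open>K\<close> are therefore comparable to coefficient differences and the parabola estimate
  applies. The constants may depend on \<open>s\<close>, since averaging over segments needs only
  that each one meets the set in measure zero.\<close>

lemma null_params_qproj_one:
  fixes L S :: "'p::euclidean_space \<Rightarrow> 'p" and K :: "(real \<times> 'p \<times> real) set"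
  assumes L: "linear L" "surj L" and S: "linear S" and sym: "\<And>x y. x \<bullet> S y = y \<bullet> S x" and pos: "\<And>x. x \<noteq> 0 \<Longrightarrow> 0 < x \<bullet> S x"
    and dim: "DIM('p) = 1" and K: "compact K" and \<tau>: "0 < \<tau>" "\<tau> < t" and t: "t < 1" and Ht: "hausdorff_measure t K \<noteq> 0"
  shows "emeasure lborel (null_params \<tau> K (qproj L S)) = 0"
proof -
  interpret L: linear L by (rule L(1))
  interpret S: linear S by (rule S)
  note cont = continuous_qproj[OF L(1) S]
  have N: "null_params \<tau> K (qproj L S) \<in> sets borel" by (rule null_params_sets[OF K cont])
  obtain e :: 'p where e: "Basis = {e}" using dim by (auto simp: card_1_singleton_iff)
  have e1: "norm e = 1" "e \<noteq> 0" using e by (metis norm_Basis singletonI, metis nonzero_Basis singletonI)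
  have inner: "x \<bullet> y = (x \<bullet> e) * (y \<bullet> e)" for x y :: 'p
    by (subst euclidean_inner) (simp add: e)
  have Le: "L e \<bullet> e \<noteq> 0"
  proof
    assume "L e \<bullet> e = 0"
    then have z: "L e = 0" unfolding euclidean_eq_iff[of "L e"] e by simp
    obtain x where x: "e = L x" using L(2) by (metis surjD)
    have "x = (x \<bullet> e) *\<^sub>R e" using euclidean_representation[of x] unfolding e by simp
    then have "L x = (x \<bullet> e) *\<^sub>R L e" by (metis L.scaleR)
    then show False using x z e1 by simp
  qed
  have line: "emeasure lborel {u \<in> {0..<1}. s + u *\<^sub>R e \<in> null_params \<tau> K (qproj L S)} = 0" for s
  proof -
    define a where "a z = qproj L S s z" for z
    define b where "b z = fst (snd z) \<bullet> L e + snd (snd z) * (e \<bullet> S s)" for z :: "real \<times> 'p \<times> real"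
    define c where "c z = snd (snd z) * (e \<bullet> S e / 2)" for z :: "real \<times> 'p \<times> real"
    have poly: "qproj L S (s + u *\<^sub>R e) z = qv a b c z u" for u z
      unfolding qproj_def qv_def a_def b_def c_def using sym[of s e]
      by (simp add: L.add L.scaleR S.add S.scaleR inner_add_left inner_add_right power2_eq_square field_simps)
    define T where "T z = (a z, b z, c z)" for z
    have linT: "linear T"
      unfolding T_def a_def b_def c_def using linear_qproj[of L S s]
      by (intro linearI) (simp_all add: linear_add linear_scale inner_add_left algebra_simps)
    interpret T: linear T by (rule linT)
    have "z = 0" if "T z = 0" for z
    proof -
      obtain r v h where z: "z = (r, v, h)" by (metis prod_cases3)
      have T0: "a z = 0" "b z = 0" "c z = 0" using that unfolding T_def by (auto simp: zero_prod_def)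
      have h: "h = 0" using T0(3) pos[OF e1(2)] unfolding c_def z by simp
      then have "v \<bullet> L e = 0" using T0(2) unfolding b_def z by simp
      then have "(v \<bullet> e) * (L e \<bullet> e) = 0" by (simp only: inner[of v "L e"])
      then have "v \<bullet> e = 0" using Le by simp
      then have v: "v = 0" unfolding euclidean_eq_iff[of v] e by simp
      have "r = 0" using T0(1) unfolding a_def qproj_def z h v by simp
      then show "z = 0" using z h v by (simp add: zero_prod_def)
    qed
    then have "inj T" using linear_injective_0[OF linT] by blast
    then obtain \<kappa> where \<kappa>: "\<kappa> > 0" "\<And>z. \<kappa> * norm z \<le> norm (T z)" using linear_inj_bounded_below_pos[OF linT] by blast
    \<comment> \<open>A box of side \<open>r\<close> in coefficient space lies in a ball of radius
      \<open>\<Lambda> * r\<close>, so the mass bound transfers with the constant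
      \<open>A * \<Lambda> powr t\<close>. Taking \<open>\<Lambda>\<close> at least 1 keeps the
      enlarged radius within the admissible scales.\<close>
    define \<Lambda> where "\<Lambda> = max 1 (3 / \<kappa>)"
    have \<Lambda>: "\<Lambda> \<ge> 1" "3 / \<kappa> \<le> \<Lambda>" unfolding \<Lambda>_def by auto
    have close: "dist x y \<le> \<Lambda> * r" if "\<bar>a x - a y\<bar> \<le> r \<and> \<bar>b x - b y\<bar> \<le> r \<and> \<bar>c x - c y\<bar> \<le> r" for x y r
    proof -
      have r: "r \<ge> 0" using that abs_ge_zero[of "a x - a y"] by linarith
      have "T (x - y) = (a x - a y, b x - b y, c x - c y)" unfolding T.diff by (simp add: T_def)
      then have "norm (T (x - y)) \<le> \<bar>a x - a y\<bar> + norm (b x - b y, c x - c y)" using norm_Pair_le[of "a x - a y" "(b x - b y, c x - c y)"] by simp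
      moreover have "norm (b x - b y, c x - c y) \<le> \<bar>b x - b y\<bar> + \<bar>c x - c y\<bar>" using norm_Pair_le[of "b x - b y" "c x - c y"] by simp
      ultimately have "\<kappa> * norm (x - y) \<le> 3 * r" using \<kappa>(2)[of "x - y"] that by linarith
      then have "dist x y \<le> (3 / \<kappa>) * r" using \<kappa>(1) by (simp add: dist_norm field_simps)
      also have "\<dots> \<le> \<Lambda> * r" using \<Lambda> r by (intro mult_right_mono) auto
      finally show ?thesis .
    qed
    obtain B where B: "B > 0" "\<And>z. norm (T z) \<le> B * norm z" using linear_bounded_pos[OF linT] by blast
    obtain R where R: "\<And>x y. x \<in> K \<Longrightarrow> y \<in> K \<Longrightarrow> dist x y \<le> R"
      using compact_imp_bounded[OF K] unfolding bounded_two_points by blast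
    obtain m :: nat where m: "B * R < 2 ^ m" using real_arch_pow[of 2] by auto
    have far: "\<bar>a x - a y\<bar> \<le> 2 ^ m \<and> \<bar>b x - b y\<bar> \<le> 2 ^ m \<and> \<bar>c x - c y\<bar> \<le> 2 ^ m" if "x \<in> K" "y \<in> K" for x y
    proof -
      have "norm (T (x - y)) \<le> B * dist x y" using B(2)[of "x - y"] by (simp add: dist_norm)
      also have "\<dots> \<le> B * R" using B R that by (intro mult_left_mono) auto
      finally have n: "norm (T (x - y)) \<le> 2 ^ m" using m by linarith
      have Tz: "T (x - y) = (a x - a y, b x - b y, c x - c y)" unfolding T.diff by (simp add: T_def)
      have "\<bar>a x - a y\<bar> \<le> norm (T (x - y))" unfolding Tz using norm_fst_le[of "a x - a y" "(b x - b y, c x - c y)"] by simp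
      moreover have s: "norm (b x - b y, c x - c y) \<le> norm (T (x - y))" unfolding Tz by (rule norm_snd_le)
      moreover have "\<bar>b x - b y\<bar> \<le> norm (b x - b y, c x - c y)" using norm_fst_le[of "b x - b y" "c x - c y"] by simp
      moreover have "\<bar>c x - c y\<bar> \<le> norm (b x - b y, c x - c y)" using norm_snd_le[of "c x - c y" "b x - b y"] by simp
      ultimately show ?thesis using n by linarith
    qed
    have cont': "continuous_on UNIV (\<lambda>(u, z). qproj L S (s + u *\<^sub>R e) z)"
    proof -
      have "continuous_on UNIV (\<lambda>p. (\<lambda>(s, z). qproj L S s z) (s + fst p *\<^sub>R e, snd p))"
        by (rule continuous_on_compose2[OF cont]) (auto intro!: continuous_intros)
      then show ?thesis by (simp add: case_prod_unfold)
    qed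
    have "emeasure lborel (null_params \<tau> K (\<lambda>u z. qproj L S (s + u *\<^sub>R e) z) \<inter> {0..<1}) = 0"
    proof (rule null_params_null[OF K cont', where t = t and p = "1 / 4"])
      fix A :: real assume A: "A \<ge> 0"
      \<comment> \<open>Half of the gap between \<open>t / 4\<close> and \<open>\<tau> / 4\<close>,
        so that the moment still decays faster than the Chebyshev weight grows.\<close>
      define \<epsilon> where "\<epsilon> = (t - \<tau>) / 8"
      have eps: "\<epsilon> > 0" unfolding \<epsilon>_def using \<tau> by simp
      have A0: "A * \<Lambda> powr t \<ge> 0" using A by simp
      have t01: "0 \<le> t" "t \<le> 1" using \<tau> t by auto
      obtain N C where NC: "N \<ge> 32" "C \<ge> 0" and est: "\<forall>n X (w :: real \<times> 'p \<times> real \<Rightarrow> real) a b c. finite X \<longrightarrow> (\<forall>x. 0 \<le> w x) \<longrightarrow>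
          (\<forall>x\<in>X. \<forall>r\<ge>1 / real N ^ n. sum w {y\<in>X. \<bar>a x - a y\<bar> \<le> r \<and> \<bar>b x - b y\<bar> \<le> r \<and> \<bar>c x - c y\<bar> \<le> r} \<le> A * \<Lambda> powr t * r powr t) \<longrightarrow>
          (\<forall>x\<in>X. \<forall>y\<in>X. \<bar>a x - a y\<bar> \<le> 2 ^ m \<and> \<bar>b x - b y\<bar> \<le> 2 ^ m \<and> \<bar>c x - c y\<bar> \<le> 2 ^ m) \<longrightarrow>
          (\<integral>\<^sup>+u. ennreal (\<Sum>x\<in>X. w x * cellmass w X (\<lambda>y. qv a b c y u) (1 / real N ^ n) x powr (1 / 4)) * indicator {0..<1} u \<partial>lborel)
            \<le> ennreal (C * sum w X * (1 / real N ^ n) powr (t / 4 - \<epsilon>))"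
        using quadratic_cellmass_bound[OF t01 eps A0, of m, where 'x = "real \<times> 'p \<times> real"] by (elim exE conjE)
      show "\<exists>N\<ge>2. \<exists>C\<ge>0. \<exists>e'>1 / 4 * \<tau>. \<forall>j X w. finite X \<longrightarrow> X \<subseteq> K \<longrightarrow> (\<forall>x. 0 \<le> w x) \<longrightarrow>
        (\<forall>x. \<forall>r\<ge>1 / real N ^ j. sum w {y\<in>X. dist x y \<le> r} \<le> A * r powr t) \<longrightarrow>
        (\<integral>\<^sup>+u. ennreal (\<Sum>x\<in>X. w x * cellmass w X (qproj L S (s + u *\<^sub>R e)) (1 / real N ^ j) x powr (1 / 4)) * indicator {0..<1} u \<partial>lborel)
          \<le> ennreal (C * sum w X * (1 / real N ^ j) powr e')"
      proof (rule exI[of _ N], rule conjI, use NC in simp, rule exI[of _ C], rule conjI, rule NC(2), rule exI[of _ "t / 4 - \<epsilon>"], intro conjI allI impI)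
        show "1 / 4 * \<tau> < t / 4 - \<epsilon>" unfolding \<epsilon>_def using \<tau> by (simp add: field_simps)
        fix j and X :: "(real \<times> 'p \<times> real) set" and w :: "real \<times> 'p \<times> real \<Rightarrow> real"
        assume X: "finite X" "X \<subseteq> K" and w: "\<forall>x. 0 \<le> w x"
          and mass: "\<forall>x. \<forall>r\<ge>1 / real N ^ j. sum w {y\<in>X. dist x y \<le> r} \<le> A * r powr t"
        have pr: "qproj L S (s + u *\<^sub>R e) = (\<lambda>y. qv a b c y u)" for u using poly by blast
        show "(\<integral>\<^sup>+u. ennreal (\<Sum>x\<in>X. w x * cellmass w X (qproj L S (s + u *\<^sub>R e)) (1 / real N ^ j) x powr (1 / 4)) * indicator {0..<1} u \<partial>lborel)
          \<le> ennreal (C * sum w X * (1 / real N ^ j) powr (t / 4 - \<epsilon>))"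
          unfolding pr
        proof (rule est[THEN spec[where x = j], THEN spec[where x = X], THEN spec[where x = w], THEN spec[where x = a],
              THEN spec[where x = b], THEN spec[where x = c], THEN mp, THEN mp, THEN mp, THEN mp])
          show "finite X" "\<forall>x. 0 \<le> w x" by (fact X(1), fact w)
          show "\<forall>x\<in>X. \<forall>y\<in>X. \<bar>a x - a y\<bar> \<le> 2 ^ m \<and> \<bar>b x - b y\<bar> \<le> 2 ^ m \<and> \<bar>c x - c y\<bar> \<le> 2 ^ m"
            using far X(2) by blast
          show "\<forall>x\<in>X. \<forall>r\<ge>1 / real N ^ j. sum w {y\<in>X. \<bar>a x - a y\<bar> \<le> r \<and> \<bar>b x - b y\<bar> \<le> r \<and> \<bar>c x - c y\<bar> \<le> r} \<le> A * \<Lambda> powr t * r powr t"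
          proof (intro ballI allI impI)
            fix x r assume r: "1 / real N ^ j \<le> r"
            have "0 \<le> 1 / real N ^ j" by simp
            then have r0: "0 \<le> r" using r by linarith
            have "1 * r \<le> \<Lambda> * r" using \<Lambda> r0 by (intro mult_right_mono) auto
            then have r': "1 / real N ^ j \<le> \<Lambda> * r" using r by linarith
            have "sum w {y\<in>X. \<bar>a x - a y\<bar> \<le> r \<and> \<bar>b x - b y\<bar> \<le> r \<and> \<bar>c x - c y\<bar> \<le> r} \<le> sum w {y\<in>X. dist x y \<le> \<Lambda> * r}"
            proof (rule sum_mono2)
              show "{y\<in>X. \<bar>a x - a y\<bar> \<le> r \<and> \<bar>b x - b y\<bar> \<le> r \<and> \<bar>c x - c y\<bar> \<le> r} \<subseteq> {y\<in>X. dist x y \<le> \<Lambda> * r}"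
                using close by blast
            qed (use X(1) w in auto)
            also have "\<dots> \<le> A * (\<Lambda> * r) powr t" using mass r' by blast
            also have "\<dots> = A * \<Lambda> powr t * r powr t" by (simp add: powr_mult)
            finally show "sum w {y\<in>X. \<bar>a x - a y\<bar> \<le> r \<and> \<bar>b x - b y\<bar> \<le> r \<and> \<bar>c x - c y\<bar> \<le> r} \<le> A * \<Lambda> powr t * r powr t" .
          qed
        qed
      qed
    qed (use \<tau> Ht in auto)
    moreover have "{u \<in> {0..<1}. s + u *\<^sub>R e \<in> null_params \<tau> K (qproj L S)} = null_params \<tau> K (\<lambda>u z. qproj L S (s + u *\<^sub>R e) z) \<inter> {0..<1}"
      unfolding null_params_reparametrize[of "\<lambda>u. s + u *\<^sub>R e", symmetric] by auto
    ultimately show ?thesis by simp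
  qed
  show ?thesis unfolding emeasure_line_average[OF N, of e] line by simp
qed

lemma AE_not_null_params_qproj:
  fixes L S :: "'p::euclidean_space \<Rightarrow> 'p" and K :: "(real \<times> 'p \<times> real) set"
  assumes L: "linear L" "surj L" and S: "linear S" and sym: "\<And>x y. x \<bullet> S y = y \<bullet> S x" and pos: "\<And>x. x \<noteq> 0 \<Longrightarrow> 0 < x \<bullet> S x"
    and K: "compact K" and \<tau>: "0 < \<tau>" "ereal \<tau> < min 1 (hausdorff_dim K)"
  shows "AE s in lborel. s \<notin> null_params \<tau> K (qproj L S)"
proof -
  \<comment> \<open>The room between \<open>\<tau>\<close> and \<open>t\<close> is what lets the
    moments beat the Chebyshev weights; \<open>t\<close> below the dimension of \<open>K\<close>
    ensures nonzero measure.\<close>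
  obtain t where t: "ereal \<tau> < ereal t" "ereal t < min 1 (hausdorff_dim K)" using ereal_dense2[OF \<tau>(2)] by blast
  have t': "\<tau> < t" "t < 1" "ereal t < hausdorff_dim K" using t by (simp_all add: one_ereal_def)
  have Ht: "hausdorff_measure t K \<noteq> 0" using t' \<tau>(1) by (intro hausdorff_measure_below_dim) auto
  have "DIM('p) > 0" by simp
  then consider "DIM('p) = 1" | "DIM('p) \<ge> 2" by linarith
  then have "emeasure lborel (null_params \<tau> K (qproj L S)) = 0"
  proof cases
    case 1
    show ?thesis by (rule null_params_qproj_one[OF L S sym pos 1 K \<tau>(1) t'(1,2) Ht])
  next
    case 2
    show ?thesis by (rule null_params_qproj_higher[OF L S sym pos 2 K \<tau>(1) t'(1,2) Ht])
  qed
  moreover have "null_params \<tau> K (qproj L S) \<in> sets borel" by (rule null_params_sets[OF K continuous_qproj[OF L(1) S]])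
  ultimately show ?thesis by (intro AE_I[of _ _ "null_params \<tau> K (qproj L S)"]) auto
qed

lemma hausdorff_dim_qproj_le:
  fixes K :: "(real \<times> 'p::euclidean_space \<times> real) set"
  assumes "compact K"
  shows "hausdorff_dim (qproj L S s ` K) \<le> min 1 (hausdorff_dim K)"
proof -
  have "bounded (qproj L S s ` K)"
    by (intro compact_imp_bounded compact_continuous_image assms linear_continuous_on)
       (simp add: linear_conv_bounded_linear[symmetric] linear_qproj)
  moreover obtain B where B: "B > 0" "\<And>z. norm (qproj L S s z) \<le> B * norm z" using linear_bounded_pos[OF linear_qproj] by blast
  have "hausdorff_dim (qproj L S s ` K) \<le> hausdorff_dim K"
  proof (rule hausdorff_dim_lipschitz_le[OF B(1)])
    fix x y
    show "dist (qproj L S s x) (qproj L S s y) \<le> B * dist x y"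
      using B(2)[of "x - y"] linear_qproj[of L S s] by (simp add: dist_norm linear_diff)
  qed
  ultimately show ?thesis by (simp add: hausdorff_dim_real_le)
qed

text \<open>The exceptional null set depends on \<open>\<tau>\<close>, so only rational
  \<open>\<tau>\<close> are used. If the projection had measure zero in some exponent below the
  claimed value, it would also have measure zero in a larger, positive rational exponent still below
  it, by \<open>hausdorff_measure_zero_mono\<close>.\<close>

lemma AE_hausdorff_dim_qproj:
  fixes L S :: "'p::euclidean_space \<Rightarrow> 'p" and K :: "(real \<times> 'p \<times> real) set"
  assumes L: "linear L" "surj L" and S: "linear S" and sym: "\<And>x y. x \<bullet> S y = y \<bullet> S x" and pos: "\<And>x. x \<noteq> 0 \<Longrightarrow> 0 < x \<bullet> S x"
    and K: "compact K"
  shows "AE s in lborel. hausdorff_dim (qproj L S s ` K) = min 1 (hausdorff_dim K)"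
proof -
  define T where "T = {\<tau> \<in> \<rat>. 0 < \<tau> \<and> ereal \<tau> < min 1 (hausdorff_dim K)}"
  have cT: "countable T" unfolding T_def by (rule countable_subset[OF _ countable_rat]) auto
  have "AE s in lborel. \<forall>\<tau>\<in>T. s \<notin> null_params \<tau> K (qproj L S)"
    unfolding AE_ball_countable[OF cT] by (intro ballI AE_not_null_params_qproj[OF L S sym pos K]) (auto simp: T_def)
  then show ?thesis
  proof (rule AE_mp, intro AE_I2 impI antisym hausdorff_dim_qproj_le[OF K])
    fix s assume s: "\<forall>\<tau>\<in>T. s \<notin> null_params \<tau> K (qproj L S)"
    show "min 1 (hausdorff_dim K) \<le> hausdorff_dim (qproj L S s ` K)"
      unfolding hausdorff_dim_def[of "qproj L S s ` K"]
    proof (rule Inf_greatest)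
      fix e assume "e \<in> {ereal u |u. 0 \<le> u \<and> hausdorff_measure u (qproj L S s ` K) = 0}"
      then obtain u where u: "e = ereal u" "0 \<le> u" "hausdorff_measure u (qproj L S s ` K) = 0" by auto
      show "min 1 (hausdorff_dim K) \<le> e"
      proof (rule ccontr)
        assume "\<not> min 1 (hausdorff_dim K) \<le> e"
        then have "ereal u < min 1 (hausdorff_dim K)" unfolding u(1) by (simp only: not_le)
        then obtain v where v: "ereal u < ereal v" "ereal v < min 1 (hausdorff_dim K)" using ereal_dense2 by blast
        then obtain \<tau> where \<tau>: "\<tau> \<in> \<rat>" "u < \<tau>" "\<tau> < v" using Rats_dense_in_real[of u v] by auto
        have "ereal \<tau> < min 1 (hausdorff_dim K)" using \<tau>(3) v(2) by (meson less_ereal.simps(1) less_trans)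
        then have "\<tau> \<in> T" using \<tau> u(2) unfolding T_def by simp
        moreover have "hausdorff_measure \<tau> (qproj L S s ` K) = 0"
          using \<tau> by (intro hausdorff_measure_zero_mono[OF u(2) _ u(3)]) simp
        moreover have "compact (qproj L S s ` K)"
          by (intro compact_continuous_image K linear_continuous_on)
             (simp add: linear_conv_bounded_linear[symmetric] linear_qproj)
        ultimately show False using s hausdorff_null_in_null_params[of "qproj L S" s K \<tau>] \<tau> u(2) by auto
      qed
    qed
  qed
qed

theorem theorem8p2:
  fixes L :: "real^'m \<Rightarrow> real^'m"
    and q :: "real^'m \<Rightarrow> real"
    and K :: "(real \<times> (real^'m) \<times> real) set"
  assumes "linear L" and "bij L"
    and "\<exists>A :: real^'m^'m. \<forall>x. q x = x \<bullet> (A *v x)"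
    and "\<forall>x. x \<noteq> 0 \<longrightarrow> q x > 0"
    and "compact K"
  shows "AE s in lborel.
           hausdorff_dim ((\<lambda>(r1, c, r2). r1 + c \<bullet> L s + r2 * q s) ` K)
             = min 1 (hausdorff_dim K)"
proof -
  obtain A :: "real^'m^'m" where A: "\<And>x. q x = x \<bullet> (A *v x)" using assms(3) by blast
  \<comment> \<open>Symmetrizing the matrix leaves the form unchanged up to the factor 2, which the
    \<open>1/2\<close> in \<open>qproj\<close> compensates.\<close>
  define S where "S x = A *v x + transpose A *v x" for x
  have tr: "x \<bullet> (transpose A *v y) = y \<bullet> (A *v x)" for x y
    by (simp add: dot_lmul_matrix[symmetric] inner_commute)
  have S: "linear S" unfolding S_def by (intro linear_compose_add matrix_vector_mul_linear)
  have sym: "x \<bullet> S y = y \<bullet> S x" for x y unfolding S_def by (simp only: inner_add_right tr add.commute)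
  have q: "q x = x \<bullet> S x / 2" for x unfolding S_def by (simp only: inner_add_right tr A) simp
  have pos: "0 < x \<bullet> S x" if "x \<noteq> 0" for x using assms(4) that q[of x] by auto
  have "(\<lambda>(r1, c, r2). r1 + c \<bullet> L s + r2 * q s) = qproj L S s" for s
    by (auto simp: fun_eq_iff qproj_def q)
  then show ?thesis
    using AE_hausdorff_dim_qproj[OF assms(1) bij_is_surj[OF assms(2)] S sym pos assms(5)] by simp
qed


end
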